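(* Let $N$ be a closed smooth $n$-dimensional Riemannian manifold, let $a\in\mathbb{R}$, and let $h:[a,\infty)\times N\to\mathbb{R}$ be a smooth positive function. If $1<q\le p<\infty$ and $\frac np$ is an integer, then $\overline{H}_{q,p}^{\frac np}(C_{a,\infty}^hN)=0$. In particular, if $1<q\le2$ and $n$ is even, then $\overline{H}_{q,2}^{\frac n2}(C_{a,\infty}^hN)=0$.
   Context: All manifolds are oriented. $C_{a,\infty}^hN$ (twisted cylinder) is the product $[a,\infty)\times N$ with the Riemannian metric $dt^2+h^2(t,x)g_N$, where $g_N$ is the metric of $N$. For a Riemannian manifold $M$ (possibly with boundary), $L^p(M,\Lambda^k)$ is the Banach space of locally integrable differential $k$-forms $\theta$ (modulo a.e. equality) with $\|\theta\|_{L^p}=(\int_M|\theta|^p\,dx)^{1/p}<\infty$, where $|\cdot|$ is the pointwise norm and $dx$ the volume induced by the metric. The differential $d$ is the weak exterior derivative (tested against smooth forms with compact support in $M\setminus\partial M$). $\Omega_{q,p}^k(M)=\{\omega\in L^q(M,\Lambda^k): d\omega\in L^p(M,\Lambda^{k+1})\}$. $Z_p^k(M)=\{\omega\in L^p(M,\Lambda^k): d\omega=0\}$; $B_{q,p}^k(M)=d\,\Omega_{q,p}^{k-1}(M)$; $\overline{B}_{q,p}^k(M)$ is the closure of $B_{q,p}^k(M)$ in $L^p(M,\Lambda^k)$. The reduced $L_{q,p}$-cohomology is $\overline{H}_{q,p}^k(M)=Z_p^k(M)/\overline{B}_{q,p}^k(M)$. *)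

theory Defs
  imports "HOL-Analysis.Analysis" "HOL-Combinatorics.Permutations"
begin

section \<open>Smooth functions on subsets of a Euclidean space\<close>

text \<open>
  The sets \<open>S\<close> below are always relatively open in the whole space or in a closed half-space, so
  that derivatives within \<open>S\<close> are unique. At boundary points they are the one-sided ones;
  \<open>Ck_on k S f\<close> thus says that \<open>f\<close> is \<open>k\<close> times continuously differentiable up to the boundary.
  The function \<open>f' b\<close> is the partial derivative in the direction of the basis vector \<open>b\<close>.
\<close>

primrec Ck_on :: "nat \<Rightarrow> 'e::euclidean_space set \<Rightarrow> ('e \<Rightarrow> 'b::real_normed_vector) \<Rightarrow> bool" where
  "Ck_on 0 S f \<longleftrightarrow> continuous_on S f"
| "Ck_on (Suc k) S f \<longleftrightarrow>
     (\<exists>f'. (\<forall>x\<in>S. (f has_derivative (\<lambda>v. \<Sum>b\<in>Basis. (v \<bullet> b) *\<^sub>R f' b x)) (at x within S)) \<and>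
           (\<forall>b\<in>Basis. Ck_on k S (f' b)))"

definition smooth_on :: "'e::euclidean_space set \<Rightarrow> ('e \<Rightarrow> 'b::real_normed_vector) \<Rightarrow> bool" where
  "smooth_on S f \<longleftrightarrow> (\<forall>k. Ck_on k S f)"


section \<open>Linear algebra on a Euclidean model space\<close>

definition lin_det :: "('e::euclidean_space \<Rightarrow> 'e) \<Rightarrow> real" where
  "lin_det f = (\<Sum>\<pi> | \<pi> permutes Basis. of_int (sign \<pi>) * (\<Prod>b\<in>Basis. f b \<bullet> \<pi> b))"

definition gram_det :: "('e::euclidean_space \<Rightarrow> 'e \<Rightarrow> real) \<Rightarrow> real" where
  "gram_det g = (\<Sum>\<pi> | \<pi> permutes Basis. of_int (sign \<pi>) * (\<Prod>b\<in>Basis. g b (\<pi> b)))"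

definition inner_product :: "('e::real_vector \<Rightarrow> 'e \<Rightarrow> real) \<Rightarrow> bool" where
  "inner_product g \<longleftrightarrow>
     (\<forall>u. linear (g u)) \<and> (\<forall>u v. g u v = g v u) \<and> (\<forall>u. u \<noteq> 0 \<longrightarrow> g u u > 0)"

text \<open>
  An alternating \<open>k\<close>-linear form takes its arguments as a sequence \<open>v 0, v 1, \<dots>\<close> and depends only
  on the first \<open>k\<close> of them.
\<close>

definition alternating :: "nat \<Rightarrow> ((nat \<Rightarrow> 'e::real_vector) \<Rightarrow> real) \<Rightarrow> bool" where
  "alternating k \<alpha> \<longleftrightarrow>
     (\<forall>v i. i < k \<longrightarrow> linear (\<lambda>x. \<alpha> (v(i := x)))) \<and>
     (\<forall>v i j. i < j \<longrightarrow> j < k \<longrightarrow> v i = v j \<longrightarrow> \<alpha> v = 0) \<and>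
     (\<forall>v w. (\<forall>i<k. v i = w i) \<longrightarrow> \<alpha> v = \<alpha> w)"

definition wedge ::
  "nat \<Rightarrow> nat \<Rightarrow> ((nat \<Rightarrow> 'e) \<Rightarrow> real) \<Rightarrow> ((nat \<Rightarrow> 'e) \<Rightarrow> real) \<Rightarrow> (nat \<Rightarrow> 'e) \<Rightarrow> real" where
  "wedge k l \<alpha> \<beta> v =
     (\<Sum>\<sigma> | \<sigma> permutes {..<k + l}. of_int (sign \<sigma>) * \<alpha> (\<lambda>j. v (\<sigma> j)) * \<beta> (\<lambda>j. v (\<sigma> (k + j))))
       / (fact k * fact l)"

definition orthonormal_basis :: "('e::euclidean_space \<Rightarrow> 'e \<Rightarrow> real) \<Rightarrow> 'e set \<Rightarrow> bool" where
  "orthonormal_basis g B \<longleftrightarrow>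
     finite B \<and> card B = DIM('e) \<and> (\<forall>u\<in>B. \<forall>v\<in>B. g u v = (if u = v then 1 else 0))"

text \<open>
  The Euclidean norm on \<open>k\<close>-forms induced by the inner product \<open>g\<close>: the products
  \<open>e\<^sub>i\<^sub>1 \<and> \<dots> \<and> e\<^sub>i\<^sub>k\<close> with \<open>i\<^sub>1 < \<dots> < i\<^sub>k\<close> of an orthonormal coframe are orthonormal. Summing over all
  \<open>k\<close>-tuples of basis vectors counts each of them \<open>k!\<close> times.
\<close>

definition alt_norm ::
  "nat \<Rightarrow> ('e::euclidean_space \<Rightarrow> 'e \<Rightarrow> real) \<Rightarrow> ((nat \<Rightarrow> 'e) \<Rightarrow> real) \<Rightarrow> real" where
  "alt_norm k g \<alpha> =
     sqrt ((\<Sum>v \<in> {..<k} \<rightarrow>\<^sub>E (SOME B. orthonormal_basis g B). (\<alpha> v)\<^sup>2) / fact k)"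

text \<open>A fixed ordering of the standard basis, that is, a fixed orientation of the model space.\<close>

definition basis_enum :: "nat \<Rightarrow> 'e::euclidean_space" where
  "basis_enum = (SOME e. bij_betw e {..<DIM('e)} Basis)"


section \<open>Oriented Riemannian manifolds with boundary\<close>

text \<open>
  A manifold is a subset \<open>carr\<close> of a second countable Hausdorff space, with the subspace topology
  and an atlas indexed by \<open>idx\<close>; the chart \<open>i\<close> maps the relatively open set \<open>cdom i\<close> onto a
  relatively open subset of \<open>model\<close>, which is the whole Euclidean space or a closed half-space.
\<close>

record ('i, 'a, 'e) mfd =
  carr :: "'a set"
  model :: "'e set"
  idx :: "'i set"
  cdom :: "'i \<Rightarrow> 'a set"
  chart :: "'i \<Rightarrow> 'a \<Rightarrow> 'e"

text \<open>
  Tangent vectors at a point are represented by their coordinates in the charts around it, and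
  tensor fields by the family of their expressions in the charts.
\<close>

record ('i, 'a, 'e) riem = "('i, 'a, 'e) mfd" +
  gmetric :: "'i \<Rightarrow> 'a \<Rightarrow> 'e \<Rightarrow> 'e \<Rightarrow> real"

definition chart_inv :: "('i, 'a, 'e, 'z) mfd_scheme \<Rightarrow> 'i \<Rightarrow> 'e \<Rightarrow> 'a" where
  "chart_inv M i = inv_into (cdom M i) (chart M i)"

definition transition :: "('i, 'a, 'e, 'z) mfd_scheme \<Rightarrow> 'i \<Rightarrow> 'i \<Rightarrow> 'e \<Rightarrow> 'e" where
  "transition M i j = chart M j \<circ> chart_inv M i"

definition transition_deriv ::
  "('i, 'a, 'e::euclidean_space, 'z) mfd_scheme \<Rightarrow> 'i \<Rightarrow> 'i \<Rightarrow> 'a \<Rightarrow> 'e \<Rightarrow> 'e" where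
  "transition_deriv M i j x =
     frechet_derivative (transition M i j)
       (at (chart M i x) within chart M i ` (cdom M i \<inter> cdom M j))"

definition oriented_manifold ::
  "('i, 'a::{second_countable_topology, t2_space}, 'e::euclidean_space, 'z) mfd_scheme \<Rightarrow> bool" where
  "oriented_manifold M \<longleftrightarrow>
     (model M = UNIV \<or> (\<exists>v c. v \<noteq> 0 \<and> model M = {y. c \<le> v \<bullet> y})) \<and>
     carr M = (\<Union>i\<in>idx M. cdom M i) \<and>
     (\<forall>i\<in>idx M. openin (top_of_set (carr M)) (cdom M i) \<and>
        openin (top_of_set (model M)) (chart M i ` cdom M i) \<and>
        homeomorphism (cdom M i) (chart M i ` cdom M i) (chart M i) (chart_inv M i)) \<and>
     (\<forall>i\<in>idx M. \<forall>j\<in>idx M.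
        smooth_on (chart M i ` (cdom M i \<inter> cdom M j)) (transition M i j) \<and>
        (\<forall>x\<in>cdom M i \<inter> cdom M j. lin_det (transition_deriv M i j x) > 0))"

definition boundary :: "('i, 'a, 'e::topological_space, 'z) mfd_scheme \<Rightarrow> 'a set" where
  "boundary M = {x. \<exists>i\<in>idx M. x \<in> cdom M i \<and> chart M i x \<in> frontier (model M)}"

definition smooth_fun ::
  "('i, 'a, 'e::euclidean_space, 'z) mfd_scheme \<Rightarrow> ('a \<Rightarrow> real) \<Rightarrow> bool" where
  "smooth_fun M f \<longleftrightarrow> (\<forall>i\<in>idx M. smooth_on (chart M i ` cdom M i) (f \<circ> chart_inv M i))"

definition riemannian_manifold ::
  "('i, 'a::{second_countable_topology, t2_space}, 'e::euclidean_space) riem \<Rightarrow> bool" where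
  "riemannian_manifold M \<longleftrightarrow>
     oriented_manifold M \<and>
     (\<forall>i\<in>idx M. (\<forall>x\<in>cdom M i. inner_product (gmetric M i x)) \<and>
        (\<forall>u v. smooth_on (chart M i ` cdom M i) (\<lambda>y. gmetric M i (chart_inv M i y) u v))) \<and>
     (\<forall>i\<in>idx M. \<forall>j\<in>idx M. \<forall>x\<in>cdom M i \<inter> cdom M j. \<forall>u v.
        gmetric M i x u v =
          gmetric M j x (transition_deriv M i j x u) (transition_deriv M i j x v))"

text \<open>Charts with values in the whole space: the boundary is empty.\<close>

definition closed_riemannian_manifold ::
  "('i, 'a::{second_countable_topology, t2_space}, 'e::euclidean_space) riem \<Rightarrow> bool" where
  "closed_riemannian_manifold M \<longleftrightarrow>
     riemannian_manifold M \<and> model M = UNIV \<and> compact (carr M)"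

text \<open>Some chart around \<open>x\<close>; used only for quantities that do not depend on the chart.\<close>

definition chart_at :: "('i, 'a, 'e, 'z) mfd_scheme \<Rightarrow> 'a \<Rightarrow> 'i" where
  "chart_at M x = (SOME i. i \<in> idx M \<and> x \<in> cdom M i)"

text \<open>
  The Riemannian volume is the unique Borel measure given in each chart by the density
  \<open>sqrt (det g)\<close>.
\<close>

definition riem_vol ::
  "('i, 'a::{second_countable_topology, t2_space}, 'e::euclidean_space) riem \<Rightarrow> 'a measure" where
  "riem_vol M = (THE \<mu>. sets \<mu> = sets (restrict_space borel (carr M)) \<and>
     (\<forall>i\<in>idx M. \<forall>A\<in>sets \<mu>. A \<subseteq> cdom M i \<longrightarrow>
        emeasure \<mu> A =
          (\<integral>\<^sup>+y\<in>chart M i ` A. ennreal (sqrt (gram_det (gmetric M i (chart_inv M i y)))) \<partial>lborel)))"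


section \<open>Differential forms\<close>

text \<open>
  \<open>\<omega> i x\<close> is the expression of the form at the point \<open>x\<close> in the chart \<open>i\<close>; it is zero where this
  makes no sense, so that forms are determined by their values on the manifold.
\<close>

type_synonym ('i, 'a, 'e) form = "'i \<Rightarrow> 'a \<Rightarrow> (nat \<Rightarrow> 'e) \<Rightarrow> real"

definition zero_form :: "('i, 'a, 'e) form" where
  "zero_form = (\<lambda>i x v. 0)"

definition form_diff ::
  "('i, 'a, 'e) form \<Rightarrow> ('i, 'a, 'e) form \<Rightarrow> ('i, 'a, 'e) form" where
  "form_diff \<omega> \<theta> = (\<lambda>i x v. \<omega> i x v - \<theta> i x v)"

definition is_form ::
  "('i, 'a, 'e::euclidean_space, 'z) mfd_scheme \<Rightarrow> nat \<Rightarrow> ('i, 'a, 'e) form \<Rightarrow> bool" where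
  "is_form M k \<omega> \<longleftrightarrow>
     (\<forall>i\<in>idx M. \<forall>x\<in>cdom M i. alternating k (\<omega> i x)) \<and>
     (\<forall>i x. \<not> (i \<in> idx M \<and> x \<in> cdom M i) \<longrightarrow> \<omega> i x = (\<lambda>v. 0)) \<and>
     (\<forall>i\<in>idx M. \<forall>j\<in>idx M. \<forall>x\<in>cdom M i \<inter> cdom M j. \<forall>v.
        \<omega> i x v = \<omega> j x (\<lambda>l. transition_deriv M i j x (v l)))"

definition measurable_form ::
  "('i, 'a::topological_space, 'e::euclidean_space, 'z) mfd_scheme \<Rightarrow> nat \<Rightarrow> ('i, 'a, 'e) form \<Rightarrow> bool"
  where
  "measurable_form M k \<omega> \<longleftrightarrow>
     is_form M k \<omega> \<and>
     (\<forall>i\<in>idx M. \<forall>v. (\<lambda>x. \<omega> i x v) \<in> borel_measurable (restrict_space borel (cdom M i)))"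

definition smooth_form ::
  "('i, 'a, 'e::euclidean_space, 'z) mfd_scheme \<Rightarrow> nat \<Rightarrow> ('i, 'a, 'e) form \<Rightarrow> bool" where
  "smooth_form M k \<omega> \<longleftrightarrow>
     is_form M k \<omega> \<and>
     (\<forall>i\<in>idx M. \<forall>v. smooth_on (chart M i ` cdom M i) (\<lambda>y. \<omega> i (chart_inv M i y) v))"

text \<open>Smooth forms with compact support in the interior of the manifold.\<close>

definition test_form ::
  "('i, 'a::topological_space, 'e::euclidean_space, 'z) mfd_scheme \<Rightarrow> nat \<Rightarrow> ('i, 'a, 'e) form \<Rightarrow> bool"
  where
  "test_form M k \<omega> \<longleftrightarrow>
     smooth_form M k \<omega> \<and>
     (\<exists>K. compact K \<and> K \<subseteq> carr M - boundary M \<and> (\<forall>i x. x \<notin> K \<longrightarrow> \<omega> i x = (\<lambda>v. 0)))"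

text \<open>
  \<open>(d\<omega>)(v\<^sub>0, \<dots>, v\<^sub>k)\<close> is the sum over \<open>j\<close> of \<open>(-1)^j\<close> times the derivative of
  \<open>\<omega>(v\<^sub>0, \<dots>, v\<^sub>k)\<close>, with \<open>v\<^sub>j\<close> omitted, in the direction of \<open>v\<^sub>j\<close>.
\<close>

definition ext_deriv ::
  "('i, 'a, 'e::euclidean_space, 'z) mfd_scheme \<Rightarrow> nat \<Rightarrow> ('i, 'a, 'e) form \<Rightarrow> ('i, 'a, 'e) form" where
  "ext_deriv M k \<omega> = (\<lambda>i x v.
     if i \<in> idx M \<and> x \<in> cdom M i then
       \<Sum>j\<le>k. (-1) ^ j *
         frechet_derivative
           (\<lambda>y. \<omega> i (chart_inv M i y) (\<lambda>l. v (if l < j then l else Suc l)))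
           (at (chart M i x) within chart M i ` cdom M i) (v j)
     else 0)"

definition wedge_form ::
  "nat \<Rightarrow> nat \<Rightarrow> ('i, 'a, 'e) form \<Rightarrow> ('i, 'a, 'e) form \<Rightarrow> ('i, 'a, 'e) form" where
  "wedge_form k l \<omega> \<theta> = (\<lambda>i x. wedge k l (\<omega> i x) (\<theta> i x))"

text \<open>
  A form of top degree is integrated by writing it as a function times the Riemannian volume form,
  whose value on the coordinate frame of a positive chart is \<open>sqrt (det g)\<close>.
\<close>

definition form_integral ::
  "('i, 'a::{second_countable_topology, t2_space}, 'e::euclidean_space) riem
     \<Rightarrow> ('i, 'a, 'e) form \<Rightarrow> real" where
  "form_integral M \<eta> =
     (LINT x|riem_vol M.
        \<eta> (chart_at M x) x basis_enum / sqrt (gram_det (gmetric M (chart_at M x) x)))"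

definition form_norm ::
  "('i, 'a, 'e::euclidean_space) riem \<Rightarrow> nat \<Rightarrow> ('i, 'a, 'e) form \<Rightarrow> 'a \<Rightarrow> real" where
  "form_norm M k \<omega> x = alt_norm k (gmetric M (chart_at M x) x) (\<omega> (chart_at M x) x)"

definition loc_integrable_form ::
  "('i, 'a::{second_countable_topology, t2_space}, 'e::euclidean_space) riem
     \<Rightarrow> nat \<Rightarrow> ('i, 'a, 'e) form \<Rightarrow> bool" where
  "loc_integrable_form M k \<omega> \<longleftrightarrow>
     measurable_form M k \<omega> \<and>
     (\<forall>K. compact K \<longrightarrow> K \<subseteq> carr M \<longrightarrow> (\<integral>\<^sup>+x\<in>K. ennreal (form_norm M k \<omega> x) \<partial>riem_vol M) < \<infinity>)"

text \<open>\<open>\<theta>\<close> is the weak exterior derivative of the \<open>k\<close>-form \<open>\<omega>\<close>.\<close>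

definition weak_deriv ::
  "('i, 'a::{second_countable_topology, t2_space}, 'e::euclidean_space) riem
     \<Rightarrow> nat \<Rightarrow> ('i, 'a, 'e) form \<Rightarrow> ('i, 'a, 'e) form \<Rightarrow> bool" where
  "weak_deriv M k \<omega> \<theta> \<longleftrightarrow>
     loc_integrable_form M k \<omega> \<and> loc_integrable_form M (Suc k) \<theta> \<and>
     (\<forall>l u. Suc k + l = DIM('e) \<longrightarrow> test_form M l u \<longrightarrow>
        form_integral M (wedge_form (Suc k) l \<theta> u) =
          (-1) ^ Suc k * form_integral M (wedge_form k (Suc l) \<omega> (ext_deriv M l u)))"


section \<open>Reduced cohomology\<close>

text \<open>
  Elements of the Lebesgue spaces are represented by Borel measurable forms, not by classes modulo
  equality almost everywhere. Forms vanishing almost everywhere lie in the closure \<open>Bbar_Lp\<close>, so the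
  quotient \<open>reduced_cohomology\<close> is the same.
\<close>

definition Lp ::
  "('i, 'a::{second_countable_topology, t2_space}, 'e::euclidean_space) riem
     \<Rightarrow> real \<Rightarrow> nat \<Rightarrow> ('i, 'a, 'e) form set" where
  "Lp M p k = {\<omega>. loc_integrable_form M k \<omega> \<and>
     (\<integral>\<^sup>+x. ennreal (form_norm M k \<omega> x powr p) \<partial>riem_vol M) < \<infinity>}"

definition Lp_norm ::
  "('i, 'a::{second_countable_topology, t2_space}, 'e::euclidean_space) riem
     \<Rightarrow> real \<Rightarrow> nat \<Rightarrow> ('i, 'a, 'e) form \<Rightarrow> real" where
  "Lp_norm M p k \<omega> = (LINT x|riem_vol M. form_norm M k \<omega> x powr p) powr (1 / p)"

definition Omega_Lp ::
  "('i, 'a::{second_countable_topology, t2_space}, 'e::euclidean_space) riem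
     \<Rightarrow> real \<Rightarrow> real \<Rightarrow> nat \<Rightarrow> ('i, 'a, 'e) form set" where
  "Omega_Lp M q p k = {\<omega> \<in> Lp M q k. \<exists>\<theta>\<in>Lp M p (Suc k). weak_deriv M k \<omega> \<theta>}"

definition Z_Lp ::
  "('i, 'a::{second_countable_topology, t2_space}, 'e::euclidean_space) riem
     \<Rightarrow> real \<Rightarrow> nat \<Rightarrow> ('i, 'a, 'e) form set" where
  "Z_Lp M p k = {\<omega> \<in> Lp M p k. weak_deriv M k \<omega> zero_form}"

text \<open>In degree \<open>0\<close> only the zero form is exact, there being no forms of degree \<open>-1\<close>.\<close>

definition B_Lp ::
  "('i, 'a::{second_countable_topology, t2_space}, 'e::euclidean_space) riem
     \<Rightarrow> real \<Rightarrow> real \<Rightarrow> nat \<Rightarrow> ('i, 'a, 'e) form set" where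
  "B_Lp M q p k = (case k of
       0 \<Rightarrow> {zero_form}
     | Suc j \<Rightarrow> {\<theta> \<in> Lp M p k. \<exists>\<omega>\<in>Omega_Lp M q p j. weak_deriv M j \<omega> \<theta>})"

definition Bbar_Lp ::
  "('i, 'a::{second_countable_topology, t2_space}, 'e::euclidean_space) riem
     \<Rightarrow> real \<Rightarrow> real \<Rightarrow> nat \<Rightarrow> ('i, 'a, 'e) form set" where
  "Bbar_Lp M q p k =
     {\<omega> \<in> Lp M p k. \<forall>\<epsilon>>0. \<exists>\<theta>\<in>B_Lp M q p k. Lp_norm M p k (form_diff \<omega> \<theta>) < \<epsilon>}"

definition cohomology_class ::
  "('i, 'a::{second_countable_topology, t2_space}, 'e::euclidean_space) riem
     \<Rightarrow> real \<Rightarrow> real \<Rightarrow> nat \<Rightarrow> ('i, 'a, 'e) form \<Rightarrow> ('i, 'a, 'e) form set" where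
  "cohomology_class M q p k \<omega> = {\<omega>' \<in> Z_Lp M p k. form_diff \<omega>' \<omega> \<in> Bbar_Lp M q p k}"

definition reduced_cohomology ::
  "('i, 'a::{second_countable_topology, t2_space}, 'e::euclidean_space) riem
     \<Rightarrow> real \<Rightarrow> real \<Rightarrow> nat \<Rightarrow> ('i, 'a, 'e) form set set" where
  "reduced_cohomology M q p k = cohomology_class M q p k ` Z_Lp M p k"


section \<open>Twisted cylinders\<close>

definition cylinder ::
  "real \<Rightarrow> ('i, 'a, 'e, 'z) mfd_scheme \<Rightarrow> ('i, real \<times> 'a, real \<times> 'e) mfd" where
  "cylinder a N =
     \<lparr>carr = {a..} \<times> carr N,
      model = {a..} \<times> model N,
      idx = idx N,
      cdom = (\<lambda>i. {a..} \<times> cdom N i),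
      chart = (\<lambda>i (t, x). (t, chart N i x))\<rparr>"

text \<open>The metric \<open>dt\<^sup>2 + h\<^sup>2(t, x) g\<^sub>N\<close>.\<close>

definition twisted_cylinder ::
  "real \<Rightarrow> (real \<times> 'a \<Rightarrow> real) \<Rightarrow> ('i, 'a, 'e) riem \<Rightarrow> ('i, real \<times> 'a, real \<times> 'e) riem" where
  "twisted_cylinder a h N =
     mfd.extend (cylinder a N)
       (riem.fields (\<lambda>i (t, x) (s, u) (s', u'). s * s' + (h (t, x))\<^sup>2 * gmetric N i x u u'))"

end

(*
  Let c be a bump function on [T, 2T] with values of order 1/T, and let kappa' = - c, where kappa = 1
  on [a, T] and kappa = 0 beyond 2T. For a closed k-form omega put, up to sign,
    psi = integral_t^oo kappa(s) (contraction of omega with d/dt)(s) ds,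
    A = integral_t^oo c(s) (part of omega without dt)(s) ds.
  Both vanish for t > 2T, and d psi = theta := kappa omega - A. The weak form of this identity is
  obtained by duality: for a test form u, the form P u = kappa(t) integral_a^t (contraction of u with
  d/dt)(s) ds is again a test form, omega is orthogonal to d (P u), and Fubini's theorem on the rays
  moves the integrals from u to omega.
  It remains to see that omega - theta = (1 - kappa) omega + A tends to 0 in L^p as T grows. For the
  first term this is dominated convergence. For the second one, k p = n makes the L^p norm of a k-form
  without dt independent of h, so that Hoelder's inequality bounds the norm of A by a constant times
  the norm of omega on {t >= T}, uniformly in T.
*)

theory Submission
 imports Defs
begin

text \<open>The form omega is only measurable, so nothing can be differentiated on its side; hence
  the duality. Its integrals along the rays exist for almost every point of \<open>N\<close> only,
  whereas forms here have a value at every point. So omega is first replaced by a representative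
  that vanishes on the bad rays (\<open>regular\<close>). \<open>riem_vol\<close> is given by a
  description and \<open>form_norm\<close> by choices of charts and bases. Both become computable by
  cutting \<open>N\<close> into finitely many disjoint Borel pieces inside compact parts of charts
  (\<open>cyl_cover\<close>). On a piece the norm is comparable, uniformly in \<open>t\<close>, to
  the coefficients in a frame whose spatial vectors are divided by \<open>h\<close>
  (\<open>scoeff\<close>); the \<open>energy\<close> built from these replaces the norm. The
  condition \<open>q \<le> p\<close> puts psi into \<open>L^q\<close>: psi lives on a strip of
  finite measure, where \<open>L^p\<close> embeds in \<open>L^q\<close>. The uniform constant is a
  count of powers of \<open>T\<close>: Hoelder on \<open>[T, 2T]\<close> gives
  \<open>(B / T)^p * T^(p - 1) = B^p / T\<close>, and integration over \<open>t\<close> in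
  \<open>[a, 2T]\<close>, of length at most \<open>3 * T\<close>, leaves
  \<open>3 * B^p\<close>.\<close>

abbreviation "swap \<equiv> Transposition.transpose"

type_synonym ('i, 'a, 'e) cform = "('i, real \<times> 'a, real \<times> 'e) form"

lemmas lint_nonneg = Bochner_Integration.integral_nonneg
lemmas hk_integral_cong = Henstock_Kurzweil_Integration.integral_cong

section \<open>Alternating forms\<close>

lemma alternating_linear:
 "alternating k \<alpha> ==> i < k ==> linear (\<lambda>x. \<alpha> (v(i := x)))"
 unfolding alternating_def by blast

lemma alternating_eq_zero:
 assumes "alternating k \<alpha>" "i < k" "j < k" "i \<noteq> j" "v i = v j"
 shows "\<alpha> v = 0"
 using assms unfolding alternating_def by (metis linorder_neqE_nat)

lemma alternating_cong:
 "alternating k \<alpha> ==> (\<And>i. i < k ==> v i = w i) ==> \<alpha> v = \<alpha> w"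
 unfolding alternating_def by blast

lemma alternating_zero_arg:
 assumes "alternating k \<alpha>" "i < k" "v i = 0"
 shows "\<alpha> v = 0"
 using linear_0[OF alternating_linear[OF assms(1,2), of v]] assms(3) by (metis fun_upd_triv)

text \<open>Polarization: the value with \<open>x + y\<close> in both slots is zero and expands into
  four terms, two of which vanish.\<close>

lemma alternating_update_swap:
 assumes A: "alternating k \<alpha>" and ij: "i < k" "j < k" "i \<noteq> j"
 shows "\<alpha> (v(i := x, j := y)) = - \<alpha> (v(i := y, j := x))"
proof -
 have li: "linear (\<lambda>z. \<alpha> (w(i := z)))" and lj: "linear (\<lambda>z. \<alpha> (w(j := z)))" for w
  using alternating_linear[OF A] ij by auto
 have addj: "\<alpha> (w(j := p + q)) = \<alpha> (w(j := p)) + \<alpha> (w(j := q))" for w p q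
  using linear_add[OF lj] .
 have addi: "\<alpha> (w(i := p + q, j := r)) = \<alpha> (w(i := p, j := r)) + \<alpha> (w(i := q, j := r))" for w p q r
  using linear_add[OF li, of "w(j := r)" p q] ij by (simp add: fun_upd_twist)
 have same: "\<alpha> (w(i := p, j := p)) = 0" for w p
  by (rule alternating_eq_zero[OF A ij]) (use ij in auto)
 have "0 = \<alpha> (v(i := x + y, j := x + y))" using same by simp
 also have "... = \<alpha> (v(i := x, j := y)) + \<alpha> (v(i := y, j := x))"
  by (simp add: addi addj same)
 finally show ?thesis by simp
qed

lemma alternating_swap:
 assumes A: "alternating k \<alpha>" and ij: "i < k" "j < k" "i \<noteq> j"
 shows "\<alpha> (v \<circ> swap i j) = - \<alpha> v"
proof -
 have "v \<circ> swap i j = v(i := v j, j := v i)"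
  by (auto simp: fun_eq_iff Transposition.transpose_def)
 thus ?thesis
  using alternating_update_swap[OF assms, of v "v j" "v i"] by simp
qed

lemma linear_real_mult: "linear f ==> linear (\<lambda>x. c * f x :: real)"
 using linear_compose_scale_right[of f c] by simp

lemma alternating_compose_linear:
 fixes T :: "'v::real_vector => 'w::real_vector"
 assumes "alternating k \<alpha>" "linear T"
 shows "alternating k (\<lambda>v. \<alpha> (\<lambda>j. T (v j)))"
proof -
 have upd: "(\<lambda>j. T ((v(i := x)) j)) = (\<lambda>j. T (v j))(i := T x)" for v i x by auto
 show ?thesis
  unfolding alternating_def
 proof (intro conjI allI impI)
  fix v :: "nat => 'v" and i assume "i < k"
  thus "linear (\<lambda>x. \<alpha> (\<lambda>j. T ((v(i := x)) j)))"
   unfolding upd using linear_compose[OF assms(2) alternating_linear[OF assms(1)]]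
   by (simp add: o_def)
 next
  fix v :: "nat => 'v" and i j assume "i < j" "j < k" "v i = v j"
  thus "\<alpha> (\<lambda>j. T (v j)) = 0"
   using alternating_eq_zero[OF assms(1), of i j "\<lambda>j. T (v j)"] by auto
 next
  fix v w :: "nat => 'v" assume "\<forall>i<k. v i = w i"
  thus "\<alpha> (\<lambda>j. T (v j)) = \<alpha> (\<lambda>j. T (w j))"
   by (intro alternating_cong[OF assms(1)]) auto
 qed
qed

lemma alternating_scale:
 assumes "alternating k \<alpha>"
 shows "alternating k (\<lambda>v. c * \<alpha> v)"
 unfolding alternating_def
proof (intro conjI allI impI)
 fix v i assume "i < k"
 thus "linear (\<lambda>x. c * \<alpha> (v(i := x)))"
  by (rule linear_real_mult[OF alternating_linear[OF assms]])
next
 fix v :: "nat => 'a" and i j assume "i < j" "j < k" "v i = v j"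
 thus "c * \<alpha> v = 0" using alternating_eq_zero[OF assms, of i j v] by simp
next
 fix v w :: "nat => 'a" assume "\<forall>i<k. v i = w i"
 thus "c * \<alpha> v = c * \<alpha> w" using alternating_cong[OF assms, of v w] by simp
qed

lemma alternating_add:
 assumes A: "alternating k \<alpha>" and B: "alternating k \<beta>"
 shows "alternating k (\<lambda>v. \<alpha> v + \<beta> v)"
 unfolding alternating_def
proof (intro conjI allI impI)
 fix v i assume "i < k"
 thus "linear (\<lambda>x. \<alpha> (v(i := x)) + \<beta> (v(i := x)))"
  by (intro linear_compose_add alternating_linear[OF A] alternating_linear[OF B])
next
 fix v :: "nat => 'a" and i j assume "i < j" "j < k" "v i = v j"
 thus "\<alpha> v + \<beta> v = 0"
  using alternating_eq_zero[OF A, of i j v] alternating_eq_zero[OF B, of i j v] by simp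
next
 fix v w :: "nat => 'a" assume vw: "\<forall>i<k. v i = w i"
 have "\<alpha> v = \<alpha> w" by (rule alternating_cong[OF A]) (use vw in blast)
 moreover have "\<beta> v = \<beta> w" by (rule alternating_cong[OF B]) (use vw in blast)
 ultimately show "\<alpha> v + \<beta> v = \<alpha> w + \<beta> w" by simp
qed

lemma alternating_zero: "alternating k (\<lambda>v. 0)"
 unfolding alternating_def by (simp add: linear_zero)

text \<open>The same index shift as in \<open>ext_deriv\<close>, so that the summands there become
  values at \<open>omit j v\<close>.\<close>

definition omit :: "nat => (nat => 'v) => nat => 'v" where
 "omit j v = (\<lambda>l. v (if l < j then l else Suc l))"

text \<open>If the entries \<open>p\<close> and \<open>p + Suc d\<close> agree, dropping either one
  leaves the same vectors, one of them displaced by \<open>d\<close> places. Each induction step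
  moves it by one adjacent swap, at the cost of one sign.\<close>

lemma alternating_omit_aux:
 assumes A: "alternating k \<alpha>"
 shows "p + Suc d \<le> k ==> v p = v (p + Suc d) ==>
  \<alpha> (omit (p + Suc d) v) = (-1) ^ d * \<alpha> (omit p v)"
proof (induction d arbitrary: v)
 case 0
 have "omit (Suc p) v = omit p v"
  using 0 by (auto simp: omit_def fun_eq_iff less_Suc_eq)
 thus ?case by simp
next
 case (Suc d)
 define q where "q = p + Suc d"
 define v' where "v' = v \<circ> Transposition.transpose q (Suc q)"
 have 1: "omit (Suc q) v = omit q v'"
  by (auto simp: omit_def v'_def fun_eq_iff Transposition.transpose_def less_Suc_eq)
 have "v' p = v p" by (auto simp: v'_def Transposition.transpose_def q_def)
 moreover have "v' q = v (Suc q)" by (simp add: v'_def)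
 ultimately have "\<alpha> (omit q v') = (-1) ^ d * \<alpha> (omit p v')"
  using Suc.IH[of v'] Suc.prems by (simp add: q_def)
 moreover have "omit p v' = omit p v \<circ> swap (q - 1) q"
  by (auto simp: omit_def v'_def fun_eq_iff Transposition.transpose_def q_def)
 moreover have "\<alpha> (omit p v \<circ> swap (q - 1) q) = - \<alpha> (omit p v)"
  by (rule alternating_swap[OF A]) (use Suc.prems in "auto simp: q_def")
 ultimately show ?case using 1 by (simp add: q_def)
qed

text \<open>The alternating signs of an exterior derivative are exactly those that make the two
  terms belonging to equal arguments cancel. This drives both the proof that
  \<open>ext_deriv\<close> is alternating and the cancellation of second derivatives.\<close>

lemma alternating_omit:
 assumes "alternating k \<alpha>" "p < q" "q \<le> k" "v p = v q"
 shows "(-1) ^ q * \<alpha> (omit q v) = - ((-1) ^ p * \<alpha> (omit p v))"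
proof -
 obtain d where d: "q = p + Suc d" using assms(2) by (metis add_Suc_right less_imp_Suc_add)
 have "\<alpha> (omit q v) = (-1) ^ d * \<alpha> (omit p v)"
  using alternating_omit_aux[OF assms(1), of p d v] assms d by simp
 thus ?thesis
  unfolding d by (simp add: power_add)
qed

lemma alternating_expand:
 assumes A: "alternating k \<alpha>" and E: "finite E"
  and w: "\<And>j. j < k ==> w j = (\<Sum>e\<in>E. c j e *\<^sub>R e)"
 shows "\<alpha> w = (\<Sum>v\<in>{..<k} \<rightarrow>\<^sub>E E. (\<Prod>j<k. c j (v j)) * \<alpha> v)"
proof -
 \<comment> \<open>Expansion slot by slot: the first \<open>m\<close> arguments are already taken
   from \<open>E\<close>, the others are still the original ones. Extensional tuples have no
   meaningful value from \<open>k\<close> on; the final \<open>alternating_cong\<close> removes the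
   dependence on these entries.\<close>
 have "m \<le> k ==> \<alpha> w = (\<Sum>v\<in>{..<m} \<rightarrow>\<^sub>E E. (\<Prod>j<m. c j (v j)) * \<alpha> (\<lambda>j. if j < m then v j else w j))" for m
 proof (induction m)
  case 0
  thus ?case by simp
 next
  case (Suc m)
  let ?g = "\<lambda>m v j. if j < m then v j else w j"
  have step: "\<alpha> (?g m v) = (\<Sum>e\<in>E. c m e * \<alpha> (?g (Suc m) (v(m := e))))" for v
  proof -
   have lin: "linear (\<lambda>x. \<alpha> ((?g m v)(m := x)))"
    using alternating_linear[OF A] Suc.prems by simp
   have "\<alpha> (?g m v) = \<alpha> ((?g m v)(m := w m))"
    by (rule arg_cong[of _ _ \<alpha>]) (auto simp: fun_eq_iff)
   also have "... = (\<Sum>e\<in>E. c m e * \<alpha> ((?g m v)(m := e)))"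
    using Suc.prems by (simp add: w linear_sum[OF lin] linear_scale[OF lin])
   also have "(\<lambda>e. (?g m v)(m := e)) = (\<lambda>e. ?g (Suc m) (v(m := e)))"
    by (auto simp: fun_eq_iff less_Suc_eq)
   finally show ?thesis by (metis (no_types, lifting))
  qed
  have "\<alpha> w = (\<Sum>v\<in>{..<m} \<rightarrow>\<^sub>E E. (\<Prod>j<m. c j (v j)) * \<alpha> (?g m v))"
   using Suc by simp
  also have "... = (\<Sum>v\<in>{..<m} \<rightarrow>\<^sub>E E. \<Sum>e\<in>E. (\<Prod>j<m. c j (v j)) * (c m e * \<alpha> (?g (Suc m) (v(m := e)))))"
   by (subst step) (simp add: sum_distrib_left)
  also have "... = (\<Sum>e\<in>E. \<Sum>v\<in>{..<m} \<rightarrow>\<^sub>E E. (\<Prod>j<m. c j (v j)) * (c m e * \<alpha> (?g (Suc m) (v(m := e)))))"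
   by (rule sum.swap)
  also have "... = (\<Sum>(e, v)\<in>E \<times> ({..<m} \<rightarrow>\<^sub>E E). (\<Prod>j<m. c j (v j)) * (c m e * \<alpha> (?g (Suc m) (v(m := e)))))"
   by (rule sum.cartesian_product)
  also have "... = (\<Sum>v\<in>{..<Suc m} \<rightarrow>\<^sub>E E. (\<Prod>j<Suc m. c j (v j)) * \<alpha> (?g (Suc m) v))"
  proof (rule sum.reindex_cong[symmetric])
   show "inj_on (\<lambda>(e, v). v(m := e)) (E \<times> ({..<m} \<rightarrow>\<^sub>E E))"
    by (rule inj_combinator) simp
   show "{..<Suc m} \<rightarrow>\<^sub>E E = (\<lambda>(e, v). v(m := e)) ` (E \<times> ({..<m} \<rightarrow>\<^sub>E E))"
    by (simp add: lessThan_Suc PiE_insert_eq)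
   fix p assume "p \<in> E \<times> ({..<m} \<rightarrow>\<^sub>E E)"
   obtain e v where p: "p = (e, v)" by (cases p)
   have "(\<Prod>j<m. c j ((v(m := e)) j)) = (\<Prod>j<m. c j (v j))"
    by (rule prod.cong) auto
   thus "(\<Prod>j<Suc m. c j ((case p of (e, v) => v(m := e)) j)) * \<alpha> (?g (Suc m) (case p of (e, v) => v(m := e)))
     = (case p of (e, v) => (\<Prod>j<m. c j (v j)) * (c m e * \<alpha> (?g (Suc m) (v(m := e)))))"
    unfolding p prod.case prod.lessThan_Suc fun_upd_same by (simp only: mult.assoc)
  qed
  finally show ?case .
 qed
 from this[of k] have "\<alpha> w = (\<Sum>v\<in>{..<k} \<rightarrow>\<^sub>E E. (\<Prod>j<k. c j (v j)) * \<alpha> (\<lambda>j. if j < k then v j else w j))"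
  by simp
 also have "... = (\<Sum>v\<in>{..<k} \<rightarrow>\<^sub>E E. (\<Prod>j<k. c j (v j)) * \<alpha> v)"
  by (intro sum.cong refl arg_cong2[of _ _ _ _ "(*)"] alternating_cong[OF A]) auto
 finally show ?thesis .
qed

text \<open>Turns a bound on change-of-basis coefficients into a bound on values of forms; norms in
  different frames are compared in this way, in both directions.\<close>

lemma alternating_expand_bound:
 assumes A: "alternating k \<alpha>" and E: "finite E"
  and w: "\<And>j. j < k ==> w j = (\<Sum>e\<in>E. c j e *\<^sub>R e)"
  and c: "\<And>j e. j < k ==> e \<in> E ==> \<bar>c j e\<bar> \<le> C"
 shows "\<bar>\<alpha> w\<bar> \<le> C ^ k * (\<Sum>v\<in>{..<k} \<rightarrow>\<^sub>E E. \<bar>\<alpha> v\<bar>)"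
proof -
 have "\<alpha> w = (\<Sum>v\<in>{..<k} \<rightarrow>\<^sub>E E. (\<Prod>j<k. c j (v j)) * \<alpha> v)"
  by (rule alternating_expand[OF A E]) (rule w)
 hence "\<bar>\<alpha> w\<bar> \<le> (\<Sum>v\<in>{..<k} \<rightarrow>\<^sub>E E. \<bar>(\<Prod>j<k. c j (v j)) * \<alpha> v\<bar>)"
  by (simp only: sum_abs)
 also have "... \<le> (\<Sum>v\<in>{..<k} \<rightarrow>\<^sub>E E. C ^ k * \<bar>\<alpha> v\<bar>)"
 proof (rule sum_mono)
  fix v assume v: "v \<in> {..<k} \<rightarrow>\<^sub>E E"
  have "\<bar>\<Prod>j<k. c j (v j)\<bar> = (\<Prod>j<k. \<bar>c j (v j)\<bar>)" by (rule abs_prod)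
  also have "... \<le> (\<Prod>j<k. C)" by (rule prod_mono) (use c v in auto)
  finally show "\<bar>(\<Prod>j<k. c j (v j)) * \<alpha> v\<bar> \<le> C ^ k * \<bar>\<alpha> v\<bar>"
   by (simp add: abs_mult mult_right_mono)
 qed
 finally show ?thesis by (simp add: sum_distrib_left)
qed

lemma basis_enum_bij: "bij_betw (basis_enum :: nat => 'e::euclidean_space) {..<DIM('e)} Basis"
proof -
 have "\<exists>f :: nat => 'e. bij_betw f {..<DIM('e)} Basis"
  using ex_bij_betw_nat_finite[OF finite_Basis] by (auto simp: atLeast0LessThan)
 thus ?thesis unfolding basis_enum_def by (rule someI_ex)
qed

lemma sign_compose_transpose:
 assumes "p permutes S" "finite S" "i \<noteq> j"
 shows "sign (p \<circ> swap i j) = - sign p" "sign (swap i j \<circ> p) = - sign p"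
proof -
 have "permutation p" using assms(1,2) unfolding permutation_permutes by blast
 thus "sign (p \<circ> swap i j) = - sign p" "sign (swap i j \<circ> p) = - sign p"
  using assms(3) by (simp_all add: sign_compose permutation_swap_id sign_swap_id)
qed

lemma alternating_permute_basis:
 fixes \<tau> :: "nat => 'e::euclidean_space"
 assumes A: "alternating m \<alpha>" and \<tau>: "bij_betw \<tau> {..<m} Basis" and p: "\<pi> permutes (Basis::'e set)"
 shows "\<alpha> (\<pi> \<circ> \<tau>) = of_int (sign \<pi>) * \<alpha> \<tau>"
 using p finite_Basis
proof (induction rule: permutes_induct)
 case id
 thus ?case by simp
next
 case (swap a b p)
 have bij: "bij_betw (p \<circ> \<tau>) {..<m} Basis"
  using \<tau> swap permutes_imp_bij bij_betw_trans by blast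
 obtain i where i: "i < m" "p (\<tau> i) = a"
  using bij swap(1) unfolding bij_betw_def by (metis comp_apply imageE lessThan_iff)
 obtain j where j: "j < m" "p (\<tau> j) = b"
  using bij swap(2) unfolding bij_betw_def by (metis comp_apply imageE lessThan_iff)
 have inj: "p (\<tau> x) = p (\<tau> y) ==> x < m ==> y < m ==> x = y" for x y
  using bij unfolding bij_betw_def inj_on_def by auto
 \<comment> \<open>Swapping the basis vectors \<open>a\<close> and \<open>b\<close> on the left
   amounts to swapping the positions \<open>i\<close> and \<open>j\<close> where they stand. The two
   sequences agree below \<open>m\<close> only, which is enough for \<alpha>.\<close>
 have "\<alpha> (Transposition.transpose a b \<circ> p \<circ> \<tau>) = \<alpha> ((p \<circ> \<tau>) \<circ> swap i j)"
  by (rule alternating_cong[OF A]) (use i j inj in "auto simp: Transposition.transpose_def")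
 also have "... = - \<alpha> (p \<circ> \<tau>)"
  using alternating_swap[OF A i(1) j(1)] i j swap(3) by auto
 finally have 1: "\<alpha> (Transposition.transpose a b \<circ> p \<circ> \<tau>) = - \<alpha> (p \<circ> \<tau>)" .
 show ?case
  by (simp only: 1 swap.IH sign_compose_transpose(2)[OF swap(4) finite_Basis swap(3)] of_int_minus mult_minus_left)
qed

text \<open>In the multilinear expansion the tuples with a repeated basis vector drop out, and the
  remaining ones are the permutations of the basis; what is left is the Leibniz sum of
  \<open>lin_det\<close>. Hence a form of top degree changes by the Jacobian determinant under a
  change of chart.\<close>

lemma alternating_top_lin_det:
 fixes T :: "'e::euclidean_space => 'e"
 assumes A: "alternating m \<alpha>" and \<tau>: "bij_betw \<tau> {..<m} (Basis :: 'e set)"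
 shows "\<alpha> (\<lambda>j. T (\<tau> j)) = lin_det T * \<alpha> \<tau>"
proof -
 let ?f = "\<lambda>\<pi>. restrict (\<pi> \<circ> \<tau>) {..<m}"
 let ?P = "{\<pi>. \<pi> permutes (Basis :: 'e set)}"
 let ?g = "\<lambda>v. (\<Prod>j<m. T (\<tau> j) \<bullet> v j) * \<alpha> v"
 have tin: "j < m ==> \<tau> j \<in> Basis" for j using \<tau> by (auto simp: bij_betw_def)
 have "\<alpha> (\<lambda>j. T (\<tau> j)) = (\<Sum>v\<in>{..<m} \<rightarrow>\<^sub>E Basis. ?g v)"
  by (rule alternating_expand[OF A finite_Basis]) (simp add: euclidean_representation)
 also have "... = (\<Sum>v\<in>?f ` ?P. ?g v)"
 proof (rule sum.mono_neutral_right)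
  show "finite ({..<m} \<rightarrow>\<^sub>E (Basis::'e set))" by (simp add: finite_PiE)
  show "?f ` ?P \<subseteq> {..<m} \<rightarrow>\<^sub>E (Basis::'e set)"
   using tin by (auto simp: permutes_in_image split: if_splits)
  show "\<forall>v\<in>({..<m} \<rightarrow>\<^sub>E Basis) - ?f ` ?P. ?g v = 0"
  proof
   fix v assume v: "v \<in> ({..<m} \<rightarrow>\<^sub>E (Basis::'e set)) - ?f ` ?P"
   \<comment> \<open>An injective tuple would be a bijection onto the basis and thus come from the
     permutation that sends \<open>\<tau> j\<close> to \<open>v j\<close>. The restriction in
     \<open>?f\<close> is there because the tuples of the sum are extensional.\<close>
   have "\<not> inj_on v {..<m}"
   proof
    assume inj: "inj_on v {..<m}"
    have sub: "v ` {..<m} \<subseteq> Basis" using v by auto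
    have cm: "card {..<m} = card (Basis::'e set)" using bij_betw_same_card[OF \<tau>] .
    have vb: "bij_betw v {..<m} Basis"
     unfolding bij_betw_def using inj sub cm
     by (metis card_image card_subset_eq finite_Basis)
    define \<pi> where "\<pi> = (\<lambda>b. if b \<in> Basis then v (inv_into {..<m} \<tau> b) else b)"
    have "bij_betw (v \<circ> inv_into {..<m} \<tau>) Basis Basis"
     using bij_betw_trans[OF bij_betw_inv_into[OF \<tau>] vb] .
    hence "bij_betw \<pi> Basis Basis"
     by (rule bij_betw_cong[THEN iffD1, rotated]) (auto simp: \<pi>_def)
    hence "\<pi> permutes Basis"
     by (rule bij_imp_permutes) (auto simp: \<pi>_def)
    moreover have "v = ?f \<pi>"
    proof
     fix j show "v j = ?f \<pi> j"
      using v tin[of j] \<tau> by (cases "j < m") (auto simp: \<pi>_def bij_betw_def PiE_def extensional_def)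
    qed
    ultimately show False using v by blast
   qed
   then obtain i j where "i < m" "j < m" "i \<noteq> j" "v i = v j"
    unfolding inj_on_def by blast
   hence "\<alpha> v = 0" using alternating_eq_zero[OF A] by metis
   thus "?g v = 0" by simp
  qed
 qed
 also have "... = (\<Sum>\<pi>\<in>?P. ?g (?f \<pi>))"
 proof (rule sum.reindex[unfolded o_def])
  show "inj_on ?f ?P"
  proof (rule inj_onI)
   fix p q assume pq: "p \<in> ?P" "q \<in> ?P" "?f p = ?f q"
   show "p = q"
   proof
    fix b show "p b = q b"
    proof (cases "b \<in> Basis")
     case True
     then obtain j where "j < m" "\<tau> j = b"
      using \<tau> unfolding bij_betw_def by (metis imageE lessThan_iff)
     thus ?thesis using fun_cong[OF pq(3), of j] by simp
    next
     case False
     thus ?thesis using pq by (auto simp: permutes_def)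
    qed
   qed
  qed
 qed
 also have "... = (\<Sum>\<pi>\<in>?P. of_int (sign \<pi>) * (\<Prod>b\<in>Basis. T b \<bullet> \<pi> b) * \<alpha> \<tau>)"
 proof (rule sum.cong[OF refl])
  fix \<pi> assume p: "\<pi> \<in> ?P"
  have "\<alpha> (?f \<pi>) = \<alpha> (\<pi> \<circ> \<tau>)" by (rule alternating_cong[OF A]) auto
  also have "... = of_int (sign \<pi>) * \<alpha> \<tau>"
   using alternating_permute_basis[OF A \<tau>] p by simp
  moreover have "(\<Prod>j<m. T (\<tau> j) \<bullet> ?f \<pi> j) = (\<Prod>b\<in>Basis. T b \<bullet> \<pi> b)"
   using prod.reindex_bij_betw[OF \<tau>, of "\<lambda>b. T b \<bullet> \<pi> b"] by simp
  ultimately show "?g (?f \<pi>) = of_int (sign \<pi>) * (\<Prod>b\<in>Basis. T b \<bullet> \<pi> b) * \<alpha> \<tau>" by simp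
 qed
 finally show ?thesis by (simp add: lin_det_def sum_distrib_right)
qed

section \<open>The wedge product\<close>

lemma bij_betw_permutes_compose_left:
 assumes q: "q permutes S"
 shows "bij_betw (\<lambda>p. q \<circ> p) {p. p permutes S} {p. p permutes S}"
 by (rule bij_betwI[of _ _ _ "\<lambda>p. inv q \<circ> p"])
   (auto simp: o_assoc permutes_inv_o[OF q] permutes_compose permutes_inv q)

text \<open>Linearity holds permutation by permutation: the argument \<open>i\<close> enters exactly
  one of the two factors, according to whether the position that receives it lies below
  \<open>k\<close>.\<close>

lemma alternating_wedge:
 assumes A: "alternating k \<alpha>" and B: "alternating l \<beta>"
 shows "alternating (k + l) (wedge k l \<alpha> \<beta>)"
 unfolding alternating_def
proof (intro conjI allI impI)
 fix v :: "nat => 'a" and i assume i: "i < k + l"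
 let ?p = "\<lambda>\<sigma> x. \<alpha> (\<lambda>j. (v(i := x)) (\<sigma> j)) * \<beta> (\<lambda>j. (v(i := x)) (\<sigma> (k + j)))"
 have lin: "linear (\<lambda>x. ?p \<sigma> x)"
  if s: "\<sigma> permutes {..<k + l}" for \<sigma>
 proof -
  have inj: "\<sigma> x = \<sigma> y \<longleftrightarrow> x = y" for x y using permutes_inj[OF s] by (auto simp: inj_def)
  obtain j0 where j0: "j0 < k + l" "\<sigma> j0 = i"
   using s i by (metis lessThan_iff permutes_def permutes_in_image)
  show ?thesis
  proof (cases "j0 < k")
   case True
   have "(\<lambda>x. ?p \<sigma> x)
    = (\<lambda>x. \<beta> (\<lambda>j. v (\<sigma> (k + j))) * \<alpha> ((\<lambda>j. v (\<sigma> j))(j0 := x)))"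
   proof
    fix x
    have "\<alpha> (\<lambda>j. (v(i := x)) (\<sigma> j)) = \<alpha> ((\<lambda>j. v (\<sigma> j))(j0 := x))"
     by (rule arg_cong[of _ _ \<alpha>]) (use j0 inj in auto)
    moreover have "\<beta> (\<lambda>j. (v(i := x)) (\<sigma> (k + j))) = \<beta> (\<lambda>j. v (\<sigma> (k + j)))"
     by (rule arg_cong[of _ _ \<beta>]) (use j0 inj True in auto)
    ultimately show "?p \<sigma> x =
      \<beta> (\<lambda>j. v (\<sigma> (k + j))) * \<alpha> ((\<lambda>j. v (\<sigma> j))(j0 := x))" by simp
   qed
   thus ?thesis
    using linear_real_mult[OF alternating_linear[OF A True]] by simp
  next
   case False
   then obtain j1 where j1: "j0 = k + j1" "j1 < l" using j0 by (metis add_less_cancel_left le_Suc_ex not_less)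
   have "(\<lambda>x. ?p \<sigma> x)
    = (\<lambda>x. \<alpha> (\<lambda>j. v (\<sigma> j)) * \<beta> ((\<lambda>j. v (\<sigma> (k + j)))(j1 := x)))"
   proof
    fix x
    have "\<beta> (\<lambda>j. (v(i := x)) (\<sigma> (k + j))) = \<beta> ((\<lambda>j. v (\<sigma> (k + j)))(j1 := x))"
     by (rule arg_cong[of _ _ \<beta>]) (use j0 j1 inj in auto)
    moreover have "\<alpha> (\<lambda>j. (v(i := x)) (\<sigma> j)) = \<alpha> (\<lambda>j. v (\<sigma> j))"
     by (rule alternating_cong[OF A]) (use j0 inj False in auto)
    ultimately show "?p \<sigma> x =
      \<alpha> (\<lambda>j. v (\<sigma> j)) * \<beta> ((\<lambda>j. v (\<sigma> (k + j)))(j1 := x))" by simp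
   qed
   thus ?thesis
    using linear_real_mult[OF alternating_linear[OF B j1(2)]] by simp
  qed
 qed
 have "wedge k l \<alpha> \<beta> (v(i := x)) = (\<Sum>\<sigma> | \<sigma> permutes {..<k + l}. (of_int (sign \<sigma>) / (fact k * fact l)) *
   (?p \<sigma> x))" for x
  unfolding wedge_def sum_divide_distrib by (rule sum.cong) auto
 moreover have "linear (\<lambda>x. \<Sum>\<sigma> | \<sigma> permutes {..<k + l}. (of_int (sign \<sigma>) / (fact k * fact l)) *
   (?p \<sigma> x))"
  by (intro linear_compose_sum ballI linear_real_mult lin) simp
 ultimately show "linear (\<lambda>x. wedge k l \<alpha> \<beta> (v(i := x)))" by presburger
next
 fix v :: "nat => 'a" and i j assume ij: "i < j" "j < k + l" "v i = v j"
 have tr: "swap i j permutes {..<k + l}" using ij by (simp add: permutes_swap_id)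
 let ?t = "\<lambda>\<sigma>. real_of_int (sign \<sigma>) * \<alpha> (\<lambda>j. v (\<sigma> j)) * \<beta> (\<lambda>j. v (\<sigma> (k + j)))"
 let ?S = "\<Sum>\<sigma> | \<sigma> permutes {..<k + l}. ?t \<sigma>"
 have vt: "v (swap i j x) = v x" for x using ij by (auto simp: Transposition.transpose_def)
 \<comment> \<open>Composition with the swap on the left reverses the sign and leaves the arguments
   unchanged because \<open>v i = v j\<close>; so the sum equals its own negative.\<close>
 have "?S = (\<Sum>\<sigma> | \<sigma> permutes {..<k + l}. ?t (swap i j \<circ> \<sigma>))"
  using sum.reindex_bij_betw[OF bij_betw_permutes_compose_left[OF tr], of ?t] by simp
 also have "... = (\<Sum>\<sigma> | \<sigma> permutes {..<k + l}. - ?t \<sigma>)"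
 proof (rule sum.cong[OF refl])
  fix \<sigma> assume "\<sigma> \<in> {\<sigma>. \<sigma> permutes {..<k + l}}"
  hence "sign (swap i j \<circ> \<sigma>) = - sign \<sigma>"
   using sign_compose_transpose(2)[of \<sigma> "{..<k+l}" i j] ij by auto
  thus "?t (swap i j \<circ> \<sigma>) = - ?t \<sigma>" by (simp add: vt)
 qed
 also have "... = - ?S" by (rule sum_negf)
 finally show "wedge k l \<alpha> \<beta> v = 0" by (simp add: wedge_def)
next
 fix v w :: "nat => 'a" assume vw: "\<forall>i<k + l. v i = w i"
 show "wedge k l \<alpha> \<beta> v = wedge k l \<alpha> \<beta> w"
  unfolding wedge_def
 proof (intro arg_cong2[of _ _ _ _ "(/)"] sum.cong refl)
  fix \<sigma> assume "\<sigma> \<in> {\<sigma>. \<sigma> permutes {..<k + l}}"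
  hence s: "x < k + l ==> \<sigma> x < k + l" for x by (metis lessThan_iff mem_Collect_eq permutes_in_image)
  have "\<alpha> (\<lambda>j. v (\<sigma> j)) = \<alpha> (\<lambda>j. w (\<sigma> j))"
   by (rule alternating_cong[OF A]) (use s vw in auto)
  moreover have "\<beta> (\<lambda>j. v (\<sigma> (k + j))) = \<beta> (\<lambda>j. w (\<sigma> (k + j)))"
   by (rule alternating_cong[OF B]) (use s vw in auto)
  ultimately show "of_int (sign \<sigma>) * \<alpha> (\<lambda>j. v (\<sigma> j)) * \<beta> (\<lambda>j. v (\<sigma> (k + j))) =
   of_int (sign \<sigma>) * \<alpha> (\<lambda>j. w (\<sigma> j)) * \<beta> (\<lambda>j. w (\<sigma> (k + j)))" by simp
 qed
qed

text \<open>The part of a shuffle sum in which position \<open>j\<close> receives argument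
  \<open>r\<close>. It is used with \<open>r\<close> the index of the axis direction d/dt, to tell
  which factor of a wedge product receives d/dt.\<close>

definition perm_sum :: "nat => nat => nat => ((nat => nat) => real) => real" where
 "perm_sum m j r F = (\<Sum>\<sigma> | \<sigma> permutes {..<m} \<and> \<sigma> j = r. of_int (sign \<sigma>) * F \<sigma>)"

lemma perm_sum_cong:
 "(\<And>\<sigma>. \<sigma> permutes {..<m} ==> \<sigma> j = r ==> F \<sigma> = G \<sigma>) ==> perm_sum m j r F = perm_sum m j r G"
 unfolding perm_sum_def by (rule sum.cong) auto

text \<open>Composition with the swap on the right flips the sign and also flips \<open>F\<close>,
  so it matches the two sums term by term.\<close>

lemma perm_sum_swap:
 assumes ij: "i < m" "j < m" and F: "\<And>\<sigma>. \<sigma> permutes {..<m} ==> i \<noteq> j ==> F (\<sigma> \<circ> swap i j) = - F \<sigma>"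
 shows "perm_sum m i r F = perm_sum m j r F"
proof (cases "i = j")
 case False
 have tr: "swap i j permutes {..<m}" using ij by (simp add: permutes_swap_id)
 show ?thesis
  unfolding perm_sum_def
 proof (rule sum.reindex_bij_witness[of _ "\<lambda>\<sigma>. \<sigma> \<circ> swap i j" "\<lambda>\<sigma>. \<sigma> \<circ> swap i j"])
  fix \<sigma> assume s: "\<sigma> \<in> {\<sigma>. \<sigma> permutes {..<m} \<and> \<sigma> i = r}"
  thus "of_int (sign (\<sigma> \<circ> swap i j)) * F (\<sigma> \<circ> swap i j) = of_int (sign \<sigma>) * F \<sigma>"
   using F[of \<sigma>] sign_compose_transpose(1)[of \<sigma> "{..<m}" i j] False by simp
 qed (use tr in "auto simp: permutes_compose o_assoc[symmetric]")
qed simp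

lemma sum_up_split: "(\<Sum>j<k + l. f j) = (\<Sum>j<k. f j) + (\<Sum>j<l::nat. f (k + j) :: real)"
 by (induction l) (auto simp: add.assoc)

text \<open>The permutations are sorted according to the factor that receives the argument \<open>v r\<close>.\<close>

lemma wedge_split:
 fixes v :: "nat => 'v::real_vector"
 assumes A: "alternating k \<alpha>" and B: "alternating l \<beta>" and r: "r < k + l"
 defines "F \<equiv> \<lambda>\<sigma>. \<alpha> (\<lambda>j. v (\<sigma> j)) * \<beta> (\<lambda>j. v (\<sigma> (k + j)))"
 shows "wedge k l \<alpha> \<beta> v =
  (real k * perm_sum (k + l) (k - 1) r F + real l * perm_sum (k + l) k r F) / (fact k * fact l)"
proof -
 let ?m = "k + l"
 have swapF: "F (\<sigma> \<circ> swap i j) = - F \<sigma>"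
  if ij: "i \<noteq> j" "i < k \<and> j < k \<or> k \<le> i \<and> k \<le> j \<and> i < ?m \<and> j < ?m" for \<sigma> i j
 proof (cases "i < k")
  case True
  hence "\<alpha> (\<lambda>x. v ((\<sigma> \<circ> swap i j) x)) = - \<alpha> (\<lambda>x. v (\<sigma> x))"
   using alternating_swap[OF A, of i j "\<lambda>x. v (\<sigma> x)"] ij by (simp add: o_def)
  moreover have "\<beta> (\<lambda>x. v ((\<sigma> \<circ> swap i j) (k + x))) = \<beta> (\<lambda>x. v (\<sigma> (k + x)))"
   by (rule arg_cong[of _ _ \<beta>]) (use True ij in "auto simp: Transposition.transpose_def")
  ultimately show ?thesis by (simp add: F_def)
 next
  case False
  then obtain i' j' where i': "i = k + i'" "j = k + j'" "i' < l" "j' < l"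
   using ij by (metis add_less_cancel_left le_Suc_ex not_less)
  have "\<alpha> (\<lambda>x. v ((\<sigma> \<circ> swap i j) x)) = \<alpha> (\<lambda>x. v (\<sigma> x))"
   by (rule alternating_cong[OF A]) (use i' in "auto simp: Transposition.transpose_def")
  moreover have "\<beta> (\<lambda>x. v ((\<sigma> \<circ> swap i j) (k + x))) = \<beta> ((\<lambda>x. v (\<sigma> (k + x))) \<circ> swap i' j')"
   by (rule arg_cong[of _ _ \<beta>]) (use i' in "auto simp: Transposition.transpose_def")
  moreover have "\<beta> ((\<lambda>x. v (\<sigma> (k + x))) \<circ> swap i' j') = - \<beta> (\<lambda>x. v (\<sigma> (k + x)))"
   using alternating_swap[OF B] i' ij by blast
  ultimately show ?thesis by (simp add: F_def)
 qed
 have "{\<sigma>. \<sigma> permutes {..<?m}} = (\<Union>j\<in>{..<?m}. {\<sigma>. \<sigma> permutes {..<?m} \<and> \<sigma> j = r})"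
 proof (intro set_eqI iffI)
  fix \<sigma> assume s: "\<sigma> \<in> {\<sigma>. \<sigma> permutes {..<?m}}"
  then obtain j where "j < ?m" "\<sigma> j = r"
   using r by (metis lessThan_iff mem_Collect_eq permutes_def permutes_in_image)
  thus "\<sigma> \<in> (\<Union>j\<in>{..<?m}. {\<sigma>. \<sigma> permutes {..<?m} \<and> \<sigma> j = r})" using s by auto
 qed auto
 moreover have "(\<Sum>\<sigma>\<in>(\<Union>j\<in>{..<?m}. {\<sigma>. \<sigma> permutes {..<?m} \<and> \<sigma> j = r}). of_int (sign \<sigma>) * F \<sigma>) =
   (\<Sum>j<?m. perm_sum ?m j r F)"
  unfolding perm_sum_def
 proof (rule sum.UNION_disjoint)
  show "\<forall>i\<in>{..<?m}. finite {\<sigma>. \<sigma> permutes {..<?m} \<and> \<sigma> i = r}"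
   using finite_permutations[of "{..<?m}"] by (auto intro: finite_subset[rotated])
  show "\<forall>i\<in>{..<?m}. \<forall>j\<in>{..<?m}. i \<noteq> j -->
    {\<sigma>. \<sigma> permutes {..<?m} \<and> \<sigma> i = r} \<inter> {\<sigma>. \<sigma> permutes {..<?m} \<and> \<sigma> j = r} = {}"
   using permutes_inj by (force simp: inj_def)
 qed simp
 ultimately have 1: "(\<Sum>\<sigma> | \<sigma> permutes {..<?m}. of_int (sign \<sigma>) * F \<sigma>) = (\<Sum>j<?m. perm_sum ?m j r F)"
  by simp
 have "(\<Sum>j<?m. perm_sum ?m j r F) = (\<Sum>j<k. perm_sum ?m j r F) + (\<Sum>j<l. perm_sum ?m (k + j) r F)"
  using sum_up_split[of "\<lambda>j. perm_sum ?m j r F" k l] .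
 \<comment> \<open>All positions inside one factor give the same sum, so the last position
   \<open>k - 1\<close> of the left factor and the first position \<open>k\<close> of the right
   factor can represent them. For \<open>k = 0\<close> the truncated difference is harmless, since
   the sum is empty and the factor \<open>real k\<close> is zero.\<close>
 also have "(\<Sum>j<k. perm_sum ?m j r F) = (\<Sum>j<k. perm_sum ?m (k - 1) r F)"
  by (intro sum.cong refl perm_sum_swap swapF) auto
 also have "(\<Sum>j<l. perm_sum ?m (k + j) r F) = (\<Sum>j<l. perm_sum ?m k r F)"
  by (intro sum.cong refl perm_sum_swap swapF) auto
 finally have 2: "(\<Sum>j<?m. perm_sum ?m j r F) = real k * perm_sum ?m (k - 1) r F + real l * perm_sum ?m k r F"
  by simp
 have "wedge k l \<alpha> \<beta> v = (\<Sum>\<sigma> | \<sigma> permutes {..<?m}. of_int (sign \<sigma>) * F \<sigma>) / (fact k * fact l)"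
  by (simp add: wedge_def F_def mult.assoc)
 also note trans[OF 1 2]
 finally show ?thesis .
qed

section \<open>Differentiability classes\<close>

text \<open>The derivative clause of \<open>Ck_on (Suc k)\<close>, named so that a chosen family of
  partial derivatives can be handed on and transformed.\<close>

definition partials_on ::
 "'e::euclidean_space set => ('e => 'b::real_normed_vector) => ('e => 'e => 'b) => bool" where
 "partials_on S f f' \<longleftrightarrow>
   (\<forall>x\<in>S. (f has_derivative (\<lambda>v. \<Sum>b\<in>Basis. (v \<bullet> b) *\<^sub>R f' b x)) (at x within S))"

lemma Ck_on_Suc_iff: "Ck_on (Suc k) S f \<longleftrightarrow> (\<exists>f'. partials_on S f f' \<and> (\<forall>b\<in>Basis. Ck_on k S (f' b)))"
 by (simp add: partials_on_def)

declare Ck_on.simps(2) [simp del]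

lemma partials_on_continuous: "partials_on S f f' ==> continuous_on S f"
 using has_derivative_continuous_on[of S f "\<lambda>x v. \<Sum>b\<in>Basis. (v \<bullet> b) *\<^sub>R f' b x"]
 unfolding partials_on_def by blast

lemma Ck_on_SucD: "Ck_on (Suc k) S f ==> Ck_on k S f"
proof (induction k arbitrary: f)
 case 0
 thus ?case by (auto simp: Ck_on_Suc_iff dest: partials_on_continuous)
next
 case (Suc k)
 thus ?case unfolding Ck_on_Suc_iff[of "Suc k"] Ck_on_Suc_iff[of k] by blast
qed

lemma Ck_on_continuous: "Ck_on k S f ==> continuous_on S f"
 by (cases k) (auto simp: Ck_on_Suc_iff dest: partials_on_continuous)

lemma partials_on_cong: "partials_on S f f' ==> (\<And>x. x \<in> S ==> g x = f x) ==> partials_on S g f'"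
 unfolding partials_on_def by (blast intro: has_derivative_transform)

lemma Ck_on_cong:
 assumes "Ck_on k S f" "\<And>x. x \<in> S ==> g x = f x"
 shows "Ck_on k S g"
proof (cases k)
 case 0
 thus ?thesis using assms continuous_on_cong[of S S g f] by auto
next
 case (Suc j)
 thus ?thesis using assms partials_on_cong unfolding Suc Ck_on_Suc_iff by blast
qed

lemma Ck_on_const: "Ck_on k S (\<lambda>x. c)"
proof (induction k arbitrary: c)
 case (Suc k)
 have "partials_on S (\<lambda>x. c) (\<lambda>b x. 0)"
  unfolding partials_on_def by (auto intro!: derivative_eq_intros)
 thus ?case using Suc unfolding Ck_on_Suc_iff by blast
qed auto

lemma Ck_on_add: "Ck_on k S f ==> Ck_on k S g ==> Ck_on k S (\<lambda>x. f x + g x)"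
proof (induction k arbitrary: f g)
 case (Suc k)
 then obtain f' g' where *: "partials_on S f f'" "\<forall>b\<in>Basis. Ck_on k S (f' b)"
   "partials_on S g g'" "\<forall>b\<in>Basis. Ck_on k S (g' b)"
  unfolding Ck_on_Suc_iff by blast
 hence "partials_on S (\<lambda>x. f x + g x) (\<lambda>b x. f' b x + g' b x)"
  unfolding partials_on_def scaleR_add_right sum.distrib by (auto intro!: has_derivative_add)
 thus ?case unfolding Ck_on_Suc_iff using Suc.IH * by blast
qed (auto intro: continuous_intros)

lemma Ck_on_mult:
 fixes f g :: "'e::euclidean_space => real"
 shows "Ck_on k S f ==> Ck_on k S g ==> Ck_on k S (\<lambda>x. f x * g x)"
proof (induction k arbitrary: f g)
 case (Suc k)
 then obtain f' g' where *: "partials_on S f f'" "\<forall>b\<in>Basis. Ck_on k S (f' b)"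
   "partials_on S g g'" "\<forall>b\<in>Basis. Ck_on k S (g' b)"
  unfolding Ck_on_Suc_iff by blast
 have "partials_on S (\<lambda>x. f x * g x) (\<lambda>b x. f x * g' b x + f' b x * g x)"
  unfolding partials_on_def
 proof
  fix x assume "x \<in> S"
  hence "(f has_derivative (\<lambda>v. \<Sum>b\<in>Basis. (v \<bullet> b) *\<^sub>R f' b x)) (at x within S)"
   "(g has_derivative (\<lambda>v. \<Sum>b\<in>Basis. (v \<bullet> b) *\<^sub>R g' b x)) (at x within S)"
   using * unfolding partials_on_def by auto
  from has_derivative_mult[OF this]
  show "((\<lambda>x. f x * g x) has_derivative (\<lambda>v. \<Sum>b\<in>Basis. (v \<bullet> b) *\<^sub>R (f x * g' b x + f' b x * g x))) (at x within S)"
   by (simp add: sum_distrib_left sum_distrib_right algebra_simps sum.distrib)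
 qed
 moreover have "Ck_on k S f" "Ck_on k S g" using Suc.prems Ck_on_SucD by auto
 ultimately show ?case unfolding Ck_on_Suc_iff
  using Suc.IH * Ck_on_add by blast
qed (auto intro: continuous_intros)

lemma Basis_prod_split:
 "(\<Sum>b\<in>Basis. ((v :: real \<times> 'e::euclidean_space) \<bullet> b) *\<^sub>R f b) =
   fst v *\<^sub>R f (1, 0) + (\<Sum>b\<in>Basis. (snd v \<bullet> b) *\<^sub>R f (0, b))"
proof -
 have inj: "inj_on (\<lambda>u. (u::real, 0::'e)) Basis" "inj_on (\<lambda>u. (0::real, u::'e)) Basis"
  by (auto intro!: inj_onI)
 show ?thesis
  unfolding Basis_prod_def
  by (subst sum.union_disjoint) (auto simp: inner_prod_def sum.reindex inj)
qed

lemma Ck_on_fst: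
 fixes f :: "real => real" and S :: "(real \<times> 'e::euclidean_space) set"
 shows "Ck_on k UNIV f ==> Ck_on k S (\<lambda>z. f (fst z))"
proof (induction k arbitrary: f)
 case 0
 thus ?case by (auto intro!: continuous_on_compose2[of UNIV f] continuous_intros)
next
 case (Suc k)
 then obtain f' where *: "partials_on UNIV f f'" "Ck_on k UNIV (f' 1)"
  unfolding Ck_on_Suc_iff by auto
 have "partials_on S (\<lambda>z. f (fst z)) (\<lambda>b z. if b = (1, 0) then f' 1 (fst z) else 0)"
  unfolding partials_on_def
 proof
  fix z assume "z \<in> S"
  have "(f has_derivative (\<lambda>v. v * f' 1 (fst z))) (at (fst z))"
   using * unfolding partials_on_def by simp
  hence "((\<lambda>z. f (fst z)) has_derivative (\<lambda>v. fst v * f' 1 (fst z))) (at z within S)"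
   by (rule has_derivative_compose[OF has_derivative_fst[OF has_derivative_ident]])
  thus "((\<lambda>z. f (fst z)) has_derivative (\<lambda>v. \<Sum>b\<in>Basis. (v \<bullet> b) *\<^sub>R
    (if b = (1, 0) then f' 1 (fst z) else 0))) (at z within S)"
   unfolding Basis_prod_split by simp
 qed
 moreover have "Ck_on k S (\<lambda>z. if b = (1, 0) then f' 1 (fst z) else 0)" for b
  using Suc.IH[OF *(2)] Ck_on_const by (cases "b = (1, 0)") auto
 ultimately show ?case unfolding Ck_on_Suc_iff by blast
qed

lemma Ck_on_real_SucI:
 fixes f :: "real => real"
 assumes "\<And>x. (f has_real_derivative f' x) (at x)" "Ck_on k UNIV f'"
 shows "Ck_on (Suc k) UNIV f"
 unfolding Ck_on_Suc_iff partials_on_def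
 using assms by (intro exI[of _ "\<lambda>b. f'"]) (simp add: has_field_derivative_def mult.commute[of _ "f' _"])

lemma Ck_on_real_SucD:
 fixes f :: "real => real"
 assumes "Ck_on (Suc k) UNIV f"
 obtains f' where "\<And>x. (f has_real_derivative f' x) (at x)" "Ck_on k UNIV f'"
proof -
 obtain f' where *: "partials_on UNIV f f'" "Ck_on k UNIV (f' 1)"
  using assms unfolding Ck_on_Suc_iff by auto
 have "(f has_real_derivative f' 1 x) (at x)" for x
  using * unfolding partials_on_def
  by (simp add: has_field_derivative_def mult.commute[of _ "f' _ _"])
 thus thesis using that * by blast
qed

lemma Ck_on_affine:
 fixes f :: "real => real"
 shows "Ck_on k UNIV f ==> Ck_on k UNIV (\<lambda>x. f (\<alpha> * x + \<beta>))"
proof (induction k arbitrary: f)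
 case 0
 thus ?case by (auto intro!: continuous_on_compose2[of UNIV f] continuous_intros)
next
 case (Suc k)
 obtain f' where f': "\<And>x. (f has_real_derivative f' x) (at x)" "Ck_on k UNIV f'"
  using Ck_on_real_SucD[OF Suc.prems] by blast
 have "((\<lambda>x. f (\<alpha> * x + \<beta>)) has_real_derivative f' (\<alpha> * x + \<beta>) * \<alpha>) (at x)" for x
  by (rule DERIV_chain2[OF f'(1)]) (auto intro!: derivative_eq_intros)
 thus ?case
  by (rule Ck_on_real_SucI) (intro Ck_on_mult Ck_on_const Suc.IH f')
qed

section \<open>Smooth cutoff functions\<close>

text \<open>The usual flat function \<open>exp (- 1 / x)\<close>, divided by powers of
  \<open>x\<close>. The whole family is needed for the induction: derivatives of members are linear
  combinations of members.\<close>

definition flat_exp :: "nat => real => real" where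
 "flat_exp m x = (if x > 0 then exp (- (1 / x)) / x ^ m else 0)"

text \<open>From \<open>y \<le> exp y\<close> at \<open>y = 1 / (n * x)\<close>, raised to the power
  \<open>n = m + 1\<close>. Taking one power more than \<open>m\<close> leaves a factor
  \<open>x\<close>, which controls the difference quotients at \<open>0\<close>.\<close>

lemma flat_exp_bound: "\<bar>flat_exp m x\<bar> \<le> real (Suc m) ^ Suc m * \<bar>x\<bar>"
proof (cases "x > 0")
 case True
 define n where "n = Suc m"
 have "1 / (real n * x) \<le> exp (1 / (real n * x))"
  using exp_ge_add_one_self[of "1 / (real n * x)"] by linarith
 hence "(1 / (real n * x)) ^ n \<le> exp (1 / (real n * x)) ^ n"
  by (rule power_mono) (use True in "simp add: n_def")
 also have "exp (1 / (real n * x)) ^ n = exp (real n * (1 / (real n * x)))"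
  by (rule exp_of_nat_mult[symmetric])
 also have "real n * (1 / (real n * x)) = 1 / x"
  by (simp add: n_def)
 finally have "1 / (real n * x) ^ n \<le> exp (1 / x)" by (simp add: power_one_over)
 moreover have "(real n * x) ^ n > 0" using True by (simp add: n_def)
 ultimately have "1 \<le> exp (1 / x) * (real n * x) ^ n" by (simp only: divide_le_eq if_True)
 hence "1 \<le> exp (1 / x) * (real n ^ n * x ^ n)"
  by (simp only: power_mult_distrib)
 hence "exp (- (1 / x)) \<le> real n ^ n * x ^ n"
  by (simp add: exp_minus field_simps)
 hence "exp (- (1 / x)) / x ^ m \<le> real n ^ n * x"
  using True by (simp add: field_simps n_def)
 thus ?thesis using True by (simp add: flat_exp_def n_def)
next
 case False
 have "0 \<le> real (Suc m) ^ Suc m * \<bar>x\<bar>" by (intro mult_nonneg_nonneg) auto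
 thus ?thesis using False by (simp add: flat_exp_def)
qed

lemma flat_exp_deriv:
 "(flat_exp m has_real_derivative flat_exp (m + 2) x - real m * flat_exp (Suc m) x) (at x)"
proof -
 consider "x > 0" | "x < 0" | "x = 0" by linarith
 thus ?thesis
 proof cases
  case 1
  have "((\<lambda>x. exp (- (1 / x))) has_real_derivative exp (- (1 / x)) * (1 / x ^ 2)) (at x)"
   using 1 by (auto intro!: derivative_eq_intros simp: power2_eq_square)
  from DERIV_divide[OF this DERIV_pow[of m x UNIV]]
  have "((\<lambda>x. exp (- (1 / x)) / x ^ m) has_real_derivative
    (exp (- (1 / x)) * (1 / x ^ 2) * x ^ m - exp (- (1 / x)) * (real m * x ^ (m - Suc 0))) / (x ^ m * x ^ m)) (at x)"
   using 1 by simp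
  also have "(exp (- (1 / x)) * (1 / x ^ 2) * x ^ m - exp (- (1 / x)) * (real m * x ^ (m - Suc 0))) / (x ^ m * x ^ m)
    = flat_exp (m + 2) x - real m * flat_exp (Suc m) x"
   using 1 by (cases m) (simp_all add: flat_exp_def field_simps power2_eq_square)
  finally have "((\<lambda>x. exp (- (1 / x)) / x ^ m) has_real_derivative
    flat_exp (m + 2) x - real m * flat_exp (Suc m) x) (at x)" .
  thus ?thesis
   by (rule has_field_derivative_transform_within_open[of _ _ _ "{0<..}"])
     (use 1 in "auto simp: flat_exp_def")
 next
  case 2
  have "((\<lambda>x. 0) has_real_derivative 0) (at x)" by simp
  hence "(flat_exp m has_real_derivative 0) (at x)"
   by (rule has_field_derivative_transform_within_open[of _ _ _ "{..<0}"])
     (use 2 in "auto simp: flat_exp_def")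
  thus ?thesis using 2 by (simp add: flat_exp_def)
 next
  case 3
  \<comment> \<open>The difference quotient at \<open>0\<close> is the next member of the family,
    and the linear bound sends it to \<open>0\<close>.\<close>
  have "((\<lambda>h. flat_exp m h / h) \<longlongrightarrow> 0) (at 0)"
  proof (rule Lim_null_comparison)
   show "\<forall>\<^sub>F h in at 0. norm (flat_exp m h / h) \<le> real (Suc (Suc m)) ^ Suc (Suc m) * \<bar>h\<bar>"
   proof (intro always_eventually allI)
    fix h :: real
    have "flat_exp m h / h = flat_exp (Suc m) h"
     by (simp add: flat_exp_def)
    thus "norm (flat_exp m h / h) \<le> real (Suc (Suc m)) ^ Suc (Suc m) * \<bar>h\<bar>"
     using flat_exp_bound[of "Suc m" h] by simp
   qed
   show "((\<lambda>h::real. real (Suc (Suc m)) ^ Suc (Suc m) * \<bar>h\<bar>) \<longlongrightarrow> 0) (at 0)"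
    by (auto intro!: tendsto_eq_intros)
  qed
  thus ?thesis
   unfolding has_field_derivative_iff 3 by (simp add: flat_exp_def)
 qed
qed

lemma Ck_on_flat_exp: "Ck_on k UNIV (flat_exp m)"
proof (induction k arbitrary: m)
 case 0
 show ?case unfolding Ck_on.simps by (rule DERIV_continuous_on) (rule flat_exp_deriv)
next
 case (Suc k)
 have "Ck_on k UNIV (\<lambda>x. flat_exp (m + 2) x + (- real m) * flat_exp (Suc m) x)"
  by (intro Ck_on_add Ck_on_mult Ck_on_const Suc.IH)
 thus ?case
  by (intro Ck_on_real_SucI[OF flat_exp_deriv]) simp
qed

text \<open>Both functions come from one bump \<open>b\<close>: \<open>c\<close> is \<open>b\<close>
  divided by its total integral, and \<kappa> is one minus the normalized primitive of
  \<open>b\<close>, which makes it \<open>1\<close> before and \<open>0\<close> after the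
  support.\<close>

lemma smooth_cutoff_exists:
 obtains c \<kappa> :: "real => real" and B where
  "\<And>k. Ck_on k UNIV c" "\<And>k. Ck_on k UNIV \<kappa>"
  "\<And>t. (\<kappa> has_real_derivative - c t) (at t)"
  "\<And>t. 0 \<le> c t" "\<And>t. c t \<le> B" "\<And>t. \<not> (1 \<le> t \<and> t \<le> 2) ==> c t = 0"
  "\<And>t. 0 \<le> \<kappa> t" "\<And>t. \<kappa> t \<le> 1" "\<And>t. t \<le> 1 ==> \<kappa> t = 1" "\<And>t. t \<ge> 2 ==> \<kappa> t = 0"
proof -
 \<comment> \<open>One flat factor switches the bump on at \<open>1\<close>, the mirrored one
   switches it off at \<open>2\<close>. The arguments are written in the affine shape that
   \<open>Ck_on_affine\<close> matches.\<close>
 define b where "b t = flat_exp 0 (1 * t + (-1)) * flat_exp 0 ((-1) * t + 2)" for t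
 have Ckb: "Ck_on k UNIV b" for k
  unfolding b_def by (intro Ck_on_mult Ck_on_affine Ck_on_flat_exp)
 have contb: "continuous_on A b" for A
  using Ck_on_continuous[OF Ckb] continuous_on_subset by blast
 have b0: "0 \<le> b t" for t by (simp add: b_def flat_exp_def)
 have bz: "b t = 0" if "\<not> (1 < t \<and> t < 2)" for t using that by (auto simp: b_def flat_exp_def)
 define I where "I = integral {1..2} b"
 have "I \<ge> 0" unfolding I_def by (rule integral_nonneg) (auto intro: integrable_continuous_real contb b0)
 moreover have "I \<noteq> 0"
 proof
  assume "I = 0"
  hence "\<forall>x\<in>{1..2}. b x = 0"
   using integral_eq_0_iff[of 1 2 b] contb b0 by (simp add: I_def)
  hence "b (3/2) = 0" by simp
  thus False by (simp add: b_def flat_exp_def)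
 qed
 ultimately have I: "I > 0" by simp
 \<comment> \<open>The base point \<open>0\<close> lies to the left of the support. For
   \<open>t < 0\<close> the interval is empty and \<open>J\<close> is \<open>0\<close>, in agreement
   with the primitive of \<open>b\<close>; so the derivative formula holds on the whole
   line.\<close>
 define J where "J t = integral {0..t} b" for t
 have J_deriv: "(J has_real_derivative b t) (at t)" for t
 proof (cases "t > 0")
  case True
  have "((\<lambda>x. integral {0..x} b) has_real_derivative b t) (at t within {0..t + 1})"
   by (rule integral_has_real_derivative) (use True contb in auto)
  thus ?thesis
   using True by (simp add: J_def[abs_def] at_within_Icc_at)
 next
  case False
  have "((\<lambda>x. 0) has_real_derivative b t) (at t)" using bz[of t] False by simp
  thus ?thesis
  proof (rule has_field_derivative_transform_within_open[of _ _ _ "{..<1}"])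
   fix x :: real assume x: "x \<in> {..<1}"
   have "integral {0..x} b = integral {0..x} (\<lambda>x. 0)"
    by (rule integral_cong) (use x bz in auto)
   thus "0 = J x" by (simp add: J_def)
  qed (use False in auto)
 qed
 have J_mono: "J s \<le> J t" if "s \<le> t" for s t
  by (rule DERIV_nonneg_imp_nondecreasing[OF that]) (use J_deriv b0 in blast)
 have J1: "J t = 0" if "t \<le> 1" for t
 proof -
  have "integral {0..t} b = integral {0..t} (\<lambda>x. 0)"
   by (rule integral_cong) (use that bz in auto)
  thus ?thesis by (simp add: J_def)
 qed
 have J2: "J t = I" if "t \<ge> 2" for t
 proof -
  have int: "b integrable_on {x..y}" for x y by (rule integrable_continuous_real[OF contb])
  have "J t = integral {0..1} b + (integral {1..2} b + integral {2..t} b)"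
   unfolding J_def using that Henstock_Kurzweil_Integration.integral_combine[of 0 1 t b]
    Henstock_Kurzweil_Integration.integral_combine[of 1 2 t b] int by simp
  moreover have "integral {2..t} b = integral {2..t} (\<lambda>x. 0)"
   by (rule integral_cong) (use bz in auto)
  ultimately show ?thesis using J1[of 1] by (simp add: I_def J_def)
 qed
 define c where "c t = (1 / I) * b t" for t
 define \<kappa> where "\<kappa> t = 1 + (- 1 / I) * J t" for t
 have "\<exists>B. \<forall>t. c t \<le> B"
 proof -
  have "compact (b ` {1..2})" by (rule compact_continuous_image[OF contb]) simp
  then obtain B where B: "\<And>t. t \<in> {1..2} ==> \<bar>b t\<bar> \<le> B"
   by (metis bounded_real compact_imp_bounded image_eqI)
  have "B \<ge> 0" using B[of 1] by simp
  hence "b t \<le> B" for t using B[of t] bz[of t] by (cases "t \<in> {1..2}") auto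
  hence "c t \<le> (1 / I) * B" for t unfolding c_def using I by (intro mult_left_mono) auto
  thus ?thesis by blast
 qed
 then obtain B where B: "\<And>t. c t \<le> B" by blast
 have Ckc: "Ck_on k UNIV c" for k unfolding c_def by (intro Ck_on_mult Ck_on_const Ckb)
 have d: "(\<kappa> has_real_derivative - c t) (at t)" for t
  using I unfolding \<kappa>_def c_def by (auto intro!: derivative_eq_intros J_deriv)
 have "Ck_on k UNIV \<kappa>" for k
 proof (cases k)
  case 0
  show ?thesis unfolding 0 Ck_on.simps by (rule DERIV_continuous_on) (rule d)
 next
  case (Suc j)
  have "Ck_on j UNIV (\<lambda>t. (- 1) * c t)" by (intro Ck_on_mult Ck_on_const Ckc)
  thus ?thesis unfolding Suc using Ck_on_real_SucI[OF d] by simp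
 qed
 moreover have "0 \<le> \<kappa> t" for t
 proof (cases "t \<le> 2")
  case True
  thus ?thesis using J_mono[OF True] J2[of 2] I by (simp add: \<kappa>_def field_simps)
 qed (use J2[of t] I in "simp add: \<kappa>_def")
 moreover have "\<kappa> t \<le> 1" for t
  using J_mono[of "min t 1" t] J1[of "min t 1"] I by (simp add: \<kappa>_def)
 moreover have "\<kappa> t = 1" if "t \<le> 1" for t using J1[OF that] by (simp add: \<kappa>_def)
 moreover have "\<kappa> t = 0" if "t \<ge> 2" for t using J2[OF that] I by (simp add: \<kappa>_def)
 moreover have "0 \<le> c t" for t using b0 I by (simp add: c_def)
 moreover have "c t = 0" if "\<not> (1 \<le> t \<and> t \<le> 2)" for t
 proof -
  have "b t = 0" by (rule bz) (use that in auto)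
  thus ?thesis by (simp add: c_def)
 qed
 ultimately show thesis using that[of c \<kappa> B] Ckc d B by blast
qed

section \<open>Symmetry of second derivatives\<close>

text \<open>The second difference of \<open>f\<close> over a small square is symmetric in the two
  directions. Two applications of the mean value theorem write it as the squared side times either
  mixed derivative at nearby points, and continuity forces the two derivatives to agree.\<close>

lemma second_partials_symmetric:
 fixes f :: "'e::euclidean_space => real"
 assumes W: "open W" "x \<in> W" and bc: "b \<in> Basis" "c \<in> Basis"
  and f': "partials_on W f f'"
  and f'': "\<And>b. b \<in> Basis ==> partials_on W (f' b) (f'' b)"
  and cont: "\<And>b c. b \<in> Basis ==> c \<in> Basis ==> continuous_on W (f'' b c)"
 shows "f'' b c x = f'' c b x"
proof (rule ccontr)
 assume ne: "f'' b c x \<noteq> f'' c b x"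
 have der: "((\<lambda>s. g (y + s *\<^sub>R d)) has_real_derivative g' d (y + s *\<^sub>R d)) (at s)"
  if "partials_on W g g'" "y + s *\<^sub>R d \<in> W" "d \<in> Basis" for g :: "'e => real" and g' y s d
 proof -
  have "(g has_derivative (\<lambda>v. \<Sum>b\<in>Basis. (v \<bullet> b) *\<^sub>R g' b (y + s *\<^sub>R d))) (at (y + s *\<^sub>R d))"
   using that(1)[unfolded partials_on_def, rule_format, OF that(2)] by (simp only: at_within_open[OF that(2) W(1)])
  hence "((\<lambda>s. g (y + s *\<^sub>R d)) has_derivative
    (\<lambda>h. \<Sum>b\<in>Basis. ((h *\<^sub>R d) \<bullet> b) *\<^sub>R g' b (y + s *\<^sub>R d))) (at s)"
   by (rule has_derivative_compose[rotated]) (auto intro!: derivative_eq_intros)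
  moreover have "(\<Sum>b\<in>Basis. ((h *\<^sub>R d) \<bullet> b) *\<^sub>R g' b (y + s *\<^sub>R d)) = g' d (y + s *\<^sub>R d) * h" for h
  proof -
   have "(\<Sum>b\<in>Basis. ((h *\<^sub>R d) \<bullet> b) *\<^sub>R g' b (y + s *\<^sub>R d)) = (\<Sum>b\<in>Basis. if b = d then h * g' b (y + s *\<^sub>R d) else 0)"
    by (intro sum.cong refl) (use that(3) in "auto simp: inner_Basis")
   thus ?thesis using that(3) by simp
  qed
  ultimately show ?thesis by (simp add: has_field_derivative_def)
 qed
 have key: "\<exists>y z. y \<in> ball x r \<and> z \<in> ball x r \<and> f'' b c y = f'' c b z" if r: "r > 0" "ball x r \<subseteq> W" for r
 proof -
  \<comment> \<open>A third of the radius keeps the whole square inside the ball, because its points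
    have distance at most \<open>2 * h\<close> from \<open>x\<close>.\<close>
  define h where "h = r / 3"
  have h: "h > 0" using r by (simp add: h_def)
  have inW: "x + s *\<^sub>R b + t *\<^sub>R c \<in> ball x r" if "0 \<le> s" "s \<le> h" "0 \<le> t" "t \<le> h" for s t
  proof -
   have "dist x (x + s *\<^sub>R b + t *\<^sub>R c) = norm (s *\<^sub>R b + t *\<^sub>R c)" by (simp add: dist_norm add.assoc norm_minus_commute add.commute)
   also have "... \<le> \<bar>s\<bar> * norm b + \<bar>t\<bar> * norm c" by (metis norm_scaleR norm_triangle_ineq)
   also have "... < r" using that bc r by (simp add: h_def)
   finally show ?thesis by simp
  qed
  \<comment> \<open>Stated for arbitrary directions so that it can be applied a second time with the
    two directions exchanged.\<close>
  have step: "\<exists>y\<in>ball x r. f (x + h *\<^sub>R b + h *\<^sub>R c) - f (x + h *\<^sub>R b) - f (x + h *\<^sub>R c) + f x = h * (h * f'' b c y)"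
   if bc: "b \<in> Basis" "c \<in> Basis" and inW: "\<And>s t. 0 \<le> s ==> s \<le> h ==> 0 \<le> t ==> t \<le> h ==> x + s *\<^sub>R b + t *\<^sub>R c \<in> ball x r" for b c
  proof -
   let ?\<phi> = "\<lambda>s. f ((x + h *\<^sub>R c) + s *\<^sub>R b) - f (x + s *\<^sub>R b)"
   have 1: "(?\<phi> has_real_derivative f' b ((x + h *\<^sub>R c) + s *\<^sub>R b) - f' b (x + s *\<^sub>R b)) (at s)"
    if "0 \<le> s" "s \<le> h" for s
   proof (intro DERIV_diff der[OF f'] bc)
    show "x + h *\<^sub>R c + s *\<^sub>R b \<in> W" using inW[of s h] that h r by (auto simp: algebra_simps)
    show "x + s *\<^sub>R b \<in> W" using inW[of s 0] that h r by auto
   qed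
   obtain \<xi> where \<xi>: "0 < \<xi>" "\<xi> < h" "?\<phi> h - ?\<phi> 0 = h * (f' b ((x + h *\<^sub>R c) + \<xi> *\<^sub>R b) - f' b (x + \<xi> *\<^sub>R b))"
    using MVT2[OF h, of ?\<phi> "\<lambda>s. f' b ((x + h *\<^sub>R c) + s *\<^sub>R b) - f' b (x + s *\<^sub>R b)"] 1 by auto
   let ?\<psi> = "\<lambda>t. f' b ((x + \<xi> *\<^sub>R b) + t *\<^sub>R c)"
   have 2: "(?\<psi> has_real_derivative f'' b c ((x + \<xi> *\<^sub>R b) + t *\<^sub>R c)) (at t)" if "0 \<le> t" "t \<le> h" for t
    by (rule der[OF f''[OF bc(1)]]) (use inW[of \<xi> t] that \<xi> h r bc in auto)
   obtain \<eta> where \<eta>: "0 < \<eta>" "\<eta> < h" "?\<psi> h - ?\<psi> 0 = h * f'' b c ((x + \<xi> *\<^sub>R b) + \<eta> *\<^sub>R c)"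
    using MVT2[OF h, of ?\<psi> "\<lambda>t. f'' b c ((x + \<xi> *\<^sub>R b) + t *\<^sub>R c)"] 2 by auto
   have e: "x + h *\<^sub>R c + \<xi> *\<^sub>R b = x + \<xi> *\<^sub>R b + h *\<^sub>R c" "x + h *\<^sub>R c + h *\<^sub>R b = x + h *\<^sub>R b + h *\<^sub>R c"
    by (simp_all add: algebra_simps)
   have "f (x + h *\<^sub>R b + h *\<^sub>R c) - f (x + h *\<^sub>R b) - (f (x + h *\<^sub>R c) - f x) =
     h * (f' b (x + \<xi> *\<^sub>R b + h *\<^sub>R c) - f' b (x + \<xi> *\<^sub>R b))"
    using \<xi>(3) unfolding e by simp
   hence "f (x + h *\<^sub>R b + h *\<^sub>R c) - f (x + h *\<^sub>R b) - f (x + h *\<^sub>R c) + f x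
     = h * (h * f'' b c ((x + \<xi> *\<^sub>R b) + \<eta> *\<^sub>R c))"
    using \<eta>(3) by simp
   moreover have "x + \<xi> *\<^sub>R b + \<eta> *\<^sub>R c \<in> ball x r" using inW[of \<xi> \<eta>] \<xi> \<eta> by simp
   ultimately show ?thesis by blast
  qed
  have inW': "x + s *\<^sub>R c + t *\<^sub>R b \<in> ball x r" if "0 \<le> s" "s \<le> h" "0 \<le> t" "t \<le> h" for s t
   using inW[of t s] that by (simp add: algebra_simps)
  obtain y where y: "y \<in> ball x r" "f (x + h *\<^sub>R b + h *\<^sub>R c) - f (x + h *\<^sub>R b) - f (x + h *\<^sub>R c) + f x = h * (h * f'' b c y)"
   using step[OF bc inW] by blast
  obtain z where z: "z \<in> ball x r" "f (x + h *\<^sub>R c + h *\<^sub>R b) - f (x + h *\<^sub>R c) - f (x + h *\<^sub>R b) + f x = h * (h * f'' c b z)"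
   using step[OF bc(2,1) inW'] by blast
  have "x + h *\<^sub>R c + h *\<^sub>R b = x + h *\<^sub>R b + h *\<^sub>R c" by (simp add: algebra_simps)
  hence "f (x + h *\<^sub>R b + h *\<^sub>R c) - f (x + h *\<^sub>R c) - f (x + h *\<^sub>R b) + f x = h * (h * f'' c b z)"
   using z(2) by (simp only:)
  with y(2) have "h * (h * f'' b c y) = h * (h * f'' c b z)" by linarith
  thus ?thesis using y z h by auto
 qed
 define \<epsilon> where "\<epsilon> = \<bar>f'' b c x - f'' c b x\<bar> / 2"
 have \<epsilon>: "\<epsilon> > 0" using ne by (simp add: \<epsilon>_def)
 have cb: "isCont (f'' b c) x" "isCont (f'' c b) x"
  using cont bc W by (auto simp: continuous_on_eq_continuous_at)
 obtain d1 where d1: "d1 > 0" "\<And>y. dist y x < d1 ==> dist (f'' b c y) (f'' b c x) < \<epsilon>"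
  using cb(1) \<epsilon> unfolding continuous_at_eps_delta by blast
 obtain d2 where d2: "d2 > 0" "\<And>y. dist y x < d2 ==> dist (f'' c b y) (f'' c b x) < \<epsilon>"
  using cb(2) \<epsilon> unfolding continuous_at_eps_delta by blast
 obtain d3 where d3: "d3 > 0" "ball x d3 \<subseteq> W" using W openE by blast
 have "min d1 (min d2 d3) > 0" "ball x (min d1 (min d2 d3)) \<subseteq> W"
  using d1(1) d2(1) d3 by auto
 then obtain y z where yz: "y \<in> ball x (min d1 (min d2 d3))" "z \<in> ball x (min d1 (min d2 d3))" "f'' b c y = f'' c b z"
  using key by blast
 have "dist (f'' b c y) (f'' b c x) < \<epsilon>" "dist (f'' c b z) (f'' c b x) < \<epsilon>"
  using d1(2)[of y] d2(2)[of z] yz by (auto simp: dist_commute)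
 hence "\<bar>f'' b c x - f'' c b x\<bar> < \<epsilon> + \<epsilon>" using yz(3) unfolding dist_real_def by linarith
 thus False by (simp add: \<epsilon>_def)
qed

section \<open>Integrals depending on a parameter\<close>

lemma continuous_on_integral_upto:
 fixes f :: "real \<times> 'e::euclidean_space => real"
 assumes f: "continuous_on ({a..} \<times> W) f"
 shows "continuous_on ({a..} \<times> W) (\<lambda>z. integral {a..fst z} (\<lambda>s. f (s, snd z)))"
proof -
 let ?F = "\<lambda>z. integral {a..fst z} (\<lambda>s. f (s, snd z))"
 have bnd: "continuous_on ({a..b} \<times> W) ?F" for b
 proof -
  have c1: "continuous_on (({a..b} \<times> W) \<times> cbox a b) (\<lambda>(z, s). f (min s (fst z), snd z))"
   unfolding case_prod_beta
   by (rule continuous_on_compose2[OF f]) (auto intro!: continuous_intros)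
  have c2: "continuous_on ({a..b} \<times> W) (\<lambda>z. integral (cbox a b) (\<lambda>s. f (min s (fst z), snd z)))"
   by (rule integral_continuous_on_param[OF c1])
  have "continuous_on ({a..b} \<times> W) (\<lambda>z. integral (cbox a b) (\<lambda>s. f (min s (fst z), snd z)) - (b - fst z) * f z)"
   by (intro continuous_intros c2 continuous_on_subset[OF f]) auto
  moreover have "?F z = integral (cbox a b) (\<lambda>s. f (min s (fst z), snd z)) - (b - fst z) * f z"
   if z: "z \<in> {a..b} \<times> W" for z
  proof -
   have zz: "a \<le> fst z" "fst z \<le> b" "snd z \<in> W" using z by auto
   have cont: "continuous_on {a..b} (\<lambda>s. f (min s (fst z), snd z))"
    by (rule continuous_on_compose2[OF f]) (use zz in "auto intro!: continuous_intros")
   have "integral {a..b} (\<lambda>s. f (min s (fst z), snd z)) =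
     integral {a..fst z} (\<lambda>s. f (min s (fst z), snd z)) + integral {fst z..b} (\<lambda>s. f (min s (fst z), snd z))"
    using Henstock_Kurzweil_Integration.integral_combine[OF zz(1,2) integrable_continuous_real[OF cont]] by simp
   also have "integral {a..fst z} (\<lambda>s. f (min s (fst z), snd z)) = ?F z"
    by (rule integral_cong) (auto simp: min_def)
   also have "integral {fst z..b} (\<lambda>s. f (min s (fst z), snd z)) = integral {fst z..b} (\<lambda>s. f z)"
    by (rule integral_cong) (auto simp: min_def)
   also have "... = (b - fst z) * f z" using zz by simp
   finally show ?thesis by simp
  qed
  ultimately show ?thesis
   using continuous_on_cong[of "{a..b} \<times> W" "{a..b} \<times> W"] by (metis (no_types, lifting))
 qed
 show ?thesis
  unfolding continuous_on_eq_continuous_within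
 proof
  fix z assume z: "z \<in> {a..} \<times> W"
  define b where "b = fst z + 1"
  have "at z within {a..b} \<times> W = at z within {a..} \<times> W"
   by (rule at_within_nhd[of _ "{..<b} \<times> UNIV"]) (use z in "auto simp: b_def intro!: open_Times")
  moreover have "continuous (at z within {a..b} \<times> W) ?F"
   using bnd[of b, unfolded continuous_on_eq_continuous_within] z by (auto simp: b_def)
  ultimately show "continuous (at z within {a..} \<times> W) ?F" by simp
 qed
qed

text \<open>The fundamental theorem of calculus gives the derivative along the axis and the Leibniz
  rule those in the other directions. Continuity of the latter in both variables combines them into
  a total derivative, one-sided at \<open>fst z = a\<close>.\<close>

lemma partials_on_integral_upto:
 fixes f :: "real \<times> 'e::euclidean_space => real"
 assumes W: "open W" and f: "partials_on ({a..} \<times> W) f f'"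
  and cont: "\<And>b. b \<in> Basis ==> continuous_on ({a..} \<times> W) (f' b)"
 shows "partials_on ({a..} \<times> W) (\<lambda>z. integral {a..fst z} (\<lambda>s. f (s, snd z)))
   (\<lambda>b z. if b = (1, 0) then f z else integral {a..fst z} (\<lambda>s. f' b (s, snd z)))"
 unfolding partials_on_def
proof
 let ?F = "\<lambda>z. integral {a..fst z} (\<lambda>s. f (s, snd z))"
 fix z assume z: "z \<in> {a..} \<times> W"
 obtain t y where ty: "z = (t, y)" by (cases z)
 have t: "a \<le> t" and y: "y \<in> W" using z ty by auto
 obtain r where r: "r > 0" "ball y r \<subseteq> W" using W y openE by blast
 \<comment> \<open>The Leibniz rule and the combination of partial derivatives ask for a convex
   parameter set, which \<open>W\<close> need not be.\<close>
 define Y where "Y = ball y r"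
 have contf: "continuous_on ({a..} \<times> W) f" by (rule partials_on_continuous[OF f])
 have fderiv: "((\<lambda>y. f (s, y)) has_derivative (\<lambda>v. \<Sum>b\<in>Basis. (v \<bullet> b) *\<^sub>R f' (0, b) (s, y'))) (at y' within Y)"
  if "a \<le> s" "y' \<in> Y" for s y'
 proof -
  have "(f has_derivative (\<lambda>v. \<Sum>b\<in>Basis. (v \<bullet> b) *\<^sub>R f' b (s, y'))) (at (s, y') within {a..} \<times> W)"
   using f that r unfolding partials_on_def Y_def by auto
  hence "(f has_derivative (\<lambda>v. \<Sum>b\<in>Basis. (v \<bullet> b) *\<^sub>R f' b (s, y'))) (at (s, y') within (Pair s) ` Y)"
   by (rule has_derivative_subset) (use that r Y_def in auto)
  moreover have "((Pair s) has_derivative (\<lambda>v. (0, v))) (at y' within Y)"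
   by (auto intro!: derivative_eq_intros)
  ultimately have "((\<lambda>y. f (s, y)) has_derivative (\<lambda>v. \<Sum>b\<in>Basis. ((0, v) \<bullet> b) *\<^sub>R f' b (s, y'))) (at y' within Y)"
   by (rule has_derivative_in_compose[rotated])
  thus ?thesis unfolding Basis_prod_split by simp
 qed
 define G where "G b z = integral {a..fst z} (\<lambda>s. f' (0, b) (s, snd z))" for b z
 have contG: "continuous_on ({a..} \<times> W) (G b)" if "b \<in> Basis" for b
  unfolding G_def by (rule continuous_on_integral_upto) (rule cont, use that in "simp add: Basis_prod_def")
 \<comment> \<open>The derivatives in the second variable as bounded linear maps, so that they form
   a normed space in which they can be integrated.\<close>
 define D where "D s y' = (\<Sum>b\<in>Basis. f' (0, b) (s, y') *\<^sub>R blinfun_inner_left b)" for s y'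
 define DG where "DG s y' = (\<Sum>b\<in>Basis. G b (s, y') *\<^sub>R blinfun_inner_left b)" for s y'
 have D_apply: "blinfun_apply (D s y') = (\<lambda>v. \<Sum>b\<in>Basis. (v \<bullet> b) *\<^sub>R f' (0, b) (s, y'))" for s y'
  by (auto simp: D_def blinfun.sum_left blinfun.scaleR_left inner_commute fun_eq_iff mult.commute)
 have contD: "continuous_on (Y \<times> cbox a t') (\<lambda>(y, s). D s y)" for t'
 proof -
  have "continuous_on (Y \<times> cbox a t') (\<lambda>z. f' (0, b) (snd z, fst z))" if "b \<in> Basis" for b
   by (rule continuous_on_compose2[OF cont[of "(0, b)"]])
     (use r that in "auto simp: Y_def Basis_prod_def intro!: continuous_intros")
  thus ?thesis
   unfolding D_def case_prod_beta by (intro continuous_intros) auto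
 qed
 have Fy: "((\<lambda>y. ?F (t', y)) has_derivative blinfun_apply (DG t' y')) (at y' within Y)"
  if "t' \<in> {a..}" "y' \<in> Y" for t' y'
 proof -
  have "((\<lambda>y. integral (cbox a t') (\<lambda>s. f (s, y))) has_derivative integral (cbox a t') (\<lambda>s. D s y')) (at y' within Y)"
  proof (rule leibniz_rule[where fx = "\<lambda>y s. D s y"])
   show "((\<lambda>y. f (s, y)) has_derivative blinfun_apply (D s y'')) (at y'' within Y)"
    if "y'' \<in> Y" "s \<in> cbox a t'" for y'' s
    unfolding D_apply using fderiv that by auto
   show "(\<lambda>s. f (s, y'')) integrable_on cbox a t'" if "y'' \<in> Y" for y''
    by (rule integrable_continuous, rule continuous_on_compose2[OF contf])
      (use that r in "auto intro!: continuous_intros simp: Y_def")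
  qed (use contD that in "auto simp: Y_def")
  moreover have "integral (cbox a t') (\<lambda>s. D s y') = DG t' y'"
   unfolding D_def DG_def
  proof (subst integral_sum)
   have i: "(\<lambda>s. f' (0, b) (s, y')) integrable_on {a..t'}" if "b \<in> Basis" for b
    by (rule integrable_continuous_real, rule continuous_on_compose2[OF cont[of "(0, b)"]])
      (use that \<open>y' \<in> Y\<close> r in "auto intro!: continuous_intros simp: Y_def Basis_prod_def")
   show "(\<lambda>s. f' (0, b) (s, y') *\<^sub>R blinfun_inner_left b) integrable_on cbox a t'" if "b \<in> Basis" for b
    using integrable_linear[OF i[OF that] bounded_linear_scaleR_left[of "blinfun_inner_left b"]] by (simp add: o_def)
   show "(\<Sum>b\<in>Basis. integral (cbox a t') (\<lambda>s. f' (0, b) (s, y') *\<^sub>R blinfun_inner_left b)) =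
     (\<Sum>b\<in>Basis. G b (t', y') *\<^sub>R blinfun_inner_left b)"
    using integral_linear[OF i bounded_linear_scaleR_left]
    by (intro sum.cong) (auto simp: G_def o_def)
  qed simp
  ultimately show ?thesis by simp
 qed
 have Ft: "((\<lambda>t. ?F (t, y)) has_derivative (\<lambda>h. h * f (t, y))) (at t within {a..})"
 proof -
  have "continuous_on {a..t + 1} (\<lambda>s. f (s, y))"
   by (rule continuous_on_compose2[OF contf]) (use y in "auto intro!: continuous_intros")
  hence "((\<lambda>x. integral {a..x} (\<lambda>s. f (s, y))) has_real_derivative f (t, y)) (at t within {a..t + 1})"
   by (rule integral_has_real_derivative) (use t in auto)
  moreover have "at t within {a..t + 1} = at t within {a..}"
   by (rule at_within_nhd[of _ "{..<t + 1}"]) auto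
  moreover have "(\<lambda>h. h * f (t, y)) = (*) (f (t, y))" by (simp add: fun_eq_iff mult.commute)
  ultimately show ?thesis by (simp only: has_field_derivative_def fst_conv snd_conv)
 qed
 have "((\<lambda>(t, y). ?F (t, y)) has_derivative (\<lambda>(th, yh). th * f (t, y) + DG t y yh)) (at (t, y) within {a..} \<times> Y)"
 proof (rule has_derivative_partialsI[where fy = "\<lambda>t y. DG t y", OF Ft Fy])
  have "continuous_on ({a..} \<times> Y) (\<lambda>(t, y). DG t y)"
  proof -
   have "continuous_on ({a..} \<times> Y) (G b)" if "b \<in> Basis" for b
    by (rule continuous_on_subset[OF contG[OF that]]) (use r in "auto simp: Y_def")
   thus ?thesis
    unfolding DG_def case_prod_beta prod.collapse by (intro continuous_intros) auto
  qed
  thus "continuous (at (t, y) within {a..} \<times> Y) (\<lambda>(t, y). DG t y)"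
   using t r by (auto simp: continuous_on_eq_continuous_within Y_def)
 qed (use r in "auto simp: Y_def")
 moreover have "at (t, y) within {a..} \<times> Y = at (t, y) within {a..} \<times> W"
  by (rule at_within_nhd[of _ "UNIV \<times> Y"]) (use r in "auto simp: Y_def intro!: open_Times")
 moreover have "(\<lambda>(th, yh). th * f (t, y) + DG t y yh) = (\<lambda>v. \<Sum>b\<in>Basis. (v \<bullet> b) *\<^sub>R
   (if b = (1, 0) then f z else integral {a..fst z} (\<lambda>s. f' b (s, snd z))))"
  unfolding Basis_prod_split
  by (auto simp: fun_eq_iff DG_def G_def blinfun.sum_left blinfun.scaleR_left inner_commute ty mult.commute)
 ultimately show "(?F has_derivative (\<lambda>v. \<Sum>b\<in>Basis. (v \<bullet> b) *\<^sub>R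
   (if b = (1, 0) then f z else integral {a..fst z} (\<lambda>s. f' b (s, snd z))))) (at z within {a..} \<times> W)"
  by (simp add: ty case_prod_unfold)
qed

lemma Ck_on_integral_upto:
 fixes f :: "real \<times> 'e::euclidean_space => real"
 assumes W: "open W"
 shows "Ck_on k ({a..} \<times> W) f ==> Ck_on k ({a..} \<times> W) (\<lambda>z. integral {a..fst z} (\<lambda>s. f (s, snd z)))"
proof (induction k arbitrary: f)
 case 0
 thus ?case using continuous_on_integral_upto by auto
next
 case (Suc k)
 obtain f' where f': "partials_on ({a..} \<times> W) f f'" "\<And>b. b \<in> Basis ==> Ck_on k ({a..} \<times> W) (f' b)"
  using Suc.prems unfolding Ck_on_Suc_iff by blast
 have "partials_on ({a..} \<times> W) (\<lambda>z. integral {a..fst z} (\<lambda>s. f (s, snd z)))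
   (\<lambda>b z. if b = (1, 0) then f z else integral {a..fst z} (\<lambda>s. f' b (s, snd z)))"
  by (rule partials_on_integral_upto[OF W f'(1)]) (rule Ck_on_continuous[OF f'(2)])
 moreover have "Ck_on k ({a..} \<times> W) (\<lambda>z. if b = (1, 0) then f z else integral {a..fst z} (\<lambda>s. f' b (s, snd z)))"
  if "b \<in> Basis" for b
  using Ck_on_SucD[OF Suc.prems] Suc.IH[OF f'(2)[OF that]] by (cases "b = (1, 0)") auto
 ultimately show ?case unfolding Ck_on_Suc_iff by blast
qed

section \<open>Determinants on Euclidean spaces\<close>

text \<open>
 The library states determinants and the change of variables formula for spaces \<open>real ^ 'n\<close>;
 the following type provides the index type of a general Euclidean space.
\<close>

typedef (overloaded) 'e bidx = "Basis :: 'e::euclidean_space set"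
 by (rule nonempty_Basis[unfolded ex_in_conv[symmetric]])

lemma bij_betw_Rep_bidx: "bij_betw Rep_bidx UNIV (Basis :: 'e::euclidean_space set)"
 unfolding bij_betw_def
 by (metis (mono_tags, lifting) Rep_bidx_inject inj_onI type_definition.Rep_range type_definition_bidx)

instance bidx :: (euclidean_space) finite
 by standard (metis bij_betw_Rep_bidx bij_betw_finite finite_Basis)

text \<open>Transports the order of the natural numbers to the index type, which the change of
  variables theorem requires to be a \<open>wellorder\<close>.\<close>

definition bidx_pos :: "'e::euclidean_space bidx => nat" where
 "bidx_pos x = inv_into {..<DIM('e)} basis_enum (Rep_bidx x)"

lemma bidx_pos_inj: "bidx_pos x = bidx_pos y \<longleftrightarrow> x = y"
proof
 assume "bidx_pos x = bidx_pos y"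
 hence "Rep_bidx x = Rep_bidx y"
  unfolding bidx_pos_def using Rep_bidx basis_enum_bij
  by (metis bij_betw_inv_into_right)
 thus "x = y" by (simp add: Rep_bidx_inject)
qed simp

instantiation bidx :: (euclidean_space) wellorder
begin

definition less_eq_bidx :: "'a bidx => 'a bidx => bool" where
 "less_eq_bidx x y \<longleftrightarrow> bidx_pos x \<le> bidx_pos y"

definition less_bidx :: "'a bidx => 'a bidx => bool" where
 "less_bidx x y \<longleftrightarrow> bidx_pos x < bidx_pos y"

instance
proof
 fix P :: "'a bidx => bool" and a :: "'a bidx"
 assume *: "\<And>x. (\<And>y. y < x ==> P y) ==> P x"
 show "P a"
  by (induction a rule: measure_induct_rule[of bidx_pos]) (rule *, simp add: less_bidx_def)
qed (auto simp: less_eq_bidx_def less_bidx_def bidx_pos_inj)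

end

lemma sum_bidx: "(\<Sum>i\<in>UNIV. f (Rep_bidx i)) = (\<Sum>b\<in>Basis. f b)"
 by (rule sum.reindex_bij_betw[OF bij_betw_Rep_bidx])

text \<open>Both sides are Leibniz sums; \<open>map_permutation\<close> carries permutations of the
  index type to permutations of the basis and keeps their signs.\<close>

lemma det_bidx:
 "det (\<chi> i j. F (Rep_bidx i) (Rep_bidx j)) =
   (\<Sum>\<pi> | \<pi> permutes (Basis :: 'e::euclidean_space set). of_int (sign \<pi>) * (\<Prod>b\<in>Basis. F b (\<pi> b) :: real))"
proof -
 let ?f = "map_permutation (UNIV :: 'e bidx set) Rep_bidx"
 let ?g = "map_permutation (Basis :: 'e set) Abs_bidx"
 have R: "bij_betw Rep_bidx (UNIV :: 'e bidx set) Basis" by (rule bij_betw_Rep_bidx)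
 have A: "bij_betw (Abs_bidx :: 'e => _) Basis UNIV"
  by (rule bij_betwI[of _ _ _ Rep_bidx]) (auto simp: Abs_bidx_inverse Rep_bidx_inverse Rep_bidx)
 show ?thesis
  unfolding det_def
 proof (rule sum.reindex_bij_witness[of _ ?g ?f])
  fix p assume "p \<in> {p. p permutes (UNIV :: 'e bidx set)}"
  hence p: "p permutes UNIV" by simp
  show "?g (?f p) = p"
   by (rule map_permutation_compose_inv[OF R p]) (simp add: Rep_bidx_inverse)
  show "?f p \<in> {\<pi>. \<pi> permutes Basis}"
   using map_permutation_permutes[OF R p] by simp
  have "(\<Prod>b\<in>Basis. F b (?f p b)) = (\<Prod>i\<in>UNIV. F (Rep_bidx i) (?f p (Rep_bidx i)))"
   by (rule prod.reindex_bij_betw[OF R, symmetric])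
  also have "... = (\<Prod>i\<in>UNIV. F (Rep_bidx i) (Rep_bidx (p i)))"
   using R by (intro prod.cong refl) (simp add: map_permutation_apply bij_betw_def)
  finally show "of_int (sign (?f p)) * (\<Prod>b\<in>Basis. F b (?f p b)) =
    of_int (sign p) * (\<Prod>i\<in>UNIV. (\<chi> i j. F (Rep_bidx i) (Rep_bidx j)) $ i $ p i)"
   using R p by (simp add: sign_map_permutation bij_betw_def)
 next
  fix \<pi> assume "\<pi> \<in> {\<pi>. \<pi> permutes (Basis :: 'e set)}"
  hence p: "\<pi> permutes Basis" by simp
  show "?f (?g \<pi>) = \<pi>"
   by (rule map_permutation_compose_inv[OF A p]) (simp add: Abs_bidx_inverse)
  show "?g \<pi> \<in> {p. p permutes UNIV}"
   using map_permutation_permutes[OF A p] by simp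
 qed
qed

lemma lin_det_eq_det: "lin_det f = det (\<chi> i j. f (Rep_bidx i) \<bullet> Rep_bidx j)"
 unfolding lin_det_def using det_bidx[of "\<lambda>b c. f b \<bullet> c"] by simp

lemma gram_det_eq_det: "gram_det g = det (\<chi> i j. g (Rep_bidx i) (Rep_bidx j))"
 unfolding gram_det_def using det_bidx[of g] by simp

lemma bidx_sum_eq_vec: "(\<Sum>i\<in>UNIV. v $ i *\<^sub>R Rep_bidx i) \<bullet> Rep_bidx j = (v $ j :: real)"
proof -
 have "(\<Sum>i\<in>UNIV. v $ i *\<^sub>R Rep_bidx i) \<bullet> Rep_bidx j = (\<Sum>i\<in>UNIV. if i = j then v $ i else 0)"
  unfolding inner_sum_left
  by (intro sum.cong refl) (auto simp: inner_Basis Rep_bidx Rep_bidx_inject)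
 thus ?thesis by simp
qed

definition from_bidx :: "real ^ 'e bidx => 'e::euclidean_space" where
 "from_bidx v = (\<Sum>i\<in>UNIV. v $ i *\<^sub>R Rep_bidx i)"

definition to_bidx :: "'e::euclidean_space => real ^ 'e bidx" where
 "to_bidx w = (\<chi> i. w \<bullet> Rep_bidx i)"

lemma to_from_bidx [simp]: "to_bidx (from_bidx v) = v"
 by (simp add: to_bidx_def from_bidx_def vec_eq_iff bidx_sum_eq_vec)

lemma from_to_bidx [simp]: "from_bidx (to_bidx w) = w"
 unfolding to_bidx_def from_bidx_def
 using sum_bidx[of "\<lambda>b. (w \<bullet> b) *\<^sub>R b"] by (simp add: euclidean_representation)

lemma linear_from_bidx: "linear from_bidx"
 unfolding from_bidx_def by (intro linear_compose_sum ballI) (auto intro!: linearI simp: algebra_simps)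

lemma linear_to_bidx: "linear to_bidx"
 unfolding to_bidx_def by (rule linearI) (auto simp: vec_eq_iff inner_add_left)

lemma lin_det_eq_det_matrix:
 "lin_det f = det (matrix (\<lambda>v. to_bidx (f (from_bidx v))))"
proof -
 have "from_bidx (axis i 1) = Rep_bidx i" for i :: "'a bidx"
  by (simp add: from_bidx_def axis_def if_distrib[of "\<lambda>x. x *\<^sub>R _"] cong: if_cong)
 hence "matrix (\<lambda>v. to_bidx (f (from_bidx v))) = Finite_Cartesian_Product.transpose (\<chi> i j. f (Rep_bidx i) \<bullet> Rep_bidx j)"
  by (simp add: matrix_def to_bidx_def vec_eq_iff Finite_Cartesian_Product.transpose_def)
 thus ?thesis by (simp add: lin_det_eq_det)
qed

lemma inner_product_linear:
 assumes "inner_product g"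
 shows "linear (g u)" "linear (\<lambda>u. g u v)" "g u v = g v u" "u \<noteq> 0 ==> 0 < g u u"
proof -
 have sym: "g u v = g v u" for u v using assms by (simp add: inner_product_def)
 show "linear (g u)" "g u v = g v u" using assms by (simp_all add: inner_product_def)
 have "(\<lambda>u. g u v) = g v" using sym by (rule ext)
 thus "linear (\<lambda>u. g u v)" using assms by (simp add: inner_product_def)
 show "u \<noteq> 0 ==> 0 < g u u" using assms by (simp add: inner_product_def)
qed

text \<open>The Gram matrix of the pulled back form is \<open>P G P^T\<close> with \<open>P\<close>
  the matrix of \<open>T\<close>. Together with the change of variables formula this makes the
  Riemannian volume independent of the chart.\<close>

lemma gram_det_linear_image:
 assumes g: "\<And>u. linear (g u)" "\<And>v. linear (\<lambda>u. g u v)"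
 shows "gram_det (\<lambda>u v. g (T u) (T v)) = (lin_det T)\<^sup>2 * gram_det g"
proof -
 let ?P = "\<chi> i j. T (Rep_bidx i) \<bullet> Rep_bidx j"
 let ?G = "\<chi> i j. g (Rep_bidx i) (Rep_bidx j)"
 have rep: "x = (\<Sum>a\<in>UNIV. (x \<bullet> Rep_bidx a) *\<^sub>R Rep_bidx a)" for x :: 'a
  using sum_bidx[of "\<lambda>b. (x \<bullet> b) *\<^sub>R b"] by (simp add: euclidean_representation)
 have gx: "g x y = (\<Sum>a\<in>UNIV. \<Sum>b\<in>UNIV. (x \<bullet> Rep_bidx a) * g (Rep_bidx a) (Rep_bidx b) * (y \<bullet> Rep_bidx b))" for x y
 proof -
  have "g x y = (\<Sum>a\<in>UNIV. (x \<bullet> Rep_bidx a) * g (Rep_bidx a) y)"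
   by (subst rep[of x]) (simp add: linear_sum[OF g(2)] linear_scale[OF g(2)])
  moreover have "g (Rep_bidx a) y = (\<Sum>b\<in>UNIV. (y \<bullet> Rep_bidx b) * g (Rep_bidx a) (Rep_bidx b))" for a
   by (subst rep[of y]) (simp add: linear_sum[OF g(1)] linear_scale[OF g(1)])
  ultimately show ?thesis by (simp add: sum_distrib_left mult_ac)
 qed
 have "(\<chi> i j. g (T (Rep_bidx i)) (T (Rep_bidx j))) = ?P ** ?G ** Finite_Cartesian_Product.transpose ?P"
  unfolding vec_eq_iff
 proof (intro allI)
  fix i j
  have "g (T (Rep_bidx i)) (T (Rep_bidx j)) = (\<Sum>b\<in>UNIV. \<Sum>a\<in>UNIV.
    (T (Rep_bidx i) \<bullet> Rep_bidx a) * g (Rep_bidx a) (Rep_bidx b) * (T (Rep_bidx j) \<bullet> Rep_bidx b))"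
   unfolding gx[of "T (Rep_bidx i)" "T (Rep_bidx j)"] by (rule sum.swap)
  thus "(\<chi> i j. g (T (Rep_bidx i)) (T (Rep_bidx j))) $ i $ j =
    (?P ** ?G ** Finite_Cartesian_Product.transpose ?P) $ i $ j"
   by (simp add: matrix_matrix_mult_def Finite_Cartesian_Product.transpose_def sum_distrib_right)
 qed
 thus ?thesis
  unfolding gram_det_eq_det lin_det_eq_det by (simp add: det_mul det_transpose power2_eq_square)
qed

section \<open>Orthonormal bases\<close>

lemma orthonormal_independent:
 assumes g: "inner_product g" and B: "finite B" "\<And>u v. u \<in> B ==> v \<in> B ==> g u v = (if u = v then 1 else 0)"
 shows "independent B"
proof -
 have coeff: "c v = g v (\<Sum>u\<in>S. c u *\<^sub>R u)" if "S \<subseteq> B" "v \<in> S" "finite S" for S c v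
 proof -
  have "g v (\<Sum>u\<in>S. c u *\<^sub>R u) = (\<Sum>u\<in>S. c u * g v u)"
   by (simp add: linear_sum[OF inner_product_linear(1)[OF g]] linear_scale[OF inner_product_linear(1)[OF g]])
  also have "... = (\<Sum>u\<in>S. if u = v then c u else 0)"
  proof (intro sum.cong refl)
   fix u assume "u \<in> S"
   hence "g v u = (if v = u then 1 else 0)" using B(2)[of v u] that by blast
   thus "c u * g v u = (if u = v then c u else 0)" by auto
  qed
  finally show ?thesis using that by simp
 qed
 show ?thesis
  unfolding independent_explicit_finite_subsets
 proof (intro allI impI ballI)
  fix S c v assume "S \<subseteq> B" "finite S" "(\<Sum>v\<in>S. c v *\<^sub>R v) = 0" "v \<in> S"
  thus "c v = 0" using coeff[of S v c] linear_0[OF inner_product_linear(1)[OF g]] by simp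
 qed
qed

text \<open>Gram-Schmidt. Existence matters because \<open>alt_norm\<close> picks its basis with
  \<open>SOME\<close>.\<close>

lemma orthonormal_basis_exists:
 fixes g :: "'e::euclidean_space => 'e => real"
 assumes g: "inner_product g"
 shows "\<exists>B. orthonormal_basis g B"
proof -
 note lin = inner_product_linear[OF g]
 have "n \<le> DIM('e) ==> \<exists>B. finite B \<and> card B = n \<and> (\<forall>u\<in>B. \<forall>v\<in>B. g u v = (if u = v then 1 else 0))" for n
 proof (induction n)
  case 0
  thus ?case by (intro exI[of _ "{}"]) auto
 next
  case (Suc n)
  then obtain B where B: "finite B" "card B = n" "\<And>u v. u \<in> B ==> v \<in> B ==> g u v = (if u = v then 1 else 0)"
   by auto
  have "dim (span B) \<le> n" using dim_le_card'[OF B(1)] B(2) by simp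
  hence "span B \<noteq> UNIV" using Suc.prems by (metis dim_UNIV not_less_eq_eq)
  then obtain x where x: "x \<notin> span B" by auto
  define y where "y = x - (\<Sum>b\<in>B. g x b *\<^sub>R b)"
  have yB: "y \<notin> span B"
  proof
   assume "y \<in> span B"
   moreover have "(\<Sum>b\<in>B. g x b *\<^sub>R b) \<in> span B" by (intro span_sum span_scale span_base)
   ultimately have "y + (\<Sum>b\<in>B. g x b *\<^sub>R b) \<in> span B" by (rule span_add)
   thus False using x by (simp add: y_def)
  qed
  hence "y \<noteq> 0" using span_zero by metis
  hence gy: "g y y > 0" by (rule lin(4))
  have orth: "g b y = 0" if "b \<in> B" for b
  proof -
   have "g b y = g b x - (\<Sum>c\<in>B. g x c * g b c)"
    by (simp add: y_def linear_diff[OF lin(1)] linear_sum[OF lin(1)] linear_scale[OF lin(1)])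
   also have "(\<Sum>c\<in>B. g x c * g b c) = (\<Sum>c\<in>B. if c = b then g x c else 0)"
    by (intro sum.cong refl) (use B(3) that in auto)
   also have "... = g b x" using B(1) that by (simp add: lin(3)[of x b])
   finally show ?thesis by simp
  qed
  define z where "z = (1 / sqrt (g y y)) *\<^sub>R y"
  have zz: "g z z = 1"
   using gy by (simp add: z_def linear_scale[OF lin(1)] linear_scale[OF lin(2)])
  have bz: "g b z = 0" "g z b = 0" if "b \<in> B" for b
   using orth[OF that] lin(3)[of z b] by (auto simp: z_def linear_scale[OF lin(1)])
  have "z \<notin> B" using zz bz by fastforce
  hence "finite (insert z B) \<and> card (insert z B) = Suc n \<and>
    (\<forall>u\<in>insert z B. \<forall>v\<in>insert z B. g u v = (if u = v then 1 else 0))"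
   using B zz bz by auto
  thus ?case by blast
 qed
 from this[of "DIM('e)"] show ?thesis unfolding orthonormal_basis_def by auto
qed

lemma orthonormal_basis_expand:
 assumes g: "inner_product g" and B: "orthonormal_basis g B"
 shows "u = (\<Sum>b\<in>B. g u b *\<^sub>R b)"
proof -
 note lin = inner_product_linear[OF g]
 have fin: "finite B" and cB: "card B = DIM('a)"
  and on: "\<And>u v. u \<in> B ==> v \<in> B ==> g u v = (if u = v then 1 else 0)"
  using B unfolding orthonormal_basis_def by auto
 have "independent B" by (rule orthonormal_independent[OF g fin on])
 hence "UNIV \<subseteq> span B" using fin cB by (intro card_ge_dim_independent) auto
 then obtain c where c: "u = (\<Sum>b\<in>B. c b *\<^sub>R b)" using span_finite[OF fin] by auto
 have "g u b = c b" if b: "b \<in> B" for b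
 proof -
  have "g u b = (\<Sum>b'\<in>B. c b' * g b' b)"
   by (simp add: c linear_sum[OF lin(2)] linear_scale[OF lin(2)])
  also have "... = (\<Sum>b'\<in>B. if b' = b then c b' else 0)"
   by (intro sum.cong refl) (use on b in auto)
  finally show ?thesis using fin b by simp
 qed
 thus ?thesis using c by simp
qed

text \<open>The coordinates \<open>S\<close> with respect to an orthonormal basis turn
  \<open>g\<close> into the standard inner product, so the Gram determinant is the square of
  \<open>lin_det S\<close>; definiteness of \<open>g\<close> makes \<open>S\<close>
  injective.\<close>

lemma gram_det_pos:
 fixes g :: "'e::euclidean_space => 'e => real"
 assumes g: "inner_product g"
 shows "gram_det g > 0"
proof -
 note lin = inner_product_linear[OF g]
 obtain B where B: "orthonormal_basis g B" using orthonormal_basis_exists[OF g] by blast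
 have fin: "finite B" and cB: "card B = card (Basis :: 'e set)"
  and on: "\<And>u v. u \<in> B ==> v \<in> B ==> g u v = (if u = v then 1 else 0)"
  using B unfolding orthonormal_basis_def by auto
 obtain \<phi> where \<phi>: "bij_betw \<phi> (Basis :: 'e set) B"
  using finite_same_card_bij[OF finite_Basis fin cB[symmetric]] by blast
 define S where "S u = (\<Sum>e\<in>Basis. g u (\<phi> e) *\<^sub>R e)" for u
 have Se: "S u \<bullet> e = g u (\<phi> e)" if "e \<in> Basis" for u e
  using that by (simp add: S_def inner_sum_left inner_Basis if_distrib cong: if_cong)
 have linS: "linear S"
  unfolding S_def by (intro linear_compose_sum ballI) (auto intro!: linearI simp: linear_add[OF lin(2)] linear_scale[OF lin(2)] algebra_simps)
 have gS: "g u v = S u \<bullet> S v" for u v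
 proof -
  have "g u v = (\<Sum>b\<in>B. g v b * g u b)"
   by (subst (1) orthonormal_basis_expand[OF g B, of v]) (simp add: linear_sum[OF lin(1)] linear_scale[OF lin(1)])
  also have "... = (\<Sum>e\<in>Basis. g v (\<phi> e) * g u (\<phi> e))"
   by (rule sum.reindex_bij_betw[OF \<phi>, symmetric])
  also have "... = S u \<bullet> S v"
   by (subst euclidean_inner) (simp add: Se mult.commute)
  finally show ?thesis .
 qed
 have "gram_det g = gram_det (\<lambda>u v. S u \<bullet> S v)" by (rule arg_cong[of _ _ gram_det]) (simp add: fun_eq_iff gS)
 also have "... = (lin_det S)\<^sup>2 * gram_det ((\<bullet>) :: 'e => 'e => real)"
  by (rule gram_det_linear_image[where g = "(\<bullet>)"]) (auto intro!: linearI simp: inner_add_left inner_add_right)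
 also have "gram_det ((\<bullet>) :: 'e => 'e => real) = 1"
 proof -
  have "(\<chi> i j. (Rep_bidx i :: 'e) \<bullet> Rep_bidx j) = mat 1"
   by (auto simp: vec_eq_iff mat_def inner_Basis Rep_bidx Rep_bidx_inject)
  thus ?thesis by (simp add: gram_det_eq_det)
 qed
 finally have "gram_det g = (lin_det S)\<^sup>2" by simp
 moreover have "lin_det S \<noteq> 0"
 proof -
  have "inj S"
  proof (rule injI)
   fix u v assume "S u = S v"
   hence "S (u - v) = 0" using linear_diff[OF linS] by simp
   hence "g (u - v) (u - v) = 0" by (simp add: gS)
   thus "u = v" using lin(4)[of "u - v"] by force
  qed
  hence "inj (\<lambda>v. to_bidx (S (from_bidx v)))"
   unfolding inj_def by (metis from_to_bidx to_from_bidx)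
  moreover have "linear (\<lambda>v. to_bidx (S (from_bidx v)))"
   using linear_compose[OF linear_compose[OF linear_from_bidx linS] linear_to_bidx] by (simp add: o_def)
  ultimately show ?thesis unfolding lin_det_eq_det_matrix using det_nz_iff_inj by blast
 qed
 ultimately show ?thesis by simp
qed

section \<open>Change of variables for nonnegative functions\<close>

text \<open>A bridge between integrability in the sense of the change of variables theorem and
  finiteness of a nonnegative integral.\<close>

lemma absolutely_integrable_nonneg_iff:
 fixes f :: "'e::euclidean_space => real"
 assumes f: "(\<lambda>x. indicator S x * f x) \<in> borel_measurable borel" "\<And>x. x \<in> S ==> 0 \<le> f x"
 shows "f absolutely_integrable_on S \<longleftrightarrow> (\<integral>\<^sup>+x. ennreal (indicator S x * f x) \<partial>lborel) < \<infinity>"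
proof -
 have "f absolutely_integrable_on S \<longleftrightarrow> integrable lebesgue (\<lambda>x. indicator S x * f x)"
  by (simp add: set_integrable_def)
 also have "... \<longleftrightarrow> integrable lborel (\<lambda>x. indicator S x * f x)"
  by (rule integrable_completion) (use f in simp)
 also have "... \<longleftrightarrow> (\<integral>\<^sup>+x. ennreal (indicator S x * f x) \<partial>lborel) < \<infinity>"
 proof -
  have "norm (indicator S x * f x) = indicator S x * f x" for x
   using f(2)[of x] by (auto simp: indicator_def)
  thus ?thesis using f(1) by (simp add: integrable_iff_bounded)
 qed
 finally show ?thesis .
qed

text \<open>For integrable functions this is the change of variables theorem. Otherwise neither side
  is integrable, and for nonnegative measurable functions this means that both sides are
  infinite.\<close>

lemma nn_integral_change_of_variables_vec:
 fixes f :: "real^'m::{finite,wellorder} => real" and g :: "real^'m::_ => real^'m::_"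
 assumes S: "S \<in> sets borel"
  and der: "\<And>x. x \<in> S ==> (g has_derivative g' x) (at x within S)"
  and inj: "inj_on g S"
  and f0: "\<And>x. x \<in> S ==> 0 \<le> f (g x)"
  and m1: "(\<lambda>y. indicator (g ` S) y * f y) \<in> borel_measurable borel"
  and m2: "(\<lambda>x. indicator S x * (\<bar>det (matrix (g' x))\<bar> * f (g x))) \<in> borel_measurable borel"
 shows "(\<integral>\<^sup>+y. ennreal (indicator (g ` S) y * f y) \<partial>lborel) =
     (\<integral>\<^sup>+x. ennreal (indicator S x * (\<bar>det (matrix (g' x))\<bar> * f (g x))) \<partial>lborel)"
proof -
 let ?D = "\<lambda>x. \<bar>det (matrix (g' x))\<bar> * f (g x)"
 have SL: "S \<in> sets lebesgue" using S by simp
 \<comment> \<open>The theorem speaks of vector valued functions; it is applied to functions with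
   values in a one-dimensional space.\<close>
 have iff: "?D absolutely_integrable_on S \<and> integral S ?D = b
   \<longleftrightarrow> f absolutely_integrable_on (g ` S) \<and> integral (g ` S) f = b" for b
  using has_absolute_integral_change_of_variables[OF SL der inj, of "\<lambda>y. vec (f y) :: real^1" "vec b"]
  unfolding absolutely_integrable_on_1_iff integral_on_1_eq by (simp add: vec_eq_iff)
 have f0': "0 \<le> f y" if "y \<in> g ` S" for y using f0 that by auto
 show ?thesis
 proof (cases "?D absolutely_integrable_on S")
  case True
  hence fa: "f absolutely_integrable_on (g ` S)" "integral (g ` S) f = integral S ?D"
   using iff[of "integral S ?D"] by auto
  have "(?D has_integral integral S ?D) S"
   using set_lebesgue_integral_eq_integral(1)[OF True] by (rule integrable_integral)
  from nn_integral_has_integral_lebesgue[OF _ this]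
  have 1: "(\<integral>\<^sup>+x. ennreal (indicator S x * ?D x) \<partial>lborel) = ennreal (integral S ?D)"
   using f0 by simp
  have "(f has_integral integral S ?D) (g ` S)"
   using set_lebesgue_integral_eq_integral(1)[OF fa(1)] fa(2) integrable_integral by metis
  from nn_integral_has_integral_lebesgue[OF _ this]
  have 2: "(\<integral>\<^sup>+y. ennreal (indicator (g ` S) y * f y) \<partial>lborel) = ennreal (integral S ?D)"
   using f0' by simp
  show ?thesis using 1 2 by simp
 next
  case False
  hence "\<not> f absolutely_integrable_on (g ` S)" using iff by blast
  hence "\<not> (\<integral>\<^sup>+y. ennreal (indicator (g ` S) y * f y) \<partial>lborel) < \<infinity>"
   using absolutely_integrable_nonneg_iff[OF m1 f0'] by blast
  moreover have "\<not> (\<integral>\<^sup>+x. ennreal (indicator S x * ?D x) \<partial>lborel) < \<infinity>"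
   using absolutely_integrable_nonneg_iff[OF m2] f0 False by auto
  ultimately show ?thesis by (simp add: not_less top_unique)
 qed
qed

lemma borel_measurable_linear_bidx [measurable]:
 "from_bidx \<in> borel_measurable borel" "to_bidx \<in> borel_measurable borel"
 by (auto intro!: borel_measurable_continuous_onI linear_continuous_on
   simp: linear_conv_bounded_linear[symmetric] linear_from_bidx linear_to_bidx)

text \<open>The coordinate isomorphism maps boxes to boxes with the same side lengths, and the
  measure of boxes determines \<open>lborel\<close>.\<close>

lemma lborel_distr_from_bidx: "(lborel :: 'e::euclidean_space measure) = distr lborel borel from_bidx"
proof (rule lborel_eqI)
 fix l u :: 'e assume lu: "\<And>b. b \<in> Basis ==> l \<bullet> b \<le> u \<bullet> b"
 have Br: "(Basis :: 'e set) = range Rep_bidx" using bij_betw_Rep_bidx by (auto simp: bij_betw_def)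
 have "from_bidx -` box l u = box (to_bidx l) (to_bidx u)"
 proof -
  have "from_bidx v \<in> box l u \<longleftrightarrow> v \<in> box (to_bidx l) (to_bidx u)" for v
  proof -
   have "from_bidx v \<in> box l u \<longleftrightarrow> (\<forall>i. l \<bullet> Rep_bidx i < v $ i \<and> v $ i < u \<bullet> Rep_bidx i)"
    unfolding mem_box Br by (simp add: from_bidx_def bidx_sum_eq_vec)
   thus ?thesis by (simp add: mem_box_cart to_bidx_def)
  qed
  thus ?thesis by auto
 qed
 moreover have "emeasure lborel (box (to_bidx l) (to_bidx u)) = (\<Prod>b\<in>Basis. (to_bidx u - to_bidx l) \<bullet> b)"
  by (rule emeasure_lborel_box) (use lu in "auto simp: Basis_vec_def to_bidx_def inner_axis Rep_bidx")
 moreover have "(\<Prod>b\<in>Basis. (to_bidx u - to_bidx l) \<bullet> b) = (\<Prod>b\<in>Basis. (u - l) \<bullet> b)"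
 proof -
  have "(\<Prod>b\<in>Basis. (to_bidx u - to_bidx l) \<bullet> b) = (\<Prod>i\<in>UNIV. (to_bidx u - to_bidx l) $ i)"
   unfolding Basis_vec_def
   by (subst prod.UNION_disjoint) (auto simp: inner_axis axis_eq_axis)
  also have "... = (\<Prod>i\<in>UNIV. (u - l) \<bullet> Rep_bidx i)"
   by (simp add: to_bidx_def inner_diff_left)
  also have "... = (\<Prod>b\<in>Basis. (u - l) \<bullet> b)"
   by (rule prod.reindex_bij_betw[OF bij_betw_Rep_bidx])
  finally show ?thesis .
 qed
 ultimately show "emeasure (distr lborel borel from_bidx) (box l u) = ennreal (\<Prod>b\<in>Basis. (u - l) \<bullet> b)"
  by (subst emeasure_distr) auto
qed simp

lemma nn_integral_lborel_from_bidx: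
 assumes F: "F \<in> borel_measurable borel"
 shows "(\<integral>\<^sup>+x. F x \<partial>lborel) = (\<integral>\<^sup>+v. F (from_bidx v) \<partial>lborel)"
 unfolding lborel_distr_from_bidx[where 'e='a]
 by (subst nn_integral_distr) (use F in auto)

text \<open>Conjugation with the coordinate isomorphism, which preserves \<open>lborel\<close> and
  turns \<open>lin_det\<close> into the determinant of a matrix.\<close>

lemma nn_integral_change_of_variables:
 fixes f :: "'e::euclidean_space => real" and g :: "'e => 'e"
 assumes S: "S \<in> sets borel"
  and der: "\<And>x. x \<in> S ==> (g has_derivative g' x) (at x within S)"
  and inj: "inj_on g S"
  and f0: "\<And>x. x \<in> S ==> 0 \<le> f (g x)"
  and m1: "(\<lambda>y. indicator (g ` S) y * f y) \<in> borel_measurable borel"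
  and m2: "(\<lambda>x. indicator S x * (\<bar>lin_det (g' x)\<bar> * f (g x))) \<in> borel_measurable borel"
 shows "(\<integral>\<^sup>+y. ennreal (indicator (g ` S) y * f y) \<partial>lborel) =
     (\<integral>\<^sup>+x. ennreal (indicator S x * (\<bar>lin_det (g' x)\<bar> * f (g x))) \<partial>lborel)"
proof -
 let ?J = "from_bidx :: _ => 'e" and ?K = "to_bidx :: 'e => _"
 define S' where "S' = ?J -` S"
 define G where "G v = ?K (g (?J v))" for v
 define G' where "G' v w = ?K (g' (?J v) (?J w))" for v w
 have S': "S' \<in> sets borel"
  unfolding S'_def using measurable_sets[OF borel_measurable_linear_bidx(1) S] by simp
 have JS: "?J ` S' = S" unfolding S'_def by (metis from_to_bidx surjI surj_image_vimage_eq)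
 have bJ: "bounded_linear ?J" "bounded_linear ?K"
  by (auto simp: linear_conv_bounded_linear[symmetric] linear_from_bidx linear_to_bidx)
 have der': "(G has_derivative G' v) (at v within S')" if "v \<in> S'" for v
 proof -
  have "(g has_derivative g' (?J v)) (at (?J v) within ?J ` S')"
   unfolding JS using der that by (simp add: S'_def)
  from has_derivative_in_compose[OF bounded_linear_imp_has_derivative[OF bJ(1)] this]
  have "((\<lambda>v. g (?J v)) has_derivative (\<lambda>w. g' (?J v) (?J w))) (at v within S')" .
  from bounded_linear.has_derivative[OF bJ(2) this]
  show ?thesis unfolding G_def[abs_def] G'_def[abs_def] .
 qed
 have inj': "inj_on G S'"
  unfolding G_def inj_on_def S'_def using inj unfolding inj_on_def
  by (metis from_to_bidx to_from_bidx vimage_eq)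
 have GS: "y \<in> G ` S' \<longleftrightarrow> ?J y \<in> g ` S" for y
 proof
  assume "?J y \<in> g ` S"
  then obtain x where x: "x \<in> S" "?J y = g x" by auto
  have "y = ?K (?J y)" by simp
  also have "... = G (?K x)" using x by (simp add: G_def)
  finally show "y \<in> G ` S'" by (rule image_eqI) (use x in "simp add: S'_def")
 qed (auto simp: G_def S'_def)
 have ldet: "lin_det (g' (?J v)) = det (matrix (G' v))" for v
  unfolding G'_def lin_det_eq_det_matrix by simp
 have m1': "(\<lambda>y. indicator (G ` S') y * f (?J y)) \<in> borel_measurable borel"
 proof -
  have "(\<lambda>y. indicator (g ` S) (?J y) * f (?J y)) \<in> borel_measurable borel"
   using measurable_compose[OF borel_measurable_linear_bidx(1) m1] .
  thus ?thesis by (simp add: indicator_def GS)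
 qed
 have m2': "(\<lambda>v. indicator S' v * (\<bar>det (matrix (G' v))\<bar> * f (?J (G v)))) \<in> borel_measurable borel"
 proof -
  have "(\<lambda>v. indicator S (?J v) * (\<bar>lin_det (g' (?J v))\<bar> * f (g (?J v)))) \<in> borel_measurable borel"
   using measurable_compose[OF borel_measurable_linear_bidx(1) m2] .
  thus ?thesis by (simp add: indicator_def S'_def ldet G_def)
 qed
 have "(\<integral>\<^sup>+y. ennreal (indicator (g ` S) y * f y) \<partial>lborel) =
   (\<integral>\<^sup>+v. ennreal (indicator (g ` S) (?J v) * f (?J v)) \<partial>lborel)"
  by (rule nn_integral_lborel_from_bidx) (use m1 in measurable)
 also have "... = (\<integral>\<^sup>+v. ennreal (indicator (G ` S') v * f (?J v)) \<partial>lborel)"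
  by (simp add: indicator_def GS)
 also have "... = (\<integral>\<^sup>+v. ennreal (indicator S' v * (\<bar>det (matrix (G' v))\<bar> * f (?J (G v)))) \<partial>lborel)"
  by (rule nn_integral_change_of_variables_vec[OF S' der' inj' _ m1' m2'])
    (use f0 in "auto simp: G_def S'_def")
 also have "... = (\<integral>\<^sup>+v. ennreal (indicator S (?J v) * (\<bar>lin_det (g' (?J v))\<bar> * f (g (?J v)))) \<partial>lborel)"
  by (simp add: indicator_def S'_def ldet G_def)
 also have "... = (\<integral>\<^sup>+x. ennreal (indicator S x * (\<bar>lin_det (g' x)\<bar> * f (g x))) \<partial>lborel)"
  by (rule nn_integral_lborel_from_bidx[symmetric]) (use m2 in measurable)
 finally show ?thesis .
qed

section \<open>Determinants on products with the real line\<close>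

text \<open>A permutation of the product basis contributes only if it fixes the first basis vector.\<close>

lemma sum_permutes_Basis_prod:
 fixes F :: "real \<times> 'e::euclidean_space => real \<times> 'e => real"
 assumes F: "\<And>b. b \<in> Basis ==> F (1, 0) (0, b) = 0" "F (1, 0) (1, 0) = 1"
 shows "(\<Sum>\<pi> | \<pi> permutes Basis. of_int (sign \<pi>) * (\<Prod>b\<in>Basis. F b (\<pi> b))) =
   (\<Sum>\<pi> | \<pi> permutes (Basis :: 'e set). of_int (sign \<pi>) * (\<Prod>b\<in>Basis. F (0, b) (0, \<pi> b)))"
proof -
 let ?o = "(1, 0) :: real \<times> 'e" and ?B = "Pair 0 ` Basis :: (real \<times> 'e) set"
 have Beq: "Basis = insert ?o ?B" "?o \<notin> ?B" by (auto simp: Basis_prod_def)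
 have bij: "bij_betw (Pair 0) (Basis :: 'e set) ?B" by (auto simp: bij_betw_def inj_on_def)
 have "(\<Sum>\<pi> | \<pi> permutes Basis. of_int (sign \<pi>) * (\<Prod>b\<in>Basis. F b (\<pi> b))) =
  (\<Sum>\<pi> | \<pi> permutes ?B. of_int (sign \<pi>) * (\<Prod>b\<in>Basis. F b (\<pi> b)))"
 proof (rule sum.mono_neutral_right)
  show "finite {\<pi>. \<pi> permutes (Basis :: (real \<times> 'e) set)}" by (simp add: finite_permutations)
  show "{\<pi>. \<pi> permutes ?B} \<subseteq> {\<pi>. \<pi> permutes Basis}"
   unfolding Beq(1) by (auto intro: permutes_subset)
  show "\<forall>\<pi>\<in>{\<pi>. \<pi> permutes Basis} - {\<pi>. \<pi> permutes ?B}. of_int (sign \<pi>) * (\<Prod>b\<in>Basis. F b (\<pi> b)) = 0"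
  proof
   fix \<pi> assume p: "\<pi> \<in> {\<pi>. \<pi> permutes Basis} - {\<pi>. \<pi> permutes ?B}"
   hence "\<pi> ?o \<noteq> ?o"
    unfolding Beq(1) using permutes_superset[of \<pi> "insert ?o ?B" ?B] by auto
   moreover have "\<pi> ?o \<in> Basis"
    using p permutes_in_image[of \<pi> Basis "?o"] by (simp add: Basis_prod_def)
   ultimately have "F ?o (\<pi> ?o) = 0" using F(1) unfolding Beq(1) by auto
   thus "of_int (sign \<pi>) * (\<Prod>b\<in>Basis. F b (\<pi> b)) = 0"
    unfolding Beq(1) by (subst prod.insert) (use Beq(2) in auto)
  qed
 qed
 also have "... = (\<Sum>\<pi> | \<pi> permutes ?B. of_int (sign \<pi>) * (\<Prod>b\<in>?B. F b (\<pi> b)))"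
 proof (intro sum.cong refl)
  fix \<pi> assume "\<pi> \<in> {\<pi>. \<pi> permutes ?B}"
  hence "\<pi> ?o = ?o" using Beq(2) by (auto simp: permutes_not_in)
  moreover have "(\<Prod>b\<in>insert ?o ?B. F b (\<pi> b)) = F ?o (\<pi> ?o) * (\<Prod>b\<in>?B. F b (\<pi> b))"
   by (rule prod.insert) (use Beq(2) in auto)
  ultimately show "of_int (sign \<pi>) * (\<Prod>b\<in>Basis. F b (\<pi> b)) = of_int (sign \<pi>) * (\<Prod>b\<in>?B. F b (\<pi> b))"
   using F(2) by (simp add: Beq(1)[symmetric])
 qed
 also have "... = (\<Sum>\<pi> | \<pi> permutes (Basis :: 'e set). of_int (sign \<pi>) * (\<Prod>b\<in>Basis. F (0, b) (0, \<pi> b)))"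
 proof (rule sum.reindex_bij_witness[of _ "map_permutation Basis (Pair 0)" "map_permutation ?B snd"])
  fix \<pi> assume "\<pi> \<in> {\<pi>. \<pi> permutes ?B}"
  hence p: "\<pi> permutes ?B" by simp
  have bs: "bij_betw snd ?B (Basis :: 'e set)" by (auto simp: bij_betw_def inj_on_def image_image)
  show "map_permutation Basis (Pair 0) (map_permutation ?B snd \<pi>) = \<pi>"
   by (rule map_permutation_compose_inv[OF bs p]) auto
  show "map_permutation ?B snd \<pi> \<in> {\<pi>. \<pi> permutes Basis}"
   using map_permutation_permutes[OF bs p] by simp
  have ap: "map_permutation ?B snd \<pi> b = snd (\<pi> (0, b))" if "b \<in> Basis" for b
   using map_permutation_apply[of snd ?B "(0, b)" \<pi>] bs that by (auto simp: bij_betw_def)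
  have "(\<Prod>b\<in>?B. F b (\<pi> b)) = (\<Prod>b\<in>Basis. F (0, b) (\<pi> (0, b)))"
   using prod.reindex_bij_betw[OF bij, of "\<lambda>b. F b (\<pi> b)"] by simp
  also have "... = (\<Prod>b\<in>Basis. F (0, b) (0, map_permutation ?B snd \<pi> b))"
  proof (intro prod.cong refl)
   fix b :: 'e assume b: "b \<in> Basis"
   hence "\<pi> (0, b) \<in> ?B" using p by (simp add: permutes_in_image)
   thus "F (0, b) (\<pi> (0, b)) = F (0, b) (0, map_permutation ?B snd \<pi> b)"
    unfolding ap[OF b] by auto
  qed
  finally show "of_int (sign (map_permutation ?B snd \<pi>)) * (\<Prod>b\<in>Basis. F (0, b) (0, map_permutation ?B snd \<pi> b)) =
    of_int (sign \<pi>) * (\<Prod>b\<in>?B. F b (\<pi> b))"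
   using bs p by (simp add: sign_map_permutation bij_betw_def)
 next
  fix \<pi> assume "\<pi> \<in> {\<pi>. \<pi> permutes (Basis :: 'e set)}"
  hence p: "\<pi> permutes Basis" by simp
  show "map_permutation ?B snd (map_permutation Basis (Pair 0) \<pi>) = \<pi>"
   by (rule map_permutation_compose_inv[OF bij p]) auto
  show "map_permutation Basis (Pair 0) \<pi> \<in> {\<pi>. \<pi> permutes ?B}"
   using map_permutation_permutes[OF bij p] by simp
 qed
 finally show ?thesis .
qed

text \<open>With \<open>c\<close> the square of \<open>h\<close>, the power on the right is the
  contribution of \<open>h\<close> to the squared volume density.\<close>

lemma gram_det_prod:
 "gram_det (\<lambda>(s, u) (s', u'). s * s' + c * g u u') = c ^ DIM('e) * gram_det (g :: 'e::euclidean_space => 'e => real)"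
 if g: "\<And>u. linear (g u)" "\<And>v. linear (\<lambda>u. g u v)"
proof -
 have z: "g 0 v = 0" "g v 0 = 0" for v using linear_0[OF g(1)] linear_0[OF g(2)] by auto
 show ?thesis
  unfolding gram_det_def
  by (subst sum_permutes_Basis_prod) (auto simp: z prod.distrib sum_distrib_left mult_ac intro!: sum.cong)
qed

lemma lin_det_prod: "lin_det (\<lambda>(s, v). (s :: real, T v :: 'e::euclidean_space)) = lin_det T" if "linear T"
proof -
 have "T 0 = 0" using that by (rule linear_0)
 thus ?thesis
  unfolding lin_det_def by (subst sum_permutes_Basis_prod) (auto simp: inner_prod_def)
qed

section \<open>Charts of a twisted cylinder\<close>

text \<open>\<open>frechet_derivative\<close> is a choice, so it can be computed only where
  derivatives are unique. At the boundary this still holds: from every point the set can be entered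
  along each basis direction, along the axis by going upwards.\<close>

lemma frechet_derivative_half_space:
 fixes f :: "real \<times> 'e::euclidean_space => 'b::real_normed_vector"
 assumes "(f has_derivative f') (at z within {a..} \<times> U)" "open U" "z \<in> {a..} \<times> U"
 shows "frechet_derivative f (at z within {a..} \<times> U) = f'"
proof -
 have uniq: "g' = f'" if g': "(f has_derivative g') (at z within {a..} \<times> U)" for g'
 proof (rule frechet_derivative_unique_within[OF g' assms(1)])
  fix i :: "real \<times> 'e" and e :: real assume i: "i \<in> Basis" and e: "e > 0"
  show "\<exists>d. 0 < \<bar>d\<bar> \<and> \<bar>d\<bar> < e \<and> z + d *\<^sub>R i \<in> {a..} \<times> U"
  proof (cases "i = (1, 0)")
   case True
   thus ?thesis using assms(3) e by (intro exI[of _ "e / 2"]) (auto simp: mem_Times_iff)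
  next
   case False
   then obtain b where b: "i = (0, b)" "b \<in> Basis" using i by (auto simp: Basis_prod_def)
   obtain r where r: "r > 0" "ball (snd z) r \<subseteq> U" using assms(2,3) openE by (metis mem_Times_iff)
   define d where "d = min (e / 2) (r / 2)"
   have d: "0 < d" "d < e" "d < r" using e r by (auto simp: d_def)
   hence "snd z + d *\<^sub>R b \<in> ball (snd z) r" using b by (simp add: dist_norm)
   thus ?thesis using assms(3) d r b by (intro exI[of _ d]) (auto simp: mem_Times_iff)
  qed
 qed
 show ?thesis
  unfolding frechet_derivative_def by (rule some_equality[of "\<lambda>D. (f has_derivative D) (at z within {a..} \<times> U)", OF assms(1)]) (rule uniq)
qed

locale cyl =
 fixes N :: "('i, 'a::{second_countable_topology, t2_space}, 'e::euclidean_space) riem"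
  and a :: real and h :: "real \<times> 'a => real"
 assumes closed_N: "closed_riemannian_manifold N"
  and smooth_h: "smooth_fun (cylinder a N) h"
  and pos_h: "\<And>z. z \<in> carr (cylinder a N) ==> h z > 0"
begin

abbreviation "M \<equiv> twisted_cylinder a h N"
abbreviation "inv_chart \<equiv> chart_inv N"

definition chart_im :: "'i => 'e set" where "chart_im i = chart N i ` cdom N i"

lemma M_simps [simp]:
 "carr M = {a..} \<times> carr N" "model M = {a..} \<times> model N" "idx M = idx N" "cdom M i = {a..} \<times> cdom N i"
 "chart M i z = (fst z, chart N i (snd z))"
 "gmetric M i z = (\<lambda>(s, u) (s', u'). s * s' + (h z)\<^sup>2 * gmetric N i (snd z) u u')"
 by (simp_all add: twisted_cylinder_def cylinder_def mfd.defs riem.defs case_prod_beta fun_eq_iff)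

lemma N_props:
 shows oriented_N: "oriented_manifold N" and model_N: "model N = UNIV" and compact_N: "compact (carr N)"
 using closed_N by (auto simp: closed_riemannian_manifold_def riemannian_manifold_def)

lemma carr_N: "carr N = (\<Union>i\<in>idx N. cdom N i)"
 using oriented_N by (simp add: oriented_manifold_def)

lemma openin_cdom: "i \<in> idx N ==> openin (top_of_set (carr N)) (cdom N i)"
 using oriented_N unfolding oriented_manifold_def by blast

lemma open_chart_im: "i \<in> idx N ==> open (chart_im i)"
 using oriented_N model_N by (simp add: oriented_manifold_def chart_im_def)

lemma homeo: "i \<in> idx N ==> homeomorphism (cdom N i) (chart_im i) (chart N i) (inv_chart i)"
 using oriented_N by (simp add: oriented_manifold_def chart_im_def)

lemma inv_chart_chart [simp]: "i \<in> idx N ==> x \<in> cdom N i ==> inv_chart i (chart N i x) = x"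
 using homeo by (auto simp: homeomorphism_def)

lemma chart_inv_chart [simp]: "i \<in> idx N ==> y \<in> chart_im i ==> chart N i (inv_chart i y) = y"
 using homeo by (auto simp: homeomorphism_def)

lemma inv_chart_in [simp]: "i \<in> idx N ==> y \<in> chart_im i ==> inv_chart i y \<in> cdom N i"
 using homeo by (auto simp: homeomorphism_def)

lemma chart_in [simp]: "x \<in> cdom N i ==> chart N i x \<in> chart_im i"
 by (auto simp: chart_im_def)

lemma continuous_chart: "i \<in> idx N ==> continuous_on (cdom N i) (chart N i)"
 using homeo by (auto simp: homeomorphism_def)

lemma continuous_inv_chart: "i \<in> idx N ==> continuous_on (chart_im i) (inv_chart i)"
 using homeo by (auto simp: homeomorphism_def)

lemma inj_chart: "i \<in> idx N ==> inj_on (chart N i) (cdom N i)"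
 by (rule inj_on_inverseI[of _ "inv_chart i"]) simp

lemma cdom_subset: "i \<in> idx N ==> cdom N i \<subseteq> carr N"
 by (auto simp: carr_N)

lemma borel_carr: "carr N \<in> sets borel"
 using compact_N by (simp add: compact_imp_closed borel_closed)

lemma borel_cdom: "i \<in> idx N ==> cdom N i \<in> sets borel"
 using openin_cdom[of i] borel_carr by (auto simp: openin_open)

definition overlap :: "'i => 'i => 'e set" where "overlap i j = chart N i ` (cdom N i \<inter> cdom N j)"

lemma overlap_eq: "i \<in> idx N ==> overlap i j = {y \<in> chart_im i. inv_chart i y \<in> cdom N j}"
 by (auto simp: overlap_def chart_im_def)

lemma overlap_subset: "overlap i j \<subseteq> chart_im i"
 by (auto simp: overlap_def chart_im_def)

lemma open_overlap:
 assumes "i \<in> idx N" "j \<in> idx N"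
 shows "open (overlap i j)"
proof -
 obtain U where U: "open U" "cdom N j = carr N \<inter> U"
  using openin_cdom[OF assms(2)] by (auto simp: openin_open)
 have "overlap i j = {y \<in> chart_im i. inv_chart i y \<in> U}"
  unfolding overlap_eq[OF assms(1)] using U(2) cdom_subset[OF assms(1)] inv_chart_in[OF assms(1)] by blast
 also have "... = chart_im i \<inter> inv_chart i -` U" by auto
 finally show ?thesis
  using continuous_on_open_vimage[OF open_chart_im[OF assms(1)], of "inv_chart i"] continuous_inv_chart[OF assms(1)] U(1)
  by (simp add: Int_commute)
qed

abbreviation "TN i j x \<equiv> transition_deriv N i j x"

lemma smooth_transition: "i \<in> idx N ==> j \<in> idx N ==> smooth_on (overlap i j) (transition N i j)"
 using oriented_N by (simp add: oriented_manifold_def overlap_def)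

lemma lin_det_TN: "i \<in> idx N ==> j \<in> idx N ==> x \<in> cdom N i ==> x \<in> cdom N j ==> 0 < lin_det (TN i j x)"
 using oriented_N by (simp add: oriented_manifold_def)

lemma chart_in_overlap: "x \<in> cdom N i ==> x \<in> cdom N j ==> chart N i x \<in> overlap i j"
 by (auto simp: overlap_def)

lemma transition_has_derivative:
 assumes ij: "i \<in> idx N" "j \<in> idx N" and x: "x \<in> cdom N i" "x \<in> cdom N j"
 shows "(transition N i j has_derivative TN i j x) (at (chart N i x))"
proof -
 have op: "open (overlap i j)" by (rule open_overlap[OF ij])
 have "Ck_on (Suc 0) (overlap i j) (transition N i j)"
  using smooth_transition[OF ij] by (simp add: smooth_on_def)
 then obtain f' where "partials_on (overlap i j) (transition N i j) f'"
  unfolding Ck_on_Suc_iff by blast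
 hence "transition N i j differentiable (at (chart N i x) within overlap i j)"
  using chart_in_overlap[OF x] unfolding partials_on_def differentiable_def by blast
 hence "(transition N i j has_derivative frechet_derivative (transition N i j) (at (chart N i x) within overlap i j))
   (at (chart N i x) within overlap i j)"
  by (simp add: frechet_derivative_works)
 thus ?thesis
  by (simp add: at_within_open[OF chart_in_overlap[OF x] op] transition_deriv_def overlap_def[symmetric])
qed

lemma linear_TN: "i \<in> idx N ==> j \<in> idx N ==> x \<in> cdom N i ==> x \<in> cdom N j ==> linear (TN i j x)"
 using transition_has_derivative has_derivative_linear by blast

lemma chart_inv_M:
 assumes i: "i \<in> idx N" and "a \<le> t" "y \<in> chart_im i"
 shows "chart_inv M i (t, y) = (t, inv_chart i y)"
proof -
 have "inj_on (chart M i) (cdom M i)"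
  using inj_chart[OF i] by (auto simp: inj_on_def)
 hence "chart_inv M i (chart M i (t, inv_chart i y)) = (t, inv_chart i y)"
  unfolding chart_inv_def[of M] by (rule inv_into_f_f) (use assms in auto)
 thus ?thesis using assms by simp
qed

lemma chart_im_M: "chart M i ` cdom M i = {a..} \<times> chart_im i"
 by (auto simp: chart_im_def) force

lemma chart_overlap_M: "chart M i ` (cdom M i \<inter> cdom M j) = {a..} \<times> overlap i j"
 by (auto simp: overlap_def) force

text \<open>The derivative of a transition map of the cylinder. It fixes d/dt and preserves the
  spatial directions, so splitting a form into parts with and without dt does not depend on the
  chart.\<close>

definition TM :: "'i => 'i => 'a => real \<times> 'e => real \<times> 'e" where
 "TM i j x = (\<lambda>(s, v). (s, TN i j x v))"

lemma transition_M:
 assumes "i \<in> idx N" "j \<in> idx N" "z \<in> {a..} \<times> overlap i j"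
 shows "transition M i j z = (fst z, transition N i j (snd z))"
proof -
 have "snd z \<in> chart_im i" "a \<le> fst z" using assms overlap_subset[of i j] by auto
 thus ?thesis
  using chart_inv_M[OF assms(1), of "fst z" "snd z"] by (simp add: transition_def)
qed

lemma transition_M_has_derivative:
 assumes ij: "i \<in> idx N" "j \<in> idx N" and x: "x \<in> cdom N i" "x \<in> cdom N j" and t: "a \<le> t"
 shows "(transition M i j has_derivative TM i j x) (at (t, chart N i x) within {a..} \<times> overlap i j)"
proof -
 have z: "(t, chart N i x) \<in> {a..} \<times> overlap i j" using t chart_in_overlap[OF x] by simp
 have "(transition N i j has_derivative TN i j x) (at (snd (t, chart N i x)))"
  using transition_has_derivative[OF ij x] by simp
 hence "((\<lambda>z. transition N i j (snd z)) has_derivative (\<lambda>v. TN i j x (snd v))) (at (t, chart N i x) within {a..} \<times> overlap i j)"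
  by (rule has_derivative_compose[OF has_derivative_snd[OF has_derivative_ident]])
 from has_derivative_Pair[OF has_derivative_fst[OF has_derivative_ident] this]
 show ?thesis
  unfolding TM_def case_prod_beta
  by (rule has_derivative_transform[OF z, rotated]) (rule transition_M[OF ij])
qed

lemma transition_deriv_M:
 assumes ij: "i \<in> idx N" "j \<in> idx N" and x: "x \<in> cdom N i" "x \<in> cdom N j" and t: "a \<le> t"
 shows "transition_deriv M i j (t, x) = TM i j x"
 unfolding transition_deriv_def chart_overlap_M
 using frechet_derivative_half_space[OF transition_M_has_derivative[OF assms] open_overlap[OF ij]]
  t chart_in_overlap[OF x] by simp

lemma linear_TM: "i \<in> idx N ==> j \<in> idx N ==> x \<in> cdom N i ==> x \<in> cdom N j ==> linear (TM i j x)"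
 using linear_TN[of i j x] unfolding TM_def
 by (auto intro!: linearI simp: linear_add linear_scale)

lemma lin_det_TM:
 "i \<in> idx N ==> j \<in> idx N ==> x \<in> cdom N i ==> x \<in> cdom N j ==> 0 < lin_det (TM i j x)"
 unfolding TM_def using lin_det_prod[OF linear_TN] lin_det_TN by simp

lemma is_form_M_iff:
 "is_form M k \<xi> \<longleftrightarrow>
   (\<forall>i\<in>idx N. \<forall>x\<in>cdom N i. \<forall>t\<ge>a. alternating k (\<xi> i (t, x))) \<and>
   (\<forall>i t x. \<not> (i \<in> idx N \<and> a \<le> t \<and> x \<in> cdom N i) --> \<xi> i (t, x) = (\<lambda>v. 0)) \<and>
   (\<forall>i\<in>idx N. \<forall>j\<in>idx N. \<forall>x\<in>cdom N i \<inter> cdom N j. \<forall>t\<ge>a. \<forall>v.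
    \<xi> i (t, x) v = \<xi> j (t, x) (\<lambda>l. TM i j x (v l)))"
proof -
 have "(\<forall>i\<in>idx N. \<forall>j\<in>idx N. \<forall>x\<in>cdom M i \<inter> cdom M j. \<forall>v.
    \<xi> i x v = \<xi> j x (\<lambda>l. transition_deriv M i j x (v l))) \<longleftrightarrow>
   (\<forall>i\<in>idx N. \<forall>j\<in>idx N. \<forall>x\<in>cdom N i \<inter> cdom N j. \<forall>t\<ge>a. \<forall>v.
    \<xi> i (t, x) v = \<xi> j (t, x) (\<lambda>l. TM i j x (v l)))"
  (is "?L \<longleftrightarrow> ?R")
 proof
  assume L: ?L
  show ?R
  proof (intro ballI allI impI)
   fix i j x t v assume ij: "i \<in> idx N" "j \<in> idx N" and x: "x \<in> cdom N i \<inter> cdom N j" and t: "a \<le> t"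
   have "(t, x) \<in> cdom M i \<inter> cdom M j" using x t by simp
   from L[rule_format, OF ij this, of v] show "\<xi> i (t, x) v = \<xi> j (t, x) (\<lambda>l. TM i j x (v l))"
    using transition_deriv_M[OF ij _ _ t, of x] x by simp
  qed
 next
  assume R: ?R
  show ?L
  proof (intro ballI allI)
   fix i j z v assume ij: "i \<in> idx N" "j \<in> idx N" and z: "z \<in> cdom M i \<inter> cdom M j"
   obtain t x where tx: "z = (t, x)" by (cases z)
   hence x: "x \<in> cdom N i \<inter> cdom N j" and t: "a \<le> t" using z by auto
   from R[rule_format, OF ij x t, of v] show "\<xi> i z v = \<xi> j z (\<lambda>l. transition_deriv M i j z (v l))"
    using transition_deriv_M[OF ij _ _ t, of x] x tx by simp
  qed
 qed
 moreover have "(\<forall>i\<in>idx M. \<forall>x\<in>cdom M i. alternating k (\<xi> i x)) \<longleftrightarrow>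
   (\<forall>i\<in>idx N. \<forall>x\<in>cdom N i. \<forall>t\<ge>a. alternating k (\<xi> i (t, x)))"
  unfolding M_simps by blast
 moreover have "(\<forall>i x. \<not> (i \<in> idx M \<and> x \<in> cdom M i) --> \<xi> i x = (\<lambda>v. 0)) \<longleftrightarrow>
   (\<forall>i t x. \<not> (i \<in> idx N \<and> a \<le> t \<and> x \<in> cdom N i) --> \<xi> i (t, x) = (\<lambda>v. 0))"
  unfolding M_simps split_paired_All by simp
 ultimately show ?thesis
  unfolding is_form_def M_simps by (simp only:)
qed

lemma is_formD:
 assumes "is_form M k \<xi>"
 shows "i \<in> idx N ==> x \<in> cdom N i ==> a \<le> t ==> alternating k (\<xi> i (t, x))"
  and "\<not> (i \<in> idx N \<and> a \<le> t \<and> x \<in> cdom N i) ==> \<xi> i (t, x) = (\<lambda>v. 0)"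
  and "i \<in> idx N ==> j \<in> idx N ==> x \<in> cdom N i ==> x \<in> cdom N j ==> a \<le> t ==>
    \<xi> i (t, x) v = \<xi> j (t, x) (\<lambda>l. TM i j x (v l))"
 using assms unfolding is_form_M_iff by blast+

lemma chart_at_M: "a \<le> t ==> chart_at M (t, x) = chart_at N x"
 by (simp add: chart_at_def)

lemma chart_at_in:
 assumes "x \<in> carr N"
 shows "chart_at N x \<in> idx N" "x \<in> cdom N (chart_at N x)"
proof -
 have "\<exists>i. i \<in> idx N \<and> x \<in> cdom N i" using assms by (auto simp: carr_N)
 from someI_ex[OF this] show "chart_at N x \<in> idx N" "x \<in> cdom N (chart_at N x)"
  by (simp_all add: chart_at_def)
qed

subsection \<open>The metric\<close>

lemma gN_inner: "i \<in> idx N ==> x \<in> cdom N i ==> inner_product (gmetric N i x)"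
 using closed_N unfolding closed_riemannian_manifold_def riemannian_manifold_def by blast

lemma gN_transform:
 "i \<in> idx N ==> j \<in> idx N ==> x \<in> cdom N i ==> x \<in> cdom N j ==>
   gmetric N i x u v = gmetric N j x (TN i j x u) (TN i j x v)"
 using closed_N unfolding closed_riemannian_manifold_def riemannian_manifold_def by blast

lemma continuous_gN: "i \<in> idx N ==> continuous_on (chart_im i) (\<lambda>y. gmetric N i (inv_chart i y) u v)"
proof -
 assume "i \<in> idx N"
 hence "smooth_on (chart_im i) (\<lambda>y. gmetric N i (inv_chart i y) u v)"
  using closed_N unfolding closed_riemannian_manifold_def riemannian_manifold_def chart_im_def by blast
 thus ?thesis unfolding smooth_on_def using Ck_on_continuous by blast
qed

lemma h_pos: "a \<le> t ==> x \<in> carr N ==> 0 < h (t, x)"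
 using pos_h[of "(t, x)"] by (simp add: cylinder_def)

lemma h_pos': "a \<le> t ==> i \<in> idx N ==> x \<in> cdom N i ==> 0 < h (t, x)"
 using h_pos cdom_subset by blast

lemma continuous_h: "i \<in> idx N ==> continuous_on ({a..} \<times> chart_im i) (\<lambda>z. h (fst z, inv_chart i (snd z)))"
proof -
 assume i: "i \<in> idx N"
 have eq: "chart (cylinder a N) i ` cdom (cylinder a N) i = {a..} \<times> chart_im i"
  using chart_im_M[of i] by (simp add: cylinder_def case_prod_beta)
 have eq2: "chart_inv (cylinder a N) i = chart_inv M i"
  by (rule ext) (simp add: chart_inv_def cylinder_def twisted_cylinder_def mfd.defs riem.defs)
 have "idx (cylinder a N) = idx N" by (simp add: cylinder_def)
 hence "smooth_on (chart (cylinder a N) i ` cdom (cylinder a N) i) (h \<circ> chart_inv (cylinder a N) i)"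
  using smooth_h i unfolding smooth_fun_def by blast
 hence "smooth_on ({a..} \<times> chart_im i) (h \<circ> chart_inv M i)" unfolding eq eq2 .
 hence "continuous_on ({a..} \<times> chart_im i) (h \<circ> chart_inv M i)"
  unfolding smooth_on_def using Ck_on_continuous by blast
 thus ?thesis
  by (rule continuous_on_eq) (use chart_inv_M[OF i] in "auto")
qed

lemma gM_bilinear:
 assumes "i \<in> idx N" "x \<in> cdom N i"
 shows "linear (gmetric M i (t, x) u)" "linear (\<lambda>u. gmetric M i (t, x) u v)"
proof -
 note lin = inner_product_linear[OF gN_inner[OF assms]]
 show "linear (gmetric M i (t, x) u)"
  by (cases u) (auto intro!: linearI simp: linear_add[OF lin(1)] linear_scale[OF lin(1)] algebra_simps)
 show "linear (\<lambda>u. gmetric M i (t, x) u v)"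
  by (cases v) (auto intro!: linearI simp: linear_add[OF lin(2)] linear_scale[OF lin(2)] algebra_simps)
qed

lemma gM_inner:
 assumes "i \<in> idx N" "x \<in> cdom N i" "a \<le> t"
 shows "inner_product (gmetric M i (t, x))"
proof -
 note lin = inner_product_linear[OF gN_inner[OF assms(1,2)]]
 have hp: "h (t, x) > 0" using h_pos' assms by blast
 have "0 < gmetric M i (t, x) u u" if "u \<noteq> 0" for u
 proof (cases u)
  case (Pair s v)
  show ?thesis
  proof (cases "v = 0")
   case True
   hence "s \<noteq> 0" using that Pair by (simp add: zero_prod_def)
   hence "0 < s * s" by (metis not_real_square_gt_zero)
   thus ?thesis using Pair True linear_0[OF lin(1)] by simp
  next
   case False
   thus ?thesis using Pair lin(4)[OF False] hp by (simp add: add_nonneg_pos)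
  qed
 qed
 moreover have "gmetric M i (t, x) u v = gmetric M i (t, x) v u" for u v
  by (simp add: case_prod_beta lin(3)[of "snd u"] mult.commute)
 ultimately show ?thesis
  unfolding inner_product_def using gM_bilinear[OF assms(1,2)] by blast
qed

lemma gM_transform:
 assumes "i \<in> idx N" "j \<in> idx N" "x \<in> cdom N i" "x \<in> cdom N j"
 shows "gmetric M i (t, x) u v = gmetric M j (t, x) (TM i j x u) (TM i j x v)"
 using gN_transform[OF assms] by (simp add: TM_def case_prod_beta)

text \<open>The density \<open>sqrt (det g)\<close> of the cylinder metric with its power of
  \<open>h\<close> split off. This power later cancels against the norm of forms without dt.\<close>

definition vol_dens :: "'i => real \<times> 'e => real" where
 "vol_dens i z = h (fst z, inv_chart i (snd z)) ^ DIM('e) * sqrt (gram_det (gmetric N i (inv_chart i (snd z))))"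

lemma sqrt_gram_M:
 assumes "i \<in> idx N" "x \<in> cdom N i" "a \<le> t"
 shows "sqrt (gram_det (gmetric M i (t, x))) = vol_dens i (t, chart N i x)"
proof -
 note lin = inner_product_linear[OF gN_inner[OF assms(1,2)]]
 have "gram_det (gmetric M i (t, x)) = (h (t, x))\<^sup>2 ^ DIM('e) * gram_det (gmetric N i x)"
  using gram_det_prod[of "gmetric N i x" "(h (t, x))\<^sup>2"] lin by simp
 moreover have "sqrt ((h (t, x))\<^sup>2 ^ DIM('e)) = h (t, x) ^ DIM('e)"
  using h_pos'[OF assms(3,1,2)] by (simp add: real_sqrt_power)
 ultimately show ?thesis using assms by (simp add: vol_dens_def real_sqrt_mult)
qed

lemma vol_dens_pos: "i \<in> idx N ==> z \<in> {a..} \<times> chart_im i ==> 0 < vol_dens i z"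
 unfolding vol_dens_def
 using gram_det_pos[OF gN_inner[of i "inv_chart i (snd z)"]] h_pos'[of "fst z" i "inv_chart i (snd z)"] by auto

lemma continuous_gram: "i \<in> idx N ==> continuous_on (chart_im i) (\<lambda>y. gram_det (gmetric N i (inv_chart i y)))"
 unfolding gram_det_def by (intro continuous_intros continuous_gN)

lemma continuous_vol_dens: "i \<in> idx N ==> continuous_on ({a..} \<times> chart_im i) (vol_dens i)"
 unfolding vol_dens_def
 by (intro continuous_intros continuous_h continuous_on_compose2[OF continuous_gram]) auto

lemma vol_dens_transform:
 assumes "i \<in> idx N" "j \<in> idx N" "x \<in> cdom N i" "x \<in> cdom N j" "a \<le> t"
 shows "vol_dens i (t, chart N i x) = lin_det (TM i j x) * vol_dens j (t, chart N j x)"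
proof -
 have "gmetric M i (t, x) = (\<lambda>u v. gmetric M j (t, x) (TM i j x u) (TM i j x v))"
  using gM_transform[OF assms(1-4)] by (simp add: fun_eq_iff)
 hence "gram_det (gmetric M i (t, x)) = (lin_det (TM i j x))\<^sup>2 * gram_det (gmetric M j (t, x))"
  using gram_det_linear_image[OF gM_bilinear[OF assms(2,4)], of t "TM i j x"] by simp
 thus ?thesis
  using lin_det_TM[OF assms(1-4)] sqrt_gram_M[OF assms(1,3,5)] sqrt_gram_M[OF assms(2,4,5)]
  by (simp add: real_sqrt_mult)
qed

end

section \<open>A finite cover by compact pieces\<close>

text \<open>The compact sets \<open>K r\<close> give uniform bounds for the metric in coordinates.
  The disjoint Borel sets \<open>D r\<close> reduce every integral to a finite sum of coordinate
  integrals, so that no partition of unity enters. The points \<open>pt r\<close> only provide a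
  default value for \<open>param\<close>.\<close>

locale cyl_cover = cyl N a h
 for N :: "('i, 'a::{second_countable_topology, t2_space}, 'e::euclidean_space) riem" and a h +
 fixes m :: nat and \<iota> :: "nat => 'i" and K D :: "nat => 'a set" and pt :: "nat => 'a"
 assumes iota: "\<And>r. r < m ==> \<iota> r \<in> idx N"
  and pt: "\<And>r. r < m ==> pt r \<in> carr N"
  and compact_K: "\<And>r. r < m ==> compact (K r)"
  and K_cdom: "\<And>r. r < m ==> K r \<subseteq> cdom N (\<iota> r)"
  and D_K: "\<And>r. r < m ==> D r \<subseteq> K r"
  and borel_D: "\<And>r. r < m ==> D r \<in> sets borel"
  and D_cover: "carr N = (\<Union>r<m. D r)"
  and D_disj: "\<And>r s. r < m ==> s < m ==> r \<noteq> s ==> D r \<inter> D s = {}"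

text \<open>Every point is the centre of a coordinate ball whose closure stays inside a chart;
  finitely many of the open balls cover the compact manifold, and the closed ones are the compact
  pieces.\<close>

lemma (in cyl) cover_exists: "\<exists>m \<iota> K D pt. cyl_cover N a h m \<iota> K D pt"
proof -
 have "\<exists>i r. i \<in> idx N \<and> x \<in> cdom N i \<and> r > 0 \<and> cball (chart N i x) r \<subseteq> chart_im i" if x: "x \<in> carr N" for x
 proof -
  obtain i where i: "i \<in> idx N" "x \<in> cdom N i" using x by (auto simp: carr_N)
  thus ?thesis using open_chart_im[OF i(1)] open_contains_cball by (metis chart_in)
 qed
 then obtain ii rr where ir: "\<And>x. x \<in> carr N ==> ii x \<in> idx N \<and> x \<in> cdom N (ii x) \<and> rr x > 0 \<and>
   cball (chart N (ii x) x) (rr x) \<subseteq> chart_im (ii x)"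
  by metis
 define U where "U x = inv_chart (ii x) ` ball (chart N (ii x) x) (rr x)" for x
 define KK where "KK x = inv_chart (ii x) ` cball (chart N (ii x) x) (rr x)" for x
 have opU: "openin (top_of_set (carr N)) (U x)" if x: "x \<in> carr N" for x
 proof -
  note i = ir[OF x]
  have bs: "ball (chart N (ii x) x) (rr x) \<subseteq> chart_im (ii x)"
   using i ball_subset_cball by blast
  have "U x = cdom N (ii x) \<inter> chart N (ii x) -` ball (chart N (ii x) x) (rr x)"
  proof (intro set_eqI iffI)
   fix w assume "w \<in> cdom N (ii x) \<inter> chart N (ii x) -` ball (chart N (ii x) x) (rr x)"
   thus "w \<in> U x" unfolding U_def using inv_chart_chart[of "ii x" w] i by (metis IntE imageI vimage_eq)
  qed (use bs i in "auto simp: U_def subset_iff")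
  moreover have "openin (top_of_set (cdom N (ii x))) (cdom N (ii x) \<inter> chart N (ii x) -` ball (chart N (ii x) x) (rr x))"
   using continuous_chart i by (simp add: continuous_openin_preimage_gen)
  ultimately show ?thesis
   using openin_cdom i openin_trans by metis
 qed
 have xU: "x \<in> U x" if "x \<in> carr N" for x
  unfolding U_def using ir[OF that] by (intro image_eqI[of _ _ "chart N (ii x) x"]) auto
 obtain F where F: "finite F" "F \<subseteq> carr N" "carr N \<subseteq> (\<Union>x\<in>F. U x)"
 proof -
  have "\<exists>V. open V \<and> U x = carr N \<inter> V" if "x \<in> carr N" for x
   using opU[OF that] by (simp add: openin_open)
  then obtain V where V: "\<And>x. x \<in> carr N ==> open (V x) \<and> U x = carr N \<inter> V x" by metis
  have "carr N \<subseteq> (\<Union>x\<in>carr N. V x)" using xU V by blast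
  with V obtain F where F: "F \<subseteq> carr N" "finite F" "carr N \<subseteq> (\<Union>x\<in>F. V x)"
   using compactE_image[OF compact_N, of "carr N" V] by metis
  have "carr N \<subseteq> (\<Union>x\<in>F. U x)" using F V by blast
  thus thesis using that F by blast
 qed
 obtain p where p: "bij_betw p {..<card F} F"
  using ex_bij_betw_nat_finite[OF F(1)] by (auto simp: atLeast0LessThan)
 define m where "m = card F"
 have pF: "p r \<in> F" if "r < m" for r using p that by (auto simp: bij_betw_def m_def)
 have pc: "p r \<in> carr N" if "r < m" for r using pF[OF that] F by auto
 define \<iota> where "\<iota> r = ii (p r)" for r
 define K where "K r = KK (p r)" for r
 define D where "D r = K r - (\<Union>s<r. K s)" for r
 have iota: "\<iota> r \<in> idx N" if "r < m" for r using ir[OF pc[OF that]] by (simp add: \<iota>_def)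
 have Kc: "compact (K r)" if "r < m" for r
  unfolding K_def KK_def
  by (rule compact_continuous_image[OF continuous_on_subset[OF continuous_inv_chart]])
    (use ir[OF pc[OF that]] in auto)
 have Kd: "K r \<subseteq> cdom N (\<iota> r)" if "r < m" for r
  unfolding K_def KK_def \<iota>_def using ir[OF pc[OF that]] by auto
 have "carr N \<subseteq> (\<Union>r<m. K r)"
 proof
  fix x assume "x \<in> carr N"
  then obtain y where "y \<in> F" "x \<in> U y" using F by auto
  moreover have "U y \<subseteq> KK y" unfolding U_def KK_def using ball_subset_cball by blast
  ultimately obtain r where "r < m" "x \<in> KK (p r)"
   using p unfolding bij_betw_def m_def by (metis imageE lessThan_iff subsetD)
  thus "x \<in> (\<Union>r<m. K r)" by (auto simp: K_def)
 qed
 moreover have "(\<Union>r<m. K r) \<subseteq> carr N" using Kd iota cdom_subset by blast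
 ultimately have Kcov: "carr N = (\<Union>r<m. K r)" by blast
 have DK: "(\<Union>r<m. K r) = (\<Union>r<m. D r)"
 proof
  show "(\<Union>r<m. K r) \<subseteq> (\<Union>r<m. D r)"
  proof
   fix x assume "x \<in> (\<Union>r<m. K r)"
   then obtain r where "r < m" "x \<in> K r" by auto
   define s where "s = (LEAST s. x \<in> K s)"
   have "x \<in> K s" "s \<le> r" using \<open>x \<in> K r\<close> unfolding s_def by (auto intro: LeastI Least_le)
   moreover have "x \<notin> K q" if "q < s" for q using not_less_Least that unfolding s_def by blast
   ultimately show "x \<in> (\<Union>r<m. D r)" using \<open>r < m\<close> by (intro UN_I[of s]) (auto simp: D_def)
  qed
 qed (auto simp: D_def)
 have "cyl_cover N a h m \<iota> K D p"
 proof unfold_locales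
  show "D r \<in> sets borel" if "r < m" for r
   unfolding D_def using Kc that by (intro sets.Diff sets.finite_UN) (auto intro!: borel_compact)
  show "D r \<inter> D s = {}" if "r < m" "s < m" "r \<noteq> s" for r s
   using that by (cases "r < s") (auto simp: D_def)
  show "D r \<subseteq> K r" for r by (auto simp: D_def)
 qed (use iota pc Kc Kd Kcov DK in auto)
 thus ?thesis by blast
qed

section \<open>The Riemannian volume of a twisted cylinder\<close>

lemma nn_integral_count_space_lborel:
 fixes F :: "nat \<times> 'e::euclidean_space => ennreal"
 assumes F: "F \<in> borel_measurable (count_space {..<m} \<Otimes>\<^sub>M lborel)"
 shows "(\<integral>\<^sup>+p. F p \<partial>(count_space {..<m} \<Otimes>\<^sub>M lborel)) = (\<Sum>r<m. \<integral>\<^sup>+z. F (r, z) \<partial>lborel)"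
 using lborel.nn_integral_fst[OF F] by (simp add: nn_integral_count_space_finite)

lemma integral_count_space_lborel:
 fixes F :: "nat \<times> 'e::euclidean_space => real"
 assumes F: "\<And>r. r < m ==> integrable lborel (\<lambda>z. F (r, z))"
 shows "(\<integral>p. F p \<partial>(count_space {..<m} \<Otimes>\<^sub>M lborel)) = (\<Sum>r<m. \<integral>z. F (r, z) \<partial>lborel)"
proof -
 interpret C: sigma_finite_measure "count_space {..<m}"
  by (rule sigma_finite_measure_count_space_finite) simp
 interpret P: pair_sigma_finite "count_space {..<m}" "lborel :: 'e measure" ..
 have Fm: "F \<in> borel_measurable (count_space {..<m} \<Otimes>\<^sub>M lborel)"
  by (rule measurable_pair_measure_countable1) (use F in auto)
 have "(\<integral>\<^sup>+p. ennreal (norm (F p)) \<partial>(count_space {..<m} \<Otimes>\<^sub>M lborel)) = (\<Sum>r<m. \<integral>\<^sup>+z. ennreal (norm (F (r, z))) \<partial>lborel)"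
  by (rule nn_integral_count_space_lborel) (use Fm in measurable)
 also have "... < \<infinity>" using F by (auto simp: integrable_iff_bounded)
 finally have "integrable (count_space {..<m} \<Otimes>\<^sub>M lborel) F"
  using Fm by (simp add: integrable_iff_bounded)
 from P.integral_fst'[OF this] show ?thesis
  by (simp add: lebesgue_integral_count_space_finite)
qed

context cyl
begin

text \<open>Forms vanish off the domain of the chart, so their coefficients are Borel on the whole space.\<close>

lemma measurable_form_iff:
 "measurable_form M k \<xi> \<longleftrightarrow> is_form M k \<xi> \<and> (\<forall>i\<in>idx N. \<forall>v. (\<lambda>z. \<xi> i z v) \<in> borel_measurable borel)"
proof -
 have "(\<lambda>z. \<xi> i z v) \<in> borel_measurable (restrict_space borel (cdom M i)) \<longleftrightarrow> (\<lambda>z. \<xi> i z v) \<in> borel_measurable borel"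
  if \<xi>: "is_form M k \<xi>" and i: "i \<in> idx N" for i v
 proof -
  have "(\<lambda>z. \<xi> i z v * indicator (cdom M i) z) = (\<lambda>z. \<xi> i z v)"
   using \<xi> i unfolding is_form_def by (auto simp: fun_eq_iff indicator_def simp del: M_simps)
  moreover have "cdom M i \<in> sets borel"
   using borel_cdom[OF i] by (auto intro: borel_Times)
  ultimately show ?thesis
   by (subst borel_measurable_restrict_space_iff) (simp_all add: mult.commute del: M_simps)
 qed
 thus ?thesis by (auto simp: measurable_form_def)
qed

lemma is_form_lincomb:
 assumes \<xi>: "is_form M k \<xi>" and \<theta>: "is_form M k \<theta>"
 shows "is_form M k (\<lambda>i z v. f z * \<xi> i z v + g z * \<theta> i z v)"
 unfolding is_form_M_iff
proof (intro conjI ballI allI impI)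
 fix i x t assume "i \<in> idx N" "x \<in> cdom N i" "a \<le> t"
 thus "alternating k (\<lambda>v. f (t, x) * \<xi> i (t, x) v + g (t, x) * \<theta> i (t, x) v)"
  by (intro alternating_add alternating_scale is_formD[OF \<xi>] is_formD[OF \<theta>])
next
 fix i t x assume "\<not> (i \<in> idx N \<and> a \<le> t \<and> x \<in> cdom N i)"
 thus "(\<lambda>v. f (t, x) * \<xi> i (t, x) v + g (t, x) * \<theta> i (t, x) v) = (\<lambda>v. 0)"
  by (simp add: is_formD(2)[OF \<xi>] is_formD(2)[OF \<theta>])
next
 fix i j x t v assume "i \<in> idx N" "j \<in> idx N" "x \<in> cdom N i \<inter> cdom N j" "a \<le> t"
 thus "f (t, x) * \<xi> i (t, x) v + g (t, x) * \<theta> i (t, x) v =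
   f (t, x) * \<xi> j (t, x) (\<lambda>l. TM i j x (v l)) + g (t, x) * \<theta> j (t, x) (\<lambda>l. TM i j x (v l))"
  using is_formD(3)[OF \<xi>, of i j x t v] is_formD(3)[OF \<theta>, of i j x t v] by simp
qed

lemma measurable_form_lincomb:
 assumes "measurable_form M k \<xi>" "measurable_form M k \<theta>" "f \<in> borel_measurable borel" "g \<in> borel_measurable borel"
 shows "measurable_form M k (\<lambda>i z v. f z * \<xi> i z v + g z * \<theta> i z v)"
 using assms unfolding measurable_form_iff
 by (intro conjI ballI allI is_form_lincomb borel_measurable_add borel_measurable_times) blast+

text \<open>An explicit formula in place of \<open>chart_inv M i\<close>, which is an
  \<open>inv_into\<close>; the two agree on the image of the chart.\<close>

definition inv_pair :: "'i => real \<times> 'e => real \<times> 'a" where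
 "inv_pair i z = (fst z, inv_chart i (snd z))"

lemma continuous_inv_pair: "i \<in> idx N ==> continuous_on (UNIV \<times> chart_im i) (inv_pair i)"
 unfolding inv_pair_def
 by (intro continuous_intros continuous_on_compose2[OF continuous_inv_chart]) auto

lemma borel_chart_im_M: "i \<in> idx N ==> {a..} \<times> chart_im i \<in> sets borel"
 unfolding borel_prod[symmetric] by (intro pair_measureI) (auto intro!: borel_open open_chart_im)

lemma chart_image_eq:
 assumes i: "i \<in> idx N" and B: "B \<subseteq> cdom M i"
 shows "chart M i ` B = {z \<in> {a..} \<times> chart_im i. inv_pair i z \<in> B}"
proof (intro set_eqI iffI)
 fix z assume "z \<in> chart M i ` B"
 thus "z \<in> {z \<in> {a..} \<times> chart_im i. inv_pair i z \<in> B}"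
  using i B by (fastforce simp: inv_pair_def subset_iff)
next
 fix z assume z: "z \<in> {z \<in> {a..} \<times> chart_im i. inv_pair i z \<in> B}"
 hence "z = chart M i (inv_pair i z)" using i by (auto simp: inv_pair_def)
 thus "z \<in> chart M i ` B" using z by blast
qed

text \<open>The image under a chart is a preimage under its continuous inverse, hence Borel.\<close>

lemma borel_chart_image:
 assumes i: "i \<in> idx N" and B: "B \<in> sets borel" "B \<subseteq> cdom M i"
 shows "chart M i ` B \<in> sets borel"
proof -
 have "inv_pair i \<in> borel_measurable (restrict_space borel ({a..} \<times> chart_im i))"
  by (rule borel_measurable_continuous_on_restrict)
    (rule continuous_on_subset[OF continuous_inv_pair[OF i]], auto)
 from measurable_sets[OF this B(1)]
 have "inv_pair i -` B \<inter> ({a..} \<times> chart_im i) \<in> sets (restrict_space borel ({a..} \<times> chart_im i))"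
  by (simp add: space_restrict_space)
 hence "inv_pair i -` B \<inter> ({a..} \<times> chart_im i) \<in> sets borel"
  using borel_chart_im_M[OF i] by (simp add: sets_restrict_space_iff)
 moreover have "chart M i ` B = inv_pair i -` B \<inter> ({a..} \<times> chart_im i)"
  unfolding chart_image_eq[OF i B(2)] by auto
 ultimately show ?thesis by simp
qed

lemma borel_vol_dens:
 assumes "i \<in> idx N" "S \<in> sets borel" "S \<subseteq> {a..} \<times> chart_im i"
 shows "(\<lambda>z. indicator S z * vol_dens i z) \<in> borel_measurable borel"
 using borel_measurable_continuous_on_indicator[OF assms(2) continuous_on_subset[OF continuous_vol_dens[OF assms(1)] assms(3)]]
 by simp

lemma borel_carr_M: "{a..} \<times> carr N \<in> sets borel"
 unfolding borel_prod[symmetric] by (intro pair_measureI borel_carr) auto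

end

context cyl_cover
begin

definition Y :: "nat => 'e set" where "Y r = chart N (\<iota> r) ` D r"
definition KY :: "nat => 'e set" where "KY r = chart N (\<iota> r) ` K r"
definition Z :: "nat => (real \<times> 'e) set" where "Z r = {a..} \<times> Y r"

abbreviation "ipr r \<equiv> inv_pair (\<iota> r)"

lemma D_cdom: "r < m ==> D r \<subseteq> cdom N (\<iota> r)" using D_K K_cdom by blast

lemma D_carr: "r < m ==> D r \<subseteq> carr N" using D_cover by blast

lemma Y_chart_im: "r < m ==> Y r \<subseteq> chart_im (\<iota> r)" using D_cdom[of r] by (auto simp: Y_def)

lemma Y_iff: "r < m ==> y \<in> Y r \<longleftrightarrow> y \<in> chart_im (\<iota> r) \<and> inv_chart (\<iota> r) y \<in> D r"
 using D_cdom[of r] iota[of r] unfolding Y_def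
 by (auto intro!: image_eqI[of y _ "inv_chart (\<iota> r) y"] simp: subset_iff)

lemma Y_KY: "Y r \<subseteq> KY r" if "r < m" using D_K[OF that] by (auto simp: Y_def KY_def)

lemma compact_KY: "r < m ==> compact (KY r)"
 unfolding KY_def
 by (rule compact_continuous_image[OF continuous_on_subset[OF continuous_chart K_cdom] compact_K]) (use iota in auto)

lemma KY_chart_im: "r < m ==> KY r \<subseteq> chart_im (\<iota> r)" using K_cdom[of r] by (auto simp: KY_def)

lemma Z_iff: "r < m ==> z \<in> Z r \<longleftrightarrow> z \<in> {a..} \<times> chart_im (\<iota> r) \<and> ipr r z \<in> {a..} \<times> D r"
 using Y_iff by (auto simp: Z_def inv_pair_def)

lemma Z_sub: "r < m ==> Z r \<subseteq> {a..} \<times> chart_im (\<iota> r)" using Z_iff by blast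

lemma ipr_in: "r < m ==> z \<in> Z r ==> ipr r z \<in> {a..} \<times> D r" using Z_iff by blast

lemma borel_DM: "r < m ==> {a..} \<times> D r \<in> sets borel"
 unfolding borel_prod[symmetric] by (intro pair_measureI borel_D) auto

lemma Z_image: "r < m ==> Z r = chart M (\<iota> r) ` ({a..} \<times> D r)"
 by (auto simp: Z_def Y_def) force

lemma borel_Z [measurable]: "r < m ==> Z r \<in> sets borel"
 unfolding Z_image by (rule borel_chart_image) (use iota borel_DM D_cdom in auto)

text \<open>The default point outside \<open>Z r\<close> makes this a total measurable map into the
  cylinder, as an image measure requires.\<close>

definition param :: "nat => real \<times> 'e => real \<times> 'a" where
 "param r z = (if z \<in> Z r then ipr r z else (a, pt r))"

lemma measurable_param:
 assumes r: "r < m"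
 shows "param r \<in> measurable borel (restrict_space borel ({a..} \<times> carr N))"
proof (rule measurable_restrict_space2)
 show "param r \<in> space borel \<rightarrow> {a..} \<times> carr N"
  using ipr_in[OF r] D_carr[OF r] pt[OF r] by (force simp: param_def)
 have "ipr r \<in> borel_measurable (restrict_space borel (Z r))"
  by (rule borel_measurable_continuous_on_restrict)
    (rule continuous_on_subset[OF continuous_inv_pair], use r iota Z_sub in auto)
 thus "param r \<in> borel_measurable borel"
  unfolding param_def using borel_Z[OF r] by (subst measurable_If_restrict_space_iff) auto
qed

definition weight :: "nat => real \<times> 'e => real" where
 "weight r z = indicator (Z r) z * vol_dens (\<iota> r) z"

lemma weight_nonneg: "r < m ==> 0 \<le> weight r z"
 unfolding weight_def using vol_dens_pos[OF iota, of r z] Z_sub[of r] by (auto simp: indicator_def less_imp_le)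

lemma measurable_weight [measurable]: "r < m ==> weight r \<in> borel_measurable borel"
 unfolding weight_def by (rule borel_vol_dens[OF iota borel_Z Z_sub]) auto

text \<open>The candidate for the Riemannian volume. Being the image of a density on the disjoint
  union of the coordinate pieces, it is a measure by construction, and its integrals are sums of
  coordinate integrals.\<close>

definition vol :: "(real \<times> 'a) measure" where
 "vol = distr (density (count_space {..<m} \<Otimes>\<^sub>M lborel) (\<lambda>p. ennreal (weight (fst p) (snd p))))
   (restrict_space borel ({a..} \<times> carr N)) (\<lambda>p. param (fst p) (snd p))"

lemma measurable_param_pair:
 "(\<lambda>p. param (fst p) (snd p)) \<in> measurable (count_space {..<m} \<Otimes>\<^sub>M lborel) (restrict_space borel ({a..} \<times> carr N))"
 by (rule measurable_pair_measure_countable1) (use measurable_param in auto)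

lemma measurable_weight_pair:
 "(\<lambda>p. weight (fst p) (snd p)) \<in> borel_measurable (count_space {..<m} \<Otimes>\<^sub>M lborel)"
 by (rule measurable_pair_measure_countable1) (use measurable_weight in auto)

lemma sets_vol: "sets vol = sets (restrict_space borel ({a..} \<times> carr N))"
 by (simp add: vol_def)

lemma nn_integral_vol0:
 assumes G: "G \<in> borel_measurable (restrict_space borel ({a..} \<times> carr N))"
 shows "(\<integral>\<^sup>+z. G z \<partial>vol) = (\<Sum>r<m. \<integral>\<^sup>+z. ennreal (weight r z) * G (param r z) \<partial>lborel)"
proof -
 have m1: "(\<lambda>p. G (param (fst p) (snd p))) \<in> borel_measurable (count_space {..<m} \<Otimes>\<^sub>M lborel)"
  by (rule measurable_compose[OF measurable_param_pair G])
 have m2: "(\<lambda>p. ennreal (weight (fst p) (snd p))) \<in> borel_measurable (count_space {..<m} \<Otimes>\<^sub>M lborel)"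
  using measurable_weight_pair by measurable
 have "(\<integral>\<^sup>+z. G z \<partial>vol) = (\<integral>\<^sup>+p. ennreal (weight (fst p) (snd p)) * G (param (fst p) (snd p)) \<partial>(count_space {..<m} \<Otimes>\<^sub>M lborel))"
  unfolding vol_def
  by (subst nn_integral_distr) (use measurable_param_pair G m1 m2 in "auto simp: nn_integral_density")
 also have "... = (\<Sum>r<m. \<integral>\<^sup>+z. ennreal (weight r z) * G (param r z) \<partial>lborel)"
  by (subst nn_integral_count_space_lborel) (use m1 m2 in auto)
 finally show ?thesis .
qed

lemma integral_vol0:
 fixes G :: "real \<times> 'a => real"
 assumes G: "G \<in> borel_measurable (restrict_space borel ({a..} \<times> carr N))"
  and int: "\<And>r. r < m ==> integrable lborel (\<lambda>z. weight r z * G (param r z))"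
 shows "(\<integral>z. G z \<partial>vol) = (\<Sum>r<m. \<integral>z. weight r z * G (param r z) \<partial>lborel)"
proof -
 have m1: "(\<lambda>p. G (param (fst p) (snd p))) \<in> borel_measurable (count_space {..<m} \<Otimes>\<^sub>M lborel)"
  by (rule measurable_compose[OF measurable_param_pair G])
 have "(\<integral>z. G z \<partial>vol) = (\<integral>p. weight (fst p) (snd p) * G (param (fst p) (snd p)) \<partial>(count_space {..<m} \<Otimes>\<^sub>M lborel))"
  unfolding vol_def
  apply (subst integral_distr)
  using measurable_param_pair apply simp
   apply (rule G)
  apply (subst integral_density)
    apply (rule m1)
   apply (rule measurable_weight_pair)
   apply (rule AE_I2)
   apply (use weight_nonneg in "auto simp: space_pair_measure")
  done
 also have "... = (\<Sum>r<m. \<integral>z. weight r z * G (param r z) \<partial>lborel)"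
  by (subst integral_count_space_lborel) (use int in auto)
 finally show ?thesis .
qed

text \<open>The property inside the description that defines \<open>riem_vol\<close>. Nothing can be
  said about \<open>riem_vol\<close> before both existence and uniqueness are settled.\<close>

definition vol_spec :: "(real \<times> 'a) measure => bool" where
 "vol_spec \<mu> \<longleftrightarrow> sets \<mu> = sets (restrict_space borel (carr M)) \<and>
   (\<forall>i\<in>idx M. \<forall>A\<in>sets \<mu>. A \<subseteq> cdom M i -->
    emeasure \<mu> A =
     (\<integral>\<^sup>+y\<in>chart M i ` A. ennreal (sqrt (gram_det (gmetric M i (chart_inv M i y)))) \<partial>lborel))"

lemma indicator_sum_pieces:
 assumes i: "i \<in> idx N" and A: "A \<subseteq> cdom M i"
 shows "(indicator (chart M i ` A) z :: real) = (\<Sum>r<m. indicator (chart M i ` (A \<inter> ({a..} \<times> D r))) z)"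
proof -
 have iff: "z \<in> chart M i ` B \<longleftrightarrow> z \<in> {a..} \<times> chart_im i \<and> inv_pair i z \<in> B" if "B \<subseteq> A" for B
  using chart_image_eq[OF i, of B] that A by blast
 show ?thesis
 proof (cases "z \<in> chart M i ` A")
  case True
  hence z: "z \<in> {a..} \<times> chart_im i" "inv_pair i z \<in> A" using iff by auto
  hence "inv_pair i z \<in> cdom M i" using A by blast
  hence "snd (inv_pair i z) \<in> carr N" "a \<le> fst (inv_pair i z)" using cdom_subset[OF i] by auto
  then obtain r where r: "r < m" "inv_pair i z \<in> {a..} \<times> D r" using D_cover by (auto simp: mem_Times_iff)
  have "(\<Sum>s<m. indicator (chart M i ` (A \<inter> ({a..} \<times> D s))) z) = (\<Sum>s<m. if s = r then 1 else 0 :: real)"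
  proof (intro sum.cong refl)
   fix s assume s: "s \<in> {..<m}"
   have "z \<in> chart M i ` (A \<inter> ({a..} \<times> D s)) \<longleftrightarrow> s = r"
    using iff[of "A \<inter> ({a..} \<times> D s)"] z r D_disj[of s r] s by (auto simp: mem_Times_iff)
   thus "indicator (chart M i ` (A \<inter> ({a..} \<times> D s))) z = (if s = r then 1 else 0 :: real)"
    by (simp add: indicator_def)
  qed
  thus ?thesis using True r by simp
 next
  case False
  thus ?thesis by (auto simp: indicator_def intro!: sum.neutral[symmetric])
 qed
qed

text \<open>Independence of the chart: the transition map carries the picture of the piece in chart
  \<open>\<iota> r\<close> to its picture in chart \<open>i\<close>, and the ratio of the two
  densities is the Jacobian determinant.\<close>

lemma emeasure_piece:
 assumes r: "r < m" and i: "i \<in> idx N" and A: "A \<in> sets borel" "A \<subseteq> cdom M i"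
 shows "(\<integral>\<^sup>+z. ennreal (weight r z) * indicator A (param r z) \<partial>lborel) =
   (\<integral>\<^sup>+z. ennreal (indicator (chart M i ` (A \<inter> ({a..} \<times> D r))) z * vol_dens i z) \<partial>lborel)"
proof -
 have ir: "\<iota> r \<in> idx N" using iota[OF r] .
 define B where "B = A \<inter> ({a..} \<times> D r)"
 have B: "B \<in> sets borel" "B \<subseteq> cdom M i" "B \<subseteq> cdom M (\<iota> r)"
  using A borel_DM[OF r] D_cdom[OF r] by (auto simp: B_def)
 define S where "S = chart M (\<iota> r) ` B"
 have S: "S \<in> sets borel" unfolding S_def by (rule borel_chart_image[OF ir B(1,3)])
 have Ssub: "S \<subseteq> {a..} \<times> overlap (\<iota> r) i"
  using B unfolding S_def by (auto simp: overlap_def)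
 let ?g = "transition M (\<iota> r) i" and ?g' = "\<lambda>z. TM (\<iota> r) i (inv_chart (\<iota> r) (snd z))"
 have Sx: "snd z = chart N (\<iota> r) (inv_chart (\<iota> r) (snd z)) \<and> a \<le> fst z \<and>
    inv_chart (\<iota> r) (snd z) \<in> cdom N (\<iota> r) \<and> inv_chart (\<iota> r) (snd z) \<in> cdom N i" if "z \<in> S" for z
  using Ssub that overlap_eq[OF ir, of i] ir by auto
 have gS: "?g (chart M (\<iota> r) x) = chart M i x" if "x \<in> B" for x
 proof -
  have "chart M (\<iota> r) x \<in> {a..} \<times> overlap (\<iota> r) i" using Ssub that by (auto simp: S_def)
  thus ?thesis
   using transition_M[OF ir i] that B ir by (auto simp: transition_def)
 qed
 have gim: "?g ` S = chart M i ` B"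
  unfolding S_def image_image using gS by (rule image_cong[OF refl])
 have der: "(?g has_derivative ?g' z) (at z within S)" if "z \<in> S" for z
 proof -
  note x = Sx[OF that]
  have "(?g has_derivative ?g' z) (at (fst z, chart N (\<iota> r) (inv_chart (\<iota> r) (snd z))) within {a..} \<times> overlap (\<iota> r) i)"
   by (rule transition_M_has_derivative[OF ir i]) (use x in auto)
  moreover have "(fst z, chart N (\<iota> r) (inv_chart (\<iota> r) (snd z))) = z"
   using x by (simp add: prod_eq_iff)
  ultimately have "(?g has_derivative ?g' z) (at z within {a..} \<times> overlap (\<iota> r) i)" by (simp only:)
  thus ?thesis by (rule has_derivative_subset[OF _ Ssub])
 qed
 have inj: "inj_on ?g S"
 proof (rule inj_onI)
  fix z w assume zw: "z \<in> S" "w \<in> S" "?g z = ?g w"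
  then obtain x y where xy: "x \<in> B" "y \<in> B" "z = chart M (\<iota> r) x" "w = chart M (\<iota> r) y" by (auto simp: S_def)
  hence "chart M i x = chart M i y" using zw gS by metis
  moreover have "x \<in> cdom M i" "y \<in> cdom M i" using xy B by auto
  ultimately have "x = y" using inj_chart[OF i] by (auto simp: inj_on_def prod_eq_iff)
  thus "z = w" using xy by simp
 qed
 have dens: "\<bar>lin_det (?g' z)\<bar> * vol_dens i (?g z) = vol_dens (\<iota> r) z" if "z \<in> S" for z
 proof -
  note x = Sx[OF that]
  let ?x = "inv_chart (\<iota> r) (snd z)"
  have "?g z = (fst z, chart N i ?x)"
   using transition_M[OF ir i] that Ssub by (auto simp: transition_def)
  moreover have "vol_dens (\<iota> r) (fst z, chart N (\<iota> r) ?x) = lin_det (TM (\<iota> r) i ?x) * vol_dens i (fst z, chart N i ?x)"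
   by (rule vol_dens_transform[OF ir i]) (use x in auto)
  moreover have "lin_det (TM (\<iota> r) i ?x) > 0" by (rule lin_det_TM[OF ir i]) (use x in auto)
  ultimately show ?thesis using x by simp
 qed
 have Sz: "ennreal (weight r z) * indicator A (param r z) = ennreal (indicator S z * vol_dens (\<iota> r) z)" for z
 proof -
  have "z \<in> S \<longleftrightarrow> z \<in> Z r \<and> param r z \<in> A"
   unfolding S_def chart_image_eq[OF ir B(3)] using Z_iff[OF r, of z] by (auto simp: B_def param_def)
  thus ?thesis by (auto simp: weight_def indicator_def)
 qed
 have "(\<integral>\<^sup>+z. ennreal (weight r z) * indicator A (param r z) \<partial>lborel) = (\<integral>\<^sup>+z. ennreal (indicator S z * (\<bar>lin_det (?g' z)\<bar> * vol_dens i (?g z))) \<partial>lborel)"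
  unfolding Sz by (rule nn_integral_cong) (use dens in "auto simp: indicator_def")
 also have "... = (\<integral>\<^sup>+z. ennreal (indicator (?g ` S) z * vol_dens i z) \<partial>lborel)"
 proof (rule nn_integral_change_of_variables[OF S der inj, symmetric])
  show "0 \<le> vol_dens i (?g z)" if "z \<in> S" for z
  proof -
   have "?g z \<in> chart M i ` B" using gim that by blast
   hence "?g z \<in> {a..} \<times> chart_im i" using B(2) by auto
   thus ?thesis using vol_dens_pos[OF i, of "?g z"] by simp
  qed
  show "(\<lambda>z. indicator (?g ` S) z * vol_dens i z) \<in> borel_measurable borel"
   unfolding gim by (rule borel_vol_dens[OF i borel_chart_image[OF i B(1,2)]]) (use B(2) in auto)
  have "(\<lambda>z. indicator S z * (\<bar>lin_det (?g' z)\<bar> * vol_dens i (?g z))) = (\<lambda>z. indicator S z * vol_dens (\<iota> r) z)"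
   using dens by (auto simp: indicator_def fun_eq_iff)
  moreover have "S \<subseteq> {a..} \<times> chart_im (\<iota> r)" using Ssub overlap_subset[of "\<iota> r" i] by auto
  ultimately show "(\<lambda>z. indicator S z * (\<bar>lin_det (?g' z)\<bar> * vol_dens i (?g z))) \<in> borel_measurable borel"
   using borel_vol_dens[OF ir S] by simp
 qed
 finally show ?thesis unfolding gim B_def .
qed

lemma vol_spec_vol: "vol_spec vol"
 unfolding vol_spec_def
proof (intro conjI ballI impI)
 let ?I = "\<lambda>i A r z. indicator (chart M i ` (A \<inter> ({a..} \<times> D r))) z * vol_dens i z"
 show "sets vol = sets (restrict_space borel (carr M))" by (simp add: sets_vol)
 fix i A assume "i \<in> idx M" and A: "A \<in> sets vol" and Ai: "A \<subseteq> cdom M i"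
 hence i: "i \<in> idx N" by simp
 have Ab: "A \<in> sets borel"
  using A borel_carr_M by (simp add: sets_vol sets_restrict_space_iff)
 have pieces: "chart M i ` (A \<inter> ({a..} \<times> D r)) \<in> sets borel" "chart M i ` (A \<inter> ({a..} \<times> D r)) \<subseteq> {a..} \<times> chart_im i"
  if "r < m" for r
  using borel_chart_image[OF i] Ab borel_DM[OF that] Ai by auto
 have "emeasure vol A = (\<integral>\<^sup>+z. indicator A z \<partial>vol)" using A by simp
 also have "... = (\<Sum>r<m. \<integral>\<^sup>+z. ennreal (weight r z) * indicator A (param r z) \<partial>lborel)"
  by (rule nn_integral_vol0) (use A in "simp add: sets_vol")
 also have "... = (\<Sum>r<m. \<integral>\<^sup>+z. ennreal (?I i A r z) \<partial>lborel)"
  by (intro sum.cong refl emeasure_piece) (use i Ab Ai in auto)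
 also have "... = (\<integral>\<^sup>+z. (\<Sum>r<m. ennreal (?I i A r z)) \<partial>lborel)"
  by (rule nn_integral_sum[symmetric]) (use borel_vol_dens[OF i pieces] in auto)
 also have "... = (\<integral>\<^sup>+y\<in>chart M i ` A. ennreal (sqrt (gram_det (gmetric M i (chart_inv M i y)))) \<partial>lborel)"
 proof (rule nn_integral_cong)
  fix z :: "real \<times> 'e"
  show "(\<Sum>r<m. ennreal (?I i A r z)) =
    ennreal (sqrt (gram_det (gmetric M i (chart_inv M i z)))) * indicator (chart M i ` A) z"
  proof (cases "z \<in> chart M i ` A")
   case True
   hence z: "z \<in> {a..} \<times> chart_im i" using Ai by auto
   have "(\<Sum>r<m. ennreal (?I i A r z)) =
     ennreal (\<Sum>r<m. ?I i A r z)"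
    using vol_dens_pos[OF i z] by (intro sum_ennreal) auto
   also have "... = ennreal (indicator (chart M i ` A) z * vol_dens i z)"
    by (simp only: indicator_sum_pieces[OF i Ai] sum_distrib_right)
   finally have 1: "(\<Sum>r<m. ennreal (?I i A r z)) =
     ennreal (indicator (chart M i ` A) z * vol_dens i z)" .
   have 2: "sqrt (gram_det (gmetric M i (chart_inv M i z))) = vol_dens i z"
    using chart_inv_M[OF i, of "fst z" "snd z"] sqrt_gram_M[OF i, of "inv_chart i (snd z)" "fst z"] z i
    by (auto simp del: M_simps)
   show ?thesis unfolding 1 2 using True by simp
  next
   case False
   hence "z \<notin> chart M i ` (A \<inter> ({a..} \<times> D r))" for r by blast
   thus ?thesis using False by (simp add: indicator_def)
  qed
 qed
 finally show "emeasure vol A = (\<integral>\<^sup>+y\<in>chart M i ` A. ennreal (sqrt (gram_det (gmetric M i (chart_inv M i y)))) \<partial>lborel)" .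
qed

text \<open>Every measurable set is a finite disjoint union of its parts in the pieces, each part
  lies in a single chart, and there the measure is prescribed.\<close>

lemma vol_spec_unique:
 assumes "vol_spec \<mu>" "vol_spec \<nu>"
 shows "\<mu> = \<nu>"
proof (rule measure_eqI)
 show "sets \<mu> = sets \<nu>" using assms by (simp add: vol_spec_def)
 fix A assume A: "A \<in> sets \<mu>"
 have sm: "sets \<mu> = sets (restrict_space borel ({a..} \<times> carr N))" "sets \<nu> = sets (restrict_space borel ({a..} \<times> carr N))"
  using assms by (simp_all add: vol_spec_def)
 have Asub: "A \<subseteq> {a..} \<times> carr N" using A unfolding sm by (auto simp: sets_restrict_space)
 have DA: "A \<inter> ({a..} \<times> D r) \<in> sets (restrict_space borel ({a..} \<times> carr N))" if "r < m" for r
  using A borel_DM[OF that] D_carr[OF that] borel_carr_M unfolding sm by (auto simp: sets_restrict_space_iff)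
 have dec: "A = (\<Union>r<m. A \<inter> ({a..} \<times> D r))" using Asub D_cover by auto
 have add: "emeasure \<kappa> A = (\<Sum>r<m. emeasure \<kappa> (A \<inter> ({a..} \<times> D r)))"
  if "sets \<kappa> = sets (restrict_space borel ({a..} \<times> carr N))" for \<kappa>
 proof -
  have "(\<Sum>r<m. emeasure \<kappa> (A \<inter> ({a..} \<times> D r))) = emeasure \<kappa> (\<Union>r<m. A \<inter> ({a..} \<times> D r))"
  proof (rule sum_emeasure)
   show "disjoint_family_on (\<lambda>r. A \<inter> ({a..} \<times> D r)) {..<m}"
    unfolding disjoint_family_on_def using D_disj by blast
  qed (use that DA in auto)
  thus ?thesis using dec by simp
 qed
 have "emeasure \<mu> (A \<inter> ({a..} \<times> D r)) = emeasure \<nu> (A \<inter> ({a..} \<times> D r))" if r: "r < m" for r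
 proof -
  have i: "\<iota> r \<in> idx M" using iota[OF r] by simp
  have sub: "A \<inter> ({a..} \<times> D r) \<subseteq> cdom M (\<iota> r)" using D_cdom[OF r] by auto
  have B: "A \<inter> ({a..} \<times> D r) \<in> sets \<mu>" "A \<inter> ({a..} \<times> D r) \<in> sets \<nu>" using DA[OF r] sm by auto
  show ?thesis
   using assms(1)[unfolded vol_spec_def, THEN conjunct2, rule_format, OF i B(1) sub]
    assms(2)[unfolded vol_spec_def, THEN conjunct2, rule_format, OF i B(2) sub] by (simp only:)
 qed
 thus "emeasure \<mu> A = emeasure \<nu> A" using add[OF sm(1)] add[OF sm(2)] by simp
qed

lemma riem_vol_eq: "riem_vol M = vol"
proof -
 have "riem_vol M = (THE \<mu>. vol_spec \<mu>)" unfolding riem_vol_def vol_spec_def ..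
 also have "... = vol" using vol_spec_vol vol_spec_unique by blast
 finally show ?thesis .
qed

text \<open>A function on the cylinder is described by its expressions \<open>\<Gamma> r\<close> in the coordinates of the pieces.\<close>

lemma measurable_pieces:
 assumes \<Gamma>: "\<And>r. r < m ==> (\<lambda>z. indicator (Z r) z * \<Gamma> r z) \<in> borel_measurable borel"
  and G: "\<And>r z. r < m ==> z \<in> Z r ==> G (ipr r z) = (\<Gamma> r z :: 'c::{topological_space, mult_zero, comm_semiring_1})"
 shows "G \<in> borel_measurable (restrict_space borel ({a..} \<times> carr N))"
proof (rule measurable_piecewise_restrict[where C = "(\<lambda>r. {a..} \<times> D r) ` {..<m}"])
 show "countable ((\<lambda>r. {a..} \<times> D r) ` {..<m})" by simp
 show "space (restrict_space borel ({a..} \<times> carr N)) \<subseteq> \<Union> ((\<lambda>r. {a..} \<times> D r) ` {..<m})"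
  using D_cover by (auto simp: space_restrict_space)
 fix \<Omega> assume "\<Omega> \<in> (\<lambda>r. {a..} \<times> D r) ` {..<m}"
 then obtain r where r: "r < m" and \<Omega>: "\<Omega> = {a..} \<times> D r" by auto
 have sub: "{a..} \<times> D r \<subseteq> {a..} \<times> carr N" using D_carr[OF r] by auto
 show "\<Omega> \<inter> space (restrict_space borel ({a..} \<times> carr N)) \<in> sets (restrict_space borel ({a..} \<times> carr N))"
  using borel_DM[OF r] sub borel_carr_M by (auto simp: \<Omega> sets_restrict_space_iff space_restrict_space Int_absorb2)
 have "restrict_space (restrict_space borel ({a..} \<times> carr N)) \<Omega> = restrict_space borel ({a..} \<times> D r)"
  using sub borel_carr_M borel_DM[OF r] by (simp add: restrict_restrict_space \<Omega> Int_absorb1)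
 moreover have "G \<in> borel_measurable (restrict_space borel ({a..} \<times> D r))"
 proof -
  have "chart M (\<iota> r) \<in> borel_measurable (restrict_space borel ({a..} \<times> D r))"
  proof (rule borel_measurable_continuous_on_restrict)
   show "continuous_on ({a..} \<times> D r) (chart M (\<iota> r))"
    unfolding M_simps(5)[abs_def]
    by (intro continuous_intros continuous_on_compose2[OF continuous_chart[OF iota[OF r]]])
      (use D_cdom[OF r] in auto)
  qed
  from measurable_compose[OF this \<Gamma>[OF r]]
  have "(\<lambda>x. indicator (Z r) (chart M (\<iota> r) x) * \<Gamma> r (chart M (\<iota> r) x)) \<in> borel_measurable (restrict_space borel ({a..} \<times> D r))" .
  thus ?thesis
  proof (rule measurable_cong[THEN iffD1, rotated])
   fix x assume "x \<in> space (restrict_space borel ({a..} \<times> D r))"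
   hence x: "x \<in> {a..} \<times> D r" by (simp add: space_restrict_space)
   hence xc: "chart M (\<iota> r) x \<in> Z r" unfolding Z_image[OF r] by (rule imageI)
   have "ipr r (chart M (\<iota> r) x) = x"
    using x D_cdom[OF r] iota[OF r] by (auto simp: inv_pair_def)
   thus "indicator (Z r) (chart M (\<iota> r) x) * \<Gamma> r (chart M (\<iota> r) x) = G x"
    using G[OF r xc] xc by simp
  qed
 qed
 ultimately show "G \<in> borel_measurable (restrict_space (restrict_space borel ({a..} \<times> carr N)) \<Omega>)" by simp
qed

lemma nn_integral_pieces:
 assumes \<Gamma>: "\<And>r. r < m ==> (\<lambda>z. indicator (Z r) z * \<Gamma> r z) \<in> borel_measurable borel"
  and G: "\<And>r z. r < m ==> z \<in> Z r ==> G (ipr r z) = (\<Gamma> r z :: ennreal)"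
 shows "(\<integral>\<^sup>+z. G z \<partial>riem_vol M) = (\<Sum>r<m. \<integral>\<^sup>+z. ennreal (weight r z) * \<Gamma> r z \<partial>lborel)"
 unfolding riem_vol_eq nn_integral_vol0[OF measurable_pieces[OF assms, simplified]]
 by (intro sum.cong refl nn_integral_cong) (use G in "auto simp: weight_def param_def indicator_def")

lemma integral_pieces:
 fixes \<Gamma> :: "nat => real \<times> 'e => real"
 assumes \<Gamma>: "\<And>r. r < m ==> (\<lambda>z. indicator (Z r) z * \<Gamma> r z) \<in> borel_measurable borel"
  and G: "\<And>r z. r < m ==> z \<in> Z r ==> G (ipr r z) = \<Gamma> r z"
  and int: "\<And>r. r < m ==> integrable lborel (\<lambda>z. weight r z * \<Gamma> r z)"
 shows "(\<integral>z. G z \<partial>riem_vol M) = (\<Sum>r<m. \<integral>z. weight r z * \<Gamma> r z \<partial>lborel)"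
proof -
 have eq: "weight r z * G (param r z) = weight r z * \<Gamma> r z" if "r < m" for r z
  using G[OF that] by (auto simp: weight_def param_def indicator_def)
 have "integrable lborel (\<lambda>z. weight r z * G (param r z))" if "r < m" for r
  unfolding eq[OF that] by (rule int[OF that])
 moreover have "G \<in> borel_measurable (restrict_space borel ({a..} \<times> carr N))"
  by (rule measurable_pieces[where \<Gamma> = \<Gamma>]) (use \<Gamma> G in auto)
 ultimately have "(\<integral>z. G z \<partial>vol) = (\<Sum>r<m. \<integral>z. weight r z * G (param r z) \<partial>lborel)"
  using integral_vol0 by blast
 thus ?thesis by (simp add: riem_vol_eq eq)
qed

definition top_coeff :: "('i, 'a, 'e) cform => nat => real \<times> 'e => real" where
 "top_coeff \<eta> r z = indicator (Z r) z * \<eta> (\<iota> r) (ipr r z) basis_enum"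

text \<open>The density of the volume cancels against the division by it in
  \<open>form_integral\<close>, so the integral is a plain Lebesgue integral of coefficients.
  Passing from the chart chosen by \<open>chart_at\<close> to \<open>\<iota> r\<close> multiplies
  the coefficient and the density by the same determinant.\<close>

lemma form_integral_pieces:
 assumes \<eta>: "is_form M (Suc DIM('e)) \<eta>"
  and int: "\<And>r. r < m ==> integrable lborel (top_coeff \<eta> r)"
 shows "form_integral M \<eta> = (\<Sum>r<m. \<integral>z. top_coeff \<eta> r z \<partial>lborel)"
proof -
 let ?\<Gamma> = "\<lambda>r z. top_coeff \<eta> r z / weight r z"
 have [measurable]: "top_coeff \<eta> r \<in> borel_measurable borel" if "r < m" for r
  using int[OF that] by simp
 have wt: "weight r z * ?\<Gamma> r z = top_coeff \<eta> r z" if r: "r < m" for r z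
  using vol_dens_pos[OF iota[OF r], of z] Z_sub[OF r] by (auto simp: weight_def top_coeff_def indicator_def)
 have "form_integral M \<eta> = (\<Sum>r<m. \<integral>z. weight r z * ?\<Gamma> r z \<partial>lborel)"
  unfolding form_integral_def
 proof (rule integral_pieces)
  show "(\<lambda>z. indicator (Z r) z * (top_coeff \<eta> r z / weight r z)) \<in> borel_measurable borel" if "r < m" for r
   using that by measurable
  show "integrable lborel (\<lambda>z. weight r z * ?\<Gamma> r z)" if "r < m" for r
   using int[OF that] wt[OF that] by simp
  fix r z assume r: "r < m" and z: "z \<in> Z r"
  obtain t y where ty: "z = (t, y)" by (cases z)
  define x where "x = inv_chart (\<iota> r) y"
  have zx: "a \<le> t" "y \<in> chart_im (\<iota> r)" "x \<in> D r"
   using z Z_iff[OF r, of z] by (auto simp: ty x_def inv_pair_def)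
  have ipx: "ipr r z = (t, x)" by (simp add: ty x_def inv_pair_def)
  have x: "x \<in> carr N" "x \<in> cdom N (\<iota> r)" using zx D_carr[OF r] D_cdom[OF r] by auto
  define i where "i = chart_at N x"
  have i: "i \<in> idx N" "x \<in> cdom N i" unfolding i_def using chart_at_in[OF x(1)] by auto
  note ir = iota[OF r]
  have y: "y = chart N (\<iota> r) x" using zx ir by (simp add: x_def)
  have "\<eta> i (t, x) basis_enum = \<eta> (\<iota> r) (t, x) (\<lambda>l. TM i (\<iota> r) x (basis_enum l))"
   by (rule is_formD(3)[OF \<eta> i(1) ir i(2) x(2) zx(1)])
  also have "... = lin_det (TM i (\<iota> r) x) * \<eta> (\<iota> r) (t, x) basis_enum"
   by (rule alternating_top_lin_det[OF is_formD(1)[OF \<eta> ir x(2) zx(1)]])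
     (use basis_enum_bij[where 'e = "real \<times> 'e"] in simp)
  finally have "\<eta> i (t, x) basis_enum / sqrt (gram_det (gmetric M i (t, x))) =
    \<eta> (\<iota> r) (t, x) basis_enum / vol_dens (\<iota> r) (t, chart N (\<iota> r) x)"
   unfolding sqrt_gram_M[OF i zx(1)] vol_dens_transform[OF i(1) ir i(2) x(2) zx(1)]
   using lin_det_TM[OF i(1) ir i(2) x(2)] by simp
  thus "\<eta> (chart_at M (ipr r z)) (ipr r z) basis_enum / sqrt (gram_det (gmetric M (chart_at M (ipr r z)) (ipr r z))) = ?\<Gamma> r z"
   unfolding ipx chart_at_M[OF zx(1)] i_def[symmetric] top_coeff_def weight_def y[symmetric] ty[symmetric]
   using z by simp
 qed
 thus ?thesis using wt by simp
qed

end

section \<open>Norms of forms in coordinates\<close>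

lemma alternating_scale_args:
 assumes A: "alternating k \<alpha>"
 shows "\<alpha> (\<lambda>j. c j *\<^sub>R v j) = (\<Prod>j<k. c j) * \<alpha> v"
proof -
 have "n \<le> k ==> \<alpha> (\<lambda>j. if j < n then c j *\<^sub>R v j else v j) = (\<Prod>j<n. c j) * \<alpha> v" for n
 proof (induction n)
  case 0
  thus ?case by simp
 next
  case (Suc n)
  let ?w = "\<lambda>j. if j < n then c j *\<^sub>R v j else v j"
  have lin: "linear (\<lambda>x. \<alpha> (?w(n := x)))" using alternating_linear[OF A] Suc.prems by simp
  have "(\<lambda>j. if j < Suc n then c j *\<^sub>R v j else v j) = ?w(n := c n *\<^sub>R v n)"
   by (auto simp: fun_eq_iff less_Suc_eq)
  hence "\<alpha> (\<lambda>j. if j < Suc n then c j *\<^sub>R v j else v j) = c n * \<alpha> (?w(n := v n))"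
   using linear_scale[OF lin, of "c n" "v n"] by simp
  also have "?w(n := v n) = ?w" by (auto simp: fun_eq_iff)
  finally show ?case using Suc by simp
 qed
 from this[of k] have "(\<Prod>j<k. c j) * \<alpha> v = \<alpha> (\<lambda>j. if j < k then c j *\<^sub>R v j else v j)" by simp
 also have "... = \<alpha> (\<lambda>j. c j *\<^sub>R v j)" by (rule alternating_cong[OF A]) auto
 finally show ?thesis by simp
qed

lemma powr_sum_le:
 fixes x :: "'b => real"
 assumes "finite I" "\<And>i. i \<in> I ==> 0 \<le> x i" "0 < p"
 shows "(\<Sum>i\<in>I. x i) powr p \<le> real (card I) powr p * (\<Sum>i\<in>I. x i powr p)"
proof (cases "I = {}")
 case False
 define y where "y = Max (x ` I)"
 have "y \<in> x ` I" unfolding y_def using assms False by (intro Max_in) auto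
 then obtain i0 where i0: "i0 \<in> I" "x i0 = y" by auto
 have "x i \<le> y" if "i \<in> I" for i unfolding y_def using assms that by simp
 hence "(\<Sum>i\<in>I. x i) \<le> real (card I) * y" using sum_bounded_above[of I x y] by simp
 hence "(\<Sum>i\<in>I. x i) powr p \<le> (real (card I) * y) powr p"
  using assms by (intro powr_mono2 sum_nonneg) auto
 also have "... = real (card I) powr p * y powr p"
  using i0 assms by (intro powr_mult)
 also have "y powr p \<le> (\<Sum>i\<in>I. x i powr p)"
  using member_le_sum[of i0 I "\<lambda>i. x i powr p"] i0 assms by simp
 finally show ?thesis by (simp add: mult_left_mono)
qed simp

text \<open>One term of Parseval's identity is at most the whole sum.\<close>

lemma orthonormal_coeff_bound:
 assumes g: "inner_product g" and B: "orthonormal_basis g B" and b: "b \<in> B"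
 shows "\<bar>g u b\<bar> \<le> sqrt (g u u)"
proof -
 note lin = inner_product_linear[OF g]
 have "g u u = (\<Sum>b\<in>B. g u b * g u b)"
  by (subst (2) orthonormal_basis_expand[OF g B, of u]) (simp add: linear_sum[OF lin(1)] linear_scale[OF lin(1)])
 moreover have "g u b * g u b \<le> (\<Sum>b\<in>B. g u b * g u b)"
  by (rule member_le_sum) (use B b in "auto simp: orthonormal_basis_def")
 ultimately have "(g u b)\<^sup>2 \<le> g u u" by (simp add: power2_eq_square)
 hence "sqrt ((g u b)\<^sup>2) \<le> sqrt (g u u)" by (rule real_sqrt_le_mono)
 thus ?thesis by simp
qed

text \<open>With \<open>c\<close> the value of \<open>h\<close>, this normalizes the spatial
  vectors: their length for the cylinder metric becomes their length for the metric of
  \<open>N\<close>, which is bounded on compact pieces.\<close>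

definition spatial_scale :: "real => real \<times> 'e::euclidean_space => real \<times> 'e" where
 "spatial_scale c w = (fst w, (1 / c) *\<^sub>R snd w)"

lemma linear_spatial_scale: "linear (spatial_scale c)"
 unfolding spatial_scale_def by (rule linearI) (auto simp: algebra_simps)

definition tuples :: "nat => (nat => 'v::euclidean_space) set" where
 "tuples k = {..<k} \<rightarrow>\<^sub>E Basis"

lemma finite_tuples [simp]: "finite (tuples k)"
 unfolding tuples_def by (simp add: finite_PiE)

text \<open>The number of arguments without d/dt, which is the exponent of \<open>1 / h\<close>
  produced by \<open>spatial_scale\<close>.\<close>

definition spatial_count :: "nat => (nat => real \<times> 'e) => nat" where
 "spatial_count k v = card {j. j < k \<and> fst (v j) = 0}"

lemma spatial_count_le: "spatial_count k v \<le> k"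
proof -
 have "spatial_count k v \<le> card {..<k}" unfolding spatial_count_def by (intro card_mono) auto
 thus ?thesis by simp
qed

lemma alternating_spatial_scale:
 fixes v :: "nat => real \<times> 'e::euclidean_space"
 assumes A: "alternating k \<alpha>" and v: "v \<in> tuples k"
 shows "\<alpha> (\<lambda>j. spatial_scale c (v j)) = (1 / c) ^ spatial_count k v * \<alpha> v"
proof -
 let ?c = "\<lambda>j. if fst (v j) = 0 then 1 / c else 1"
 have "\<alpha> (\<lambda>j. spatial_scale c (v j)) = \<alpha> (\<lambda>j. ?c j *\<^sub>R v j)"
 proof (rule alternating_cong[OF A])
  fix j assume "j < k"
  hence "v j \<in> Basis" using v by (auto simp: tuples_def)
  thus "spatial_scale c (v j) = ?c j *\<^sub>R v j"
   by (auto simp: spatial_scale_def Basis_prod_def)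
 qed
 also have "... = (\<Prod>j<k. ?c j) * \<alpha> v" by (rule alternating_scale_args[OF A])
 also have "(\<Prod>j<k. ?c j) = (\<Prod>j | j < k \<and> fst (v j) = 0. 1 / c)"
  by (rule prod.mono_neutral_cong_right) auto
 finally show ?thesis by (simp add: spatial_count_def)
qed

context cyl_cover
begin

lemma ipr_Z:
 assumes r: "r < m" and z: "z \<in> Z r"
 shows "fst (ipr r z) = fst z" "a \<le> fst z" "snd (ipr r z) \<in> D r" "snd (ipr r z) \<in> K r"
  "snd (ipr r z) \<in> cdom N (\<iota> r)" "snd (ipr r z) \<in> carr N"
  "chart N (\<iota> r) (snd (ipr r z)) = snd z" "ipr r z = (fst z, snd (ipr r z))" "snd z \<in> KY r" "snd z \<in> Y r"
proof -
 have "z \<in> {a..} \<times> chart_im (\<iota> r)" "ipr r z \<in> {a..} \<times> D r" using z Z_iff[OF r] by auto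
 thus "fst (ipr r z) = fst z" "a \<le> fst z" "snd (ipr r z) \<in> D r" "snd (ipr r z) \<in> K r"
  "snd (ipr r z) \<in> cdom N (\<iota> r)" "snd (ipr r z) \<in> carr N"
  "chart N (\<iota> r) (snd (ipr r z)) = snd z" "ipr r z = (fst z, snd (ipr r z))"
  using D_K[OF r] D_cdom[OF r] D_carr[OF r] iota[OF r] by (auto simp: inv_pair_def)
 show "snd z \<in> KY r" "snd z \<in> Y r" using z Y_KY[OF r] by (auto simp: Z_def)
qed

text \<open>The quadratic form is continuous and positive on the compact product of the piece with
  the unit sphere, so it is bounded from above and away from zero; homogeneity extends the bounds to
  all vectors.\<close>

lemma metric_bounds:
 assumes r: "r < m"
 obtains C where "C \<ge> 1" "\<And>x u. x \<in> K r ==> norm u \<le> C * sqrt (gmetric N (\<iota> r) x u u)"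
  "\<And>x u. x \<in> K r ==> sqrt (gmetric N (\<iota> r) x u u) \<le> C * norm u"
proof -
 let ?g = "\<lambda>y. gmetric N (\<iota> r) (inv_chart (\<iota> r) y)"
 note i = iota[OF r]
 have lin: "linear (?g y u)" "linear (\<lambda>u. ?g y u v)" "u \<noteq> 0 ==> 0 < ?g y u u" if "y \<in> KY r" for y u v
 proof -
  have "y \<in> chart_im (\<iota> r)" using that KY_chart_im[OF r] by blast
  hence "inner_product (?g y)" using gN_inner[OF i] inv_chart_in[OF i] by blast
  note l = inner_product_linear[OF this]
  show "linear (?g y u)" "linear (\<lambda>u. ?g y u v)" "u \<noteq> 0 ==> 0 < ?g y u u"
   by (rule l(1), rule l(2), rule l(4))
 qed
 let ?q = "\<lambda>p. ?g (fst p) (snd p) (snd p)"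
 have q_eq: "?q p = (\<Sum>b\<in>Basis. \<Sum>c\<in>Basis. (snd p \<bullet> b) * (snd p \<bullet> c) * ?g (fst p) b c)"
  if "fst p \<in> KY r" for p
 proof -
  note l = lin[OF that]
  have "?q p = (\<Sum>b\<in>Basis. (snd p \<bullet> b) * ?g (fst p) b (snd p))"
   by (subst (2) euclidean_representation[symmetric]) (simp add: linear_sum[OF l(2)] linear_scale[OF l(2)])
  moreover have "?g (fst p) b (snd p) = (\<Sum>c\<in>Basis. (snd p \<bullet> c) * ?g (fst p) b c)" for b
   by (subst euclidean_representation[symmetric]) (simp add: linear_sum[OF l(1)] linear_scale[OF l(1)])
  ultimately show ?thesis by (simp add: sum_distrib_left mult.assoc)
 qed
 let ?X = "KY r \<times> sphere (0::'e) 1"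
 have cX: "compact ?X" by (intro compact_Times compact_KY r) simp
 have contg: "continuous_on ?X (\<lambda>p. ?g (fst p) b c)" for b c
  by (rule continuous_on_compose2[OF continuous_gN[OF i]]) (use KY_chart_im[OF r] in "auto intro!: continuous_intros")
 have contq: "continuous_on ?X ?q"
  by (rule continuous_on_eq[of _ "\<lambda>p. \<Sum>b\<in>Basis. \<Sum>c\<in>Basis. (snd p \<bullet> b) * (snd p \<bullet> c) * ?g (fst p) b c"])
    (use q_eq in "auto intro!: continuous_intros contg")
 have qpos: "0 < ?q p" if "p \<in> ?X" for p
 proof -
  have "norm (snd p) = 1" "fst p \<in> KY r" using that by (auto simp: mem_Times_iff)
  thus ?thesis using lin(3)[of "fst p" "snd p"] by force
 qed
 have contq': "continuous_on ?X (\<lambda>p. 1 / ?q p)"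
  by (intro continuous_on_divide continuous_on_const contq) (use qpos in fastforce)
 obtain B1 where "\<forall>w\<in>?q ` ?X. \<bar>w\<bar> \<le> B1"
  using compact_imp_bounded[OF compact_continuous_image[OF contq cX]] unfolding bounded_real by (rule exE)
 hence B1: "\<And>p. p \<in> ?X ==> \<bar>?q p\<bar> \<le> B1" by (auto simp: mem_Times_iff)
 obtain B2 where "\<forall>w\<in>(\<lambda>p. 1 / ?q p) ` ?X. \<bar>w\<bar> \<le> B2"
  using compact_imp_bounded[OF compact_continuous_image[OF contq' cX]] unfolding bounded_real by (rule exE)
 hence B2: "\<And>p. p \<in> ?X ==> \<bar>1 / ?q p\<bar> \<le> B2" by (auto simp: mem_Times_iff)
 define C where "C = max 1 (max B1 B2)"
 have C: "C \<ge> 1" "C \<ge> B1" "C \<ge> B2" by (auto simp: C_def)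
 \<comment> \<open>The compactness bounds concern the quadratic form, the claim its square root; as
   \<open>C\<close> is at least \<open>1\<close>, its square dominates them.\<close>
 have CC: "C \<le> C\<^sup>2" using C by (simp add: power2_eq_square)
 have both: "norm u \<le> C * sqrt (gmetric N (\<iota> r) x u u) \<and> sqrt (gmetric N (\<iota> r) x u u) \<le> C * norm u"
  if x: "x \<in> K r" for x u
 proof (cases "u = 0")
  case True
  thus ?thesis using linear_0[OF inner_product_linear(1)[OF gN_inner[OF i]]] x K_cdom[OF r] by auto
 next
  case False
  define y where "y = chart N (\<iota> r) x"
  have y: "y \<in> KY r" "inv_chart (\<iota> r) y = x" using x K_cdom[OF r] i by (auto simp: y_def KY_def)
  define v where "v = (1 / norm u) *\<^sub>R u"
  have v: "(y, v) \<in> ?X" "u = norm u *\<^sub>R v" using y False by (auto simp: v_def)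
  have gu: "gmetric N (\<iota> r) x u u = (norm u)\<^sup>2 * ?q (y, v)"
  proof -
   have "gmetric N (\<iota> r) x u u = ?g y (norm u *\<^sub>R v) (norm u *\<^sub>R v)" using y(2) v(2) by simp
   also have "... = norm u * (norm u * ?g y v v)"
    by (simp only: linear_scale[OF lin(1)[OF y(1)]] linear_scale[OF lin(2)[OF y(1)]] real_scaleR_def)
   finally show ?thesis by (simp add: power2_eq_square)
  qed
  have q: "0 < ?q (y, v)" "?q (y, v) \<le> C\<^sup>2" "1 \<le> C\<^sup>2 * ?q (y, v)"
  proof -
   show q0: "0 < ?q (y, v)" by (rule qpos[OF v(1)])
   show "?q (y, v) \<le> C\<^sup>2" using B1[OF v(1)] C CC by linarith
   have "1 / ?q (y, v) \<le> C\<^sup>2" using B2[OF v(1)] C CC by linarith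
   thus "1 \<le> C\<^sup>2 * ?q (y, v)" using q0 by (simp add: divide_le_eq)
  qed
  have "norm u = sqrt ((norm u)\<^sup>2)" by simp
  also have "... \<le> sqrt (C\<^sup>2 * gmetric N (\<iota> r) x u u)"
   unfolding gu using mult_left_mono[OF q(3), of "(norm u)\<^sup>2"] by (intro real_sqrt_le_mono) (simp add: mult_ac)
  also have "... = C * sqrt (gmetric N (\<iota> r) x u u)" using C by (simp add: real_sqrt_mult)
  finally have 1: "norm u \<le> C * sqrt (gmetric N (\<iota> r) x u u)" .
  have "sqrt (gmetric N (\<iota> r) x u u) \<le> sqrt (C\<^sup>2 * (norm u)\<^sup>2)"
   unfolding gu using mult_left_mono[OF q(2), of "(norm u)\<^sup>2"] by (intro real_sqrt_le_mono) (simp add: mult_ac)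
  also have "... = C * norm u" using C by (simp add: real_sqrt_mult)
  finally show ?thesis using 1 by blast
 qed
 show thesis by (rule that[of C]) (use C both in auto)
qed

definition coeff :: "('i, 'a, 'e) cform => nat => (nat => real \<times> 'e) => real \<times> 'e => real" where
 "coeff \<xi> r v z = \<xi> (\<iota> r) (ipr r z) v"

text \<open>Coefficients in the \<open>h\<close>-normalized coordinate frame. They are comparable to
  the pointwise norm with constants independent of \<open>t\<close> and \<open>h\<close>, unlike the
  plain \<open>coeff\<close>.\<close>

definition scoeff :: "('i, 'a, 'e) cform => nat => (nat => real \<times> 'e) => real \<times> 'e => real" where
 "scoeff \<xi> r v z = \<xi> (\<iota> r) (ipr r z) (\<lambda>j. spatial_scale (h (ipr r z)) (v j))"

lemma form_alternating: "is_form M k \<xi> ==> r < m ==> z \<in> Z r ==> alternating k (\<xi> (\<iota> r) (ipr r z))"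
 using is_formD(1)[of k \<xi> "\<iota> r" "snd (ipr r z)" "fst z"] ipr_Z[of r z] iota by metis

lemma h_ipr_pos: "r < m ==> z \<in> Z r ==> 0 < h (ipr r z)"
 using h_pos[of "fst z" "snd (ipr r z)"] ipr_Z[of r z] by metis

lemma scoeff_eq:
 assumes "is_form M k \<xi>" "r < m" "z \<in> Z r" "v \<in> tuples k"
 shows "scoeff \<xi> r v z = (1 / h (ipr r z)) ^ spatial_count k v * coeff \<xi> r v z"
 unfolding scoeff_def coeff_def
 by (rule alternating_spatial_scale[OF form_alternating[OF assms(1-3)] assms(4)])

text \<open>Two frames are compared: the orthonormal one chosen inside \<open>alt_norm\<close>,
  moved to the chart \<open>\<iota> r\<close>, and the \<open>h\<close>-normalized coordinate frame.
  The matrices between them are bounded in both directions by \<open>metric_bounds\<close>, and a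
  form of degree \<open>k\<close> changes by \<open>k\<close> such factors.\<close>

lemma norm_compare:
 assumes r: "r < m"
 obtains C where "C > 0" "\<And>\<xi> z. is_form M k \<xi> ==> z \<in> Z r ==>
   form_norm M k \<xi> (ipr r z) \<le> C * (\<Sum>v\<in>tuples k. \<bar>scoeff \<xi> r v z\<bar>)"
  "\<And>\<xi> z v. is_form M k \<xi> ==> z \<in> Z r ==> v \<in> tuples k ==>
   \<bar>scoeff \<xi> r v z\<bar> \<le> C * form_norm M k \<xi> (ipr r z)"
proof -
 let ?P = "\<lambda>B0. {..<k} \<rightarrow>\<^sub>E B0"
 let ?F = "\<lambda>\<xi> z. form_norm M k \<xi> (ipr r z)"
 obtain C where C: "C \<ge> 1" "\<And>x u. x \<in> K r ==> norm u \<le> C * sqrt (gmetric N (\<iota> r) x u u)"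
  "\<And>x u. x \<in> K r ==> sqrt (gmetric N (\<iota> r) x u u) \<le> C * norm u"
  using metric_bounds[OF r] by blast
 define \<kappa> where "\<kappa> = real (DIM(real \<times> 'e) ^ k)"
 \<comment> \<open>\<open>C ^ k\<close> bounds the change of frame, \<kappa> counts the tuples, and
   \<open>sqrt (fact k)\<close> is the normalization in \<open>alt_norm\<close>.\<close>
 define C' where "C' = C ^ k * \<kappa> * sqrt (fact k)"
 have k1: "\<kappa> \<ge> 1" "sqrt (fact k :: real) \<ge> 1" "C ^ k \<ge> 1" using C by (auto simp: \<kappa>_def one_le_power simp del: DIM_prod)
 have main: "?F \<xi> z \<le> C' * (\<Sum>v\<in>tuples k. \<bar>scoeff \<xi> r v z\<bar>) \<and>
   (\<forall>e\<in>tuples k. \<bar>scoeff \<xi> r e z\<bar> \<le> C' * ?F \<xi> z)"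
  if \<xi>: "is_form M k \<xi>" and z: "z \<in> Z r" for \<xi> z
 proof -
  define t x where "t = fst z" and "x = snd (ipr r z)"
  have P: "ipr r z = (t, x)" and t: "a \<le> t" and xK: "x \<in> K r" and xc: "x \<in> cdom N (\<iota> r)" and xN: "x \<in> carr N"
   using ipr_Z[OF r z] by (auto simp: t_def x_def)
  define hh where "hh = h (t, x)"
  have hh: "hh > 0" using h_pos[OF t xN] by (simp add: hh_def)
  define i0 where "i0 = chart_at N x"
  have i0: "i0 \<in> idx N" "x \<in> cdom N i0" using chart_at_in[OF xN] by (auto simp: i0_def)
  note ir = iota[OF r]
  define T where "T = TM i0 (\<iota> r) x"
  have linT: "linear T" unfolding T_def by (rule linear_TM[OF i0(1) ir i0(2) xc])
  define g0 gr where "g0 = gmetric M i0 (t, x)" and "gr = gmetric M (\<iota> r) (t, x)"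
  have g0: "inner_product g0" and gr: "inner_product gr"
   unfolding g0_def gr_def by (rule gM_inner[OF i0 t], rule gM_inner[OF ir xc t])
  have gT: "g0 u v = gr (T u) (T v)" for u v
   unfolding g0_def gr_def T_def by (rule gM_transform[OF i0(1) ir i0(2) xc])
  \<comment> \<open>This has to be the very basis chosen in \<open>alt_norm\<close>; a different
    orthonormal basis would require invariance of the norm.\<close>
  define B0 where "B0 = (SOME B. orthonormal_basis g0 B)"
  have B0: "orthonormal_basis g0 B0" unfolding B0_def by (rule someI_ex[OF orthonormal_basis_exists[OF g0]])
  have fB0: "finite B0" and cB0: "card B0 = DIM(real \<times> 'e)"
   and on: "\<And>u v. u \<in> B0 ==> v \<in> B0 ==> g0 u v = (if u = v then 1 else 0)"
   using B0 unfolding orthonormal_basis_def by auto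
  have injT: "inj_on T B0"
  proof (rule inj_onI, rule ccontr)
   fix u v assume uv: "u \<in> B0" "v \<in> B0" "T u = T v" "u \<noteq> v"
   hence "g0 u v = g0 u u" using gT by simp
   thus False using on uv by simp
  qed
  have TB: "orthonormal_basis gr (T ` B0)"
   unfolding orthonormal_basis_def
  proof (intro conjI ballI)
   show "card (T ` B0) = DIM(real \<times> 'e)" using card_image[OF injT] cB0 by simp
   fix u v assume "u \<in> T ` B0" "v \<in> T ` B0"
   then obtain u' v' where "u = T u'" "v = T v'" "u' \<in> B0" "v' \<in> B0" by auto
   moreover from this have "u = v \<longleftrightarrow> u' = v'" using inj_on_eq_iff[OF injT] by simp
   ultimately show "gr u v = (if u = v then 1 else 0)"
    using gT[of u' v'] on[of u' v'] by simp
  qed (use fB0 in simp)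
  let ?W = "\<lambda>v. \<xi> i0 (t, x) v"
  have W: "alternating k ?W" by (rule is_formD(1)[OF \<xi> i0 t])
  have WT: "?W v = \<xi> (\<iota> r) (t, x) (\<lambda>l. T (v l))" for v
   unfolding T_def by (rule is_formD(3)[OF \<xi> i0(1) ir i0(2) xc t])
  define \<alpha> where "\<alpha> w = \<xi> (\<iota> r) (t, x) (\<lambda>j. spatial_scale hh (w j))" for w
  have \<alpha>: "alternating k \<alpha>"
   unfolding \<alpha>_def by (rule alternating_compose_linear[OF is_formD(1)[OF \<xi> ir xc t] linear_spatial_scale])
  have sc: "scoeff \<xi> r e z = \<alpha> e" for e
   by (simp add: scoeff_def \<alpha>_def P hh_def)
  define Q where "Q = (\<Sum>v\<in>tuples k. \<bar>\<alpha> v\<bar>)"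
  \<comment> \<open>The factor \<open>h\<close> squared of the metric cancels against the scaling,
    so \<open>h\<close> disappears from all later bounds.\<close>
  have gS: "gr (spatial_scale hh w) (spatial_scale hh w) = (fst w)\<^sup>2 + gmetric N (\<iota> r) x (snd w) (snd w)" for w
  proof -
   note l = inner_product_linear[OF gN_inner[OF ir xc]]
   show ?thesis using hh
    by (simp add: gr_def spatial_scale_def hh_def[symmetric] linear_scale[OF l(1)] linear_scale[OF l(2)] power2_eq_square)
  qed
  have gpos: "0 \<le> gmetric N (\<iota> r) x u u" for u
  proof (cases "u = 0")
   case True
   thus ?thesis using linear_0[OF inner_product_linear(1)[OF gN_inner[OF ir xc]]] by simp
  qed (use inner_product_linear(4)[OF gN_inner[OF ir xc]] less_imp_le in blast)
  have lower: "norm w \<le> C * sqrt (gr (spatial_scale hh w) (spatial_scale hh w))" for w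
  proof -
   have "(norm (snd w))\<^sup>2 \<le> (C * sqrt (gmetric N (\<iota> r) x (snd w) (snd w)))\<^sup>2"
    using C(2)[OF xK] by (intro power_mono) auto
   hence "(norm (snd w))\<^sup>2 \<le> C\<^sup>2 * gmetric N (\<iota> r) x (snd w) (snd w)"
    using gpos by (simp add: power_mult_distrib)
   moreover have "(fst w)\<^sup>2 \<le> C\<^sup>2 * (fst w)\<^sup>2" using C(1) mult_right_mono[of 1 "C\<^sup>2" "(fst w)\<^sup>2"] by simp
   ultimately have "sqrt ((norm (fst w))\<^sup>2 + (norm (snd w))\<^sup>2) \<le> sqrt (C\<^sup>2 * gr (spatial_scale hh w) (spatial_scale hh w))"
    unfolding gS by (intro real_sqrt_le_mono) (simp add: distrib_left)
   thus ?thesis using C(1) by (simp add: norm_prod_def real_sqrt_mult)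
  qed
  have upper: "sqrt (gr (spatial_scale hh w) (spatial_scale hh w)) \<le> C * norm w" for w
  proof -
   have "(sqrt (gmetric N (\<iota> r) x (snd w) (snd w)))\<^sup>2 \<le> (C * norm (snd w))\<^sup>2"
    using C(3)[OF xK] gpos by (intro power_mono) auto
   hence "gmetric N (\<iota> r) x (snd w) (snd w) \<le> C\<^sup>2 * (norm (snd w))\<^sup>2"
    using gpos by (simp add: power_mult_distrib)
   moreover have "(fst w)\<^sup>2 \<le> C\<^sup>2 * (fst w)\<^sup>2" using C(1) mult_right_mono[of 1 "C\<^sup>2" "(fst w)\<^sup>2"] by simp
   ultimately have "sqrt (gr (spatial_scale hh w) (spatial_scale hh w)) \<le> sqrt (C\<^sup>2 * ((norm (fst w))\<^sup>2 + (norm (snd w))\<^sup>2))"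
    unfolding gS by (intro real_sqrt_le_mono) (simp add: distrib_left)
   thus ?thesis using C(1) by (simp add: norm_prod_def real_sqrt_mult)
  qed
  define R where "R = sqrt (\<Sum>v\<in>{..<k} \<rightarrow>\<^sub>E B0. (?W v)\<^sup>2)"
  have fn: "?F \<xi> z = R / sqrt (fact k)"
   by (simp add: form_norm_def alt_norm_def P chart_at_M[OF t] i0_def[symmetric] R_def B0_def g0_def real_sqrt_divide del: M_simps)
  have cardP: "real (card (?P B0)) = \<kappa>" by (simp add: card_PiE cB0 \<kappa>_def)
  have finP: "finite (?P B0)" using fB0 by (simp add: finite_PiE)
  have Wbound: "\<bar>?W v\<bar> \<le> C ^ k * Q" if v: "v \<in> {..<k} \<rightarrow>\<^sub>E B0" for v
  proof -
   \<comment> \<open>The preimage of \<open>T (v l)\<close> under the scaling. Its coordinates are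
     bounded by \<open>C\<close>, because \<open>T (v l)\<close> has length one.\<close>
   define w where "w l = (fst (T (v l)), hh *\<^sub>R snd (T (v l)))" for l
   have Sw: "spatial_scale hh (w l) = T (v l)" for l using hh by (simp add: spatial_scale_def w_def)
   have "?W v = \<alpha> w" unfolding WT \<alpha>_def Sw ..
   also have "\<bar>\<alpha> w\<bar> \<le> C ^ k * (\<Sum>v\<in>{..<k} \<rightarrow>\<^sub>E Basis. \<bar>\<alpha> v\<bar>)"
   proof (rule alternating_expand_bound[OF \<alpha> finite_Basis, where c = "\<lambda>j b. w j \<bullet> b"])
    show "w j = (\<Sum>b\<in>Basis. (w j \<bullet> b) *\<^sub>R b)" for j by (simp add: euclidean_representation)
    fix j b assume j: "j < k" and b: "b \<in> (Basis :: (real \<times> 'e) set)"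
    have "\<bar>w j \<bullet> b\<bar> \<le> norm (w j)" using b by (rule Basis_le_norm)
    also have "... \<le> C * sqrt (gr (T (v j)) (T (v j)))" using lower[of "w j"] by (simp add: Sw)
    also have "gr (T (v j)) (T (v j)) = 1"
    proof -
     have vj: "v j \<in> B0" using v j by auto
     show ?thesis using gT[of "v j" "v j"] on[OF vj vj] by simp
    qed
    finally show "\<bar>w j \<bullet> b\<bar> \<le> C" by simp
   qed
   finally show ?thesis by (simp add: Q_def tuples_def)
  qed
  have Q0: "Q \<ge> 0" unfolding Q_def by (simp add: sum_nonneg)
  have "R \<le> (\<Sum>v\<in>{..<k} \<rightarrow>\<^sub>E B0. \<bar>?W v\<bar>)"
   unfolding R_def using L2_set_le_sum_abs[of ?W "{..<k} \<rightarrow>\<^sub>E B0"] by (simp add: L2_set_def)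
  also have "... \<le> real (card (?P B0)) * (C ^ k * Q)"
   using sum_bounded_above[of "{..<k} \<rightarrow>\<^sub>E B0" "\<lambda>v. \<bar>?W v\<bar>" "C ^ k * Q"] Wbound by simp
  finally have RQ: "R \<le> C ^ k * \<kappa> * Q" by (simp add: cardP mult_ac)
  have R0: "R \<ge> 0" by (simp add: R_def sum_nonneg)
  have "?F \<xi> z \<le> R"
   unfolding fn using k1(2) R0 by (simp add: divide_le_eq mult_le_cancel_left1 mult.commute)
  also have "... \<le> C ^ k * \<kappa> * Q" by (rule RQ)
  also have "... \<le> C' * Q"
  proof (rule mult_right_mono[OF _ Q0])
   have "C ^ k * \<kappa> * 1 \<le> C ^ k * \<kappa> * sqrt (fact k)"
    by (rule mult_left_mono[OF k1(2)]) (use k1 in auto)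
   thus "C ^ k * \<kappa> \<le> C'" by (simp add: C'_def)
  qed
  finally have 1: "?F \<xi> z \<le> C' * Q" .
  have 2: "\<bar>\<alpha> e\<bar> \<le> C' * ?F \<xi> z" if e: "e \<in> tuples k" for e
  proof -
   \<comment> \<open>Conversely, the scaled coordinate vectors are expanded in the image of
     \<open>B0\<close> under \<open>T\<close>; being orthonormal, it gives coefficients bounded by
     the lengths of these vectors.\<close>
   define c where "c j b = gr (spatial_scale hh (e j)) (T b)" for j b
   define w where "w j = (\<Sum>b\<in>B0. c j b *\<^sub>R b)" for j
   have Tw: "T (w j) = spatial_scale hh (e j)" for j
   proof -
    have "spatial_scale hh (e j) = (\<Sum>b\<in>T ` B0. gr (spatial_scale hh (e j)) b *\<^sub>R b)"
     by (rule orthonormal_basis_expand[OF gr TB])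
    also have "... = (\<Sum>b\<in>B0. c j b *\<^sub>R T b)" by (simp add: sum.reindex[OF injT] c_def)
    also have "... = T (w j)" by (simp add: w_def linear_sum[OF linT] linear_scale[OF linT])
    finally show ?thesis by simp
   qed
   have "\<alpha> e = ?W w" unfolding WT \<alpha>_def Tw ..
   also have "\<bar>?W w\<bar> \<le> C ^ k * (\<Sum>v\<in>{..<k} \<rightarrow>\<^sub>E B0. \<bar>?W v\<bar>)"
   proof (rule alternating_expand_bound[OF W fB0, where c = c])
    show "w j = (\<Sum>b\<in>B0. c j b *\<^sub>R b)" for j by (simp add: w_def)
    fix j b assume j: "j < k" and b: "b \<in> B0"
    have "\<bar>c j b\<bar> \<le> sqrt (gr (spatial_scale hh (e j)) (spatial_scale hh (e j)))"
     unfolding c_def by (rule orthonormal_coeff_bound[OF gr TB]) (use b in simp)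
    also have "... \<le> C * norm (e j)" by (rule upper)
    also have "norm (e j) = 1"
    proof (rule norm_Basis)
     show "e j \<in> Basis" using e j unfolding tuples_def by blast
    qed
    finally show "\<bar>c j b\<bar> \<le> C" by simp
   qed
   also have "(\<Sum>v\<in>{..<k} \<rightarrow>\<^sub>E B0. \<bar>?W v\<bar>) \<le> real (card (?P B0)) * R"
   proof (rule sum_bounded_above)
    fix v assume v: "v \<in> {..<k} \<rightarrow>\<^sub>E B0"
    have "(?W v)\<^sup>2 \<le> (\<Sum>v\<in>{..<k} \<rightarrow>\<^sub>E B0. (?W v)\<^sup>2)"
     by (rule member_le_sum[OF v]) (use finP in auto)
    hence "sqrt ((?W v)\<^sup>2) \<le> R" unfolding R_def by (rule real_sqrt_le_mono)
    thus "\<bar>?W v\<bar> \<le> R" by simp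
   qed
   finally have "\<bar>\<alpha> e\<bar> \<le> C ^ k * (\<kappa> * R)" using C(1) by (simp add: cardP mult_left_mono)
   also have "R = sqrt (fact k) * ?F \<xi> z" by (simp add: fn)
   finally show ?thesis by (simp add: C'_def mult_ac)
  qed
  show ?thesis unfolding sc Q_def[symmetric] using 1 2 by blast
 qed
 have "C' > 0" unfolding C'_def using k1 by (intro mult_pos_pos) auto
 thus thesis by (rule that[of C']) (use main in blast)+
qed

subsection \<open>Measurability of coefficients\<close>

lemma measurable_ipr:
 assumes r: "r < m"
 shows "ipr r \<in> measurable (restrict_space borel (Z r)) (restrict_space borel (cdom M (\<iota> r)))"
proof (rule measurable_restrict_space2)
 show "ipr r \<in> space (restrict_space borel (Z r)) \<rightarrow> cdom M (\<iota> r)"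
  using ipr_Z[OF r] by (fastforce simp: space_restrict_space mem_Times_iff)
 show "ipr r \<in> borel_measurable (restrict_space borel (Z r))"
  by (rule borel_measurable_continuous_on_restrict)
    (rule continuous_on_subset[OF continuous_inv_pair], use r iota Z_sub in auto)
qed

lemma measurable_on_Z:
 fixes f :: "real \<times> 'e => real"
 assumes "r < m" "f \<in> borel_measurable (restrict_space borel (Z r))"
 shows "(\<lambda>z. indicator (Z r) z * f z) \<in> borel_measurable borel"
 using assms borel_Z[OF assms(1)] by (subst (asm) borel_measurable_restrict_space_iff) (auto simp: mult.commute)

lemma measurable_coeff:
 assumes "measurable_form M k \<xi>" and r: "r < m"
 shows "coeff \<xi> r v \<in> borel_measurable (restrict_space borel (Z r))"
proof -
 have "(\<lambda>x. \<xi> (\<iota> r) x v) \<in> borel_measurable (restrict_space borel (cdom M (\<iota> r)))"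
  using assms iota[OF r] unfolding measurable_form_def by simp
 from measurable_compose[OF measurable_ipr[OF r] this] show ?thesis by (simp add: coeff_def[abs_def])
qed

lemma continuous_h_ipr: "r < m ==> continuous_on ({a..} \<times> chart_im (\<iota> r)) (\<lambda>z. h (ipr r z))"
 unfolding inv_pair_def by (rule continuous_h[OF iota])

lemma measurable_h_ipr: "r < m ==> (\<lambda>z. h (ipr r z)) \<in> borel_measurable (restrict_space borel (Z r))"
 by (rule borel_measurable_continuous_on_restrict[OF continuous_on_subset[OF continuous_h_ipr Z_sub]])

lemma measurable_scoeff:
 assumes \<xi>: "measurable_form M k \<xi>" and r: "r < m" and v: "v \<in> tuples k"
 shows "scoeff \<xi> r v \<in> borel_measurable (restrict_space borel (Z r))"
proof -
 have form: "is_form M k \<xi>" using \<xi> by (simp add: measurable_form_def)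
 have "(\<lambda>z. (1 / h (ipr r z)) ^ spatial_count k v * coeff \<xi> r v z) \<in> borel_measurable (restrict_space borel (Z r))"
  using measurable_coeff[OF \<xi> r, of v] measurable_h_ipr[OF r] by measurable
 thus ?thesis
  by (rule measurable_cong[THEN iffD1, rotated])
    (use scoeff_eq[OF form r _ v] in "simp add: space_restrict_space")
qed

lemma weight_measurable_on_Z:
 fixes f :: "real \<times> 'e => real"
 assumes r: "r < m" and f: "f \<in> borel_measurable (restrict_space borel (Z r))"
 shows "(\<lambda>z. weight r z * f z) \<in> borel_measurable borel"
proof -
 have "(\<lambda>z. weight r z * (indicator (Z r) z * f z)) \<in> borel_measurable borel"
  using measurable_weight[OF r] measurable_on_Z[OF r f] by measurable
 moreover have "weight r z * (indicator (Z r) z * f z) = weight r z * f z" for z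
  by (auto simp: weight_def indicator_def)
 ultimately show ?thesis by simp
qed

text \<open>Continuity on a compact part of the half-space. The constant depends on the height
  \<open>b\<close>, so this serves for finiteness statements and not for the estimate that must be
  uniform in the height.\<close>

lemma compact_bounds:
 assumes r: "r < m"
 obtains B where "B \<ge> 1" "\<And>z. z \<in> Z r ==> fst z \<le> b ==> weight r z \<le> B \<and> 1 / B \<le> weight r z \<and>
   h (ipr r z) \<le> B \<and> 1 / B \<le> h (ipr r z)"
proof -
 let ?X = "{a..b} \<times> KY r"
 have cX: "compact ?X" by (intro compact_Times compact_KY r) simp
 have sub: "?X \<subseteq> {a..} \<times> chart_im (\<iota> r)" using KY_chart_im[OF r] by auto
 have bnd: "\<exists>B. \<forall>z\<in>?X. \<bar>f z\<bar> \<le> B" if "continuous_on ({a..} \<times> chart_im (\<iota> r)) f" for f :: "real \<times> 'e => real"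
  using compact_imp_bounded[OF compact_continuous_image[OF continuous_on_subset[OF that sub] cX]]
  unfolding bounded_real by auto
 have vp: "vol_dens (\<iota> r) z > 0" "h (ipr r z) > 0" if "z \<in> {a..} \<times> chart_im (\<iota> r)" for z
  using vol_dens_pos[OF iota[OF r] that] h_pos'[of "fst z" "\<iota> r" "snd (ipr r z)"] that iota[OF r]
  by (auto simp: inv_pair_def)
 obtain B1 where B1: "\<forall>z\<in>?X. \<bar>vol_dens (\<iota> r) z\<bar> \<le> B1" using bnd[OF continuous_vol_dens[OF iota[OF r]]] by blast
 obtain B2 where B2: "\<forall>z\<in>?X. \<bar>h (ipr r z)\<bar> \<le> B2" using bnd[OF continuous_h_ipr[OF r]] by blast
 have "continuous_on ({a..} \<times> chart_im (\<iota> r)) (\<lambda>z. 1 / vol_dens (\<iota> r) z)"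
  by (intro continuous_on_divide continuous_on_const continuous_vol_dens iota r) (use vp in fastforce)
 from bnd[OF this] obtain B3 where B3: "\<forall>z\<in>?X. \<bar>1 / vol_dens (\<iota> r) z\<bar> \<le> B3" by blast
 have "continuous_on ({a..} \<times> chart_im (\<iota> r)) (\<lambda>z. 1 / h (ipr r z))"
  by (intro continuous_on_divide continuous_on_const continuous_h_ipr r) (use vp in fastforce)
 from bnd[OF this] obtain B4 where B4: "\<forall>z\<in>?X. \<bar>1 / h (ipr r z)\<bar> \<le> B4" by blast
 define B where "B = max 1 (max (max B1 B2) (max B3 B4))"
 have B: "B \<ge> 1" "B \<ge> B1" "B \<ge> B2" "B \<ge> B3" "B \<ge> B4" by (auto simp: B_def)
 show thesis
 proof (rule that[OF B(1)])
  fix z assume z: "z \<in> Z r" "fst z \<le> b"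
  have zX: "z \<in> ?X" using ipr_Z[OF r z(1)] z(2) by (auto simp: mem_Times_iff)
  have p: "vol_dens (\<iota> r) z > 0" "h (ipr r z) > 0" using vp sub zX by blast+
  have "1 / vol_dens (\<iota> r) z \<le> B" "1 / h (ipr r z) \<le> B" "vol_dens (\<iota> r) z \<le> B" "h (ipr r z) \<le> B"
   using abs_le_D1[OF B1[rule_format, OF zX]] abs_le_D1[OF B2[rule_format, OF zX]]
    abs_le_D1[OF B3[rule_format, OF zX]] abs_le_D1[OF B4[rule_format, OF zX]] B by linarith+
  thus "weight r z \<le> B \<and> 1 / B \<le> weight r z \<and> h (ipr r z) \<le> B \<and> 1 / B \<le> h (ipr r z)"
   using p B(1) z(1) by (simp add: weight_def field_simps)
 qed
qed

lemma finite_strip: "r < m ==> emeasure lborel (Z r \<inter> {..b} \<times> UNIV) < \<infinity>"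
proof -
 assume r: "r < m"
 have "Z r \<inter> {..b} \<times> UNIV \<subseteq> {a..b} \<times> KY r" using Y_KY[OF r] by (auto simp: Z_def)
 moreover have "bounded ({a..b} \<times> KY r)" using compact_KY[OF r] by (intro bounded_Times compact_imp_bounded) auto
 ultimately have "bounded (Z r \<inter> {..b} \<times> UNIV)" by (rule bounded_subset[rotated])
 thus ?thesis by (rule emeasure_bounded_finite)
qed

subsection \<open>Energies\<close>

text \<open>One summand of the \<open>p\<close>-th power of the norm, in the coordinates of one
  piece and for one tuple of basis vectors. Values in \<open>ennreal\<close> allow estimates before
  finiteness is known.\<close>

definition energy :: "real => nat => ('i, 'a, 'e) cform => nat => (nat => real \<times> 'e) => ennreal" where
 "energy p k \<xi> r v = (\<integral>\<^sup>+z. ennreal (weight r z * \<bar>scoeff \<xi> r v z\<bar> powr p) \<partial>lborel)"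

lemma form_norm_nonneg: "0 \<le> form_norm M k \<xi> z"
 unfolding form_norm_def alt_norm_def by (intro real_sqrt_ge_zero divide_nonneg_nonneg sum_nonneg) auto

text \<open>The chart and the basis chosen in \<open>form_norm\<close> are not known to depend
  measurably on the point. So only monotonicity is applied to its integral, against measurable
  functions \<open>G\<close> glued from the pieces, one as a majorant and one as a minorant.\<close>

lemma energy_bounds:
 assumes p: "1 \<le> p"
 obtains C where "C > 0"
  "\<And>\<xi>. measurable_form M k \<xi> ==> (\<integral>\<^sup>+z. ennreal (form_norm M k \<xi> z powr p) \<partial>riem_vol M)
    \<le> ennreal C * (\<Sum>r<m. \<Sum>v\<in>tuples k. energy p k \<xi> r v)"
  "\<And>\<xi> r v. measurable_form M k \<xi> ==> r < m ==> v \<in> tuples k ==>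
    energy p k \<xi> r v \<le> ennreal C * (\<integral>\<^sup>+z. ennreal (form_norm M k \<xi> z powr p) \<partial>riem_vol M)"
proof -
 let ?N = "\<lambda>\<xi>. \<integral>\<^sup>+z. ennreal (form_norm M k \<xi> z powr p) \<partial>riem_vol M"
 let ?S = "\<lambda>\<xi> r z. \<Sum>v\<in>tuples k. \<bar>scoeff \<xi> r v z\<bar>"
 let ?P = "\<lambda>\<xi> r z. \<Sum>v\<in>tuples k. \<bar>scoeff \<xi> r v z\<bar> powr p"
 let ?s = "\<lambda>\<xi> r v z. \<bar>scoeff \<xi> r v z\<bar>"
 have "\<forall>r. \<exists>C. r < m --> C > 0 \<and> (\<forall>\<xi> z. is_form M k \<xi> --> z \<in> Z r -->
   form_norm M k \<xi> (ipr r z) \<le> C * ?S \<xi> r z) \<and>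
   (\<forall>\<xi> z v. is_form M k \<xi> --> z \<in> Z r --> v \<in> tuples k -->
   ?s \<xi> r v z \<le> C * form_norm M k \<xi> (ipr r z))"
  using norm_compare[where k = k] by metis
 then obtain c where c: "\<And>r. r < m ==> c r > 0"
  and cu: "\<And>r \<xi> z. r < m ==> is_form M k \<xi> ==> z \<in> Z r ==>
   form_norm M k \<xi> (ipr r z) \<le> c r * ?S \<xi> r z"
  and cl: "\<And>r \<xi> z v. r < m ==> is_form M k \<xi> ==> z \<in> Z r ==> v \<in> tuples k ==>
   ?s \<xi> r v z \<le> c r * form_norm M k \<xi> (ipr r z)"
  by metis
 define c0 where "c0 = Max (insert 1 (c ` {..<m}))"
 have c0: "c0 \<ge> 1" "\<And>r. r < m ==> c r \<le> c0" unfolding c0_def by auto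
 define n where "n = real (card (tuples k :: (nat => real \<times> 'e) set))"
 define C where "C = c0 powr p * (n powr p + 1)"
 have C0: "C > 0" unfolding C_def using c0 by (intro mult_pos_pos) (auto simp: add_nonneg_pos)
 have C1: "c0 powr p \<le> C" unfolding C_def using mult_left_mono[of 1 "n powr p + 1" "c0 powr p"] by simp
 have C2: "c0 powr p * n powr p \<le> C" unfolding C_def by (simp add: distrib_left)
 show thesis
 proof (rule that[OF C0])
  fix \<xi> :: "('i, 'a, 'e) cform" assume \<xi>: "measurable_form M k \<xi>"
  hence form: "is_form M k \<xi>" by (simp add: measurable_form_def)
  define \<Gamma> where "\<Gamma> r z = indicator (Z r) z * (C * ?P \<xi> r z)" for r z
  have \<Gamma>m: "\<Gamma> r \<in> borel_measurable borel" if "r < m" for r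
   unfolding \<Gamma>_def by (rule measurable_on_Z[OF that]) (use measurable_scoeff[OF \<xi> that] in measurable)
  \<comment> \<open>As the sets \<open>D r\<close> are disjoint, exactly one summand is active at
    each point of the cylinder.\<close>
  define G where "G P = (\<Sum>r<m. indicator ({a..} \<times> D r) P * \<Gamma> r (chart M (\<iota> r) P))" for P
  have GZ: "G (ipr r z) = \<Gamma> r z" if r: "r < m" and z: "z \<in> Z r" for r z
  proof -
   note iz = ipr_Z[OF r z]
   have "G (ipr r z) = (\<Sum>s<m. if s = r then \<Gamma> r z else 0)"
    unfolding G_def
   proof (intro sum.cong refl)
    fix s assume s: "s \<in> {..<m}"
    show "indicator ({a..} \<times> D s) (ipr r z) * \<Gamma> s (chart M (\<iota> s) (ipr r z)) = (if s = r then \<Gamma> r z else 0)"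
    proof (cases "s = r")
     case True
     thus ?thesis using iz by (auto simp: indicator_def mem_Times_iff)
    next
     case False
     hence "snd (ipr r z) \<notin> D s" using D_disj[of r s] r s iz by auto
     thus ?thesis using False by (auto simp: indicator_def mem_Times_iff)
    qed
   qed
   thus ?thesis using r by simp
  qed
  have fG: "form_norm M k \<xi> P powr p \<le> G P" if P: "P \<in> {a..} \<times> carr N" for P
  proof -
   obtain r where r: "r < m" "snd P \<in> D r" using P D_cover by (auto simp: mem_Times_iff)
   define z where "z = chart M (\<iota> r) P"
   have z: "z \<in> Z r" unfolding z_def Z_image[OF r(1)] using P r by (intro imageI) (auto simp: mem_Times_iff)
   have Pz: "P = ipr r z" using r D_cdom[OF r(1)] iota[OF r(1)] by (auto simp: z_def inv_pair_def prod_eq_iff)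
   have "form_norm M k \<xi> P powr p \<le> (c0 * ?S \<xi> r z) powr p"
   proof (rule powr_mono2)
    have "c r * ?S \<xi> r z \<le> c0 * ?S \<xi> r z"
     by (rule mult_right_mono[OF c0(2)[OF r(1)] sum_nonneg]) simp
    thus "form_norm M k \<xi> P \<le> c0 * ?S \<xi> r z"
     using cu[OF r(1) form z] unfolding Pz by linarith
   qed (use p form_norm_nonneg in auto)
   also have "... = c0 powr p * ?S \<xi> r z powr p"
    using c0 by (intro powr_mult)
   also have "... \<le> c0 powr p * (n powr p * ?P \<xi> r z)"
    unfolding n_def using p by (intro mult_left_mono powr_sum_le) auto
   also have "... \<le> C * ?P \<xi> r z"
    unfolding mult.assoc[symmetric] by (intro mult_right_mono C2 sum_nonneg) auto
   also have "... = G P" using GZ[OF r(1) z] z by (simp add: Pz \<Gamma>_def)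
   finally show ?thesis .
  qed
  have "?N \<xi> \<le> (\<integral>\<^sup>+z. ennreal (G z) \<partial>riem_vol M)"
  proof (rule nn_integral_mono)
   fix z assume "z \<in> space (riem_vol M)"
   hence "z \<in> {a..} \<times> carr N" unfolding riem_vol_eq vol_def by (simp add: space_restrict_space)
   thus "ennreal (form_norm M k \<xi> z powr p) \<le> ennreal (G z)" using fG by (intro ennreal_leI) blast
  qed
  also have "... = (\<Sum>r<m. \<integral>\<^sup>+z. ennreal (weight r z) * ennreal (\<Gamma> r z) \<partial>lborel)"
   by (rule nn_integral_pieces) (use \<Gamma>m GZ in auto)
  also have "... = (\<Sum>r<m. \<integral>\<^sup>+z. ennreal C * (\<Sum>v\<in>tuples k. ennreal (weight r z * ?s \<xi> r v z powr p)) \<partial>lborel)"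
  proof (intro sum.cong refl nn_integral_cong)
   fix r z assume "r \<in> {..<m}"
   hence w: "weight r z \<ge> 0" using weight_nonneg by simp
   have "weight r z * \<Gamma> r z = C * (\<Sum>v\<in>tuples k. weight r z * ?s \<xi> r v z powr p)"
    by (auto simp: \<Gamma>_def weight_def indicator_def sum_distrib_left mult_ac)
   thus "ennreal (weight r z) * ennreal (\<Gamma> r z) = ennreal C * (\<Sum>v\<in>tuples k. ennreal (weight r z * ?s \<xi> r v z powr p))"
    using w C0 by (simp add: ennreal_mult'[symmetric] sum_ennreal)
  qed
  also have "... = ennreal C * (\<Sum>r<m. \<Sum>v\<in>tuples k. energy p k \<xi> r v)"
  proof -
   have m: "(\<lambda>z. ennreal (weight r z * ?s \<xi> r v z powr p)) \<in> borel_measurable lborel"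
    if "r < m" "v \<in> tuples k" for r v
   proof -
    have "(\<lambda>z. ?s \<xi> r v z powr p) \<in> borel_measurable (restrict_space borel (Z r))"
     using measurable_scoeff[OF \<xi> that] by measurable
    from weight_measurable_on_Z[OF that(1) this] show ?thesis by simp
   qed
   show ?thesis
    unfolding energy_def sum_distrib_left
    by (intro sum.cong refl, subst nn_integral_sum) (use m in "auto simp: nn_integral_cmult")
  qed
  finally show "?N \<xi>
    \<le> ennreal C * (\<Sum>r<m. \<Sum>v\<in>tuples k. energy p k \<xi> r v)" .
 next
  fix \<xi> :: "('i, 'a, 'e) cform" and r0 and v :: "nat => real \<times> 'e"
  assume \<xi>: "measurable_form M k \<xi>" and r0: "r0 < m" and v: "v \<in> tuples k"
  hence form: "is_form M k \<xi>" by (simp add: measurable_form_def)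
  define \<Gamma> where "\<Gamma> r z = (if r = r0 then indicator (Z r) z * ?s \<xi> r v z powr p else 0)" for r z
  have \<Gamma>m: "\<Gamma> r \<in> borel_measurable borel" if "r < m" for r
  proof (cases "r = r0")
   case True
   have "(\<lambda>z. \<bar>scoeff \<xi> r0 v z\<bar> powr p) \<in> borel_measurable (restrict_space borel (Z r0))"
    using measurable_scoeff[OF \<xi> r0 v] by measurable
   from measurable_on_Z[OF r0 this] show ?thesis using True by (simp add: \<Gamma>_def[abs_def])
  qed (simp add: \<Gamma>_def[abs_def])
  define G where "G P = indicator ({a..} \<times> D r0) P * \<Gamma> r0 (chart M (\<iota> r0) P)" for P
  have GZ: "G (ipr r z) = \<Gamma> r z" if r: "r < m" and z: "z \<in> Z r" for r z
  proof (cases "r = r0")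
   case True
   thus ?thesis using ipr_Z[OF r z] by (auto simp: indicator_def mem_Times_iff G_def)
  next
   case False
   hence "snd (ipr r z) \<notin> D r0" using D_disj[of r r0] r r0 ipr_Z[OF r z] by auto
   thus ?thesis using False by (auto simp: indicator_def mem_Times_iff G_def \<Gamma>_def)
  qed
  have fG: "G P \<le> C * form_norm M k \<xi> P powr p" for P
  proof (cases "P \<in> {a..} \<times> D r0")
   case True
   define z where "z = chart M (\<iota> r0) P"
   have z: "z \<in> Z r0" unfolding z_def Z_image[OF r0] using True by (rule imageI)
   have Pz: "P = ipr r0 z" using True D_cdom[OF r0] iota[OF r0] by (auto simp: z_def inv_pair_def prod_eq_iff)
   have "\<bar>scoeff \<xi> r0 v z\<bar> powr p \<le> (c0 * form_norm M k \<xi> P) powr p"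
   proof (rule powr_mono2)
    have "c r0 * form_norm M k \<xi> P \<le> c0 * form_norm M k \<xi> P"
     by (rule mult_right_mono[OF c0(2)[OF r0] form_norm_nonneg])
    thus "\<bar>scoeff \<xi> r0 v z\<bar> \<le> c0 * form_norm M k \<xi> P"
     using cl[OF r0 form z v] unfolding Pz by linarith
   qed (use p in auto)
   also have "... = c0 powr p * form_norm M k \<xi> P powr p"
    using c0 form_norm_nonneg by (intro powr_mult)
   also have "... \<le> C * form_norm M k \<xi> P powr p" by (intro mult_right_mono C1) auto
   finally show ?thesis using GZ[OF r0 z] z by (simp add: Pz \<Gamma>_def)
  next
   case False
   thus ?thesis using C0 by (simp add: G_def)
  qed
  have "energy p k \<xi> r0 v = (\<integral>\<^sup>+z. ennreal (weight r0 z) * ennreal (\<Gamma> r0 z) \<partial>lborel)"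
   unfolding energy_def
   by (rule nn_integral_cong) (auto simp: \<Gamma>_def weight_def indicator_def ennreal_mult'')
  also have "... \<le> (\<Sum>r<m. \<integral>\<^sup>+z. ennreal (weight r z) * ennreal (\<Gamma> r z) \<partial>lborel)"
   by (rule member_le_sum) (use r0 in auto)
  also have "... = (\<integral>\<^sup>+z. ennreal (G z) \<partial>riem_vol M)"
   by (rule nn_integral_pieces[symmetric]) (use \<Gamma>m GZ in auto)
  also have "... = (\<integral>\<^sup>+z. ennreal C * ennreal (G z / C) \<partial>riem_vol M)"
   using C0 by (simp add: ennreal_mult'[symmetric])
  \<comment> \<open>The constant is taken out while the integrand is still the measurable
    \<open>G\<close>, since \<open>nn_integral_cmult\<close> asks for measurability.\<close>
  also have "... = ennreal C * (\<integral>\<^sup>+z. ennreal (G z / C) \<partial>riem_vol M)"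
  proof (rule nn_integral_cmult)
   have "G \<in> borel_measurable (restrict_space borel ({a..} \<times> carr N))"
    by (rule measurable_pieces[where \<Gamma> = \<Gamma>]) (use \<Gamma>m GZ in auto)
   hence "G \<in> borel_measurable (riem_vol M)"
    unfolding riem_vol_eq using measurable_cong_sets[OF sets_vol refl] by blast
   thus "(\<lambda>z. ennreal (G z / C)) \<in> borel_measurable (riem_vol M)" by measurable
  qed
  also have "... \<le> ennreal C * ?N \<xi>"
   using fG C0 by (intro mult_left_mono nn_integral_mono ennreal_leI) (auto simp: divide_le_eq mult.commute)
  finally show "energy p k \<xi> r0 v \<le> ennreal C * ?N \<xi>" .
 qed
qed

end

section \<open>Lebesgue spaces of forms\<close>

text \<open>If \<open>f\<close> is not measurable, its Bochner integral is zero by convention and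
  the bound persists. In this way \<open>Lp_norm\<close> is estimated without measurability of
  \<open>form_norm\<close>.\<close>

lemma integral_le_enn2real_nn_integral:
 assumes "\<And>x. 0 \<le> f x" "(\<integral>\<^sup>+x. ennreal (f x) \<partial>M) \<le> ennreal c" "0 \<le> c"
 shows "(\<integral>x. f x \<partial>M) \<le> c"
proof (cases "f \<in> borel_measurable M")
 case True
 hence "(\<integral>x. f x \<partial>M) = enn2real (\<integral>\<^sup>+x. ennreal (f x) \<partial>M)"
  by (intro integral_eq_nn_integral) (use assms in auto)
 also have "... \<le> enn2real (ennreal c)" by (intro enn2real_mono) (use assms in auto)
 finally show ?thesis using assms by simp
next
 case False
 hence "\<not> integrable M f" by auto
 thus ?thesis using assms by (simp add: not_integrable_integral_eq)
qed

lemma powr_add_le: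
 fixes x y :: real
 assumes "0 < p"
 shows "\<bar>x + y\<bar> powr p \<le> 2 powr p * (\<bar>x\<bar> powr p + \<bar>y\<bar> powr p)"
proof -
 have "\<bar>x + y\<bar> powr p \<le> (2 * max \<bar>x\<bar> \<bar>y\<bar>) powr p" by (intro powr_mono2) (use assms in auto)
 also have "... = 2 powr p * max \<bar>x\<bar> \<bar>y\<bar> powr p" by (rule powr_mult)
 also have "max \<bar>x\<bar> \<bar>y\<bar> powr p \<le> \<bar>x\<bar> powr p + \<bar>y\<bar> powr p" by (auto simp: max_def)
 finally show ?thesis by (simp add: mult_left_mono)
qed

lemma abs_le_one_plus_powr: "\<bar>x\<bar> \<le> 1 + \<bar>x :: real\<bar> powr p" if "1 \<le> p"
proof (cases "\<bar>x\<bar> \<le> 1")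
 case False
 hence "\<bar>x\<bar> powr 1 \<le> \<bar>x\<bar> powr p" using that by (intro powr_mono) auto
 thus ?thesis using False by simp
qed (simp add: add_increasing2)

context cyl_cover
begin

definition strip :: "nat => real => (real \<times> 'e) set" where "strip r b = Z r \<inter> {..b} \<times> UNIV"

lemma borel_strip [measurable]: "r < m ==> strip r b \<in> sets borel"
 unfolding strip_def by (intro sets.Int borel_Z) (auto intro!: borel_closed closed_Times)

lemma emeasure_strip: "r < m ==> emeasure lborel (strip r b) < \<infinity>"
 unfolding strip_def by (rule finite_strip)

lemma measurable_energy:
 assumes "measurable_form M k \<xi>" "r < m" "v \<in> tuples k"
 shows "(\<lambda>z. weight r z * \<bar>scoeff \<xi> r v z\<bar> powr p) \<in> borel_measurable borel"
 by (rule weight_measurable_on_Z[OF assms(2)]) (use measurable_scoeff[OF assms] in measurable)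

lemma measurable_coeff_powr:
 assumes "measurable_form M k \<xi>" "r < m"
 shows "(\<lambda>z. indicator (strip r b) z * \<bar>coeff \<xi> r v z\<bar> powr p) \<in> borel_measurable borel"
proof -
 have "(\<lambda>z. indicator (Z r) z * \<bar>coeff \<xi> r v z\<bar> powr p) \<in> borel_measurable borel"
  by (rule measurable_on_Z[OF assms(2)]) (use measurable_coeff[OF assms] in measurable)
 hence "(\<lambda>z. indicator (strip r b) z * (indicator (Z r) z * \<bar>coeff \<xi> r v z\<bar> powr p)) \<in> borel_measurable borel"
  using borel_strip[OF assms(2)] by measurable
 moreover have "indicator (strip r b) z * (indicator (Z r) z * \<bar>coeff \<xi> r v z\<bar> powr p)
   = indicator (strip r b) z * \<bar>coeff \<xi> r v z\<bar> powr p" for z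
  by (auto simp: strip_def indicator_def)
 ultimately show ?thesis by simp
qed

lemma measurable_coeff_strip:
 assumes "measurable_form M k \<xi>" "r < m"
 shows "(\<lambda>z. indicator (strip r b) z * coeff \<xi> r v z) \<in> borel_measurable borel"
proof -
 have "(\<lambda>z. indicator (Z r) z * coeff \<xi> r v z) \<in> borel_measurable borel"
  by (rule measurable_on_Z[OF assms(2) measurable_coeff[OF assms]])
 hence "(\<lambda>z. indicator (strip r b) z * (indicator (Z r) z * coeff \<xi> r v z)) \<in> borel_measurable borel"
  using borel_strip[OF assms(2)] by measurable
 moreover have "indicator (strip r b) z * (indicator (Z r) z * coeff \<xi> r v z)
   = indicator (strip r b) z * coeff \<xi> r v z" for z
  by (auto simp: strip_def indicator_def)
 ultimately show ?thesis by simp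
qed

text \<open>Below height \<open>b\<close> the numbers \<open>h\<close>, \<open>1 / h\<close> and the
  weight and its inverse are at most \<open>B\<close>, and \<open>h\<close> occurs with exponent at
  most \<open>k\<close>. So weighted scaled coefficients and plain coefficients are equivalent
  there.\<close>

lemma strip_comparison:
 assumes r: "r < m" and p: "0 < p"
 obtains C where "C \<ge> 1"
  "\<And>\<xi> v z. is_form M k \<xi> ==> v \<in> tuples k ==> z \<in> strip r b ==>
    \<bar>coeff \<xi> r v z\<bar> powr p \<le> C * (weight r z * \<bar>scoeff \<xi> r v z\<bar> powr p)"
  "\<And>\<xi> v z. is_form M k \<xi> ==> v \<in> tuples k ==> z \<in> strip r b ==>
    weight r z * \<bar>scoeff \<xi> r v z\<bar> powr p \<le> C * \<bar>coeff \<xi> r v z\<bar> powr p"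
proof -
 let ?s = "\<lambda>\<xi> v z. \<bar>scoeff \<xi> r v z\<bar>"
 let ?c = "\<lambda>\<xi> v z. \<bar>coeff \<xi> r v z\<bar>"
 obtain B where B: "B \<ge> 1" "\<And>z. z \<in> Z r ==> fst z \<le> b ==> weight r z \<le> B \<and> 1 / B \<le> weight r z \<and>
   h (ipr r z) \<le> B \<and> 1 / B \<le> h (ipr r z)"
  using compact_bounds[OF r] by blast
 define C where "C = (B ^ k) powr p * B"
 have Bk: "B ^ k \<ge> 1" using B by (simp add: one_le_power)
 have Bp: "(B ^ k) powr p \<ge> 1" using Bk p by (intro ge_one_powr_ge_zero) auto
 have C1: "C \<ge> 1" using mult_mono[OF Bp B(1)] B unfolding C_def by simp
 show thesis
 proof (rule that[OF C1])
  fix \<xi> :: "('i, 'a, 'e) cform" and v :: "nat => real \<times> 'e" and z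
  assume form: "is_form M k \<xi>" and v: "v \<in> tuples k" and z: "z \<in> strip r b"
  have zZ: "z \<in> Z r" "fst z \<le> b" using z by (auto simp: strip_def)
  define q w c where "q = h (ipr r z)" and "w = weight r z" and "c = spatial_count k v"
  have q: "q > 0" "q \<le> B" "1 / q \<le> B" using B(2)[OF zZ] h_ipr_pos[OF r zZ(1)] B(1) by (auto simp: q_def field_simps)
  have w0: "w \<le> B" "1 / B \<le> w" using B(2)[OF zZ] by (auto simp: w_def)
  have "0 < 1 / B" using B(1) by simp
  with w0(2) have "0 < w" by linarith
  hence w: "w \<le> B" "1 \<le> B * w" "0 < w" using w0 B(1) by (auto simp: field_simps)
  have eq: "scoeff \<xi> r v z = (1 / q) ^ c * coeff \<xi> r v z"
   unfolding q_def c_def by (rule scoeff_eq[OF form r zZ(1) v])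
  have ck: "c \<le> k" unfolding c_def by (rule spatial_count_le)
  have "q ^ c \<le> B ^ c" using q by (intro power_mono) auto
  also have "... \<le> B ^ k" using B ck by (intro power_increasing)
  finally have qc: "q ^ c \<le> B ^ k" .
  have "(1 / q) ^ c \<le> B ^ c" using q by (intro power_mono) auto
  also have "... \<le> B ^ k" using B ck by (intro power_increasing)
  finally have qc': "(1 / q) ^ c \<le> B ^ k" .
  have "coeff \<xi> r v z = q ^ c * scoeff \<xi> r v z"
   unfolding eq using q by (simp add: power_one_over)
  hence "?c \<xi> v z \<le> B ^ k * ?s \<xi> v z"
   using mult_right_mono[OF qc, of "?s \<xi> v z"] q by (simp add: abs_mult)
  hence "?c \<xi> v z powr p \<le> (B ^ k * ?s \<xi> v z) powr p"
   using p by (intro powr_mono2) auto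
  also have "... = (B ^ k) powr p * ?s \<xi> v z powr p" by (rule powr_mult)
  also have "... \<le> (B ^ k) powr p * ?s \<xi> v z powr p * (B * w)"
   using w mult_left_mono[of 1 "B * w" "(B ^ k) powr p * ?s \<xi> v z powr p"] by simp
  finally show "?c \<xi> v z powr p \<le> C * (weight r z * ?s \<xi> v z powr p)"
   by (simp add: C_def w_def mult_ac)
  have "?s \<xi> v z \<le> B ^ k * ?c \<xi> v z"
   unfolding eq using mult_right_mono[OF qc', of "?c \<xi> v z"] q by (simp add: abs_mult)
  hence "?s \<xi> v z powr p \<le> (B ^ k * ?c \<xi> v z) powr p"
   using p by (intro powr_mono2) auto
  also have "... = (B ^ k) powr p * ?c \<xi> v z powr p" by (rule powr_mult)
  finally have "w * ?s \<xi> v z powr p \<le> B * ((B ^ k) powr p * ?c \<xi> v z powr p)"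
   using w by (intro mult_mono) auto
  thus "weight r z * ?s \<xi> v z powr p \<le> C * ?c \<xi> v z powr p"
   by (simp add: C_def w_def mult_ac)
 qed
qed

lemma strip_energy_finite:
 assumes \<xi>: "measurable_form M k \<xi>" and r: "r < m" and v: "v \<in> tuples k" and p: "0 < p"
  and E: "energy p k \<xi> r v < \<infinity>"
 shows "(\<integral>\<^sup>+z. ennreal (indicator (strip r b) z * \<bar>coeff \<xi> r v z\<bar> powr p) \<partial>lborel) < \<infinity>"
proof -
 have form: "is_form M k \<xi>" using \<xi> by (simp add: measurable_form_def)
 obtain C where C: "C \<ge> 1" "\<And>z. z \<in> strip r b ==>
    \<bar>coeff \<xi> r v z\<bar> powr p \<le> C * (weight r z * \<bar>scoeff \<xi> r v z\<bar> powr p)"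
  using strip_comparison[OF r p, of k b] form v by metis
 have "(\<integral>\<^sup>+z. ennreal (indicator (strip r b) z * \<bar>coeff \<xi> r v z\<bar> powr p) \<partial>lborel)
   \<le> (\<integral>\<^sup>+z. ennreal C * ennreal (weight r z * \<bar>scoeff \<xi> r v z\<bar> powr p) \<partial>lborel)"
 proof (rule nn_integral_mono)
  fix z
  have "indicator (strip r b) z * \<bar>coeff \<xi> r v z\<bar> powr p \<le> C * (weight r z * \<bar>scoeff \<xi> r v z\<bar> powr p)"
   using C weight_nonneg[OF r, of z] by (cases "z \<in> strip r b") auto
  thus "ennreal (indicator (strip r b) z * \<bar>coeff \<xi> r v z\<bar> powr p) \<le> ennreal C * ennreal (weight r z * \<bar>scoeff \<xi> r v z\<bar> powr p)"
   using C(1) by (simp add: ennreal_mult'[symmetric] ennreal_leI)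
 qed
 also have "... = ennreal C * energy p k \<xi> r v"
  unfolding energy_def by (rule nn_integral_cmult) (use measurable_energy[OF \<xi> r v] in simp)
 also have "... < \<infinity>" using E by (simp add: ennreal_mult_less_top)
 finally show ?thesis .
qed

text \<open>Nothing contributes above height \<open>b\<close>, so plain coefficients on the strip
  decide. Membership of the fibre integrals in Lebesgue spaces is proved through this
  criterion.\<close>

lemma energy_finite_of_strip:
 assumes \<xi>: "measurable_form M k \<xi>" and r: "r < m" and v: "v \<in> tuples k" and p: "0 < p"
  and supp: "\<And>z. z \<in> Z r ==> b < fst z ==> coeff \<xi> r v z = 0"
  and E: "(\<integral>\<^sup>+z. ennreal (indicator (strip r b) z * \<bar>coeff \<xi> r v z\<bar> powr p) \<partial>lborel) < \<infinity>"
 shows "energy p k \<xi> r v < \<infinity>"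
proof -
 have form: "is_form M k \<xi>" using \<xi> by (simp add: measurable_form_def)
 obtain C where C: "C \<ge> 1" "\<And>z. z \<in> strip r b ==>
    weight r z * \<bar>scoeff \<xi> r v z\<bar> powr p \<le> C * \<bar>coeff \<xi> r v z\<bar> powr p"
  using strip_comparison[OF r p, of k b] form v by metis
 have "energy p k \<xi> r v \<le> (\<integral>\<^sup>+z. ennreal C * ennreal (indicator (strip r b) z * \<bar>coeff \<xi> r v z\<bar> powr p) \<partial>lborel)"
  unfolding energy_def
 proof (rule nn_integral_mono)
  fix z
  have "weight r z * \<bar>scoeff \<xi> r v z\<bar> powr p \<le> C * (indicator (strip r b) z * \<bar>coeff \<xi> r v z\<bar> powr p)"
  proof (cases "z \<in> strip r b")
   case False
   have z0: "weight r z * \<bar>scoeff \<xi> r v z\<bar> powr p = 0"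
   proof (cases "z \<in> Z r")
    case True
    hence "coeff \<xi> r v z = 0" using supp False by (auto simp: strip_def mem_Times_iff)
    thus ?thesis using scoeff_eq[OF form r True v] p by simp
   qed (simp add: weight_def)
   show ?thesis unfolding z0 using C(1) by simp
  qed (use C(2) in simp)
  thus "ennreal (weight r z * \<bar>scoeff \<xi> r v z\<bar> powr p) \<le> ennreal C * ennreal (indicator (strip r b) z * \<bar>coeff \<xi> r v z\<bar> powr p)"
   using C(1) by (simp add: ennreal_mult'[symmetric] ennreal_leI)
 qed
 also have "... = ennreal C * (\<integral>\<^sup>+z. ennreal (indicator (strip r b) z * \<bar>coeff \<xi> r v z\<bar> powr p) \<partial>lborel)"
  by (rule nn_integral_cmult) (use measurable_coeff_powr[OF \<xi> r] in simp)
 also have "... < \<infinity>" using E by (simp add: ennreal_mult_less_top)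
 finally show ?thesis .
qed

definition truncate_form :: "real => ('i, 'a, 'e) cform => ('i, 'a, 'e) cform" where
 "truncate_form b \<xi> = (\<lambda>i z v. if fst z \<le> b then \<xi> i z v else 0)"

lemma measurable_truncate_form:
 assumes "measurable_form M k \<xi>"
 shows "measurable_form M k (truncate_form b \<xi>)"
proof -
 have "(\<lambda>z. indicator ({..b} \<times> UNIV) z :: real) \<in> borel_measurable borel"
  by (intro borel_measurable_indicator borel_closed closed_Times) auto
 from measurable_form_lincomb[OF assms assms this borel_measurable_const[of 0]] show ?thesis
  by (rule back_subst[where P = "measurable_form M k"]) (auto simp: truncate_form_def fun_eq_iff indicator_def)
qed

text \<open>Finiteness of the energies is the coordinate form of the norm condition. The local
  integrability demanded by \<open>Lp\<close> then comes for free: a compact set lies in a strip,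
  which has finite coordinate measure, and \<open>\<bar>x\<bar>\<close> is at most \<open>1\<close>
  plus its \<open>p\<close>-th power.\<close>

lemma Lp_iff:
 assumes p: "1 \<le> p"
 shows "\<xi> \<in> Lp M p k \<longleftrightarrow> measurable_form M k \<xi> \<and> (\<forall>r<m. \<forall>v\<in>tuples k. energy p k \<xi> r v < \<infinity>)"
proof
 assume L: "\<xi> \<in> Lp M p k"
 hence meas: "measurable_form M k \<xi>" and fin: "(\<integral>\<^sup>+x. ennreal (form_norm M k \<xi> x powr p) \<partial>riem_vol M) < \<infinity>"
  by (auto simp: Lp_def loc_integrable_form_def)
 obtain C where C: "C > 0" "\<And>r v. r < m ==> v \<in> tuples k ==>
    energy p k \<xi> r v \<le> ennreal C * (\<integral>\<^sup>+z. ennreal (form_norm M k \<xi> z powr p) \<partial>riem_vol M)"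
  using energy_bounds[OF p, of k] meas by metis
 have "energy p k \<xi> r v < \<infinity>" if "r < m" "v \<in> tuples k" for r v
  using C(2)[OF that] fin by (metis ennreal_less_top ennreal_mult_less_top infinity_ennreal_def le_less_trans)
 thus "measurable_form M k \<xi> \<and> (\<forall>r<m. \<forall>v\<in>tuples k. energy p k \<xi> r v < \<infinity>)" using meas by blast
next
 assume R: "measurable_form M k \<xi> \<and> (\<forall>r<m. \<forall>v\<in>tuples k. energy p k \<xi> r v < \<infinity>)"
 hence meas: "measurable_form M k \<xi>" by blast
 obtain C where C: "C > 0" "(\<integral>\<^sup>+z. ennreal (form_norm M k \<xi> z powr p) \<partial>riem_vol M)
    \<le> ennreal C * (\<Sum>r<m. \<Sum>v\<in>tuples k. energy p k \<xi> r v)"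
  using energy_bounds[OF p, of k] meas by metis
 have fin: "(\<Sum>r<m. \<Sum>v\<in>tuples k. energy p k \<xi> r v) < \<infinity>" using R by (simp add: less_top[symmetric])
 have I: "(\<integral>\<^sup>+z. ennreal (form_norm M k \<xi> z powr p) \<partial>riem_vol M) < \<infinity>"
  by (rule le_less_trans[OF C(2)]) (use fin in "simp add: ennreal_mult_less_top")
 have "(\<integral>\<^sup>+x\<in>Kc. ennreal (form_norm M k \<xi> x) \<partial>riem_vol M) < \<infinity>" if Kc: "compact Kc" "Kc \<subseteq> carr M" for Kc
 proof -
  have "compact (fst ` Kc)" by (intro compact_continuous_image continuous_on_fst continuous_on_id Kc)
  then obtain b where b: "\<And>z. z \<in> Kc ==> fst z \<le> b"
   by (meson bounded_imp_bdd_above bdd_above.E compact_imp_bounded imageI)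
  \<comment> \<open>\<open>energy_bounds\<close> is a statement on the whole cylinder, so the
    compact set is replaced by truncation at its largest height; with exponent \<open>1\<close> the
    statement then yields local integrability.\<close>
  define \<xi>' where "\<xi>' = truncate_form b \<xi>"
  have meas': "measurable_form M k \<xi>'" unfolding \<xi>'_def by (rule measurable_truncate_form[OF meas])
  have E1: "energy 1 k \<xi>' r v < \<infinity>" if r: "r < m" and v: "v \<in> tuples k" for r v
  proof (rule energy_finite_of_strip[OF meas' r v])
   have co: "coeff \<xi>' r v z = (if fst z \<le> b then coeff \<xi> r v z else 0)" for z
    by (simp add: coeff_def \<xi>'_def truncate_form_def inv_pair_def)
   show "coeff \<xi>' r v z = 0" if "z \<in> Z r" "b < fst z" for z using that by (simp add: co)
   have "(\<integral>\<^sup>+z. ennreal (indicator (strip r b) z * \<bar>coeff \<xi>' r v z\<bar> powr 1) \<partial>lborel)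
    \<le> (\<integral>\<^sup>+z. indicator (strip r b) z + ennreal (indicator (strip r b) z * \<bar>coeff \<xi> r v z\<bar> powr p) \<partial>lborel)"
   proof (rule nn_integral_mono)
    fix z
    have "indicator (strip r b) z * \<bar>coeff \<xi>' r v z\<bar> powr 1 \<le> indicator (strip r b) z + indicator (strip r b) z * \<bar>coeff \<xi> r v z\<bar> powr p"
     using abs_le_one_plus_powr[OF p, of "coeff \<xi> r v z"] by (auto simp: co indicator_def)
    hence "ennreal (indicator (strip r b) z * \<bar>coeff \<xi>' r v z\<bar> powr 1) \<le> ennreal (indicator (strip r b) z + indicator (strip r b) z * \<bar>coeff \<xi> r v z\<bar> powr p)"
     by (rule ennreal_leI)
    thus "ennreal (indicator (strip r b) z * \<bar>coeff \<xi>' r v z\<bar> powr 1) \<le> indicator (strip r b) z + ennreal (indicator (strip r b) z * \<bar>coeff \<xi> r v z\<bar> powr p)"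
     by (simp add: ennreal_plus ennreal_indicator)
   qed
   also have "... = emeasure lborel (strip r b) + (\<integral>\<^sup>+z. ennreal (indicator (strip r b) z * \<bar>coeff \<xi> r v z\<bar> powr p) \<partial>lborel)"
    using measurable_coeff_powr[OF meas r] borel_strip[OF r] by (subst nn_integral_add) auto
   also have "... < \<infinity>"
    using emeasure_strip[OF r] strip_energy_finite[OF meas r v] R r v p by simp
   finally show "(\<integral>\<^sup>+z. ennreal (indicator (strip r b) z * \<bar>coeff \<xi>' r v z\<bar> powr 1) \<partial>lborel) < \<infinity>" .
  qed simp
  obtain C1 where C1: "C1 > 0" "(\<integral>\<^sup>+z. ennreal (form_norm M k \<xi>' z powr 1) \<partial>riem_vol M)
    \<le> ennreal C1 * (\<Sum>r<m. \<Sum>v\<in>tuples k. energy 1 k \<xi>' r v)"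
   using energy_bounds[of 1 k] meas' by (metis order_refl)
  have "(\<integral>\<^sup>+x\<in>Kc. ennreal (form_norm M k \<xi> x) \<partial>riem_vol M) \<le> (\<integral>\<^sup>+z. ennreal (form_norm M k \<xi>' z powr 1) \<partial>riem_vol M)"
  proof (rule nn_integral_mono)
   fix z
   show "ennreal (form_norm M k \<xi> z) * indicator Kc z \<le> ennreal (form_norm M k \<xi>' z powr 1)"
   proof (cases "z \<in> Kc")
    case True
    hence "form_norm M k \<xi>' z = form_norm M k \<xi> z"
     using b by (simp add: form_norm_def alt_norm_def \<xi>'_def truncate_form_def del: M_simps)
    thus ?thesis using form_norm_nonneg[of k \<xi> z] by (simp add: indicator_def)
   qed simp
  qed
  also have "... \<le> ennreal C1 * (\<Sum>r<m. \<Sum>v\<in>tuples k. energy 1 k \<xi>' r v)" by (rule C1(2))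
  also have "... < \<infinity>"
  proof -
   have "\<forall>r<m. \<forall>v\<in>tuples k. energy 1 k \<xi>' r v < \<infinity>" using E1 by blast
   hence "(\<Sum>r<m. \<Sum>v\<in>tuples k. energy 1 k \<xi>' r v) < \<infinity>" by (simp add: less_top[symmetric])
   thus ?thesis by (simp add: ennreal_mult_less_top)
  qed
  finally show ?thesis .
 qed
 thus "\<xi> \<in> Lp M p k" using meas I by (simp add: Lp_def loc_integrable_form_def del: M_simps)
qed

lemma Lp_norm_le:
 assumes p: "1 \<le> p"
 obtains C where "C > 0" "\<And>\<xi> \<delta>. measurable_form M k \<xi> ==> 0 \<le> \<delta> ==>
   (\<Sum>r<m. \<Sum>v\<in>tuples k. energy p k \<xi> r v) \<le> ennreal \<delta> ==> Lp_norm M p k \<xi> \<le> (C * \<delta>) powr (1 / p)"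
proof -
 obtain C where C: "C > 0" "\<And>\<xi>. measurable_form M k \<xi> ==> (\<integral>\<^sup>+z. ennreal (form_norm M k \<xi> z powr p) \<partial>riem_vol M)
    \<le> ennreal C * (\<Sum>r<m. \<Sum>v\<in>tuples k. energy p k \<xi> r v)"
  using energy_bounds[OF p, of k] by metis
 show thesis
 proof (rule that[OF C(1)])
  fix \<xi> :: "('i, 'a, 'e) cform" and \<delta> :: real
  assume \<xi>: "measurable_form M k \<xi>" and \<delta>: "0 \<le> \<delta>" "(\<Sum>r<m. \<Sum>v\<in>tuples k. energy p k \<xi> r v) \<le> ennreal \<delta>"
  have "(\<integral>\<^sup>+z. ennreal (form_norm M k \<xi> z powr p) \<partial>riem_vol M) \<le> ennreal C * ennreal \<delta>"
   by (rule order_trans[OF C(2)[OF \<xi>] mult_left_mono[OF \<delta>(2)]]) simp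
  also have "... = ennreal (C * \<delta>)" using C(1) \<delta> by (simp add: ennreal_mult')
  finally have "(\<integral>z. form_norm M k \<xi> z powr p \<partial>riem_vol M) \<le> C * \<delta>"
   by (intro integral_le_enn2real_nn_integral) (use C(1) \<delta> in auto)
  thus "Lp_norm M p k \<xi> \<le> (C * \<delta>) powr (1 / p)"
   unfolding Lp_norm_def using p by (intro powr_mono2 lint_nonneg) auto
 qed
qed

lemma coeff_strip_integrable:
 assumes \<xi>: "\<xi> \<in> Lp M p k" and p: "1 \<le> p" and r: "r < m" and v: "v \<in> tuples k"
 shows "integrable lborel (\<lambda>z. indicator (strip r b) z * coeff \<xi> r v z)"
  and "integrable lborel (\<lambda>z. indicator (strip r b) z * \<bar>coeff \<xi> r v z\<bar> powr p)"
proof -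
 have meas: "measurable_form M k \<xi>" and E: "energy p k \<xi> r v < \<infinity>" using \<xi> Lp_iff[OF p] r v by auto
 have "(\<integral>\<^sup>+z. ennreal (indicator (strip r b) z * \<bar>coeff \<xi> r v z\<bar> powr p) \<partial>lborel) < \<infinity>"
  using strip_energy_finite[OF meas r v _ E] p by simp
 thus ip: "integrable lborel (\<lambda>z. indicator (strip r b) z * \<bar>coeff \<xi> r v z\<bar> powr p)"
  using measurable_coeff_powr[OF meas r] by (intro integrableI_nonneg) auto
 have i1: "integrable lborel (indicator (strip r b) :: _ => real)"
  using emeasure_strip[OF r] borel_strip[OF r] by (simp add: less_top[symmetric])
 show "integrable lborel (\<lambda>z. indicator (strip r b) z * coeff \<xi> r v z)"
 proof (rule Bochner_Integration.integrable_bound[OF Bochner_Integration.integrable_add[OF i1 ip]])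
  show "(\<lambda>z. indicator (strip r b) z * coeff \<xi> r v z) \<in> borel_measurable lborel"
   using measurable_coeff_strip[OF meas r] by simp
  show "AE z in lborel. norm (indicator (strip r b) z * coeff \<xi> r v z) \<le>
    norm (indicator (strip r b) z + indicator (strip r b) z * \<bar>coeff \<xi> r v z\<bar> powr p)"
   using abs_le_one_plus_powr[OF p] by (intro AE_I2) (auto simp: indicator_def)
 qed
qed

section \<open>Integrals of wedge products\<close>

lemma is_form_wedge:
 assumes \<xi>: "is_form M k \<xi>" and \<beta>: "is_form M l \<beta>"
 shows "is_form M (k + l) (wedge_form k l \<xi> \<beta>)"
 unfolding is_form_M_iff
proof (intro conjI ballI allI impI)
 fix i x t assume i: "i \<in> idx N" "x \<in> cdom N i" "a \<le> t"
 show "alternating (k + l) (wedge_form k l \<xi> \<beta> i (t, x))"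
  unfolding wedge_form_def by (rule alternating_wedge[OF is_formD(1)[OF \<xi> i] is_formD(1)[OF \<beta> i]])
next
 fix i t x assume "\<not> (i \<in> idx N \<and> a \<le> t \<and> x \<in> cdom N i)"
 hence "\<xi> i (t, x) = (\<lambda>v. 0)" by (rule is_formD(2)[OF \<xi>])
 thus "wedge_form k l \<xi> \<beta> i (t, x) = (\<lambda>v. 0)" by (simp add: wedge_form_def wedge_def fun_eq_iff)
next
 fix i j x t v assume ij: "i \<in> idx N" "j \<in> idx N" "x \<in> cdom N i \<inter> cdom N j" "a \<le> t"
 have "\<xi> i (t, x) w = \<xi> j (t, x) (\<lambda>l. TM i j x (w l))" "\<beta> i (t, x) w = \<beta> j (t, x) (\<lambda>l. TM i j x (w l))" for w
  using is_formD(3)[OF \<xi>, of i j x t w] is_formD(3)[OF \<beta>, of i j x t w] ij by auto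
 thus "wedge_form k l \<xi> \<beta> i (t, x) v = wedge_form k l \<xi> \<beta> j (t, x) (\<lambda>l. TM i j x (v l))"
  by (simp add: wedge_form_def wedge_def)
qed

definition continuous_form :: "('i, 'a, 'e) cform => bool" where
 "continuous_form \<beta> \<longleftrightarrow> (\<forall>i\<in>idx N. \<forall>v. continuous_on ({a..} \<times> chart_im i) (\<lambda>z. \<beta> i (inv_pair i z) v))"

lemma continuous_coeff: "continuous_form \<beta> ==> r < m ==> continuous_on ({a..} \<times> chart_im (\<iota> r)) (coeff \<beta> r v)"
 using iota unfolding continuous_form_def coeff_def by blast

definition wedge_coeff where
 "wedge_coeff k l \<xi> \<beta> r z = wedge k l (\<xi> (\<iota> r) (ipr r z)) (\<beta> (\<iota> r) (ipr r z)) (basis_enum :: nat => real \<times> 'e)"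

lemma restrict_in_tuples:
 assumes "\<sigma> permutes {..<Suc DIM('e)}" "\<And>j. j < k ==> f j < Suc DIM('e)"
 shows "restrict (\<lambda>j. basis_enum (\<sigma> (f j))) {..<k} \<in> (tuples k :: (nat => real \<times> 'e) set)"
proof -
 have "\<sigma> (f j) < Suc DIM('e)" if "j < k" for j
  using assms permutes_in_image[OF assms(1), of "f j"] that by auto
 thus ?thesis
  using basis_enum_bij[where 'e = "real \<times> 'e"] by (auto simp: tuples_def bij_betw_def)
qed

text \<open>The second factor is continuous and vanishes above height \<open>b\<close>, so its
  coefficients are bounded on the pieces; the first factor is integrable on strips. Convergence is
  secured here for all pairings that occur later.\<close>

lemma wedge_integral:
 assumes \<xi>: "\<xi> \<in> Lp M p k" and p: "1 \<le> p" and \<beta>: "is_form M l \<beta>" "continuous_form \<beta>"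
  and supp: "\<And>i t x. b < t ==> \<beta> i (t, x) = (\<lambda>v. 0)" and kl: "k + l = Suc DIM('e)"
 shows "r < m ==> integrable lborel (\<lambda>z. indicator (Z r) z * wedge_coeff k l \<xi> \<beta> r z)"
  and "form_integral M (wedge_form k l \<xi> \<beta>) = (\<Sum>r<m. \<integral>z. indicator (Z r) z * wedge_coeff k l \<xi> \<beta> r z \<partial>lborel)"
proof -
 let ?w = "\<lambda>r z. indicator (Z r) z * wedge_coeff k l \<xi> \<beta> r z"
 have form: "is_form M k \<xi>" using \<xi> by (simp add: Lp_iff[OF p] measurable_form_def)
 show int: "integrable lborel (\<lambda>z. ?w r z)" if r: "r < m" for r
 proof -
  \<comment> \<open>A term of the wedge sum, with the arguments of \<xi> restricted so that they
    form an element of \<open>tuples k\<close>.\<close>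
  let ?t = "\<lambda>\<sigma> z. indicator (strip r b) z * coeff \<xi> r (restrict (\<lambda>j. basis_enum (\<sigma> j)) {..<k}) z *
    coeff \<beta> r (\<lambda>j. basis_enum (\<sigma> (k + j))) z"
  have eq: "?w r z =
    (\<Sum>\<sigma> | \<sigma> permutes {..<k + l}. (of_int (sign \<sigma>) / (fact k * fact l)) * ?t \<sigma> z)" for z
  proof (cases "z \<in> strip r b")
   case True
   hence z: "z \<in> Z r" by (simp add: strip_def)
   have "\<xi> (\<iota> r) (ipr r z) (\<lambda>j. basis_enum (\<sigma> j)) = coeff \<xi> r (restrict (\<lambda>j. basis_enum (\<sigma> j)) {..<k}) z" for \<sigma>
    unfolding coeff_def by (rule alternating_cong[OF form_alternating[OF form r z]]) simp
   thus ?thesis using True z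
    by (simp add: wedge_coeff_def wedge_def sum_divide_distrib coeff_def[of \<beta>] mult.assoc)
  next
   case False
   have "?w r z = 0"
   proof (cases "z \<in> Z r")
    case True
    hence "b < fst z" using False by (auto simp: strip_def mem_Times_iff)
    hence "\<beta> (\<iota> r) (ipr r z) = (\<lambda>v. 0)" using supp by (simp add: inv_pair_def)
    thus ?thesis by (simp add: wedge_coeff_def wedge_def)
   qed simp
   thus ?thesis using False by simp
  qed
  have "integrable lborel (?t \<sigma>)" if s: "\<sigma> permutes {..<k + l}" for \<sigma>
  proof -
   have tup: "restrict (\<lambda>j. basis_enum (\<sigma> j)) {..<k} \<in> (tuples k :: (nat => real \<times> 'e) set)"
    by (rule restrict_in_tuples) (use s kl in auto)
   let ?f = "coeff \<beta> r (\<lambda>j. basis_enum (\<sigma> (k + j)))"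
   let ?X = "{a..b} \<times> KY r"
   have cont: "continuous_on ?X ?f"
    by (rule continuous_on_subset[OF continuous_coeff[OF \<beta>(2) r]]) (use KY_chart_im[OF r] in auto)
   have "compact ?X" by (intro compact_Times compact_KY r) simp
   then obtain B where "\<forall>y\<in>?f ` ?X. \<bar>y\<bar> \<le> B"
    using compact_imp_bounded[OF compact_continuous_image[OF cont]] unfolding bounded_real by blast
   hence B: "\<bar>?f z\<bar> \<le> B" if "z \<in> strip r b" for z
    using that Y_KY[OF r] by (auto simp: strip_def Z_def)
   have "continuous_on (strip r b) ?f"
    by (rule continuous_on_subset[OF continuous_coeff[OF \<beta>(2) r]]) (use Z_sub[OF r] in "auto simp: strip_def")
   from borel_measurable_continuous_on_indicator[OF borel_strip[OF r] this]
   have m1: "(\<lambda>z. indicator (strip r b) z * ?f z) \<in> borel_measurable borel" by simp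
   note i1 = coeff_strip_integrable(1)[OF \<xi> p r tup, of b]
   have teq: "?t \<sigma> z = (indicator (strip r b) z * coeff \<xi> r (restrict (\<lambda>j. basis_enum (\<sigma> j)) {..<k}) z) * (indicator (strip r b) z * ?f z)" for z
    by (auto simp: indicator_def)
   show ?thesis
   proof (rule Bochner_Integration.integrable_bound[OF integrable_mult_left[OF i1, of B]])
    show "?t \<sigma> \<in> borel_measurable lborel" unfolding teq using m1 i1 by measurable
    show "AE z in lborel. norm (?t \<sigma> z) \<le> norm (indicator (strip r b) z * coeff \<xi> r (restrict (\<lambda>j. basis_enum (\<sigma> j)) {..<k}) z * B)"
    proof (intro AE_I2)
     fix z
     show "norm (?t \<sigma> z) \<le> norm (indicator (strip r b) z * coeff \<xi> r (restrict (\<lambda>j. basis_enum (\<sigma> j)) {..<k}) z * B)"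
     proof (cases "z \<in> strip r b")
      case True
      hence "\<bar>?f z\<bar> \<le> \<bar>B\<bar>" using B[OF True] by simp
      thus ?thesis using True by (simp add: abs_mult mult_left_mono)
     qed simp
    qed
   qed
  qed
  thus ?thesis unfolding eq by (intro Bochner_Integration.integrable_sum integrable_mult_right) simp
 qed
 have tc: "top_coeff (wedge_form k l \<xi> \<beta>) r = (\<lambda>z. ?w r z)" for r
  by (simp add: fun_eq_iff top_coeff_def wedge_coeff_def wedge_form_def)
 show "form_integral M (wedge_form k l \<xi> \<beta>) = (\<Sum>r<m. \<integral>z. ?w r z \<partial>lborel)"
  unfolding tc[symmetric]
  by (rule form_integral_pieces) (use is_form_wedge[OF form \<beta>(1)] kl int tc in auto)
qed

end

section \<open>The exterior derivative\<close>

text \<open>If the arguments \<open>p\<close> and \<open>q\<close> agree, every term that omits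
  neither of them vanishes, and the two remaining terms cancel by
  \<open>alternating_omit\<close>.\<close>

lemma alternating_ext_sum:
 assumes A: "\<And>d. alternating k (\<lambda>w. \<delta> w d)" and L: "\<And>w. linear (\<delta> w)"
 shows "alternating (Suc k) (\<lambda>v. \<Sum>j\<le>k. (-1) ^ j * \<delta> (omit j v) (v j))"
 unfolding alternating_def
proof (intro conjI allI impI)
 fix v :: "nat => 'a" and p assume p: "p < Suc k"
 have "linear (\<lambda>x. (-1) ^ j * \<delta> (omit j (v(p := x))) ((v(p := x)) j))" if j: "j \<le> k" for j
 proof (cases "j = p")
  case True
  have "omit p (v(p := x)) = omit p v" for x by (auto simp: omit_def)
  thus ?thesis using linear_real_mult[OF L, of "(-1) ^ j"] True by simp
 next
  case False
  \<comment> \<open>The position of argument \<open>p\<close> after argument \<open>j\<close> has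
    been removed.\<close>
  define p' where "p' = (if p < j then p else p - 1)"
  have "omit j (v(p := x)) = (omit j v)(p' := x)" for x
   using False by (auto simp: omit_def p'_def fun_eq_iff)
  moreover have "p' < k" using False p j by (auto simp: p'_def)
  ultimately show ?thesis
   using False linear_real_mult[OF alternating_linear[OF A], of p' "(-1) ^ j"] by simp
 qed
 thus "linear (\<lambda>x. \<Sum>j\<le>k. (-1) ^ j * \<delta> (omit j (v(p := x))) ((v(p := x)) j))"
  by (intro linear_compose_sum) auto
next
 fix v :: "nat => 'a" and p q assume pq: "p < q" "q < Suc k" "v p = v q"
 have "(\<Sum>j\<le>k. (-1) ^ j * \<delta> (omit j v) (v j)) = (\<Sum>j\<in>{p, q}. (-1) ^ j * \<delta> (omit j v) (v j))"
 proof (rule sum.mono_neutral_right)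
  show "\<forall>j\<in>{..k} - {p, q}. (-1) ^ j * \<delta> (omit j v) (v j) = 0"
  proof
   fix j assume j: "j \<in> {..k} - {p, q}"
   define p' q' where "p' = (if p < j then p else p - 1)" and "q' = (if q < j then q else q - 1)"
   have "\<delta> (omit j v) (v j) = 0"
    by (rule alternating_eq_zero[OF A, of p' q']) (use pq j in "auto simp: omit_def p'_def q'_def")
   thus "(-1) ^ j * \<delta> (omit j v) (v j) = 0" by simp
  qed
 qed (use pq in auto)
 also have "... = (-1) ^ p * \<delta> (omit p v) (v p) + (-1) ^ q * \<delta> (omit q v) (v p)"
  using pq by simp
 also have "... = 0" using alternating_omit[OF A pq(1), of v "v p"] pq by simp
 finally show "(\<Sum>j\<le>k. (-1) ^ j * \<delta> (omit j v) (v j)) = 0" .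
next
 fix v w :: "nat => 'a" assume vw: "\<forall>i<Suc k. v i = w i"
 show "(\<Sum>j\<le>k. (-1) ^ j * \<delta> (omit j v) (v j)) = (\<Sum>j\<le>k. (-1) ^ j * \<delta> (omit j w) (w j))"
 proof (intro sum.cong refl)
  fix j assume j: "j \<in> {..k}"
  have "\<delta> (omit j v) (v j) = \<delta> (omit j w) (v j)"
   by (rule alternating_cong[OF A]) (use vw in "auto simp: omit_def")
  thus "(-1) ^ j * \<delta> (omit j v) (v j) = (-1) ^ j * \<delta> (omit j w) (w j)" using vw j by simp
 qed
qed

text \<open>The terms with second derivatives cancel in pairs.\<close>

lemma alternating_symmetric_cancel:
 assumes G: "alternating k G" and sym: "\<And>j q. \<beta> j q = \<beta> q j"
 shows "(\<Sum>j\<le>k. \<Sum>p<k. (-1) ^ j * G ((omit j V)(p := \<beta> j (if p < j then p else Suc p)))) = (0 :: real)"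
proof -
 \<comment> \<open>\<open>E j q\<close> puts the vector \<open>\<beta> j q\<close> into both slots
   \<open>j\<close> and \<open>q\<close> and then omits slot \<open>j\<close>. Omitting slot
   \<open>q\<close> instead changes only the sign, so \<open>E\<close> is antisymmetric and its
   double sum vanishes.\<close>
 define E where "E j q = (if q = j then 0 else (-1) ^ j * G (omit j (V(j := \<beta> j q, q := \<beta> j q))))" for j q
 have inner: "(\<Sum>p<k. (-1) ^ j * G ((omit j V)(p := \<beta> j (if p < j then p else Suc p)))) = (\<Sum>q\<le>k. E j q)"
  if j: "j \<le> k" for j
 proof -
  let ?f = "\<lambda>p. if p < j then p else Suc p"
  have "(\<Sum>q\<le>k. E j q) = (\<Sum>q\<in>{..k} - {j}. E j q)"
   by (rule sum.mono_neutral_right) (auto simp: E_def)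
  also have "... = (\<Sum>p<k. E j (?f p))"
  proof (rule sum.reindex_bij_witness[of _ ?f "\<lambda>q. if q < j then q else q - 1"])
   fix q assume q: "q \<in> {..k} - {j}"
   show q': "?f (if q < j then q else q - 1) = q" using q by auto
   show "(if q < j then q else q - 1) \<in> {..<k}" using q j by auto
   show "E j (?f (if q < j then q else q - 1)) = E j q" unfolding q' ..
  qed (use j in auto)
  also have "... = (\<Sum>p<k. (-1) ^ j * G ((omit j V)(p := \<beta> j (?f p))))"
  proof (intro sum.cong refl)
   fix p assume "p \<in> {..<k}"
   have "omit j (V(j := \<beta> j (?f p), ?f p := \<beta> j (?f p))) = (omit j V)(p := \<beta> j (?f p))"
    by (auto simp: omit_def fun_eq_iff)
   thus "E j (?f p) = (-1) ^ j * G ((omit j V)(p := \<beta> j (?f p)))" by (simp add: E_def)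
  qed
  finally show ?thesis by simp
 qed
 have anti: "E j q = - E q j" if "j \<le> k" "q \<le> k" "j < q" for j q
 proof -
  define v where "v = V(j := \<beta> j q, q := \<beta> j q)"
  have "(-1) ^ q * G (omit q v) = - ((-1) ^ j * G (omit j v))"
   by (rule alternating_omit[OF G]) (use that in "auto simp: v_def")
  moreover have "V(q := \<beta> q j, j := \<beta> q j) = v"
   unfolding v_def sym[of q j] by (rule fun_upd_twist) (use that in simp)
  ultimately show ?thesis using that by (simp add: E_def v_def)
 qed
 have anti': "E j q = - E q j" if "j \<le> k" "q \<le> k" for j q
  using anti[of j q] anti[of q j] that by (cases j q rule: linorder_cases) (auto simp: E_def)
 have "(\<Sum>j\<le>k. \<Sum>q\<le>k. E j q) = (\<Sum>j\<le>k. \<Sum>q\<le>k. - E q j)"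
  by (intro sum.cong refl anti') auto
 also have "... = - (\<Sum>j\<le>k. \<Sum>q\<le>k. E q j)" by (simp add: sum_negf)
 also have "(\<Sum>j\<le>k. \<Sum>q\<le>k. E q j) = (\<Sum>j\<le>k. \<Sum>q\<le>k. E j q)" by (rule sum.swap)
 finally have "(\<Sum>j\<le>k. \<Sum>q\<le>k. E j q) = 0" by simp
 thus ?thesis using inner by simp
qed

text \<open>Product rule for a form evaluated on moving arguments. Expansion in the standard basis
  separates the dependence of the form on the point from that of the arguments; after
  differentiation the sums are folded back.\<close>

lemma has_derivative_alternating_compose:
 fixes F :: "'u::euclidean_space => (nat => 'v::euclidean_space) => real"
 assumes z: "z \<in> S" and \<Phi>S: "\<And>z. z \<in> S ==> \<Phi> z \<in> S'"
  and A: "\<And>y. y \<in> S' ==> alternating k (F y)" and A': "\<And>d. alternating k (\<lambda>e. F' e d)"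
  and F': "\<And>e. ((\<lambda>y. F y e) has_derivative F' e) (at (\<Phi> z) within S')"
  and \<Phi>': "(\<Phi> has_derivative \<Phi>') (at z within S)"
  and a': "\<And>p. p < k ==> (a p has_derivative a' p) (at z within S)"
 shows "((\<lambda>z. F (\<Phi> z) (\<lambda>p. a p z)) has_derivative
   (\<lambda>d. F' (\<lambda>p. a p z) (\<Phi>' d) + (\<Sum>p<k. F (\<Phi> z) ((\<lambda>q. a q z)(p := a' p d))))) (at z within S)"
proof -
 let ?t = "\<lambda>e p d. (a' p d \<bullet> e p) * (\<Prod>q\<in>{..<k} - {p}. a q z \<bullet> e q)"
 let ?Q = "\<lambda>e z. (\<Prod>p<k. a p z \<bullet> e p)"
 let ?E = "{..<k} \<rightarrow>\<^sub>E (Basis :: 'v set)"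
 have dF: "((\<lambda>z. F (\<Phi> z) e) has_derivative (\<lambda>d. F' e (\<Phi>' d))) (at z within S)" for e
 proof -
  have "((\<lambda>y. F y e) has_derivative F' e) (at (\<Phi> z) within \<Phi> ` S)"
   by (rule has_derivative_subset[OF F']) (use \<Phi>S in blast)
  from has_derivative_in_compose[OF \<Phi>' this] show ?thesis .
 qed
 have dP: "((\<lambda>z. \<Prod>p<k. a p z \<bullet> e p) has_derivative
   (\<lambda>d. \<Sum>p<k. ?t e p d)) (at z within S)" for e
  by (rule has_derivative_prod) (intro has_derivative_inner_left a', simp)
 have "((\<lambda>z. \<Sum>e\<in>?E. ?Q e z * F (\<Phi> z) e) has_derivative
   (\<lambda>d. \<Sum>e\<in>?E. ?Q e z * F' e (\<Phi>' d) +
    (\<Sum>p<k. ?t e p d) * F (\<Phi> z) e)) (at z within S)"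
  by (intro has_derivative_sum has_derivative_mult dP dF)
 moreover have "(\<lambda>d. \<Sum>e\<in>?E. ?Q e z * F' e (\<Phi>' d) +
    (\<Sum>p<k. ?t e p d) * F (\<Phi> z) e) =
   (\<lambda>d. F' (\<lambda>p. a p z) (\<Phi>' d) + (\<Sum>p<k. F (\<Phi> z) ((\<lambda>q. a q z)(p := a' p d))))"
 proof
  fix d
  have 1: "F' (\<lambda>p. a p z) (\<Phi>' d) = (\<Sum>e\<in>?E. ?Q e z * F' e (\<Phi>' d))"
   by (rule alternating_expand[OF A' finite_Basis]) (simp add: euclidean_representation)
  have 2: "F (\<Phi> z) ((\<lambda>q. a q z)(p := a' p d)) =
    (\<Sum>e\<in>?E. ?t e p d * F (\<Phi> z) e)" if p: "p < k" for p
  proof -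
   let ?w = "(\<lambda>q. a q z)(p := a' p d)"
   have "F (\<Phi> z) ?w = (\<Sum>e\<in>?E. (\<Prod>q<k. ?w q \<bullet> e q) * F (\<Phi> z) e)"
    by (rule alternating_expand[OF A[OF \<Phi>S[OF z]] finite_Basis]) (simp add: euclidean_representation)
   also have "... = (\<Sum>e\<in>?E. ?t e p d * F (\<Phi> z) e)"
   proof (intro sum.cong refl arg_cong2[of _ _ _ _ "(*)"])
    fix e
    have "(\<Prod>q<k. ?w q \<bullet> e q) = (?w p \<bullet> e p) * (\<Prod>q\<in>{..<k} - {p}. ?w q \<bullet> e q)"
     by (rule prod.remove) (use p in auto)
    also have "(\<Prod>q\<in>{..<k} - {p}. ?w q \<bullet> e q) = (\<Prod>q\<in>{..<k} - {p}. a q z \<bullet> e q)"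
     by (rule prod.cong) auto
    finally show "(\<Prod>q<k. ?w q \<bullet> e q) = ?t e p d" by simp
   qed
   finally show ?thesis .
  qed
  have 3: "(\<Sum>p<k. F (\<Phi> z) ((\<lambda>q. a q z)(p := a' p d))) =
    (\<Sum>e\<in>?E. (\<Sum>p<k. ?t e p d) * F (\<Phi> z) e)"
   using 2 by (simp add: sum_distrib_right) (rule sum.swap)
  show "(\<Sum>e\<in>?E. ?Q e z * F' e (\<Phi>' d) +
    (\<Sum>p<k. ?t e p d) * F (\<Phi> z) e) =
    F' (\<lambda>p. a p z) (\<Phi>' d) + (\<Sum>p<k. F (\<Phi> z) ((\<lambda>q. a q z)(p := a' p d)))"
   unfolding 1 3 by (rule sum.distrib)
 qed
 ultimately have "((\<lambda>z. \<Sum>e\<in>?E. ?Q e z * F (\<Phi> z) e) has_derivative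
   (\<lambda>d. F' (\<lambda>p. a p z) (\<Phi>' d) + (\<Sum>p<k. F (\<Phi> z) ((\<lambda>q. a q z)(p := a' p d))))) (at z within S)" by simp
 thus ?thesis
  by (rule has_derivative_transform[OF z, rotated])
    (rule alternating_expand[OF A[OF \<Phi>S] finite_Basis], auto simp: euclidean_representation)
qed

context cyl
begin

definition loc :: "('i, 'a, 'e) cform => 'i => (nat => real \<times> 'e) => real \<times> 'e => real" where
 "loc u i w z = u i (inv_pair i z) w"

abbreviation "half i \<equiv> {a..} \<times> chart_im i"

definition dloc where
 "dloc u i w z = frechet_derivative (loc u i w) (at z within half i)"

lemma half_inv: "i \<in> idx N ==> z \<in> half i ==> inv_pair i z = (fst z, inv_chart i (snd z)) \<and>
  a \<le> fst z \<and> inv_chart i (snd z) \<in> cdom N i \<and> chart M i (inv_pair i z) = z"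
 by (auto simp: inv_pair_def)

lemma smooth_form_Ck:
 assumes "smooth_form M k u" "i \<in> idx N"
 shows "Ck_on n (half i) (loc u i w)"
proof -
 have "smooth_on (half i) (\<lambda>y. u i (chart_inv M i y) w)"
  using assms unfolding smooth_form_def M_simps(3) chart_im_M by blast
 hence "Ck_on n (half i) (\<lambda>y. u i (chart_inv M i y) w)" by (simp add: smooth_on_def)
 thus ?thesis
  by (rule Ck_on_cong) (use chart_inv_M[OF assms(2)] in "auto simp: loc_def inv_pair_def")
qed

lemma smooth_form_is_form: "smooth_form M k u ==> is_form M k u"
 by (simp add: smooth_form_def)

lemma dloc_eq: "i \<in> idx N ==> z \<in> half i ==> (loc u i w has_derivative D) (at z within half i) ==> dloc u i w z = D"
 unfolding dloc_def by (rule frechet_derivative_half_space) (auto intro: open_chart_im)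

lemma loc_partials:
 assumes "smooth_form M k u" "i \<in> idx N"
 obtains f' where "partials_on (half i) (loc u i w) f'" "\<And>b. b \<in> Basis ==> continuous_on (half i) (f' b)"
  "\<And>z d. z \<in> half i ==> dloc u i w z d = (\<Sum>b\<in>Basis. (d \<bullet> b) *\<^sub>R f' b z)"
proof -
 obtain f' where f': "partials_on (half i) (loc u i w) f'" "\<forall>b\<in>Basis. Ck_on 0 (half i) (f' b)"
  using smooth_form_Ck[OF assms, of "Suc 0" w] unfolding Ck_on_Suc_iff by blast
 show thesis
 proof (rule that[OF f'(1)])
  show "continuous_on (half i) (f' b)" if "b \<in> Basis" for b using f'(2) that by simp
  fix z d assume z: "z \<in> half i"
  have "dloc u i w z = (\<lambda>v. \<Sum>b\<in>Basis. (v \<bullet> b) *\<^sub>R f' b z)"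
   by (rule dloc_eq[OF assms(2) z]) (use f'(1) z in "unfold partials_on_def, blast")
  thus "dloc u i w z d = (\<Sum>b\<in>Basis. (d \<bullet> b) *\<^sub>R f' b z)" by simp
 qed
qed

lemma loc_has_derivative:
 assumes "smooth_form M k u" "i \<in> idx N" "z \<in> half i"
 shows "(loc u i w has_derivative dloc u i w z) (at z within half i)"
proof -
 obtain f' where "partials_on (half i) (loc u i w) f'"
  by (rule loc_partials[OF assms(1,2)])
 hence "\<exists>D. (loc u i w has_derivative D) (at z within half i)"
  using assms(3) unfolding partials_on_def by blast
 thus ?thesis using dloc_eq[OF assms(2,3)] by metis
qed

lemma continuous_dloc:
 assumes "smooth_form M k u" "i \<in> idx N"
 shows "continuous_on (half i) (\<lambda>z. dloc u i w z d)"
proof -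
 obtain f' where f': "\<And>b. b \<in> Basis ==> continuous_on (half i) (f' b)"
  "\<And>z d. z \<in> half i ==> dloc u i w z d = (\<Sum>b\<in>Basis. (d \<bullet> b) *\<^sub>R f' b z)"
  by (rule loc_partials[OF assms, of w]) blast
 have "continuous_on (half i) (\<lambda>z. \<Sum>b\<in>Basis. (d \<bullet> b) *\<^sub>R f' b z)"
  by (intro continuous_intros f'(1))
 thus ?thesis by (rule continuous_on_eq) (simp add: f'(2))
qed

lemma alternating_loc: "is_form M k u ==> i \<in> idx N ==> z \<in> half i ==> alternating k (\<lambda>w. loc u i w z)"
 unfolding loc_def inv_pair_def by (rule is_formD(1)) auto

lemma linear_dloc:
 assumes "smooth_form M k u" "i \<in> idx N" "z \<in> half i"
 shows "linear (dloc u i w z)"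
 using loc_has_derivative[OF assms] has_derivative_linear by blast

text \<open>Every identity that holds for the coefficients at all points of the half-space passes to
  their derivatives, by uniqueness of the derivative.\<close>

lemma alternating_dloc:
 assumes u: "smooth_form M k u" and i: "i \<in> idx N" and z: "z \<in> half i"
 shows "alternating k (\<lambda>w. dloc u i w z d)"
 unfolding alternating_def
proof (intro conjI allI impI)
 have alt: "alternating k (\<lambda>w. loc u i w z)" if "z \<in> half i" for z
  by (rule alternating_loc[OF smooth_form_is_form[OF u] i that])
 note D = loc_has_derivative[OF u i z]
 fix v :: "nat => real \<times> 'e" and p assume p: "p < k"
 have lin: "linear (\<lambda>x. loc u i (v(p := x)) z)" if "z \<in> half i" for z
  by (rule alternating_linear[OF alt[OF that] p])
 have add: "dloc u i (v(p := x + y)) z d = dloc u i (v(p := x)) z d + dloc u i (v(p := y)) z d" for x y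
 proof -
  have "(loc u i (v(p := x + y)) has_derivative (\<lambda>d. dloc u i (v(p := x)) z d + dloc u i (v(p := y)) z d)) (at z within half i)"
   by (rule has_derivative_transform[OF z _ has_derivative_add[OF D D]]) (use linear_add[OF lin] in blast)
  from dloc_eq[OF i z this] show ?thesis by simp
 qed
 have scale: "dloc u i (v(p := c *\<^sub>R x)) z d = c * dloc u i (v(p := x)) z d" for c x
 proof -
  have "(loc u i (v(p := c *\<^sub>R x)) has_derivative (\<lambda>d. c * dloc u i (v(p := x)) z d)) (at z within half i)"
   by (rule has_derivative_transform[OF z _ has_derivative_mult_right[OF D]])
     (use linear_scale[OF lin] in simp)
  from dloc_eq[OF i z this] show ?thesis by simp
 qed
 show "linear (\<lambda>x. dloc u i (v(p := x)) z d)" by (rule linearI) (simp_all add: add scale)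
next
 have zero: "dloc u i v z d = 0" if "\<And>z. z \<in> half i ==> loc u i v z = 0" for v
 proof -
  have "(loc u i v has_derivative (\<lambda>d. 0)) (at z within half i)"
   by (rule has_derivative_transform[OF z that has_derivative_const])
  from dloc_eq[OF i z this] show ?thesis by simp
 qed
 have alt: "alternating k (\<lambda>w. loc u i w z)" if "z \<in> half i" for z
  by (rule alternating_loc[OF smooth_form_is_form[OF u] i that])
 fix v :: "nat => real \<times> 'e" and p q assume pq: "p < q" "q < k" "v p = v q"
 show "dloc u i v z d = 0"
  by (rule zero, rule alternating_eq_zero[OF alt, of _ p q]) (use pq in auto)
next
 have alt: "alternating k (\<lambda>w. loc u i w z)" if "z \<in> half i" for z
  by (rule alternating_loc[OF smooth_form_is_form[OF u] i that])
 fix v w :: "nat => real \<times> 'e" assume vw: "\<forall>i<k. v i = w i"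
 have "(loc u i v has_derivative dloc u i w z) (at z within half i)"
  by (rule has_derivative_transform[OF z _ loc_has_derivative[OF u i z]])
    (rule alternating_cong[OF alt], use vw in auto)
 from dloc_eq[OF i z this] show "dloc u i v z d = dloc u i w z d" by simp
qed

lemma ext_deriv_loc:
 assumes u: "smooth_form M k u" and i: "i \<in> idx N" and z: "z \<in> half i"
 shows "ext_deriv M k u i (inv_pair i z) v = (\<Sum>j\<le>k. (-1) ^ j * dloc u i (omit j v) z (v j))"
proof -
 note hz = half_inv[OF i z]
 have fd: "frechet_derivative (\<lambda>y. u i (chart_inv M i y) w) (at z within half i) = dloc u i w z" for w
 proof (rule frechet_derivative_half_space[OF _ open_chart_im[OF i] z])
  show "((\<lambda>y. u i (chart_inv M i y) w) has_derivative dloc u i w z) (at z within half i)"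
   by (rule has_derivative_transform[OF z _ loc_has_derivative[OF u i z]])
     (use chart_inv_M[OF i] in "auto simp: loc_def inv_pair_def")
 qed
 have c: "i \<in> idx M \<and> inv_pair i z \<in> cdom M i" using hz i by simp
 have cz: "chart M i (inv_pair i z) = z" using hz by blast
 show ?thesis
  unfolding ext_deriv_def chart_im_M cz fd if_P[OF c] omit_def ..
qed

text \<open>\<open>B\<close> is the second derivative of the transition map; its symmetry is that of
  the mixed partial derivatives of each component.\<close>

lemma TM_second_derivative:
 assumes ij: "i \<in> idx N" "j \<in> idx N" and z: "z \<in> {a..} \<times> overlap i j"
 obtains B where "\<And>w. ((\<lambda>z. TM i j (inv_chart i (snd z)) w) has_derivative (\<lambda>d. B d w)) (at z within {a..} \<times> overlap i j)"
  "\<And>d w. B d w = B w d"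
proof -
 let ?W = "overlap i j" and ?\<phi> = "transition N i j"
 have op: "open ?W" by (rule open_overlap[OF ij])
 have y: "snd z \<in> ?W" using z by auto
 have "Ck_on (Suc (Suc 0)) ?W ?\<phi>" using smooth_transition[OF ij] by (simp add: smooth_on_def)
 then obtain f' where f': "partials_on ?W ?\<phi> f'" "\<And>b. b \<in> Basis ==> Ck_on (Suc 0) ?W (f' b)"
  unfolding Ck_on_Suc_iff[of "Suc 0"] by blast
 hence "\<forall>b. \<exists>g. b \<in> Basis --> partials_on ?W (f' b) g \<and> (\<forall>c\<in>Basis. continuous_on ?W (g c))"
  unfolding Ck_on_Suc_iff Ck_on.simps(1) by blast
 then obtain f'' where f'': "\<And>b. b \<in> Basis ==> partials_on ?W (f' b) (f'' b)"
  "\<And>b c. b \<in> Basis ==> c \<in> Basis ==> continuous_on ?W (f'' b c)" by metis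
 have TN: "TN i j (inv_chart i y) v = (\<Sum>b\<in>Basis. (v \<bullet> b) *\<^sub>R f' b y)" if y: "y \<in> ?W" for y v
 proof -
  have yc: "y \<in> chart_im i" "inv_chart i y \<in> cdom N j" "inv_chart i y \<in> cdom N i"
   using y ij by (auto simp: overlap_eq)
  have "(?\<phi> has_derivative TN i j (inv_chart i y)) (at y)"
   using transition_has_derivative[OF ij yc(3,2)] yc ij by simp
  moreover have "(?\<phi> has_derivative (\<lambda>v. \<Sum>b\<in>Basis. (v \<bullet> b) *\<^sub>R f' b y)) (at y)"
   using f'(1)[unfolded partials_on_def, rule_format, OF y] by (simp only: at_within_open[OF y op])
  ultimately have "TN i j (inv_chart i y) = (\<lambda>v. \<Sum>b\<in>Basis. (v \<bullet> b) *\<^sub>R f' b y)" by (rule has_derivative_unique)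
  thus ?thesis by simp
 qed
 \<comment> \<open>The axis component is zero because \<open>TM\<close> is the identity there, and
   only spatial components of \<open>d\<close> enter because \<open>TM\<close> does not depend on
   \<open>t\<close>.\<close>
 define B where "B d w = ((0::real), \<Sum>b\<in>Basis. (snd w \<bullet> b) *\<^sub>R (\<Sum>c\<in>Basis. (snd d \<bullet> c) *\<^sub>R f'' b c (snd z)))" for d w :: "real \<times> 'e"
 show thesis
 proof (rule that)
  fix w :: "real \<times> 'e"
  have "((\<lambda>z. f' b (snd z)) has_derivative (\<lambda>d. \<Sum>c\<in>Basis. (snd d \<bullet> c) *\<^sub>R f'' b c (snd z))) (at z within {a..} \<times> ?W)"
   if b: "b \<in> Basis" for b
  proof -
   have "(f' b has_derivative (\<lambda>v. \<Sum>c\<in>Basis. (v \<bullet> c) *\<^sub>R f'' b c (snd z))) (at (snd z))"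
    using f''(1)[OF b, unfolded partials_on_def, rule_format, OF y] by (simp only: at_within_open[OF y op])
   thus ?thesis
    by (rule has_derivative_compose[OF has_derivative_snd[OF has_derivative_ident]])
  qed
  hence "((\<lambda>z. (fst w, \<Sum>b\<in>Basis. (snd w \<bullet> b) *\<^sub>R f' b (snd z))) has_derivative (\<lambda>d. B d w)) (at z within {a..} \<times> ?W)"
   unfolding B_def
   by (intro has_derivative_Pair has_derivative_const has_derivative_sum has_derivative_scaleR_right)
  thus "((\<lambda>z. TM i j (inv_chart i (snd z)) w) has_derivative (\<lambda>d. B d w)) (at z within {a..} \<times> ?W)"
   by (rule has_derivative_transform[OF z, rotated]) (auto simp: TM_def TN case_prod_beta)
 next
  fix d w :: "real \<times> 'e"
  have sym: "f'' b c (snd z) = f'' c b (snd z)" if bc: "b \<in> Basis" "c \<in> Basis" for b c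
  proof (rule euclidean_eqI)
   fix e :: 'e assume e: "e \<in> Basis"
   have inn: "partials_on ?W (\<lambda>x. g x \<bullet> e) (\<lambda>b x. g' b x \<bullet> e)" if "partials_on ?W g g'" for g :: "'e => 'e" and g'
    unfolding partials_on_def
   proof
    fix x assume "x \<in> ?W"
    hence "(g has_derivative (\<lambda>v. \<Sum>b\<in>Basis. (v \<bullet> b) *\<^sub>R g' b x)) (at x within ?W)"
     using that unfolding partials_on_def by auto
    from has_derivative_inner_left[OF this, of e]
    show "((\<lambda>x. g x \<bullet> e) has_derivative (\<lambda>v. \<Sum>b\<in>Basis. (v \<bullet> b) *\<^sub>R (g' b x \<bullet> e))) (at x within ?W)"
     by (simp add: inner_sum_left)
   qed
   show "f'' b c (snd z) \<bullet> e = f'' c b (snd z) \<bullet> e"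
    by (rule second_partials_symmetric[OF op y bc inn[OF f'(1)], where f'' = "\<lambda>b c x. f'' b c x \<bullet> e"])
      (auto intro!: inn f'' continuous_intros)
  qed
  have "(\<Sum>b\<in>Basis. (snd w \<bullet> b) *\<^sub>R (\<Sum>c\<in>Basis. (snd d \<bullet> c) *\<^sub>R f'' b c (snd z))) =
    (\<Sum>b\<in>Basis. \<Sum>c\<in>Basis. ((snd w \<bullet> b) * (snd d \<bullet> c)) *\<^sub>R f'' b c (snd z))"
   by (simp add: scaleR_sum_right)
  also have "... = (\<Sum>c\<in>Basis. \<Sum>b\<in>Basis. ((snd w \<bullet> b) * (snd d \<bullet> c)) *\<^sub>R f'' b c (snd z))"
   by (rule sum.swap)
  also have "... = (\<Sum>c\<in>Basis. \<Sum>b\<in>Basis. ((snd d \<bullet> c) * (snd w \<bullet> b)) *\<^sub>R f'' c b (snd z))"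
   by (intro sum.cong refl) (simp add: sym mult.commute)
  also have "... = (\<Sum>b\<in>Basis. (snd d \<bullet> b) *\<^sub>R (\<Sum>c\<in>Basis. (snd w \<bullet> c) *\<^sub>R f'' b c (snd z)))"
   by (simp add: scaleR_sum_right)
  finally show "B d w = B w d" by (simp add: B_def)
 qed
qed

text \<open>The exterior derivative commutes with changes of chart. This makes
  \<open>ext_deriv\<close> of a smooth form a form, as needed in order to pair it with other
  forms.\<close>

lemma ext_deriv_natural:
 assumes u: "smooth_form M k u" and ij: "i \<in> idx N" "j \<in> idx N" and x: "x \<in> cdom N i" "x \<in> cdom N j" and t: "a \<le> t"
 shows "ext_deriv M k u i (t, x) v = ext_deriv M k u j (t, x) (\<lambda>l. TM i j x (v l))"
proof -
 note form = smooth_form_is_form[OF u]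
 let ?S = "{a..} \<times> overlap i j" and ?\<Phi> = "transition M i j"
 define z where "z = (t, chart N i x)"
 have zS: "z \<in> ?S" using t chart_in_overlap[OF x] by (simp add: z_def)
 have S_half: "?S \<subseteq> half i" using overlap_subset[of i j] by auto
 have zi: "z \<in> half i" using zS S_half by blast
 have ipz: "inv_pair i z = (t, x)" using x ij by (simp add: z_def inv_pair_def)
 have \<Phi>: "?\<Phi> z' \<in> half j \<and> inv_pair j (?\<Phi> z') = inv_pair i z'" if "z' \<in> ?S" for z'
 proof -
  have c: "snd z' \<in> chart_im i" "inv_chart i (snd z') \<in> cdom N j" "a \<le> fst z'"
  proof -
   have "snd z' \<in> overlap i j" "a \<le> fst z'" using that by auto
   thus "snd z' \<in> chart_im i" "inv_chart i (snd z') \<in> cdom N j" "a \<le> fst z'"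
    unfolding overlap_eq[OF ij(1)] by simp_all
  qed
  have "?\<Phi> z' = (fst z', chart N j (inv_chart i (snd z')))"
   using transition_M[OF ij that] by (simp add: transition_def)
  thus ?thesis using c ij by (simp add: inv_pair_def)
 qed
 define z2 where "z2 = ?\<Phi> z"
 have z2: "z2 \<in> half j" "inv_pair j z2 = (t, x)" using \<Phi>[OF zS] ipz by (auto simp: z2_def)
 let ?A = "TM i j x"
 obtain B where B: "\<And>w. ((\<lambda>z. TM i j (inv_chart i (snd z)) w) has_derivative (\<lambda>d. B d w)) (at z within ?S)"
  "\<And>d w. B d w = B w d"
  using TM_second_derivative[OF ij zS] by blast
 have Az: "TM i j (inv_chart i (snd z)) = ?A" using x ij by (simp add: z_def)
 \<comment> \<open>Chain rule in the overlap: the first term is the transformed derivative, the sum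
   comes from differentiating the Jacobian inside the arguments and cancels after
   antisymmetrization.\<close>
 have key: "dloc u i w z d = dloc u j (\<lambda>l. ?A (w l)) z2 (?A d) + (\<Sum>p<k. loc u j ((\<lambda>q. ?A (w q))(p := B d (w p))) z2)" for w d
 proof -
  have "((\<lambda>z. loc u j (\<lambda>p. TM i j (inv_chart i (snd z)) (w p)) (?\<Phi> z)) has_derivative
    (\<lambda>d. dloc u j (\<lambda>p. TM i j (inv_chart i (snd z)) (w p)) z2 (?A d) +
     (\<Sum>p<k. loc u j ((\<lambda>q. TM i j (inv_chart i (snd z)) (w q))(p := B d (w p))) (?\<Phi> z)))) (at z within ?S)"
  proof (rule has_derivative_alternating_compose[where S' = "half j" and F = "\<lambda>y w. loc u j w y"])
   show "z \<in> ?S" by (rule zS)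
   show "?\<Phi> z' \<in> half j" if "z' \<in> ?S" for z' using \<Phi>[OF that] by blast
   show "alternating k (\<lambda>w. loc u j w y)" if "y \<in> half j" for y by (rule alternating_loc[OF form ij(2) that])
   show "alternating k (\<lambda>e. dloc u j e z2 d)" for d by (rule alternating_dloc[OF u ij(2) z2(1)])
   show "((\<lambda>y. loc u j e y) has_derivative dloc u j e z2) (at (?\<Phi> z) within half j)" for e
    using loc_has_derivative[OF u ij(2) z2(1), of e] by (simp add: z2_def)
   show "(?\<Phi> has_derivative ?A) (at z within ?S)"
    unfolding z_def by (rule transition_M_has_derivative[OF ij x t])
   show "((\<lambda>z. TM i j (inv_chart i (snd z)) (w p)) has_derivative (\<lambda>d. B d (w p))) (at z within ?S)" for p
    by (rule B(1))
  qed
  hence D1: "(loc u i w has_derivative (\<lambda>d. dloc u j (\<lambda>l. ?A (w l)) z2 (?A d) + (\<Sum>p<k. loc u j ((\<lambda>q. ?A (w q))(p := B d (w p))) z2))) (at z within ?S)"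
   unfolding Az z2_def[symmetric]
  proof (rule has_derivative_transform[OF zS, rotated])
   fix z' assume z': "z' \<in> ?S"
   have "snd z' \<in> overlap i j" and c4: "a \<le> fst z'" using z' by auto
   hence c: "snd z' \<in> chart_im i" "inv_chart i (snd z') \<in> cdom N j" "inv_chart i (snd z') \<in> cdom N i" "a \<le> fst z'"
    unfolding overlap_eq[OF ij(1)] using ij(1) by simp_all
   show "loc u i w z' = loc u j (\<lambda>p. TM i j (inv_chart i (snd z')) (w p)) (?\<Phi> z')"
    unfolding loc_def conjunct2[OF \<Phi>[OF z']] unfolding inv_pair_def
    by (rule is_formD(3)[OF form ij c(3,2,4)])
  qed
  have D2: "(loc u i w has_derivative dloc u i w z) (at z within ?S)"
   by (rule has_derivative_subset[OF loc_has_derivative[OF u ij(1) zi] S_half])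
  from frechet_derivative_half_space[OF D1 open_overlap[OF ij] zS] frechet_derivative_half_space[OF D2 open_overlap[OF ij] zS]
  show ?thesis by simp
 qed
 have "ext_deriv M k u i (t, x) v = (\<Sum>q\<le>k. (-1) ^ q * dloc u i (omit q v) z (v q))"
  using ext_deriv_loc[OF u ij(1) zi, of v] by (simp add: ipz)
 also have "... = (\<Sum>q\<le>k. (-1) ^ q * dloc u j (omit q (\<lambda>l. ?A (v l))) z2 (?A (v q))) +
   (\<Sum>q\<le>k. \<Sum>p<k. (-1) ^ q * loc u j ((omit q (\<lambda>l. ?A (v l)))(p := B (v q) (v (if p < q then p else Suc p)))) z2)"
  unfolding key distrib_left sum.distrib sum_distrib_left by (simp add: omit_def)
 also have "(\<Sum>q\<le>k. \<Sum>p<k. (-1) ^ q * loc u j ((omit q (\<lambda>l. ?A (v l)))(p := B (v q) (v (if p < q then p else Suc p)))) z2) = 0"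
  by (rule alternating_symmetric_cancel[OF alternating_loc[OF form ij(2) z2(1)], where \<beta> = "\<lambda>q p. B (v q) (v p)"]) (rule B(2))
 also have "(\<Sum>q\<le>k. (-1) ^ q * dloc u j (omit q (\<lambda>l. ?A (v l))) z2 (?A (v q))) = ext_deriv M k u j (t, x) (\<lambda>l. ?A (v l))"
  using ext_deriv_loc[OF u ij(2) z2(1), of "\<lambda>l. ?A (v l)"] by (simp add: z2(2))
 finally show ?thesis by simp
qed

lemma is_form_ext_deriv:
 assumes u: "smooth_form M k u"
 shows "is_form M (Suc k) (ext_deriv M k u)"
 unfolding is_form_M_iff
proof (intro conjI ballI allI impI)
 fix i x t assume i: "i \<in> idx N" "x \<in> cdom N i" "a \<le> t"
 define z where "z = (t, chart N i x)"
 have z: "z \<in> half i" "inv_pair i z = (t, x)" using i by (auto simp: z_def inv_pair_def)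
 have "ext_deriv M k u i (t, x) = (\<lambda>v. \<Sum>j\<le>k. (-1) ^ j * dloc u i (omit j v) z (v j))"
  using ext_deriv_loc[OF u i(1) z(1)] z(2) by (simp add: fun_eq_iff)
 thus "alternating (Suc k) (ext_deriv M k u i (t, x))"
  using alternating_ext_sum[of k "\<lambda>w. dloc u i w z"] alternating_dloc[OF u i(1) z(1)] linear_dloc[OF u i(1) z(1)] by simp
next
 fix i t x assume "\<not> (i \<in> idx N \<and> a \<le> t \<and> x \<in> cdom N i)"
 thus "ext_deriv M k u i (t, x) = (\<lambda>v. 0)" by (auto simp: ext_deriv_def fun_eq_iff)
next
 fix i j x t v assume "i \<in> idx N" "j \<in> idx N" "x \<in> cdom N i \<inter> cdom N j" "a \<le> t"
 thus "ext_deriv M k u i (t, x) v = ext_deriv M k u j (t, x) (\<lambda>l. TM i j x (v l))"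
  using ext_deriv_natural[OF u] by blast
qed

end

context cyl_cover
begin

lemma continuous_form_smooth: "smooth_form M k u ==> continuous_form u"
 unfolding continuous_form_def using Ck_on_continuous[OF smooth_form_Ck] by (auto simp: loc_def[abs_def])

lemma continuous_form_ext_deriv:
 assumes u: "smooth_form M k u"
 shows "continuous_form (ext_deriv M k u)"
 unfolding continuous_form_def
proof (intro ballI allI)
 fix i v assume i: "i \<in> idx N"
 have "continuous_on (half i) (\<lambda>z. \<Sum>j\<le>k. (-1) ^ j * dloc u i (omit j v) z (v j))"
  by (intro continuous_intros continuous_dloc[OF u i])
 thus "continuous_on (half i) (\<lambda>z. ext_deriv M k u i (inv_pair i z) v)"
  by (rule continuous_on_eq) (simp add: ext_deriv_loc[OF u i])
qed

end

section \<open>Integration along the cylinder\<close>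

lemma set_integrable_bounded_mult:
 fixes f g :: "real => real"
 assumes g: "set_integrable lborel S g" and f: "f \<in> borel_measurable borel" "\<And>s. \<bar>f s\<bar> \<le> B"
 shows "set_integrable lborel S (\<lambda>s. f s * g s)"
proof -
 have gm: "(\<lambda>s. indicator S s *\<^sub>R g s) \<in> borel_measurable lborel"
  using g unfolding set_integrable_def by (rule borel_measurable_integrable)
 have "integrable lborel (\<lambda>s. f s * (indicator S s *\<^sub>R g s))"
 proof (rule Bochner_Integration.integrable_bound)
  show "integrable lborel (\<lambda>s. B * (indicator S s *\<^sub>R g s))"
   using g unfolding set_integrable_def by (intro integrable_mult_right) simp
  show "(\<lambda>s. f s * (indicator S s *\<^sub>R g s)) \<in> borel_measurable lborel"
   using f(1) gm by (intro borel_measurable_times) simp_all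
  have "\<bar>f s\<bar> \<le> \<bar>B\<bar>" for s using f(2)[of s] by linarith
  hence "\<bar>f s\<bar> * \<bar>c\<bar> \<le> \<bar>B\<bar> * \<bar>c\<bar>" for s c by (rule mult_right_mono) simp
  thus "AE s in lborel. norm (f s * (indicator S s *\<^sub>R g s)) \<le> norm (B * (indicator S s *\<^sub>R g s))"
   unfolding real_norm_def abs_mult by simp
 qed
 moreover have "(\<lambda>s. f s * (indicator S s *\<^sub>R g s)) = (\<lambda>s. indicator S s *\<^sub>R (f s * g s))"
  by (simp add: fun_eq_iff)
 ultimately show ?thesis by (simp add: set_integrable_def)
qed

text \<open>Both products have the same integral, namely that of \<open>f s * g t\<close> over the
  triangle \<open>a \<le> t \<le> s \<le> b\<close>. This moves an integral from the test form to
  the form paired with it.\<close>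

lemma triangle_fubini:
 fixes f g :: "real => real"
 assumes f: "set_integrable lborel {a..b} f" and g: "continuous_on {a..b} g"
 shows "has_bochner_integral lborel
  (\<lambda>t. indicator {a..b} t * (f t * integral {a..t} g - (LINT s:{t..b}|lborel. f s) * g t)) 0"
proof -
 define f1 where "f1 s = indicator {a..b} s * f s" for s
 define g1 where "g1 t = indicator {a..b} t * g t" for t
 \<comment> \<open>Integration over \<open>s\<close> first produces the tail of \<open>f\<close>,
   integration over \<open>t\<close> first the primitive of \<open>g\<close>.\<close>
 define H where "H t s = indicator {(t, s). t \<le> s} (t, s) * (f1 s * g1 t)" for t s
 have gi: "set_integrable lborel {a..t} g" if "t \<le> b" for t
  unfolding set_integrable_def using that
  by (intro borel_integrable_compact) (auto intro: continuous_on_subset[OF g])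
 have f1: "integrable lborel f1" using f by (simp add: f1_def[abs_def] set_integrable_def)
 have g1: "integrable lborel g1" using gi[of b] by (simp add: g1_def[abs_def] set_integrable_def)
 have fm [measurable]: "f1 \<in> borel_measurable borel" and gm [measurable]: "g1 \<in> borel_measurable borel"
  using borel_measurable_integrable[OF f1] borel_measurable_integrable[OF g1] by simp_all
 have [measurable]: "{(t, s). t \<le> (s::real)} \<in> sets (lborel \<Otimes>\<^sub>M lborel)"
  unfolding lborel_prod sets_lborel case_prod_unfold
  by (intro borel_closed closed_Collect_le continuous_intros)
 have Hm: "case_prod H \<in> borel_measurable (lborel \<Otimes>\<^sub>M lborel)"
  unfolding H_def case_prod_unfold by measurable
 have Hs: "integrable lborel (H t)" for t
 proof (rule Bochner_Integration.integrable_bound)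
  show "integrable lborel (\<lambda>s. g1 t * f1 s)" using f1 by simp
  show "H t \<in> borel_measurable lborel" using measurable_compose[OF measurable_Pair1' Hm, of t] by (simp add: case_prod_unfold)
  show "AE s in lborel. norm (H t s) \<le> norm (g1 t * f1 s)" by (simp add: H_def abs_mult indicator_def)
 qed
 have int_norm: "integrable lborel (\<lambda>t. \<integral>s. norm (H t s) \<partial>lborel)"
 proof (rule Bochner_Integration.integrable_bound)
  show "integrable lborel (\<lambda>t. (\<integral>s. \<bar>f1 s\<bar> \<partial>lborel) * \<bar>g1 t\<bar>)" using g1 by simp
  show "(\<lambda>t. \<integral>s. norm (H t s) \<partial>lborel) \<in> borel_measurable lborel"
  proof (rule lborel.borel_measurable_lebesgue_integral)
   show "(\<lambda>(t, s). norm (H t s)) \<in> borel_measurable (lborel \<Otimes>\<^sub>M lborel)"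
    using measurable_compose[OF Hm borel_measurable_norm] by (simp add: case_prod_unfold)
  qed
  show "AE t in lborel. norm (\<integral>s. norm (H t s) \<partial>lborel) \<le> norm ((\<integral>s. \<bar>f1 s\<bar> \<partial>lborel) * \<bar>g1 t\<bar>)"
  proof (rule AE_I2)
   fix t
   have "(\<integral>s. norm (H t s) \<partial>lborel) \<le> (\<integral>s. \<bar>f1 s\<bar> * \<bar>g1 t\<bar> \<partial>lborel)"
    using f1 by (intro integral_mono integrable_norm Hs integrable_mult_left integrable_abs) (auto simp: H_def abs_mult indicator_def)
   moreover have "0 \<le> (\<integral>s. norm (H t s) \<partial>lborel)" by (rule lint_nonneg) simp
   ultimately show "norm (\<integral>s. norm (H t s) \<partial>lborel) \<le> norm ((\<integral>s. \<bar>f1 s\<bar> \<partial>lborel) * \<bar>g1 t\<bar>)"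
    by simp
  qed
 qed
 have H: "integrable (lborel \<Otimes>\<^sub>M lborel) (case_prod H)"
  by (rule lborel_pair.Fubini_integrable[OF Hm]) (use int_norm Hs in "simp_all")
 have in_s: "(\<integral>s. H t s \<partial>lborel) = indicator {a..b} t * ((LINT s:{t..b}|lborel. f s) * g t)" for t
 proof -
  have "H t = (\<lambda>s. (indicator {a..b} t * g t) * (indicator {t..b} s *\<^sub>R f s))"
   by (auto simp: H_def f1_def g1_def fun_eq_iff indicator_def)
  thus ?thesis by (simp add: set_lebesgue_integral_def)
 qed
 have in_t: "(\<integral>t. H t s \<partial>lborel) = indicator {a..b} s * (f s * integral {a..s} g)" for s
 proof (cases "s \<in> {a..b}")
  case True
  have "(\<lambda>t. H t s) = (\<lambda>t. f s * (indicator {a..s} t *\<^sub>R g t))"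
   using True by (auto simp: H_def f1_def g1_def fun_eq_iff indicator_def)
  hence "(\<integral>t. H t s \<partial>lborel) = f s * (LINT t:{a..s}|lborel. g t)" by (simp add: set_lebesgue_integral_def)
  also have "(LINT t:{a..s}|lborel. g t) = integral {a..s} g"
   using gi[of s] True by (intro set_borel_integral_eq_integral) simp
  finally show ?thesis using True by simp
 qed (simp add: H_def f1_def)
 have 1: "has_bochner_integral lborel (\<lambda>s. \<integral>t. H t s \<partial>lborel) (\<integral>t. (\<integral>s. H t s \<partial>lborel) \<partial>lborel)"
  using lborel_pair.Fubini_integral[of H] H lborel_pair.integrable_snd[of H]
  by (simp add: has_bochner_integral_iff)
 have 2: "has_bochner_integral lborel (\<lambda>t. \<integral>s. H t s \<partial>lborel) (\<integral>t. (\<integral>s. H t s \<partial>lborel) \<partial>lborel)"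
  using lborel_pair.integrable_fst'[OF H] by (simp add: has_bochner_integral_iff)
 show ?thesis
  using has_bochner_integral_diff[OF 1 2] unfolding in_s in_t by (simp add: algebra_simps)
qed

section \<open>Splitting off the axis direction, and fibre integrals\<close>

definition spatial :: "(nat => real \<times> 'v::real_vector) => nat => real \<times> 'v" where
 "spatial v = (\<lambda>j. (0, snd (v j)))"

lemma alternating_cons:
 assumes A: "alternating (Suc k) \<alpha>"
 shows "alternating k (\<lambda>v. \<alpha> (case_nat e v))"
 unfolding alternating_def
proof (intro conjI allI impI)
 fix v :: "nat => 'a" and i assume "i < k"
 moreover have "case_nat e (v(i := x)) = (case_nat e v)(Suc i := x)" for x by (auto simp: fun_eq_iff split: nat.split)
 ultimately show "linear (\<lambda>x. \<alpha> (case_nat e (v(i := x))))"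
  using alternating_linear[OF A, of "Suc i" "case_nat e v"] by simp
next
 fix v :: "nat => 'a" and i j assume "i < j" "j < k" "v i = v j"
 thus "\<alpha> (case_nat e v) = 0" by (intro alternating_eq_zero[OF A, of "Suc i" "Suc j"]) auto
next
 fix v w :: "nat => 'a" assume "\<forall>i<k. v i = w i"
 thus "\<alpha> (case_nat e v) = \<alpha> (case_nat e w)"
  by (intro alternating_cong[OF A]) (auto split: nat.split)
qed

lemma alternating_snoc:
 assumes A: "alternating (Suc k) \<alpha>"
 shows "alternating k (\<lambda>v. \<alpha> (v(k := e)))"
 unfolding alternating_def
proof (intro conjI allI impI)
 fix v :: "nat => 'a" and i assume i: "i < k"
 have "(v(i := x))(k := e) = (v(k := e))(i := x)" for x using i by (intro fun_upd_twist) simp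
 thus "linear (\<lambda>x. \<alpha> ((v(i := x))(k := e)))"
  using alternating_linear[OF A, of i "v(k := e)"] i by simp
next
 fix v :: "nat => 'a" and i j assume "i < j" "j < k" "v i = v j"
 thus "\<alpha> (v(k := e)) = 0" by (intro alternating_eq_zero[OF A, of i j]) auto
next
 fix v w :: "nat => 'a" assume "\<forall>i<k. v i = w i"
 thus "\<alpha> (v(k := e)) = \<alpha> (w(k := e))" by (intro alternating_cong[OF A]) auto
qed

lemma alternating_spatial:
 fixes \<alpha> :: "(nat => real \<times> 'v::real_vector) => real"
 assumes "alternating k \<alpha>"
 shows "alternating k (\<lambda>v. \<alpha> (spatial v))"
 unfolding spatial_def
 by (rule alternating_compose_linear[OF assms]) (auto intro!: linearI simp: algebra_simps)

text \<open>Integrability is assumed for all argument lists, so that additivity in each slot passes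
  through the integral.\<close>

lemma alternating_LINT:
 fixes S :: "real set"
 assumes A: "\<And>s. s \<in> S ==> alternating k (\<alpha> s)" and int: "\<And>v. set_integrable lborel S (\<lambda>s. \<alpha> s v)"
  and S: "S \<in> sets borel"
 shows "alternating k (\<lambda>v. LINT s:S|lborel. \<alpha> s v)"
 unfolding alternating_def
proof (intro conjI allI impI)
 fix v :: "nat => 'a" and i assume i: "i < k"
 have L: "linear (\<lambda>x. \<alpha> s (v(i := x)))" if "s \<in> S" for s by (rule alternating_linear[OF A[OF that] i])
 show "linear (\<lambda>x. LINT s:S|lborel. \<alpha> s (v(i := x)))"
 proof (rule linearI)
  fix x y :: 'a
  have "(LINT s:S|lborel. \<alpha> s (v(i := x + y))) = (LINT s:S|lborel. \<alpha> s (v(i := x)) + \<alpha> s (v(i := y)))"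
   using L S by (intro set_lebesgue_integral_cong) (auto simp: linear_add[OF L])
  thus "(LINT s:S|lborel. \<alpha> s (v(i := x + y))) = (LINT s:S|lborel. \<alpha> s (v(i := x))) + (LINT s:S|lborel. \<alpha> s (v(i := y)))"
   using set_integral_add(2)[OF int[of "v(i := x)"] int[of "v(i := y)"]] by simp
 next
  fix x :: 'a and c :: real
  have "(LINT s:S|lborel. \<alpha> s (v(i := c *\<^sub>R x))) = (LINT s:S|lborel. c *\<^sub>R \<alpha> s (v(i := x)))"
   using L S by (intro set_lebesgue_integral_cong) (auto simp: linear_scale[OF L])
  thus "(LINT s:S|lborel. \<alpha> s (v(i := c *\<^sub>R x))) = c *\<^sub>R (LINT s:S|lborel. \<alpha> s (v(i := x)))"
   by simp
 qed
next
 fix v :: "nat => 'a" and i j assume ij: "i < j" "j < k" "v i = v j"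
 have "(LINT s:S|lborel. \<alpha> s v) = (LINT s:S|lborel. 0)"
  using ij S by (intro set_lebesgue_integral_cong) (auto intro!: alternating_eq_zero[OF A, of _ i j])
 thus "(LINT s:S|lborel. \<alpha> s v) = 0" by simp
next
 fix v w :: "nat => 'a" assume vw: "\<forall>i<k. v i = w i"
 show "(LINT s:S|lborel. \<alpha> s v) = (LINT s:S|lborel. \<alpha> s w)"
  using vw S by (intro set_lebesgue_integral_cong) (auto intro!: alternating_cong[OF A])
qed

context cyl
begin

text \<open>Transition maps commute with the spatial projection and fix d/dt; hence the horizontal
  part and the contractions below are again forms.\<close>

lemma TM_simps:
 assumes "i \<in> idx N" "j \<in> idx N" "x \<in> cdom N i" "x \<in> cdom N j"
 shows "spatial (\<lambda>l. TM i j x (v l)) = (\<lambda>l. TM i j x (spatial v l))"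
  and "TM i j x (1, 0) = (1, 0)"
 using linear_0[OF linear_TN[OF assms]] by (auto simp: spatial_def TM_def case_prod_unfold fun_eq_iff)

definition hor :: "('i, 'a, 'e) cform => ('i, 'a, 'e) cform" where
 "hor \<xi> = (\<lambda>i z v. \<xi> i z (spatial v))"

definition con_first :: "('i, 'a, 'e) cform => ('i, 'a, 'e) cform" where
 "con_first \<xi> = (\<lambda>i z v. \<xi> i z (case_nat (1, 0) (spatial v)))"

text \<open>Contraction with d/dt in the last of the \<open>Suc k\<close> slots. In the wedge
  product d/dt then stands at the border of the two factors, where it can be counted with either of
  them without moving other arguments; the sign against contraction in the first slot is put into
  \<open>tail\<close> later.\<close>

definition con_last :: "nat => ('i, 'a, 'e) cform => ('i, 'a, 'e) cform" where
 "con_last k \<xi> = (\<lambda>i z v. \<xi> i z ((spatial v)(k := (1, 0))))"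

lemma is_form_pullback:
 assumes \<xi>: "is_form M k' \<xi>" and A: "\<And>\<alpha>. alternating k' \<alpha> ==> alternating k (\<lambda>v. \<alpha> (\<Phi> v))"
  and T: "\<And>i j x v. i \<in> idx N ==> j \<in> idx N ==> x \<in> cdom N i ==> x \<in> cdom N j ==>
   \<Phi> (\<lambda>l. TM i j x (v l)) = (\<lambda>l. TM i j x (\<Phi> v l))"
 shows "is_form M k (\<lambda>i z v. \<xi> i z (\<Phi> v))"
 unfolding is_form_M_iff
proof (intro conjI ballI allI impI)
 fix i x t assume "i \<in> idx N" "x \<in> cdom N i" "a \<le> t"
 thus "alternating k (\<lambda>v. \<xi> i (t, x) (\<Phi> v))" by (intro A is_formD[OF \<xi>])
next
 fix i t x assume "\<not> (i \<in> idx N \<and> a \<le> t \<and> x \<in> cdom N i)"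
 hence "\<xi> i (t, x) = (\<lambda>v. 0)" by (rule is_formD(2)[OF \<xi>])
 thus "(\<lambda>v. \<xi> i (t, x) (\<Phi> v)) = (\<lambda>v. 0)" by simp
next
 fix i j x t v assume "i \<in> idx N" "j \<in> idx N" "x \<in> cdom N i \<inter> cdom N j" "a \<le> t"
 thus "\<xi> i (t, x) (\<Phi> v) = \<xi> j (t, x) (\<Phi> (\<lambda>l. TM i j x (v l)))"
  using is_formD(3)[OF \<xi>, of i j x t "\<Phi> v"] T[of i j x v] by simp
qed

lemma is_form_hor: "is_form M k \<xi> ==> is_form M k (hor \<xi>)"
 unfolding hor_def by (rule is_form_pullback[OF _ alternating_spatial TM_simps(1)])

lemma is_form_con_first: "is_form M (Suc k) \<xi> ==> is_form M k (con_first \<xi>)"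
 unfolding con_first_def
proof (rule is_form_pullback)
 show "alternating k (\<lambda>v. \<alpha> (case_nat (1, 0) (spatial v)))" if "alternating (Suc k) \<alpha>" for \<alpha> :: "(nat => real \<times> 'e) => real"
  by (rule alternating_spatial[OF alternating_cons[OF that]])
qed (auto simp: TM_simps fun_eq_iff split: nat.split)

lemma is_form_con_last: "is_form M (Suc k) \<xi> ==> is_form M k (con_last k \<xi>)"
 unfolding con_last_def
proof (rule is_form_pullback)
 show "alternating k (\<lambda>v. \<alpha> ((spatial v)(k := (1, 0))))" if "alternating (Suc k) \<alpha>" for \<alpha> :: "(nat => real \<times> 'e) => real"
  by (rule alternating_spatial[OF alternating_snoc[OF that]])
qed (auto simp: TM_simps fun_eq_iff)

lemma form_zero_arg:
 assumes \<xi>: "is_form M k \<xi>" and j: "j < k" "v j = 0"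
 shows "\<xi> i z v = 0"
proof (cases "i \<in> idx N \<and> a \<le> fst z \<and> snd z \<in> cdom N i")
 case True
 hence "alternating k (\<xi> i z)" using is_formD(1)[OF \<xi>, of i "snd z" "fst z"] by simp
 thus ?thesis by (rule alternating_zero_arg) (use j in auto)
next
 case False
 thus ?thesis using is_formD(2)[OF \<xi>, of i "fst z" "snd z"] by simp
qed

definition fscale :: "(real => real) => ('i, 'a, 'e) cform => ('i, 'a, 'e) cform" where
 "fscale f \<xi> = (\<lambda>i z v. f (fst z) * \<xi> i z v)"

lemma is_form_fscale: "is_form M k \<xi> ==> is_form M k (fscale f \<xi>)"
 using is_form_lincomb[of k \<xi> \<xi> "\<lambda>z. f (fst z)" "\<lambda>z. 0"] by (simp add: fscale_def)

lemma is_form_diff: "is_form M k \<xi> ==> is_form M k \<theta> ==> is_form M k (form_diff \<xi> \<theta>)"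
 using is_form_lincomb[of k \<xi> \<theta> "\<lambda>z. 1" "\<lambda>z. -1"] by (simp add: form_diff_def)

text \<open>Integrability on every ray and not only on almost every one: \<open>tail\<close> has to
  be alternating and compatible with the charts at every point.\<close>

definition fibre_integrable :: "real => ('i, 'a, 'e) cform => bool" where
 "fibre_integrable b \<xi> \<longleftrightarrow>
   (\<forall>i\<in>idx N. \<forall>x\<in>cdom N i. \<forall>v. set_integrable lborel {a..b} (\<lambda>s. \<xi> i (s, x) v))"

text \<open>Both \<open>A\<close> and psi of the overview are tails, with \<open>f\<close> the bump
  and the signed cutoff respectively. For \<open>fst z > b\<close> the interval is empty, so tails
  vanish there.\<close>

definition tail :: "(real => real) => real => ('i, 'a, 'e) cform => ('i, 'a, 'e) cform" where
 "tail f b \<xi> = (\<lambda>i z v. if a \<le> fst z then LINT s:{fst z..b}|lborel. f s * \<xi> i (s, snd z) v else 0)"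

lemma fibre_integrable_con: 
 "fibre_integrable b \<xi> ==> fibre_integrable b (hor \<xi>)"
 "fibre_integrable b \<xi> ==> fibre_integrable b (con_last k \<xi>)"
 by (auto simp: fibre_integrable_def hor_def con_last_def)

lemma fibre_integrableD:
 assumes "fibre_integrable b \<xi>" "i \<in> idx N" "x \<in> cdom N i" "a \<le> t"
  "f \<in> borel_measurable borel" "\<And>s. \<bar>f s\<bar> \<le> B"
 shows "set_integrable lborel {t..b} (\<lambda>s. f s * \<xi> i (s, x) v)"
proof (rule set_integrable_subset)
 show "set_integrable lborel {a..b} (\<lambda>s. f s * \<xi> i (s, x) v)"
  by (rule set_integrable_bounded_mult) (use assms in "auto simp: fibre_integrable_def")
qed (use assms in auto)

lemma is_form_tail:
 assumes \<xi>: "is_form M k \<xi>" and F: "fibre_integrable b \<xi>"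
  and f: "f \<in> borel_measurable borel" "\<And>s. \<bar>f s\<bar> \<le> B"
 shows "is_form M k (tail f b \<xi>)"
 unfolding is_form_M_iff
proof (intro conjI ballI allI impI)
 fix i x t assume *: "i \<in> idx N" "x \<in> cdom N i" "a \<le> t"
 have "alternating k (\<lambda>v. LINT s:{t..b}|lborel. f s * \<xi> i (s, x) v)"
  by (rule alternating_LINT)
    (use * in "auto intro!: alternating_scale is_formD[OF \<xi>] fibre_integrableD[OF F _ _ _ f]")
 thus "alternating k (tail f b \<xi> i (t, x))" using * by (simp add: tail_def)
next
 fix i t x assume *: "\<not> (i \<in> idx N \<and> a \<le> t \<and> x \<in> cdom N i)"
 show "tail f b \<xi> i (t, x) = (\<lambda>v. 0)"
 proof (cases "a \<le> t")
  case True
  hence "\<xi> i (s, x) = (\<lambda>v. 0)" for s using is_formD(2)[OF \<xi>, of i s x] * by blast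
  thus ?thesis by (simp add: tail_def fun_eq_iff)
 qed (simp add: tail_def fun_eq_iff)
next
 fix i j x t v assume *: "i \<in> idx N" "j \<in> idx N" "x \<in> cdom N i \<inter> cdom N j" "a \<le> t"
 have "(LINT s:{t..b}|lborel. f s * \<xi> i (s, x) v) = (LINT s:{t..b}|lborel. f s * \<xi> j (s, x) (\<lambda>l. TM i j x (v l)))"
  using * by (intro set_lebesgue_integral_cong) (auto simp: is_formD(3)[OF \<xi>, of i j x _ v])
 thus "tail f b \<xi> i (t, x) v = tail f b \<xi> j (t, x) (\<lambda>l. TM i j x (v l))" by (simp add: tail_def)
qed

lemma measurable_tail:
 assumes \<xi>: "measurable_form M k \<xi>" and F: "fibre_integrable b \<xi>"
  and f: "f \<in> borel_measurable borel" "\<And>s. \<bar>f s\<bar> \<le> B"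
 shows "measurable_form M k (tail f b \<xi>)"
 unfolding measurable_form_iff
proof (intro conjI ballI allI)
 show "is_form M k (tail f b \<xi>)" using \<xi> F f by (auto simp: measurable_form_iff intro: is_form_tail)
 fix i v assume i: "i \<in> idx N"
 have m: "(\<lambda>z. \<xi> i z v) \<in> borel_measurable (borel \<Otimes>\<^sub>M borel)"
  using \<xi> i by (simp add: measurable_form_iff borel_prod)
 have [measurable]: "(\<lambda>p. \<xi> i (snd p, snd (fst p)) v) \<in> borel_measurable ((borel \<Otimes>\<^sub>M borel) \<Otimes>\<^sub>M (lborel::real measure))"
  by (rule measurable_compose[OF _ m]) simp
 have [measurable]: "f \<in> borel_measurable borel" by (rule f)
 have "(\<lambda>(z, s). (if fst z \<le> s \<and> s \<le> b then f s * \<xi> i (s, snd z) v else 0)) \<in> borel_measurable ((borel \<Otimes>\<^sub>M borel) \<Otimes>\<^sub>M lborel)"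
  unfolding case_prod_unfold by measurable
 from lborel.borel_measurable_lebesgue_integral[OF this]
 have [measurable]: "(\<lambda>z. \<integral>s. (if fst z \<le> s \<and> s \<le> b then f s * \<xi> i (s, snd z) v else 0) \<partial>lborel) \<in> borel_measurable (borel \<Otimes>\<^sub>M borel)"
  by simp
 have "tail f b \<xi> i z v = (if a \<le> fst z then \<integral>s. (if fst z \<le> s \<and> s \<le> b then f s * \<xi> i (s, snd z) v else 0) \<partial>lborel else 0)" for z
  by (auto simp: tail_def set_lebesgue_integral_def intro!: Bochner_Integration.integral_cong)
 moreover have "(\<lambda>z. if a \<le> fst z then \<integral>s. (if fst z \<le> s \<and> s \<le> b then f s * \<xi> i (s, snd z) v else 0) \<partial>lborel else 0) \<in> borel_measurable (borel \<Otimes>\<^sub>M borel)"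
  by measurable
 ultimately show "(\<lambda>z. tail f b \<xi> i z v) \<in> borel_measurable borel" by (simp add: borel_prod)
qed

end

section \<open>Test forms and their primitives along the rays\<close>

context cyl
begin

lemma boundary_M: "boundary M = {a} \<times> carr N"
proof -
 have "frontier ({a..} \<times> (UNIV :: 'e set)) = {a} \<times> UNIV"
  by (simp add: frontier_def closure_Times interior_Times interior_real_atLeast set_eq_iff) force
 moreover have "a = fst z \<and> x \<in> cdom N i ==> i \<in> idx N ==> x \<in> carr N" for i x and z :: "real \<times> 'a" using carr_N by blast
 ultimately show ?thesis
  unfolding boundary_def using carr_N model_N by (auto simp: mem_Times_iff)
qed

text \<open>The heights of a compact set in the interior form a compact set above \<open>a\<close>,
  so the form vanishes near the boundary and far up.\<close>

lemma test_form_support: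
 assumes "test_form M k u"
 obtains \<epsilon> b where "\<epsilon> > 0" "\<And>i t x. t < a + \<epsilon> ==> u i (t, x) = (\<lambda>v. 0)" "\<And>i t x. b < t ==> u i (t, x) = (\<lambda>v. 0)"
proof -
 obtain K where K: "compact K" "K \<subseteq> carr M - boundary M" and u: "\<And>i x. x \<notin> K ==> u i x = (\<lambda>v. 0)"
  using assms unfolding test_form_def by blast
 have gt: "a < fst z" if "z \<in> K" for z
 proof -
  have "z \<in> {a..} \<times> carr N" "z \<notin> {a} \<times> carr N" using K(2) that boundary_M M_simps(1) by blast+
  hence "a \<le> fst z" "fst z \<noteq> a" by (auto simp: mem_Times_iff)
  thus ?thesis by simp
 qed
 show ?thesis
 proof (cases "K = {}")
  case True
  show ?thesis by (rule that[of 1 0]) (use True u in auto)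
 next
  case False
  have c: "compact (fst ` K)" by (intro compact_continuous_image continuous_intros K)
  obtain t0 where t0: "t0 \<in> fst ` K" "\<And>t. t \<in> fst ` K ==> t0 \<le> t"
   using compact_attains_inf[OF c] False by blast
  obtain t1 where t1: "\<And>t. t \<in> fst ` K ==> t \<le> t1"
   using compact_attains_sup[OF c] False by blast
  show ?thesis
  proof (rule that[of "t0 - a" t1])
   show "0 < t0 - a" using t0(1) gt by auto
   show "u i (t, x) = (\<lambda>v. 0)" if "t < a + (t0 - a)" for i t x
    using that t0(2)[of t] by (intro u) (auto simp: image_iff Bex_def)
   show "u i (t, x) = (\<lambda>v. 0)" if "t1 < t" for i t x
    using that t1[of t] by (intro u) (auto simp: image_iff Bex_def)
  qed
 qed
qed

definition head :: "('i, 'a, 'e) cform => ('i, 'a, 'e) cform" where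
 "head u = (\<lambda>i z v. if a \<le> fst z then integral {a..fst z} (\<lambda>s. u i (s, snd z) v) else 0)"

text \<open>This is the form \<open>P u\<close> of the overview. The integral starts at
  \<open>a\<close>, before the support of \<open>u\<close>; the primitive need not vanish above that
  support, so \<kappa> has to cut it off.\<close>

definition prim :: "(real => real) => ('i, 'a, 'e) cform => ('i, 'a, 'e) cform" where
 "prim \<kappa> u = fscale \<kappa> (head (con_first u))"

lemma is_form_head:
 assumes u: "is_form M k u"
  and cont: "\<And>i x v. i \<in> idx N ==> x \<in> cdom N i ==> continuous_on {a..} (\<lambda>s. u i (s, x) v)"
 shows "is_form M k (head u)"
 unfolding is_form_M_iff
proof (intro conjI ballI allI impI)
 fix i x t assume *: "i \<in> idx N" "x \<in> cdom N i" "a \<le> t"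
 have S: "set_integrable lborel {a..t} (\<lambda>s. u i (s, x) v)" for v
  unfolding set_integrable_def
  by (intro borel_integrable_compact continuous_on_subset[OF cont]) (use * in auto)
 have "alternating k (\<lambda>v. LINT s:{a..t}|lborel. u i (s, x) v)"
  by (rule alternating_LINT) (use * S in "auto intro!: is_formD[OF u]")
 thus "alternating k (head u i (t, x))"
  using * set_borel_integral_eq_integral(2)[OF S] by (simp add: head_def)
next
 fix i t x assume *: "\<not> (i \<in> idx N \<and> a \<le> t \<and> x \<in> cdom N i)"
 show "head u i (t, x) = (\<lambda>v. 0)"
 proof (cases "a \<le> t")
  case True
  hence "u i (s, x) = (\<lambda>v. 0)" for s using is_formD(2)[OF u, of i s x] * by blast
  thus ?thesis by (simp add: head_def fun_eq_iff)
 qed (simp add: head_def fun_eq_iff)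
next
 fix i j x t v assume *: "i \<in> idx N" "j \<in> idx N" "x \<in> cdom N i \<inter> cdom N j" "a \<le> t"
 have "integral {a..t} (\<lambda>s. u i (s, x) v) = integral {a..t} (\<lambda>s. u j (s, x) (\<lambda>l. TM i j x (v l)))"
  using * by (intro hk_integral_cong) (auto simp: is_formD(3)[OF u, of i j x _ v])
 thus "head u i (t, x) v = head u j (t, x) (\<lambda>l. TM i j x (v l))" by (simp add: head_def)
qed

lemma continuous_slice:
 assumes "continuous_on (half i) f" "y \<in> chart_im i" "a \<le> a'"
 shows "continuous_on {a'..t} (\<lambda>s. f (s, y))"
 by (rule continuous_on_compose2[OF assms(1)]) (use assms in "auto intro!: continuous_intros")

lemma is_form_prim:
 assumes u: "smooth_form M (Suc l) u" shows "is_form M l (prim \<kappa> u)"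
 unfolding prim_def
proof (intro is_form_fscale is_form_head is_form_con_first)
 show "is_form M (Suc l) u" using u by (rule smooth_form_is_form)
 fix i x v assume i: "i \<in> idx N" and x: "x \<in> cdom N i"
 have "continuous_on (half i) (loc u i (case_nat (1, 0) (spatial v)))"
  using smooth_form_Ck[OF u i, of 0] by simp
 hence "continuous_on {a..} (\<lambda>s. loc u i (case_nat (1, 0) (spatial v)) (s, chart N i x))"
  by (rule continuous_on_compose2) (use i x in "auto intro!: continuous_intros")
 thus "continuous_on {a..} (\<lambda>s. con_first u i (s, x) v)"
  using i x by (simp add: loc_def inv_pair_def con_first_def)
qed

lemma loc_prim:
 assumes "z \<in> half i"
 shows "loc (prim \<kappa> u) i w z =
  \<kappa> (fst z) * integral {a..fst z} (\<lambda>s. loc u i (case_nat (1, 0) (spatial w)) (s, snd z))"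
 using assms by (auto simp: loc_def prim_def fscale_def head_def con_first_def inv_pair_def)

lemma smooth_form_prim:
 assumes u: "smooth_form M (Suc l) u" and \<kappa>: "\<And>k. Ck_on k UNIV \<kappa>"
 shows "smooth_form M l (prim \<kappa> u)"
 unfolding smooth_form_def smooth_on_def
proof (intro conjI ballI allI)
 show "is_form M l (prim \<kappa> u)" by (rule is_form_prim[OF u])
 fix i w k assume "i \<in> idx M"
 hence i: "i \<in> idx N" by simp
 have "Ck_on k (half i) (\<lambda>z. \<kappa> (fst z) * integral {a..fst z} (\<lambda>s. loc u i (case_nat (1, 0) (spatial w)) (s, snd z)))"
  by (intro Ck_on_mult Ck_on_fst \<kappa> Ck_on_integral_upto open_chart_im i smooth_form_Ck[OF u i])
 thus "Ck_on k (chart M i ` cdom M i) (\<lambda>y. prim \<kappa> u i (chart_inv M i y) w)"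
  unfolding chart_im_M
 proof (rule Ck_on_cong)
  fix z assume z: "z \<in> half i"
  hence "chart_inv M i z = inv_pair i z" using chart_inv_M[OF i, of "fst z" "snd z"] by (auto simp: inv_pair_def)
  thus "prim \<kappa> u i (chart_inv M i z) w = \<kappa> (fst z) * integral {a..fst z} (\<lambda>s. loc u i (case_nat (1, 0) (spatial w)) (s, snd z))"
   using loc_prim[OF z, of \<kappa> u w] by (simp add: loc_def)
 qed
qed

lemma prim_eq_zero: "b < t ==> (\<And>t. b < t ==> \<kappa> t = 0) ==> prim \<kappa> u i (t, x) = (\<lambda>v. 0)"
 by (simp add: prim_def fscale_def fun_eq_iff)

text \<open>The primitive inherits the gap above \<open>a\<close> from \<open>u\<close>, the cutoff
  bounds the support from above, and in the direction of \<open>N\<close> compactness of the whole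
  manifold is enough.\<close>

lemma test_form_prim:
 assumes u: "test_form M (Suc l) u" and \<kappa>: "\<And>k. Ck_on k UNIV \<kappa>" and b: "\<And>t. b < t ==> \<kappa> t = 0"
 shows "test_form M l (prim \<kappa> u)"
 unfolding test_form_def
proof (intro conjI)
 have su: "smooth_form M (Suc l) u" using u by (simp add: test_form_def)
 thus "smooth_form M l (prim \<kappa> u)" by (rule smooth_form_prim[OF _ \<kappa>])
 obtain \<epsilon> where \<epsilon>: "\<epsilon> > 0" "\<And>i t x. t < a + \<epsilon> ==> u i (t, x) = (\<lambda>v. 0)"
  using test_form_support[OF u] by metis
 have z: "prim \<kappa> u i (t, x) = (\<lambda>v. 0)" if "t < a + \<epsilon>" for i t x
 proof -
  have "integral {a..t} (\<lambda>s. con_first u i (s, x) v) = integral {a..t} (\<lambda>s. 0)" for v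
   using that \<epsilon>(2) by (intro hk_integral_cong) (auto simp: con_first_def)
  thus ?thesis by (simp add: prim_def fscale_def head_def fun_eq_iff)
 qed
 show "\<exists>K. compact K \<and> K \<subseteq> carr M - boundary M \<and> (\<forall>i x. x \<notin> K --> prim \<kappa> u i x = (\<lambda>v. 0))"
 proof (intro exI[of _ "{a + \<epsilon>..b} \<times> carr N"] conjI allI impI)
  show "compact ({a + \<epsilon>..b} \<times> carr N)" by (intro compact_Times compact_N) simp
  show "{a + \<epsilon>..b} \<times> carr N \<subseteq> carr M - boundary M" using \<epsilon>(1) by (auto simp: boundary_M)
  fix i and x :: "real \<times> 'a" assume "x \<notin> {a + \<epsilon>..b} \<times> carr N"
  then consider "fst x < a + \<epsilon>" | "b < fst x" | "snd x \<notin> carr N" by (auto simp: mem_Times_iff not_le)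
  thus "prim \<kappa> u i x = (\<lambda>v. 0)"
  proof cases
   case 1 thus ?thesis using z[of "fst x" i "snd x"] by simp
  next
   case 2 thus ?thesis using prim_eq_zero[of b "fst x" \<kappa> u i "snd x"] b by simp
  next
   case 3
   hence "\<not> (i \<in> idx N \<and> a \<le> fst x \<and> snd x \<in> cdom N i)" using carr_N by blast
   thus ?thesis using is_formD(2)[OF is_form_prim[OF su], of i "fst x" "snd x"] by simp
  qed
 qed
qed

text \<open>Product rule for \<kappa> and the integral, whose derivative is the integrand along the
  axis and the integral of the derivative in spatial directions.\<close>

lemma dloc_prim:
 fixes w :: "nat => real \<times> 'e"
 assumes u: "smooth_form M (Suc l) u" and \<kappa>: "\<And>t. (\<kappa> has_real_derivative \<kappa>' t) (at t)"
  and i: "i \<in> idx N" and z: "z \<in> half i"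
 defines "W \<equiv> case_nat (1, 0) (spatial w)"
 shows "dloc (prim \<kappa> u) i w z d =
  \<kappa>' (fst z) * fst d * integral {a..fst z} (\<lambda>s. loc u i W (s, snd z)) +
  \<kappa> (fst z) * (fst d * loc u i W z + integral {a..fst z} (\<lambda>s. dloc u i W (s, snd z) (0, snd d)))"
proof -
 obtain f' where f': "partials_on (half i) (loc u i W) f'" and cont: "\<And>b. b \<in> Basis ==> continuous_on (half i) (f' b)"
  and df: "\<And>z d. z \<in> half i ==> dloc u i W z d = (\<Sum>b\<in>Basis. (d \<bullet> b) *\<^sub>R f' b z)"
  by (rule loc_partials[OF u i, of W]) blast
 define J where "J z = integral {a..fst z} (\<lambda>s. loc u i W (s, snd z))" for z
 define J' where "J' d = fst d * loc u i W z + integral {a..fst z} (\<lambda>s. dloc u i W (s, snd z) (0, snd d))" for d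
 have y: "snd z \<in> chart_im i" using z by (auto simp: mem_Times_iff)
 have dsum: "integral {a..fst z} (\<lambda>s. dloc u i W (s, snd z) (0, snd d)) =
   (\<Sum>b\<in>Basis. (snd d \<bullet> b) * integral {a..fst z} (\<lambda>s. f' (0, b) (s, snd z)))" for d
 proof -
  have int: "(\<lambda>s. f' (0, b) (s, snd z)) integrable_on {a..fst z}" if "b \<in> Basis" for b :: 'e
   by (intro integrable_continuous_real continuous_slice[where i = i] cont y) (use that in "auto simp: Basis_prod_def")
  have "integral {a..fst z} (\<lambda>s. dloc u i W (s, snd z) (0, snd d)) =
    integral {a..fst z} (\<lambda>s. \<Sum>b\<in>Basis. (snd d \<bullet> b) * f' (0, b) (s, snd z))"
  proof (intro hk_integral_cong)
   fix s assume "s \<in> {a..fst z}"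
   hence "(s, snd z) \<in> half i" using y by simp
   thus "dloc u i W (s, snd z) (0, snd d) = (\<Sum>b\<in>Basis. (snd d \<bullet> b) * f' (0, b) (s, snd z))"
    unfolding df[OF \<open>(s, snd z) \<in> half i\<close>] Basis_prod_split by simp
  qed
  also have "... = (\<Sum>b\<in>Basis. (snd d \<bullet> b) * integral {a..fst z} (\<lambda>s. f' (0, b) (s, snd z)))"
   using int by (subst Henstock_Kurzweil_Integration.integral_sum) (auto intro!: integrable_on_mult_right)
  finally show ?thesis .
 qed
 have "(J has_derivative J') (at z within half i)"
 proof -
  have "partials_on (half i) J (\<lambda>b z. if b = (1, 0) then loc u i W z else integral {a..fst z} (\<lambda>s. f' b (s, snd z)))"
   unfolding J_def by (rule partials_on_integral_upto[OF open_chart_im[OF i] f' cont])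
  hence "(J has_derivative (\<lambda>d. \<Sum>b\<in>Basis. (d \<bullet> b) *\<^sub>R
    (if b = (1, 0) then loc u i W z else integral {a..fst z} (\<lambda>s. f' b (s, snd z))))) (at z within half i)"
   using z unfolding partials_on_def by blast
  also have "(\<lambda>d. \<Sum>b\<in>Basis. (d \<bullet> b) *\<^sub>R
    (if b = (1, 0) then loc u i W z else integral {a..fst z} (\<lambda>s. f' b (s, snd z)))) = J'"
   unfolding Basis_prod_split J'_def dsum by (simp add: fun_eq_iff)
  finally show ?thesis .
 qed
 moreover have "((\<lambda>z. \<kappa> (fst z)) has_derivative (\<lambda>d. fst d * \<kappa>' (fst z))) (at z within half i)"
 proof -
  have k: "(\<kappa> has_derivative (\<lambda>h. h * \<kappa>' (fst z))) (at (fst z))"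
   using \<kappa>[of "fst z"] by (simp add: has_field_derivative_def mult.commute[of _ "\<kappa>' (fst z)"])
  show ?thesis
   by (rule has_derivative_compose[where g = \<kappa> and f = fst, OF _ k])
     (rule bounded_linear.has_derivative[OF bounded_linear_fst], rule has_derivative_ident)
 qed
 ultimately have "((\<lambda>z. \<kappa> (fst z) * J z) has_derivative
   (\<lambda>d. \<kappa> (fst z) * J' d + (fst d * \<kappa>' (fst z)) * J z)) (at z within half i)"
  by (intro has_derivative_mult)
 hence "(loc (prim \<kappa> u) i w has_derivative
   (\<lambda>d. \<kappa> (fst z) * J' d + (fst d * \<kappa>' (fst z)) * J z)) (at z within half i)"
  by (rule has_derivative_transform[OF z, rotated]) (simp add: loc_prim J_def W_def)
 from dloc_eq[OF i z this] show ?thesis by (simp add: J_def J'_def algebra_simps)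
qed

text \<open>The exterior derivative in the directions of \<open>N\<close> of the contraction of
  \<open>u\<close> with d/dt, for spatial arguments \<open>V\<close>. It appears both in the
  derivative of the primitive and in that of \<open>u\<close>, and it cancels between them.\<close>

definition fibre_deriv where
 "fibre_deriv l u i V z = (\<Sum>j\<le>l. (-1) ^ j * dloc u i (case_nat (1, 0) (spatial (omit j V))) z (V j))"

text \<open>On spatial vectors no derivative along the axis occurs, so the exterior derivative
  passes through the cutoff and the integral.\<close>

lemma ext_deriv_prim_spatial:
 assumes u: "smooth_form M (Suc l) u" and \<kappa>: "\<And>t. (\<kappa> has_real_derivative \<kappa>' t) (at t)" "\<And>k. Ck_on k UNIV \<kappa>"
  and i: "i \<in> idx N" and z: "z \<in> half i" and V: "\<And>j. j \<le> l ==> fst (V j) = 0"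
 shows "ext_deriv M l (prim \<kappa> u) i (inv_pair i z) V =
   \<kappa> (fst z) * integral {a..fst z} (\<lambda>s. fibre_deriv l u i V (s, snd z))"
proof -
 have y: "snd z \<in> chart_im i" using z by (auto simp: mem_Times_iff)
 let ?D = "\<lambda>j s. dloc u i (case_nat (1, 0) (spatial (omit j V))) (s, snd z) (V j)"
 have int: "(\<lambda>s. ?D j s) integrable_on {a..fst z}" for j
  by (intro integrable_continuous_real continuous_slice[where i = i] continuous_dloc[OF u i] y) simp
 have "ext_deriv M l (prim \<kappa> u) i (inv_pair i z) V =
   (\<Sum>j\<le>l. (-1) ^ j * (\<kappa> (fst z) * integral {a..fst z} (?D j)))"
  unfolding ext_deriv_loc[OF smooth_form_prim[OF u \<kappa>(2)] i z]
 proof (intro sum.cong refl)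
  fix j assume "j \<in> {..l}"
  hence "fst (V j) = 0" "(0, snd (V j)) = V j" using V[of j] by (auto simp: prod_eq_iff)
  thus "(-1) ^ j * dloc (prim \<kappa> u) i (omit j V) z (V j) = (-1) ^ j * (\<kappa> (fst z) * integral {a..fst z} (?D j))"
   by (simp add: dloc_prim[OF u \<kappa>(1) i z])
 qed
 also have "... = \<kappa> (fst z) * (\<Sum>j\<le>l. integral {a..fst z} (\<lambda>s. (-1) ^ j * ?D j s))"
  by (simp add: sum_distrib_left algebra_simps)
 also have "(\<Sum>j\<le>l. integral {a..fst z} (\<lambda>s. (-1) ^ j * ?D j s)) = integral {a..fst z} (\<lambda>s. fibre_deriv l u i V (s, snd z))"
  unfolding fibre_deriv_def using int
  by (subst Henstock_Kurzweil_Integration.integral_sum) (auto intro!: integrable_on_mult_right)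
 finally show ?thesis .
qed

text \<open>With d/dt in first place only the term that differentiates along d/dt survives; the
  product rule gives one contribution from the cutoff and one from the end point of the
  integral.\<close>

lemma ext_deriv_prim_normal:
 assumes u: "smooth_form M (Suc l) u" and \<kappa>: "\<And>t. (\<kappa> has_real_derivative \<kappa>' t) (at t)" "\<And>k. Ck_on k UNIV \<kappa>"
  and i: "i \<in> idx N" and z: "z \<in> half i" and V: "V 0 = (1, 0)" "\<And>j. j < l ==> fst (V (Suc j)) = 0"
 shows "ext_deriv M l (prim \<kappa> u) i (inv_pair i z) V =
   \<kappa>' (fst z) * integral {a..fst z} (\<lambda>s. loc u i V (s, snd z)) + \<kappa> (fst z) * loc u i V z"
proof -
 let ?R = "\<kappa>' (fst z) * integral {a..fst z} (\<lambda>s. loc u i V (s, snd z)) + \<kappa> (fst z) * loc u i V z"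
 have y: "snd z \<in> chart_im i" using z by (auto simp: mem_Times_iff)
 have fu: "is_form M (Suc l) u" by (rule smooth_form_is_form[OF u])
 define W where "W j = case_nat (1, 0) (spatial (omit j V))" for j
 have W0: "loc u i (W 0) z' = loc u i V z'" "dloc u i (W 0) z' d = dloc u i V z' d" if z': "z' \<in> half i" for z' d
 proof -
  have "W 0 j = V j" if "j < Suc l" for j
   using that V by (cases j) (auto simp: W_def spatial_def omit_def prod_eq_iff)
  thus "loc u i (W 0) z' = loc u i V z'" "dloc u i (W 0) z' d = dloc u i V z' d"
   using alternating_cong[OF alternating_loc[OF fu i z'], of "W 0" V] alternating_cong[OF alternating_dloc[OF u i z'], of "W 0" V d]
   by blast+
 qed
 \<comment> \<open>For \<open>j > 0\<close> the vector d/dt stays among the arguments, where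
   \<open>spatial\<close> turns it into zero.\<close>
 have Wj: "loc u i (W j) z' = 0" "dloc u i (W j) z' d = 0" if "z' \<in> half i" "0 < j" "j \<le> l" for z' d j
 proof -
  have "W j 1 = 0" using that V by (simp add: W_def spatial_def omit_def zero_prod_def)
  moreover have "1 < Suc l" using that by simp
  ultimately show "loc u i (W j) z' = 0" "dloc u i (W j) z' d = 0"
   using alternating_zero_arg[OF alternating_loc[OF fu i that(1)], of 1 "W j"]
    alternating_zero_arg[OF alternating_dloc[OF u i that(1)], of 1 "W j" d] by blast+
 qed
 have D: "dloc (prim \<kappa> u) i (omit j V) z (V j) =
   (if j = 0 then ?R else 0)"
  if "j \<le> l" for j
 proof (cases "j = 0")
  case True
  have "integral {a..fst z} (\<lambda>s. loc u i (W 0) (s, snd z)) = integral {a..fst z} (\<lambda>s. loc u i V (s, snd z))"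
   using y by (intro hk_integral_cong W0) auto
  moreover have "integral {a..fst z} (\<lambda>s. dloc u i (W 0) (s, snd z) (0, 0)) = integral {a..fst z} (\<lambda>s. 0)"
  proof (intro hk_integral_cong)
   fix s assume "s \<in> {a..fst z}"
   hence "(s, snd z) \<in> half i" using y by simp
   from linear_0[OF linear_dloc[OF u i this]] show "dloc u i (W 0) (s, snd z) (0, 0) = 0" by (simp add: zero_prod_def)
  qed
  ultimately show ?thesis
   using True V W0[OF z] by (simp add: dloc_prim[OF u \<kappa>(1) i z] W_def[symmetric])
 next
  case False
  have "integral {a..fst z} (\<lambda>s. loc u i (W j) (s, snd z)) = integral {a..fst z} (\<lambda>s. 0)"
   using y False that by (intro hk_integral_cong Wj) auto
  moreover have "integral {a..fst z} (\<lambda>s. dloc u i (W j) (s, snd z) d) = integral {a..fst z} (\<lambda>s. 0)" for d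
   using y False that by (intro hk_integral_cong Wj) auto
  ultimately show ?thesis
   using False Wj(1)[OF z, of j] that by (simp add: dloc_prim[OF u \<kappa>(1) i z] W_def[symmetric])
 qed
 have "ext_deriv M l (prim \<kappa> u) i (inv_pair i z) V = (\<Sum>j\<le>l. (-1) ^ j * dloc (prim \<kappa> u) i (omit j V) z (V j))"
  by (rule ext_deriv_loc[OF smooth_form_prim[OF u \<kappa>(2)] i z])
 also have "... = (\<Sum>j\<le>l. if j = 0 then ?R else 0)"
  by (intro sum.cong refl) (simp add: D)
 also have "... = ?R"
  by (subst sum.delta) simp_all
 finally show ?thesis .
qed

text \<open>On d/dt and spatial vectors the exterior derivative of \<open>u\<close> is its
  derivative along the axis minus \<open>fibre_deriv\<close>. Integration along the ray gives
  \<open>u\<close> itself, because \<open>u\<close> vanishes at the starting point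
  \<open>a\<close>.\<close>

lemma integral_ext_deriv_normal:
 assumes u: "smooth_form M (Suc l) u" and i: "i \<in> idx N" and z: "z \<in> half i"
  and V: "\<And>j. j \<le> l ==> fst (V j) = 0" and ua: "\<And>x. u i (a, x) = (\<lambda>v. 0)"
 shows "integral {a..fst z} (\<lambda>s. ext_deriv M (Suc l) u i (inv_pair i (s, snd z)) (case_nat (1, 0) V)) =
   loc u i V z - integral {a..fst z} (\<lambda>s. fibre_deriv l u i V (s, snd z))"
proof -
 have y: "snd z \<in> chart_im i" and t: "a \<le> fst z" using z by (auto simp: mem_Times_iff)
 have ptw: "ext_deriv M (Suc l) u i (inv_pair i (s, snd z)) (case_nat (1, 0) V) =
   dloc u i V (s, snd z) (1, 0) - fibre_deriv l u i V (s, snd z)" if "a \<le> s" for s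
 proof -
  have sz: "(s, snd z) \<in> half i" using y that by simp
  have om: "omit 0 (case_nat (1, 0) V) = V" by (simp add: omit_def fun_eq_iff)
  have dl: "dloc u i (omit (Suc j) (case_nat (1, 0) V)) (s, snd z) (V j) =
    dloc u i (case_nat (1, 0) (spatial (omit j V))) (s, snd z) (V j)" if j: "j \<le> l" for j
  proof (rule alternating_cong[OF alternating_dloc[OF u i sz]])
   fix p assume "p < Suc l"
   thus "omit (Suc j) (case_nat (1, 0) V) p = case_nat (1, 0) (spatial (omit j V)) p"
    using V by (cases p) (auto simp: omit_def spatial_def prod_eq_iff)
  qed
  have "ext_deriv M (Suc l) u i (inv_pair i (s, snd z)) (case_nat (1, 0) V) =
    (\<Sum>j\<le>Suc l. (-1) ^ j * dloc u i (omit j (case_nat (1, 0) V)) (s, snd z) (case_nat (1, 0) V j))"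
   by (rule ext_deriv_loc[OF u i sz])
  also have "... = dloc u i V (s, snd z) (1, 0) + (\<Sum>j\<le>l. - ((-1) ^ j * dloc u i (case_nat (1, 0) (spatial (omit j V))) (s, snd z) (V j)))"
   unfolding sum.atMost_Suc_shift om by (simp add: dl)
  finally show ?thesis by (simp add: fibre_deriv_def sum_negf)
 qed
 have ftc: "((\<lambda>s. dloc u i V (s, snd z) (1, 0)) has_integral (loc u i V (fst z, snd z) - loc u i V (a, snd z))) {a..fst z}"
 proof (rule fundamental_theorem_of_calculus[OF t])
  fix s assume s: "s \<in> {a..fst z}"
  hence sz: "(s, snd z) \<in> half i" using y by simp
  have "((\<lambda>s. loc u i V (s, snd z)) has_derivative (\<lambda>d. dloc u i V (s, snd z) (d, 0))) (at s within {a..fst z})"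
  proof (rule has_derivative_in_compose2[where f = "\<lambda>s. (s, snd z)" and g = "loc u i V" and t = "half i" and g' = "dloc u i V"])
   show "((\<lambda>s. (s, snd z)) has_derivative (\<lambda>d. (d, 0))) (at s within {a..fst z})"
    by (auto intro!: derivative_eq_intros)
  qed (use s y loc_has_derivative[OF u i] in auto)
  moreover have "(\<lambda>d. dloc u i V (s, snd z) (d, 0)) = (\<lambda>d. d *\<^sub>R dloc u i V (s, snd z) (1, 0))"
  proof
   fix d :: real
   have "(d, 0 :: 'e) = d *\<^sub>R (1, 0)" by (simp add: prod_eq_iff)
   thus "dloc u i V (s, snd z) (d, 0) = d *\<^sub>R dloc u i V (s, snd z) (1, 0)"
    by (simp only: linear_scale[OF linear_dloc[OF u i sz]])
  qed
  ultimately show "((\<lambda>s. loc u i V (s, snd z)) has_vector_derivative dloc u i V (s, snd z) (1, 0)) (at s within {a..fst z})"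
   unfolding has_vector_derivative_def by (simp only:)
 qed
 have fi: "(\<lambda>s. fibre_deriv l u i V (s, snd z)) integrable_on {a..fst z}"
  unfolding fibre_deriv_def
  by (intro integrable_sum integrable_on_mult_right integrable_continuous_real continuous_slice[where i = i] continuous_dloc[OF u i] y) auto
 have "integral {a..fst z} (\<lambda>s. ext_deriv M (Suc l) u i (inv_pair i (s, snd z)) (case_nat (1, 0) V)) =
   integral {a..fst z} (\<lambda>s. dloc u i V (s, snd z) (1, 0) - fibre_deriv l u i V (s, snd z))"
  by (intro hk_integral_cong) (simp add: ptw)
 also have "... = (loc u i V z - loc u i V (a, snd z)) - integral {a..fst z} (\<lambda>s. fibre_deriv l u i V (s, snd z))"
  using ftc fi by (subst Henstock_Kurzweil_Integration.integral_diff) (auto simp: has_integral_integrable_integral)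
 also have "loc u i V (a, snd z) = 0" by (simp add: loc_def inv_pair_def ua)
 finally show ?thesis by simp
qed

end

section \<open>The identity between the cut form and its primitive, ray by ray\<close>

lemma basis_enum_normal:
 obtains r where "r < Suc DIM('e)" "(basis_enum :: nat => real \<times> 'e::euclidean_space) r = (1, 0)"
  "\<And>j. j < Suc DIM('e) ==> j \<noteq> r ==> fst ((basis_enum :: nat => real \<times> 'e) j) = 0"
proof -
 have bij: "bij_betw (basis_enum :: nat => real \<times> 'e) {..<Suc DIM('e)} Basis"
  using basis_enum_bij[where 'e = "real \<times> 'e"] by simp
 have "(1, 0) \<in> (Basis :: (real \<times> 'e) set)" by (simp add: Basis_prod_def)
 then obtain r where r: "r < Suc DIM('e)" "(basis_enum :: nat => real \<times> 'e) r = (1, 0)"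
  using bij_betw_imp_surj_on[OF bij] by (metis (no_types, lifting) imageE lessThan_iff)
 moreover have "fst ((basis_enum :: nat => real \<times> 'e) j) = 0" if "j < Suc DIM('e)" "j \<noteq> r" for j
 proof -
  have "(basis_enum :: nat => real \<times> 'e) j \<in> Basis" using bij_betw_apply[OF bij, of j] that by simp
  moreover have "(basis_enum :: nat => real \<times> 'e) j \<noteq> (1, 0)"
   using inj_onD[OF bij_betw_imp_inj_on[OF bij], of j r] r that by auto
  ultimately show ?thesis by (auto simp: Basis_prod_def)
 qed
 ultimately show ?thesis by (rule that)
qed

lemma perm_sum_diff: "perm_sum m j r F - perm_sum m j r G = perm_sum m j r (\<lambda>\<sigma>. F \<sigma> - G \<sigma>)"
 by (simp add: perm_sum_def sum_subtractf[symmetric] algebra_simps)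

lemma perm_sum_cmult: "c * perm_sum m j r F = perm_sum m j r (\<lambda>\<sigma>. c * F \<sigma>)"
 by (simp add: perm_sum_def sum_distrib_left algebra_simps)

lemma perm_sum_zero: "perm_sum m j r (\<lambda>\<sigma>. 0) = 0"
 by (simp add: perm_sum_def)

lemma has_bochner_integral_perm_sum:
 assumes "\<And>\<sigma>. has_bochner_integral L (\<lambda>t. i t * F \<sigma> t) 0"
 shows "has_bochner_integral L (\<lambda>t. i t * perm_sum m j r (\<lambda>\<sigma>. F \<sigma> t)) 0"
proof -
 have "has_bochner_integral L (\<lambda>t. \<Sum>\<sigma> | \<sigma> permutes {..<m} \<and> \<sigma> j = r. of_int (sign \<sigma>) * (i t * F \<sigma> t)) 
   (\<Sum>\<sigma> | \<sigma> permutes {..<m} \<and> \<sigma> j = r. of_int (sign \<sigma>) * 0)"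
  by (intro has_bochner_integral_sum has_bochner_integral_mult_right assms)
 thus ?thesis by (simp add: perm_sum_def sum_distrib_left algebra_simps)
qed

lemma wedge_zero_left: "wedge k l (\<lambda>v. 0) \<beta> = (\<lambda>v. 0)" and wedge_zero_right: "wedge k l \<alpha> (\<lambda>v. 0) = (\<lambda>v. 0)"
 by (simp_all add: wedge_def fun_eq_iff)

context cyl
begin

lemma ext_deriv_support:
 assumes "\<And>i t x. b < t ==> u i (t, x) = (\<lambda>v. 0)" "b < t"
 shows "ext_deriv M k u i (t, x) = (\<lambda>v. 0)"
proof
 fix v :: "nat => real \<times> 'e"
 show "ext_deriv M k u i (t, x) v = 0"
 proof (cases "i \<in> idx M \<and> (t, x) \<in> cdom M i")
  case True
  hence i: "i \<in> idx N" and t: "a \<le> t" and x: "x \<in> cdom N i" by auto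
  let ?z = "(t, chart N i x)"
  have z: "?z \<in> half i" using t x by simp
  have "frechet_derivative (\<lambda>y. u i (chart_inv M i y) w) (at ?z within half i) = (\<lambda>_. 0)" for w
  proof (rule frechet_derivative_half_space[OF _ open_chart_im[OF i] z])
   show "((\<lambda>y. u i (chart_inv M i y) w) has_derivative (\<lambda>_. 0)) (at ?z within half i)"
   proof (rule has_derivative_transform_within[OF _ _ z])
    show "((\<lambda>_. 0) has_derivative (\<lambda>_. 0 :: real)) (at ?z within half i)" by simp
    show "0 < t - b" using assms by simp
    fix z' assume z': "z' \<in> half i" "dist z' ?z < t - b"
    have "dist (fst z') t \<le> dist z' ?z" using dist_fst_le[of z' ?z] by simp
    hence "b < fst z'" using z'(2) by (simp add: dist_real_def)
    thus "0 = u i (chart_inv M i z') w"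
     using assms(1)[of "fst z'"] chart_inv_M[OF i, of "fst z'" "snd z'"] z'(1) by (auto simp: mem_Times_iff)
   qed
  qed
  thus ?thesis unfolding ext_deriv_def chart_im_M using True by simp
 next
  case False
  thus ?thesis unfolding ext_deriv_def by (simp only: if_False)
 qed
qed

text \<open>The equation for the weak derivative of \<psi>, before integration over
  \<open>N\<close>. Permutations are sorted by the factor that receives d/dt; for each single
  permutation the difference of the products has the shape treated by
  \<open>triangle_fubini\<close>.\<close>

lemma fibre_identity:
 assumes \<xi>: "is_form M (Suc k1) \<xi>" and F: "fibre_integrable b \<xi>"
  and u: "smooth_form M (Suc l) u" and ua: "\<And>i x. u i (a, x) = (\<lambda>v. 0)"
  and \<kappa>: "\<And>t. (\<kappa> has_real_derivative - c t) (at t)" "\<And>k. Ck_on k UNIV \<kappa>" "\<And>t. \<bar>\<kappa> t\<bar> \<le> B"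
  and c: "c \<in> borel_measurable borel" "\<And>t. \<bar>c t\<bar> \<le> B"
  and kl: "Suc k1 + Suc l = Suc DIM('e)" and i: "i \<in> idx N" and x: "x \<in> cdom N i"
 defines "\<theta> \<equiv> form_diff (fscale \<kappa> \<xi>) (tail c b (hor \<xi>))"
  and "\<psi> \<equiv> tail (\<lambda>s. (-1) ^ Suc k1 * \<kappa> s) b (con_last k1 \<xi>)"
 shows "has_bochner_integral lborel (\<lambda>t. indicator {a..b} t *
   (wedge (Suc k1) (Suc l) (\<theta> i (t, x)) (u i (t, x)) (basis_enum :: nat => real \<times> 'e)
    - wedge (Suc k1) (Suc l) (\<xi> i (t, x)) (ext_deriv M l (prim \<kappa> u) i (t, x)) basis_enum
    - (-1) ^ Suc k1 * wedge k1 (Suc (Suc l)) (\<psi> i (t, x)) (ext_deriv M (Suc l) u i (t, x)) basis_enum)) 0"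
proof -
 let ?dP = "\<lambda>t. ext_deriv M l (prim \<kappa> u) i (t, x)"
 let ?du = "\<lambda>t. ext_deriv M (Suc l) u i (t, x)"
 let ?w = "\<lambda>s. \<xi> i (s, x)"
 define \<tau> where "\<tau> = (basis_enum :: nat => real \<times> 'e)"
 let ?t = "\<lambda>\<sigma>. (\<lambda>j. \<tau> (\<sigma> j))"
 define m where "m = Suc k1 + Suc l"
 define y where "y = chart N i x"
 obtain r where r: "r < m" "\<tau> r = (1, 0)" "\<And>j. j < m ==> j \<noteq> r ==> fst (\<tau> j) = 0"
  using basis_enum_normal[where 'e = 'e] unfolding \<tau>_def m_def kl by metis
 have km: "Suc k1 + Suc l = m" "k1 + Suc (Suc l) = m" by (simp_all add: m_def)
 have y: "y \<in> chart_im i" using x by (simp add: y_def)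
 have ip: "inv_pair i (t, y) = (t, x)" for t using i x by (simp add: inv_pair_def y_def)
 have \<kappa>m: "\<kappa> \<in> borel_measurable borel" using Ck_on_continuous[OF \<kappa>(2)[of 0]] by (rule borel_measurable_continuous_onI)
 have fu: "is_form M (Suc l) u" by (rule smooth_form_is_form[OF u])
 have f\<theta>: "is_form M (Suc k1) \<theta>" unfolding \<theta>_def
  by (intro is_form_diff is_form_fscale is_form_tail[OF _ _ c] is_form_hor \<xi> fibre_integrable_con F)
 have f\<psi>: "is_form M k1 \<psi>" unfolding \<psi>_def
  by (rule is_form_tail[where B = B]; (intro is_form_con_last \<xi> fibre_integrable_con F borel_measurable_times \<kappa>m borel_measurable_const)?)
    (simp_all add: abs_mult power_abs \<kappa>(3))
 have fdu: "is_form M (Suc (Suc l)) (ext_deriv M (Suc l) u)" by (rule is_form_ext_deriv[OF u])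
 have fdp: "is_form M (Suc l) (ext_deriv M l (prim \<kappa> u))"
  by (rule is_form_ext_deriv[OF smooth_form_prim[OF u \<kappa>(2)]])
 have spat: "spatial (\<lambda>j. \<tau> (\<sigma> (d + j))) j = \<tau> (\<sigma> (d + j))" "fst (\<tau> (\<sigma> (d + j))) = 0"
  if "\<sigma> permutes {..<m}" "\<sigma> q = r" "d + j < m" "d + j \<noteq> q" for \<sigma> q d j
 proof -
  have "\<sigma> (d + j) < m" using permutes_in_image[OF that(1), of "d + j"] that(3) by simp
  moreover have "\<sigma> (d + j) \<noteq> r" using permutes_inj[OF that(1)] that(2,4) by (metis injD)
  ultimately show "fst (\<tau> (\<sigma> (d + j))) = 0" by (rule r(3))
  thus "spatial (\<lambda>j. \<tau> (\<sigma> (d + j))) j = \<tau> (\<sigma> (d + j))" by (simp add: spatial_def prod_eq_iff)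
 qed
 \<comment> \<open>The integrand of \<open>triangle_fubini\<close>. The pair \<open>f1\<close>,
   \<open>g1\<close> belongs to permutations that give d/dt to \<xi>, the pair \<open>f2\<close>,
   \<open>g2\<close> to those that give it to the test form.\<close>
 define G where "G f g t = f t * integral {a..t} g - (LINT s:{t..b}|lborel. f s) * g t" for f g :: "real => real" and t
 define f1 where "f1 \<sigma> s = \<kappa> s * ?w s (?t \<sigma>)" for \<sigma> s
 define f2 where "f2 \<sigma> s = c s * ?w s (?t \<sigma>)" for \<sigma> s
 define g1 where "g1 \<sigma> s = ext_deriv M (Suc l) u i (s, x) (case_nat (1, 0) (\<lambda>j. \<tau> (\<sigma> (Suc k1 + j))))" for \<sigma> s
 define g2 where "g2 \<sigma> s = u i (s, x) (\<lambda>j. \<tau> (\<sigma> (Suc k1 + j)))" for \<sigma> s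
 have "set_integrable lborel {a..b} (f1 \<sigma>)" "set_integrable lborel {a..b} (f2 \<sigma>)" for \<sigma>
  unfolding f1_def f2_def using i x \<kappa> \<kappa>m c by (auto intro!: fibre_integrableD[OF F])
 moreover have "continuous_on {a..b} (g2 \<sigma>)" for \<sigma>
 proof -
  have "continuous_on {a..b} (\<lambda>s. loc u i (\<lambda>j. \<tau> (\<sigma> (Suc k1 + j))) (s, y))"
   using smooth_form_Ck[OF u i, of 0] y by (intro continuous_slice[where i = i]) simp_all
  thus ?thesis by (simp add: g2_def[abs_def] loc_def ip)
 qed
 moreover have "continuous_on {a..b} (g1 \<sigma>)" for \<sigma>
 proof -
  let ?V = "case_nat (1, 0) (\<lambda>j. \<tau> (\<sigma> (Suc k1 + j)))"
  have "continuous_on {a..b} (\<lambda>s. \<Sum>j\<le>Suc l. (-1) ^ j * dloc u i (omit j ?V) (s, y) (?V j))"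
   by (intro continuous_intros continuous_slice[where i = i] continuous_dloc[OF u i] y) simp
  thus ?thesis
  proof (rule continuous_on_eq)
   fix s assume "s \<in> {a..b}"
   hence "(s, y) \<in> half i" using y by simp
   from ext_deriv_loc[OF u i this, of ?V]
   show "(\<Sum>j\<le>Suc l. (-1) ^ j * dloc u i (omit j ?V) (s, y) (?V j)) = g1 \<sigma> s"
    unfolding g1_def ip by (rule sym)
  qed
 qed
 ultimately have G0: "has_bochner_integral lborel (\<lambda>t. indicator {a..b} t * G (f1 \<sigma>) (g1 \<sigma>) t) 0"
   "has_bochner_integral lborel (\<lambda>t. indicator {a..b} t * G (f2 \<sigma>) (g2 \<sigma>) t) 0" for \<sigma>
  unfolding G_def by (intro triangle_fubini; blast)+
 \<comment> \<open>A pointwise identity in \<open>t\<close>: the three wedge products combine to the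
   functions \<open>G\<close>, with no remainder.\<close>
 have ptw: "wedge (Suc k1) (Suc l) (\<theta> i (t, x)) (u i (t, x)) \<tau>
    - wedge (Suc k1) (Suc l) (?w t) (?dP t) \<tau>
    - (-1) ^ Suc k1 * wedge k1 (Suc (Suc l)) (\<psi> i (t, x)) (?du t) \<tau> =
   (real (Suc k1) * perm_sum m k1 r (\<lambda>\<sigma>. G (f1 \<sigma>) (g1 \<sigma>) t) +
   real (Suc l) * perm_sum m (Suc k1) r (\<lambda>\<sigma>. G (f2 \<sigma>) (g2 \<sigma>) t)) / (fact (Suc k1) * fact (Suc l))"
  if t: "a \<le> t" for t
 proof -
  have z: "(t, y) \<in> half i" using t y by simp
  note alt = is_formD(1)[OF _ i x t]
  define Fa where "Fa \<sigma> = \<theta> i (t, x) (?t \<sigma>) * u i (t, x) (\<lambda>j. \<tau> (\<sigma> (Suc k1 + j)))" for \<sigma>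
  define Fb where "Fb \<sigma> = ?w t (?t \<sigma>) * ?dP t (\<lambda>j. \<tau> (\<sigma> (Suc k1 + j)))" for \<sigma>
  define Fc where "Fc \<sigma> = \<psi> i (t, x) (?t \<sigma>) * ?du t (\<lambda>j. \<tau> (\<sigma> (k1 + j)))" for \<sigma>
  have Wa: "wedge (Suc k1) (Suc l) (\<theta> i (t, x)) (u i (t, x)) \<tau> =
    (real (Suc k1) * perm_sum m k1 r Fa + real (Suc l) * perm_sum m (Suc k1) r Fa) / (fact (Suc k1) * fact (Suc l))"
   using wedge_split[OF alt[OF f\<theta>] alt[OF fu], of r \<tau>] r(1) unfolding km Fa_def[symmetric] by simp
  have Wb: "wedge (Suc k1) (Suc l) (?w t) (?dP t) \<tau> =
    (real (Suc k1) * perm_sum m k1 r Fb + real (Suc l) * perm_sum m (Suc k1) r Fb) / (fact (Suc k1) * fact (Suc l))"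
   using wedge_split[OF alt[OF \<xi>] alt[OF fdp], of r \<tau>] r(1) unfolding km Fb_def[symmetric] by simp
  have Wc: "wedge k1 (Suc (Suc l)) (\<psi> i (t, x)) (?du t) \<tau> =
    (real k1 * perm_sum m (k1 - 1) r Fc + real (Suc (Suc l)) * perm_sum m k1 r Fc) / (fact k1 * fact (Suc (Suc l)))"
   using wedge_split[OF alt[OF f\<psi>] alt[OF fdu], of r \<tau>] r(1) unfolding km Fc_def[symmetric] by simp
  \<comment> \<open>If \<psi> itself receives d/dt, the term is zero: the contraction has used d/dt
    already, and \<open>spatial\<close> annihilates the second one.\<close>
  have Wc0: "real k1 * perm_sum m (k1 - 1) r Fc = 0"
  proof (cases k1)
   case (Suc k2)
   have "perm_sum m k2 r Fc = perm_sum m k2 r (\<lambda>_. 0)"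
   proof (rule perm_sum_cong)
    fix \<sigma> assume "\<sigma> k2 = r"
    hence "((spatial (?t \<sigma>))(k1 := (1, 0))) k2 = 0"
     using r(2) Suc by (simp add: spatial_def zero_prod_def)
    hence "con_last k1 \<xi> i (s, x) (?t \<sigma>) = 0" for s
     unfolding con_last_def by (rule form_zero_arg[OF \<xi>, rotated]) (use Suc in simp)
    thus "Fc \<sigma> = 0" by (simp add: Fc_def \<psi>_def tail_def)
   qed
   thus ?thesis using Suc by (simp add: perm_sum_zero)
  qed simp
  \<comment> \<open>Position \<open>k1\<close> holds d/dt: the last slot of \<xi>, and equally the
    first slot of the derivative of \<open>u\<close> once \<psi> takes only \<open>k1\<close>
    arguments. The horizontal part vanishes here, and the terms with \<open>fibre_deriv\<close>
    cancel.\<close>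
  have "perm_sum m k1 r Fa - perm_sum m k1 r Fb - (-1) ^ Suc k1 * perm_sum m k1 r Fc =
    perm_sum m k1 r (\<lambda>\<sigma>. Fa \<sigma> - Fb \<sigma> - (-1) ^ Suc k1 * Fc \<sigma>)"
   by (simp only: perm_sum_diff perm_sum_cmult)
  also have "... = perm_sum m k1 r (\<lambda>\<sigma>. G (f1 \<sigma>) (g1 \<sigma>) t)"
  proof (rule perm_sum_cong)
   fix \<sigma> assume \<sigma>: "\<sigma> permutes {..<m}" "\<sigma> k1 = r"
   let ?V = "\<lambda>j. \<tau> (\<sigma> (Suc k1 + j))"
   have V: "fst (?V j) = 0" if "j \<le> l" for j
    using spat(2)[OF \<sigma>, of "Suc k1" j] that by (simp add: m_def)
   have "spatial (?t \<sigma>) k1 = 0" using \<sigma>(2) r(2) by (simp add: spatial_def zero_prod_def)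
   hence "hor \<xi> i (s, x) (?t \<sigma>) = 0" for s
    unfolding hor_def by (rule form_zero_arg[OF \<xi>, rotated]) simp
   hence th: "\<theta> i (t, x) (?t \<sigma>) = f1 \<sigma> t"
    by (simp add: \<theta>_def form_diff_def fscale_def f1_def tail_def)
   have "con_last k1 \<xi> i (s, x) (?t \<sigma>) = ?w s (?t \<sigma>)" if "a \<le> s" for s
    unfolding con_last_def
   proof (rule alternating_cong[OF is_formD(1)[OF \<xi> i x that]])
    fix j assume "j < Suc k1"
    thus "((spatial (?t \<sigma>))(k1 := (1, 0))) j = \<tau> (\<sigma> j)"
     using spat(1)[OF \<sigma>, of 0 j] \<sigma>(2) r(2) by (auto simp: m_def)
   qed
   hence "\<psi> i (t, x) (?t \<sigma>) = (LINT s:{t..b}|lborel. (-1) ^ Suc k1 * f1 \<sigma> s)"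
    using t by (auto simp: \<psi>_def tail_def f1_def mult.assoc intro!: set_lebesgue_integral_cong)
   also have "... = (-1) ^ Suc k1 * (LINT s:{t..b}|lborel. f1 \<sigma> s)" by (rule set_integral_mult_right)
   finally have ps: "(-1) ^ Suc k1 * \<psi> i (t, x) (?t \<sigma>) = (LINT s:{t..b}|lborel. f1 \<sigma> s)"
    by (simp add: mult.assoc[symmetric] power_add[symmetric] power_mult_distrib[symmetric])
   have "(\<lambda>j. \<tau> (\<sigma> (k1 + j))) = case_nat (1, 0) ?V"
    using \<sigma>(2) r(2) by (auto simp: fun_eq_iff split: nat.split)
   hence du: "?du t (\<lambda>j. \<tau> (\<sigma> (k1 + j))) = g1 \<sigma> t" by (simp add: g1_def)
   have dp: "?dP t ?V = \<kappa> t * integral {a..t} (\<lambda>s. fibre_deriv l u i ?V (s, y))"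
    using ext_deriv_prim_spatial[OF u \<kappa>(1,2) i z V] by (simp add: ip)
   have U: "u i (t, x) ?V = integral {a..t} (g1 \<sigma>) + integral {a..t} (\<lambda>s. fibre_deriv l u i ?V (s, y))"
    using integral_ext_deriv_normal[OF u i z V ua] by (simp add: ip loc_def g1_def[abs_def])
   have "Fa \<sigma> - Fb \<sigma> = f1 \<sigma> t * integral {a..t} (g1 \<sigma>)"
    unfolding Fa_def Fb_def th dp U by (simp add: f1_def algebra_simps)
   moreover have "(-1) ^ Suc k1 * Fc \<sigma> = (LINT s:{t..b}|lborel. f1 \<sigma> s) * g1 \<sigma> t"
    unfolding Fc_def du ps[symmetric] by (simp only: mult.assoc)
   ultimately show "Fa \<sigma> - Fb \<sigma> - (-1) ^ Suc k1 * Fc \<sigma> = G (f1 \<sigma>) (g1 \<sigma>) t"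
    by (simp only: G_def)
  qed
  finally have first: "perm_sum m k1 r Fa - perm_sum m k1 r Fb - (-1) ^ Suc k1 * perm_sum m k1 r Fc =
    perm_sum m k1 r (\<lambda>\<sigma>. G (f1 \<sigma>) (g1 \<sigma>) t)" .
  \<comment> \<open>Now the test form receives d/dt. The terms with \<kappa> cancel, and what
    remains is the bump \<open>c\<close> from the derivative of the cutoff against the tail that
    forms \<open>A\<close>.\<close>
  have "perm_sum m (Suc k1) r Fa - perm_sum m (Suc k1) r Fb = perm_sum m (Suc k1) r (\<lambda>\<sigma>. Fa \<sigma> - Fb \<sigma>)"
   by (rule perm_sum_diff)
  also have "... = perm_sum m (Suc k1) r (\<lambda>\<sigma>. G (f2 \<sigma>) (g2 \<sigma>) t)"
  proof (rule perm_sum_cong)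
   fix \<sigma> assume \<sigma>: "\<sigma> permutes {..<m}" "\<sigma> (Suc k1) = r"
   let ?V = "\<lambda>j. \<tau> (\<sigma> (Suc k1 + j))"
   have V: "?V 0 = (1, 0)" "fst (?V (Suc j)) = 0" if "j < l" for j
    using spat(2)[OF \<sigma>, of "Suc k1" "Suc j"] that \<sigma>(2) r(2) by (simp_all add: m_def)
   have V0: "?V 0 = (1, 0)" using \<sigma>(2) r(2) by simp
   have "hor \<xi> i (s, x) (?t \<sigma>) = ?w s (?t \<sigma>)" if "a \<le> s" for s
    unfolding hor_def
   proof (rule alternating_cong[OF is_formD(1)[OF \<xi> i x that]])
    fix j assume "j < Suc k1"
    thus "spatial (?t \<sigma>) j = \<tau> (\<sigma> j)"
     using spat(1)[OF \<sigma>, of 0 j] by (simp add: m_def)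
   qed
   hence "tail c b (hor \<xi>) i (t, x) (?t \<sigma>) = (LINT s:{t..b}|lborel. f2 \<sigma> s)"
    using t by (auto simp: tail_def f2_def intro!: set_lebesgue_integral_cong)
   hence th: "\<theta> i (t, x) (?t \<sigma>) = \<kappa> t * ?w t (?t \<sigma>) - (LINT s:{t..b}|lborel. f2 \<sigma> s)"
    by (simp add: \<theta>_def form_diff_def fscale_def)
   have dp: "?dP t ?V = - c t * integral {a..t} (g2 \<sigma>) + \<kappa> t * g2 \<sigma> t"
    using ext_deriv_prim_normal[OF u \<kappa>(1,2) i z V0 V(2)] by (simp add: ip loc_def g2_def[abs_def])
   have ug: "u i (t, x) ?V = g2 \<sigma> t" and f2t: "f2 \<sigma> t = c t * ?w t (?t \<sigma>)"
    by (simp_all add: g2_def f2_def)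
   show "Fa \<sigma> - Fb \<sigma> = G (f2 \<sigma>) (g2 \<sigma>) t"
    unfolding Fa_def Fb_def th dp ug G_def f2t by (simp add: algebra_simps)
  qed
  finally have second: "perm_sum m (Suc k1) r Fa - perm_sum m (Suc k1) r Fb = perm_sum m (Suc k1) r (\<lambda>\<sigma>. G (f2 \<sigma>) (g2 \<sigma>) t)" .
  \<comment> \<open>The normalizations of the two wedge products agree: each side is
    \<open>X / (fact k1 * fact (Suc l))\<close>.\<close>
  have fac: "real (Suc (Suc l)) * X / (fact k1 * fact (Suc (Suc l))) = real (Suc k1) * X / (fact (Suc k1) * fact (Suc l))" for X
   by (simp add: divide_simps)
  show ?thesis
   unfolding Wa Wb Wc Wc0 add_0 fac first[symmetric] second[symmetric]
   by (simp add: diff_divide_distrib add_divide_distrib algebra_simps del: fact_Suc)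
 qed
 have "has_bochner_integral lborel (\<lambda>t. (real (Suc k1) * (indicator {a..b} t * perm_sum m k1 r (\<lambda>\<sigma>. G (f1 \<sigma>) (g1 \<sigma>) t)) +
   real (Suc l) * (indicator {a..b} t * perm_sum m (Suc k1) r (\<lambda>\<sigma>. G (f2 \<sigma>) (g2 \<sigma>) t))) / (fact (Suc k1) * fact (Suc l)))
   ((real (Suc k1) * 0 + real (Suc l) * 0) / (fact (Suc k1) * fact (Suc l)))"
  by (intro has_bochner_integral_divide has_bochner_integral_add has_bochner_integral_mult_right
    has_bochner_integral_perm_sum[where i = "indicator {a..b}"] G0)
 moreover have "(real (Suc k1) * (indicator {a..b} t * perm_sum m k1 r (\<lambda>\<sigma>. G (f1 \<sigma>) (g1 \<sigma>) t)) +
   real (Suc l) * (indicator {a..b} t * perm_sum m (Suc k1) r (\<lambda>\<sigma>. G (f2 \<sigma>) (g2 \<sigma>) t))) / (fact (Suc k1) * fact (Suc l)) =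
   indicator {a..b} t * (wedge (Suc k1) (Suc l) (\<theta> i (t, x)) (u i (t, x)) \<tau>
    - wedge (Suc k1) (Suc l) (?w t) (?dP t) \<tau>
    - (-1) ^ Suc k1 * wedge k1 (Suc (Suc l)) (\<psi> i (t, x)) (?du t) \<tau>)" for t
 proof (cases "t \<in> {a..b}")
  case True
  hence "a \<le> t" by simp
  from ptw[OF this] True show ?thesis by (simp del: fact_Suc)
 next
  case False
  thus ?thesis by simp
 qed
 ultimately show ?thesis unfolding \<tau>_def by (simp only: mult_zero_right add_0 div_0)
qed

end

context cyl_cover
begin

lemma test_wedge_integral:
 assumes \<xi>: "\<xi> \<in> Lp M p k" and p: "1 \<le> p" and kl: "Suc k + l = DIM(real \<times> 'e)" and u: "test_form M l u"
 shows "r < m ==> integrable lborel (\<lambda>z. indicator (Z r) z * wedge_coeff k (Suc l) \<xi> (ext_deriv M l u) r z)"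
  and "form_integral M (wedge_form k (Suc l) \<xi> (ext_deriv M l u)) =
   (\<Sum>r<m. \<integral>z. indicator (Z r) z * wedge_coeff k (Suc l) \<xi> (ext_deriv M l u) r z \<partial>lborel)"
proof -
 have su: "smooth_form M l u" using u by (simp add: test_form_def)
 have kl': "k + Suc l = Suc DIM('e)" using kl by simp
 obtain \<epsilon> b where "\<epsilon> > 0" "\<And>i t x. t < a + \<epsilon> ==> u i (t, x) = (\<lambda>v. 0)" and b: "\<And>i t x. b < t ==> u i (t, x) = (\<lambda>v. 0)"
  using test_form_support[OF u] by blast
 have du0: "ext_deriv M l u i (t, x) = (\<lambda>v. 0)" if "b < t" for i t x
  by (rule ext_deriv_support[where b = b and u = u]) (use b that in blast)+
 show "r < m ==> integrable lborel (\<lambda>z. indicator (Z r) z * wedge_coeff k (Suc l) \<xi> (ext_deriv M l u) r z)"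
  and "form_integral M (wedge_form k (Suc l) \<xi> (ext_deriv M l u)) =
   (\<Sum>r<m. \<integral>z. indicator (Z r) z * wedge_coeff k (Suc l) \<xi> (ext_deriv M l u) r z \<partial>lborel)"
  by (rule wedge_integral[where b = b, OF \<xi> p is_form_ext_deriv[OF su] continuous_form_ext_deriv[OF su] _ kl'];
    (erule du0 | assumption))+
qed

text \<open>Summing the ray identity over the pieces and integrating it over \<open>N\<close> gives
  the equation up to the pairing of \<xi> with the derivative of \<open>P\<close>, which closedness
  removes.\<close>

lemma weak_deriv_cut:
 assumes p: "1 \<le> p" "1 \<le> q" and \<xi>: "\<xi> \<in> Lp M p (Suc k1)" and closed: "weak_deriv M (Suc k1) \<xi> zero_form"
  and F: "fibre_integrable b \<xi>"
  and \<kappa>: "\<And>t. (\<kappa> has_real_derivative - c t) (at t)" "\<And>k. Ck_on k UNIV \<kappa>" "\<And>t. \<bar>\<kappa> t\<bar> \<le> B" "\<And>t. b < t ==> \<kappa> t = 0"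
  and c: "c \<in> borel_measurable borel" "\<And>t. \<bar>c t\<bar> \<le> B"
  and kn: "Suc k1 \<le> DIM('e)"
 defines "\<theta> \<equiv> form_diff (fscale \<kappa> \<xi>) (tail c b (hor \<xi>))"
  and "\<psi> \<equiv> tail (\<lambda>s. (-1) ^ Suc k1 * \<kappa> s) b (con_last k1 \<xi>)"
 assumes \<theta>: "\<theta> \<in> Lp M p (Suc k1)" and \<psi>: "\<psi> \<in> Lp M q k1"
 shows "weak_deriv M k1 \<psi> \<theta>"
 unfolding weak_deriv_def
proof (intro conjI allI impI)
 show "loc_integrable_form M k1 \<psi>" "loc_integrable_form M (Suc k1) \<theta>" using \<theta> \<psi> by (simp_all add: Lp_def)
 fix l' u assume l': "Suc k1 + l' = DIM(real \<times> 'e)" and tu': "test_form M l' u"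
 \<comment> \<open>The degree of the form is at most the dimension of \<open>N\<close>, so the
   complementary test form on the cylinder has positive degree and can be contracted with
   d/dt.\<close>
 then obtain l where l: "l' = Suc l" using kn by (cases l') auto
 have kl: "Suc k1 + Suc l = Suc DIM('e)" using l' l by simp
 have tu: "test_form M (Suc l) u" using tu' l by simp
 hence su: "smooth_form M (Suc l) u" by (simp add: test_form_def)
 obtain \<epsilon> b' where \<epsilon>: "\<epsilon> > 0" "\<And>i t x. t < a + \<epsilon> ==> u i (t, x) = (\<lambda>v. 0)" "\<And>i t x. b' < t ==> u i (t, x) = (\<lambda>v. 0)"
  using test_form_support[OF tu] by blast
 have ua: "u i (a, x) = (\<lambda>v. 0)" for i x by (rule \<epsilon>(2)) (use \<epsilon>(1) in simp)
 have \<xi>f: "is_form M (Suc k1) \<xi>"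
  using \<xi> by (simp add: Lp_def loc_integrable_form_def measurable_form_def)
 define P where "P = prim \<kappa> u"
 have tP: "test_form M l P" unfolding P_def by (rule test_form_prim[OF tu \<kappa>(2,4)])
 hence sP: "smooth_form M l P" by (simp add: test_form_def)
 have P0: "P i (t, x) = (\<lambda>v. 0)" if "b < t" for i t x
  unfolding P_def by (rule prim_eq_zero[OF that \<kappa>(4)])
 define du where "du = ext_deriv M (Suc l) u"
 define dP where "dP = ext_deriv M l P"
 have dP0: "dP i (t, x) = (\<lambda>v. 0)" if "b < t" for i t x
  unfolding dP_def by (rule ext_deriv_support[where b = b and u = P]) (use P0 that in blast)+
 have W1: "r < m ==> integrable lborel (\<lambda>z. indicator (Z r) z * wedge_coeff (Suc k1) (Suc l) \<theta> u r z)"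
   "form_integral M (wedge_form (Suc k1) (Suc l) \<theta> u) = (\<Sum>r<m. \<integral>z. indicator (Z r) z * wedge_coeff (Suc k1) (Suc l) \<theta> u r z \<partial>lborel)" for r
  by (rule wedge_integral[where b = b', OF \<theta> p(1) smooth_form_is_form[OF su] continuous_form_smooth[OF su] _ kl]; (erule \<epsilon>(3) | assumption))+
 have kl2: "Suc (Suc k1) + l = DIM(real \<times> 'e)" using kl by simp
 note W2 = test_wedge_integral[OF \<xi> p(1) kl2 tP, folded dP_def]
 note W3 = test_wedge_integral[OF \<psi> p(2) l'[unfolded l] tu, folded du_def]
 \<comment> \<open>This is where closedness of \<xi> enters, with the primitive \<open>P\<close> as
   the test form.\<close>
 have cl: "form_integral M (wedge_form (Suc k1) (Suc l) \<xi> dP) = 0"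
 proof -
  have "form_integral M (wedge_form (Suc (Suc k1)) l zero_form P) =
    (-1) ^ Suc (Suc k1) * form_integral M (wedge_form (Suc k1) (Suc l) \<xi> dP)"
   using closed tP l' l unfolding weak_deriv_def dP_def by auto
  moreover have "wedge_form (Suc (Suc k1)) l zero_form P = zero_form"
   by (simp add: wedge_form_def zero_form_def wedge_zero_left)
  ultimately show ?thesis by (simp add: form_integral_def zero_form_def)
 qed
 define I where "I k l \<alpha> \<beta> r = (\<integral>z. indicator (Z r) z * wedge_coeff k l \<alpha> \<beta> r z \<partial>lborel)" for k l \<alpha> \<beta> r
 have piece: "I (Suc k1) (Suc l) \<theta> u r - I (Suc k1) (Suc l) \<xi> dP r - (-1) ^ Suc k1 * I k1 (Suc (Suc l)) \<psi> du r = 0"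
  if r: "r < m" for r
 proof -
  define f where "f z = indicator (Z r) z * wedge_coeff (Suc k1) (Suc l) \<theta> u r z
   - indicator (Z r) z * wedge_coeff (Suc k1) (Suc l) \<xi> dP r z
   - (-1) ^ Suc k1 * (indicator (Z r) z * wedge_coeff k1 (Suc (Suc l)) \<psi> du r z)" for z
  have fi: "integrable lborel f" unfolding f_def
   by (intro Bochner_Integration.integrable_diff integrable_mult_right W1(1) W2(1) W3(1) r)
  have fI: "integral\<^sup>L lborel f = I (Suc k1) (Suc l) \<theta> u r - I (Suc k1) (Suc l) \<xi> dP r - (-1) ^ Suc k1 * I k1 (Suc (Suc l)) \<psi> du r"
   unfolding f_def I_def
   by (simp only: Bochner_Integration.integral_diff Bochner_Integration.integrable_diff integrable_mult_right
     W1(1)[OF r] W2(1)[OF r] W3(1)[OF r] integral_mult_right_zero)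
  have "(\<integral>t. f (t, y) \<partial>lborel) = 0" for y
  proof (cases "y \<in> Y r")
   case True
   hence y: "y \<in> chart_im (\<iota> r)" using Y_chart_im[OF r] by blast
   define x where "x = inv_chart (\<iota> r) y"
   have x: "x \<in> cdom N (\<iota> r)" using y iota[OF r] by (simp add: x_def)
   have ip: "ipr r (t, y) = (t, x)" for t by (simp add: inv_pair_def x_def)
   have big: "f (t, y) = 0" if "b < t" for t
   proof -
    have "\<theta> i (t, x) = (\<lambda>v. 0)" "\<psi> i (t, x) = (\<lambda>v. 0)" "dP i (t, x) = (\<lambda>v. 0)" for i
     using that \<kappa>(4)[OF that] dP0[OF that]
     by (simp_all add: \<theta>_def \<psi>_def form_diff_def fscale_def tail_def fun_eq_iff set_lebesgue_integral_def)
    thus ?thesis by (simp add: f_def wedge_coeff_def ip wedge_zero_left wedge_zero_right)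
   qed
   have "(\<lambda>t. f (t, y)) = (\<lambda>t. indicator {a..b} t *
    (wedge (Suc k1) (Suc l) (\<theta> (\<iota> r) (t, x)) (u (\<iota> r) (t, x)) basis_enum
     - wedge (Suc k1) (Suc l) (\<xi> (\<iota> r) (t, x)) (dP (\<iota> r) (t, x)) basis_enum
     - (-1) ^ Suc k1 * wedge k1 (Suc (Suc l)) (\<psi> (\<iota> r) (t, x)) (du (\<iota> r) (t, x)) basis_enum))"
   proof
    fix t
    have "indicator (Z r) (t, y) = (indicator {a..} t :: real)" using True by (simp add: Z_def indicator_def)
    thus "f (t, y) = indicator {a..b} t *
    (wedge (Suc k1) (Suc l) (\<theta> (\<iota> r) (t, x)) (u (\<iota> r) (t, x)) basis_enum
     - wedge (Suc k1) (Suc l) (\<xi> (\<iota> r) (t, x)) (dP (\<iota> r) (t, x)) basis_enum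
     - (-1) ^ Suc k1 * wedge k1 (Suc (Suc l)) (\<psi> (\<iota> r) (t, x)) (du (\<iota> r) (t, x)) basis_enum)"
     using big[of t] by (cases "b < t"; cases "a \<le> t") (simp_all add: f_def wedge_coeff_def ip)
   qed
   thus ?thesis
    using fibre_identity[OF \<xi>f F su ua \<kappa>(1-3) c kl iota[OF r] x]
    unfolding \<theta>_def \<psi>_def dP_def du_def P_def by (simp only: has_bochner_integral_iff)
  next
   case False
   thus ?thesis by (simp add: f_def Z_def)
  qed
  \<comment> \<open>Fubini with the axis variable innermost. It applies because each of the three
    products is integrable in both variables together.\<close>
  moreover have "(\<integral>y. (\<integral>t. f (t, y) \<partial>lborel) \<partial>lborel) = integral\<^sup>L (lborel \<Otimes>\<^sub>M lborel) (case_prod (\<lambda>t y. f (t, y)))"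
   by (rule lborel_pair.integral_snd) (use fi in "simp add: lborel_prod")
  ultimately have "integral\<^sup>L lborel f = 0" by (simp add: lborel_prod)
  thus ?thesis unfolding fI .
 qed
 have "form_integral M (wedge_form (Suc k1) (Suc l) \<theta> u) - form_integral M (wedge_form (Suc k1) (Suc l) \<xi> dP)
   - (-1) ^ Suc k1 * form_integral M (wedge_form k1 (Suc (Suc l)) \<psi> du) =
  (\<Sum>r<m. I (Suc k1) (Suc l) \<theta> u r - I (Suc k1) (Suc l) \<xi> dP r - (-1) ^ Suc k1 * I k1 (Suc (Suc l)) \<psi> du r)"
  unfolding W1(2) W2(2) W3(2) I_def[symmetric] sum_subtractf sum_distrib_left[symmetric] ..
 also have "... = 0" by (rule sum.neutral) (use piece in auto)
 finally show "form_integral M (wedge_form (Suc k1) l' \<theta> u) =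
   (-1) ^ Suc k1 * form_integral M (wedge_form k1 (Suc l') \<psi> (ext_deriv M l' u))"
  unfolding cl l du_def diff_0_right right_minus_eq .
qed

end

section \<open>Estimates for fibre integrals\<close>

lemma nn_integral_lborel_snd:
 fixes f :: "real \<times> 'v::euclidean_space => ennreal"
 assumes "f \<in> borel_measurable borel"
 shows "(\<integral>\<^sup>+y. (\<integral>\<^sup>+s. f (s, y) \<partial>lborel) \<partial>lborel) = (\<integral>\<^sup>+z. f z \<partial>lborel)"
 using lborel_pair.nn_integral_snd[of f] assms by (simp add: lborel_prod)

text \<open>The bound is the same for all heights \<open>t\<close> in \<open>[a, b]\<close>, so
  integration over \<open>t\<close> costs the factor \<open>b - a\<close> and integration over
  \<open>y\<close> restores the full integral of \<phi>.\<close>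

lemma nn_integral_fibre_bound:
 fixes \<phi> \<Phi> :: "real \<times> 'v::euclidean_space => ennreal"
 assumes \<phi>: "\<phi> \<in> borel_measurable borel" and ab: "a \<le> b"
  and le: "\<And>t y. \<Phi> (t, y) \<le> indicator {a..b} t * (\<integral>\<^sup>+s. \<phi> (s, y) \<partial>lborel)"
 shows "(\<integral>\<^sup>+z. \<Phi> z \<partial>lborel) \<le> ennreal (b - a) * (\<integral>\<^sup>+z. \<phi> z \<partial>lborel)"
proof -
 define C where "C = (\<integral>\<^sup>+z. \<phi> z \<partial>lborel)"
 have "(\<lambda>(y, s). \<phi> (s, y)) \<in> borel_measurable (borel \<Otimes>\<^sub>M lborel)"
 proof -
  have "(\<lambda>p. (snd p, fst p)) \<in> borel \<Otimes>\<^sub>M lborel \<rightarrow>\<^sub>M (borel :: real measure) \<Otimes>\<^sub>M (borel :: 'v measure)" by simp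
  from measurable_compose[OF this, of \<phi> borel] \<phi> show ?thesis by (simp add: borel_prod case_prod_unfold)
 qed
 from lborel.borel_measurable_nn_integral[OF this]
 have [measurable]: "(\<lambda>y. \<integral>\<^sup>+s. \<phi> (s, y) \<partial>lborel) \<in> borel_measurable borel" .
 have m: "(\<lambda>z. indicator {a..b} (fst z) * (\<integral>\<^sup>+s. \<phi> (s, snd z) \<partial>lborel)) \<in> borel_measurable (lborel \<Otimes>\<^sub>M lborel)"
  by measurable
 have "(\<integral>\<^sup>+z. \<Phi> z \<partial>lborel) \<le> (\<integral>\<^sup>+z. indicator {a..b} (fst z) * (\<integral>\<^sup>+s. \<phi> (s, snd z) \<partial>lborel) \<partial>(lborel :: (real \<times> 'v) measure))"
 proof (rule nn_integral_mono)
  fix z :: "real \<times> 'v"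
  show "\<Phi> z \<le> indicator {a..b} (fst z) * (\<integral>\<^sup>+s. \<phi> (s, snd z) \<partial>lborel)" using le[of "fst z" "snd z"] by simp
 qed
 also have "... = (\<integral>\<^sup>+t. (\<integral>\<^sup>+y. indicator {a..b} t * (\<integral>\<^sup>+s. \<phi> (s, y) \<partial>lborel) \<partial>lborel) \<partial>lborel)"
  using lborel.nn_integral_fst[OF m] by (simp add: lborel_prod)
 also have "... = (\<integral>\<^sup>+t. C * indicator {a..b} t \<partial>lborel)"
  unfolding C_def by (simp add: nn_integral_cmult nn_integral_lborel_snd[OF \<phi>] mult.commute)
 also have "... = C * ennreal (b - a)" using ab by (simp add: nn_integral_cmult_indicator)
 finally show ?thesis by (simp add: C_def mult.commute)
qed

lemma AE_lborel_snd:
 assumes "AE y in lborel. P y"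
 shows "AE z in (lborel :: (real \<times> 'v::euclidean_space) measure). P (snd z)"
proof -
 obtain A where A: "{y. \<not> P y} \<subseteq> A" "A \<in> null_sets lborel"
  using assms by (auto elim!: AE_E simp: null_sets_def)
 have "emeasure (lborel \<Otimes>\<^sub>M lborel) (UNIV \<times> A) = 0"
  using A(2) by (subst lborel.emeasure_pair_measure_Times) (auto simp: null_sets_def)
 moreover have "UNIV \<times> A \<in> sets (lborel \<Otimes>\<^sub>M lborel)"
  using A(2) by (intro pair_measureI) (auto simp: null_sets_def)
 ultimately have "(UNIV :: real set) \<times> A \<in> null_sets lborel"
  unfolding lborel_prod by (simp add: null_sets_def)
 thus ?thesis by (rule AE_I') (use A(1) in auto)
qed

text \<open>Hoelder's inequality against the constant function one, derived from Young's
  inequality.\<close>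

lemma powr_integral_Icc_le:
 fixes g :: "real => real"
 assumes q: "1 < q" and cd: "c < d" and g1: "integrable lborel (\<lambda>s. indicator {c..d} s * \<bar>g s\<bar>)"
  and gq: "integrable lborel (\<lambda>s. indicator {c..d} s * \<bar>g s\<bar> powr q)"
 shows "(\<integral>s. indicator {c..d} s * \<bar>g s\<bar> \<partial>lborel) powr q \<le>
  (d - c) powr (q - 1) * (\<integral>s. indicator {c..d} s * \<bar>g s\<bar> powr q \<partial>lborel)" (is "?I powr q \<le> _ * ?J")
proof (cases "?I = 0")
 case True
 have "0 \<le> ?J" by (rule lint_nonneg) simp
 thus ?thesis using True q by simp
next
 case False
 have I: "0 < ?I"
  by (rule le_neq_trans[OF _ False[symmetric]]) (rule lint_nonneg, simp)
 \<comment> \<open>The mean value of the function. With this scaling Young's inequality is sharp at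
   \<open>x = m\<close>, which produces the optimal constant after integration.\<close>
 define m where "m = ?I / (d - c)"
 have m: "0 < m" and Im: "?I = m * (d - c)" using I cd by (simp_all add: m_def)
 have young: "x \<le> m powr (1 - q) / q * x powr q + m * (1 - 1 / q)" if "0 \<le> x" for x
 proof -
  have "x / m * 1 \<le> (x / m) powr q / q + 1 powr (q / (q - 1)) / (q / (q - 1))"
   by (rule Youngs_inequality) (use q m that in "auto simp: field_simps")
  hence "m * (x / m) \<le> m * ((x / m) powr q / q + (1 - 1 / q))"
   using m q by (intro mult_left_mono) (auto simp: field_simps)
  also have "... = m powr (1 - q) / q * x powr q + m * (1 - 1 / q)"
   using m q that by (simp add: powr_divide powr_diff field_simps)
  finally show ?thesis using m by simp
 qed
 have i1: "integrable lborel (\<lambda>s. m * (1 - 1 / q) * indicator {c..d} s)"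
  using cd by (intro integrable_mult_right integrable_real_indicator) (auto simp: emeasure_lborel_Icc)
 have "?I \<le> (\<integral>s. m powr (1 - q) / q * (indicator {c..d} s * \<bar>g s\<bar> powr q) + m * (1 - 1 / q) * indicator {c..d} s \<partial>lborel)"
  using g1 gq i1 young by (intro integral_mono Bochner_Integration.integrable_add integrable_mult_right) (auto simp: indicator_def)
 also have "... = m powr (1 - q) / q * ?J + m * (1 - 1 / q) * (d - c)"
  using gq i1 cd by (subst Bochner_Integration.integral_add) (auto intro: integrable_mult_right)
 finally have "m * (d - c) / q \<le> m powr (1 - q) * ?J / q" unfolding Im using q by (simp add: field_simps)
 hence "m * (d - c) \<le> m powr (1 - q) * ?J" using q by (simp add: divide_le_cancel)
 hence "m powr (q - 1) * (m * (d - c)) \<le> m powr (q - 1) * (m powr (1 - q) * ?J)" by (rule mult_left_mono) simp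
 moreover have "m powr (q - 1) * m powr (1 - q) = 1" "m powr (q - 1) * m = m powr q"
  using m by (simp_all add: powr_add[symmetric] powr_diff)
 ultimately have "m powr q * (d - c) \<le> ?J" by (simp only: mult.assoc[symmetric] mult_1_left)
 hence "(d - c) powr (q - 1) * (m powr q * (d - c)) \<le> (d - c) powr (q - 1) * ?J" by (rule mult_left_mono) simp
 moreover have "?I powr q = (d - c) powr (q - 1) * (m powr q * (d - c))"
  unfolding Im using m cd by (simp add: powr_mult powr_diff)
 ultimately show ?thesis by simp
qed

text \<open>If the integral on the right is infinite there is nothing to do, as the constant in
  front is positive. Otherwise the \<open>q\<close>-th power is integrable on the bounded interval
  \<open>[c, d]\<close>, hence so is \<open>g\<close>, and Hoelder applies there.\<close>

lemma tail_powr_bound: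
 fixes f g :: "real => real"
 assumes q: "1 < q" and g: "g \<in> borel_measurable borel" and f: "\<And>s. \<bar>f s\<bar> \<le> B" and B: "0 < B" and cd: "c < d"
  and supp: "\<And>s. s \<in> {t..b} ==> s \<notin> {c..d} ==> f s = 0"
 shows "ennreal (\<bar>LINT s : {t..b}|lborel. f s * g s\<bar> powr q) \<le>
  ennreal (B powr q * (d - c) powr (q - 1)) * (\<integral>\<^sup>+s. ennreal (indicator {c..d} s * \<bar>g s\<bar> powr q) \<partial>lborel)"
proof (cases "(\<integral>\<^sup>+s. ennreal (indicator {c..d} s * \<bar>g s\<bar> powr q) \<partial>lborel) < \<infinity>")
 case False
 hence "(\<integral>\<^sup>+s. ennreal (indicator {c..d} s * \<bar>g s\<bar> powr q) \<partial>lborel) = top" by (simp add: less_top[symmetric])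
 moreover have "0 < B powr q * (d - c) powr (q - 1)" using B cd by simp
 ultimately show ?thesis using B cd by (simp add: ennreal_mult_top)
next
 case True
 note [measurable] = g
 have gq: "integrable lborel (\<lambda>s. indicator {c..d} s * \<bar>g s\<bar> powr q)"
  using True by (intro integrableI_bounded) simp_all
 have g1: "integrable lborel (\<lambda>s. indicator {c..d} s * \<bar>g s\<bar>)"
 proof (rule Bochner_Integration.integrable_bound)
  show "integrable lborel (\<lambda>s. indicator {c..d} s + indicator {c..d} s * \<bar>g s\<bar> powr q)"
   using gq cd by (intro Bochner_Integration.integrable_add integrable_real_indicator) (auto simp: emeasure_lborel_Icc)
  show "AE s in lborel. norm (indicator {c..d} s * \<bar>g s\<bar>) \<le> norm (indicator {c..d} s + indicator {c..d} s * \<bar>g s\<bar> powr q)"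
   using abs_le_one_plus_powr[of q] q by (intro AE_I2) (simp add: indicator_def)
 qed simp
 have "\<bar>LINT s : {t..b}|lborel. f s * g s\<bar> \<le> (\<integral>s. \<bar>indicator {t..b} s * (f s * g s)\<bar> \<partial>lborel)"
  unfolding set_lebesgue_integral_def using integral_norm_bound[of lborel "\<lambda>s. indicator {t..b} s * (f s * g s)"] by simp
 also have "... \<le> (\<integral>s. B * (indicator {c..d} s * \<bar>g s\<bar>) \<partial>lborel)"
 proof (rule integral_mono')
  show "integrable lborel (\<lambda>s. B * (indicator {c..d} s * \<bar>g s\<bar>))" using g1 by (rule integrable_mult_right)
  show "\<bar>indicator {t..b} s * (f s * g s)\<bar> \<le> B * (indicator {c..d} s * \<bar>g s\<bar>)" for s
   using supp[of s] f[of s] B by (auto simp: indicator_def abs_mult intro!: mult_right_mono)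
 qed (use B in simp)
 also have "... = B * (LINT s:{c..d}|lborel. \<bar>g s\<bar>)" by (simp add: set_lebesgue_integral_def)
 finally have le: "\<bar>LINT s : {t..b}|lborel. f s * g s\<bar> \<le> B * (LINT s:{c..d}|lborel. \<bar>g s\<bar>)" .
 have pos: "0 \<le> (LINT s:{c..d}|lborel. \<bar>g s\<bar>)"
  unfolding set_lebesgue_integral_def by (rule lint_nonneg) simp
 have pq: "(LINT s:{c..d}|lborel. \<bar>g s\<bar>) powr q \<le> (d - c) powr (q - 1) * (LINT s:{c..d}|lborel. \<bar>g s\<bar> powr q)"
  using powr_integral_Icc_le[OF q cd g1 gq] by (simp add: set_lebesgue_integral_def)
 have "\<bar>LINT s : {t..b}|lborel. f s * g s\<bar> powr q \<le> (B * (LINT s:{c..d}|lborel. \<bar>g s\<bar>)) powr q"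
  using le q by (intro powr_mono2) auto
 also have "... = B powr q * (LINT s:{c..d}|lborel. \<bar>g s\<bar>) powr q"
  using B pos by (simp add: powr_mult)
 also have "... \<le> B powr q * ((d - c) powr (q - 1) * (LINT s:{c..d}|lborel. \<bar>g s\<bar> powr q))"
  by (intro mult_left_mono pq) simp
 finally have "\<bar>LINT s : {t..b}|lborel. f s * g s\<bar> powr q \<le>
   B powr q * (d - c) powr (q - 1) * (\<integral>s. indicator {c..d} s * \<bar>g s\<bar> powr q \<partial>lborel)"
  by (simp add: set_lebesgue_integral_def mult.assoc)
 hence "ennreal (\<bar>LINT s : {t..b}|lborel. f s * g s\<bar> powr q) \<le>
   ennreal (B powr q * (d - c) powr (q - 1) * (\<integral>s. indicator {c..d} s * \<bar>g s\<bar> powr q \<partial>lborel))"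
  by (rule ennreal_leI)
 also have "... = ennreal (B powr q * (d - c) powr (q - 1)) * ennreal (\<integral>s. indicator {c..d} s * \<bar>g s\<bar> powr q \<partial>lborel)"
  by (rule ennreal_mult) (auto intro!: lint_nonneg)
 also have "ennreal (\<integral>s. indicator {c..d} s * \<bar>g s\<bar> powr q \<partial>lborel) = (\<integral>\<^sup>+s. ennreal (indicator {c..d} s * \<bar>g s\<bar> powr q) \<partial>lborel)"
  by (rule nn_integral_eq_integral[symmetric, OF gq]) simp
 finally show ?thesis .
qed

context cyl
begin

lemma form_cong:
 assumes \<xi>: "is_form M k \<xi>" and vw: "\<And>j. j < k ==> v j = w j"
 shows "\<xi> i z v = \<xi> i z w"
proof (cases "i \<in> idx N \<and> a \<le> fst z \<and> snd z \<in> cdom N i")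
 case True
 hence "alternating k (\<xi> i z)" using is_formD(1)[OF \<xi>, of i "snd z" "fst z"] by simp
 thus ?thesis by (rule alternating_cong) (rule vw)
next
 case False
 thus ?thesis using is_formD(2)[OF \<xi>, of i "fst z" "snd z"] by simp
qed

lemma measurable_form_con:
 "measurable_form M k \<xi> ==> measurable_form M k (hor \<xi>)"
 "measurable_form M (Suc k) \<xi> ==> measurable_form M k (con_last k \<xi>)"
 unfolding measurable_form_iff
 by (auto intro: is_form_hor is_form_con_last) (auto simp: hor_def con_last_def)

lemma measurable_form_fscale:
 assumes \<xi>: "measurable_form M k \<xi>" and f: "f \<in> borel_measurable borel"
 shows "measurable_form M k (fscale f \<xi>)"
proof -
 have "(\<lambda>z. f (fst z)) \<in> borel_measurable (borel :: (real \<times> 'a) measure)"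
  by (rule measurable_compose[OF _ f]) (intro borel_measurable_continuous_onI continuous_intros)
 from measurable_form_lincomb[OF \<xi> \<xi> this borel_measurable_const[of 0]] show ?thesis by (simp add: fscale_def)
qed

lemma measurable_form_diff:
 "measurable_form M k \<xi> ==> measurable_form M k \<theta> ==> measurable_form M k (form_diff \<xi> \<theta>)"
 using measurable_form_lincomb[of k \<xi> \<theta> "\<lambda>z. 1" "\<lambda>z. -1"] by (simp add: form_diff_def)

lemma measurable_slice:
 assumes "measurable_form M k \<xi>" "i \<in> idx N"
 shows "(\<lambda>s. \<xi> i (s, x) v) \<in> borel_measurable borel"
proof (rule measurable_compose[of "\<lambda>s. (s, x)"])
 show "(\<lambda>z. \<xi> i z v) \<in> borel_measurable borel" using assms by (simp add: measurable_form_iff)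
 show "(\<lambda>s. (s, x)) \<in> borel_measurable borel" by (intro borel_measurable_continuous_onI continuous_intros)
qed

end

context cyl_cover
begin

text \<open>On a tuple of basis vectors the spatial projection either changes nothing or creates a
  zero argument.\<close>

lemma coeff_hor:
 assumes \<xi>: "is_form M k \<xi>" and v: "v \<in> tuples k"
 shows "coeff (hor \<xi>) r v z = (if spatial_count k v = k then coeff \<xi> r v z else 0)"
proof (cases "\<forall>j<k. fst (v j) = 0")
 case True
 hence "{j. j < k \<and> fst (v j) = 0} = {..<k}" by auto
 hence "spatial_count k v = k" by (simp add: spatial_count_def)
 moreover have "coeff (hor \<xi>) r v z = coeff \<xi> r v z"
  unfolding coeff_def hor_def by (rule form_cong[OF \<xi>]) (use True in "simp add: spatial_def prod_eq_iff")
 ultimately show ?thesis by simp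
next
 case False
 then obtain j where j: "j < k" "fst (v j) \<noteq> 0" by blast
 have "card {j. j < k \<and> fst (v j) = 0} < card {..<k}"
  by (rule psubset_card_mono) (use j in auto)
 hence "spatial_count k v \<noteq> k" by (simp add: spatial_count_def)
 moreover have "v j \<in> Basis" using v j(1) by (auto simp: tuples_def)
 hence "spatial v j = 0" using j(2) by (auto simp: spatial_def Basis_prod_def zero_prod_def)
 hence "coeff (hor \<xi>) r v z = 0" unfolding coeff_def hor_def by (rule form_zero_arg[OF \<xi> j(1)])
 ultimately show ?thesis by simp
qed

text \<open>The contracted coefficient is zero or equals the coefficient on the tuple extended by
  d/dt.\<close>

lemma coeff_con_last:
 assumes \<xi>: "is_form M (Suc k) \<xi>" and v: "v \<in> tuples k"
 obtains w where "w \<in> tuples (Suc k)" "\<And>z. \<bar>coeff (con_last k \<xi>) r v z\<bar> \<le> \<bar>coeff \<xi> r w z\<bar>"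
proof -
 define w where "w = restrict (v(k := (1, 0))) {..<Suc k}"
 have vB: "v j \<in> Basis" if "j < k" for j using v that by (auto simp: tuples_def)
 have "(1, 0) \<in> (Basis :: (real \<times> 'e) set)" by (simp add: Basis_prod_def)
 hence "w \<in> tuples (Suc k)" using vB by (auto simp: w_def tuples_def less_Suc_eq)
 moreover have "\<bar>coeff (con_last k \<xi>) r v z\<bar> \<le> \<bar>coeff \<xi> r w z\<bar>" for z
 proof (cases "\<forall>j<k. fst (v j) = 0")
  case True
  have "coeff (con_last k \<xi>) r v z = coeff \<xi> r w z"
   unfolding coeff_def con_last_def w_def
   by (rule form_cong[OF \<xi>]) (use True in "auto simp: spatial_def prod_eq_iff less_Suc_eq")
  thus ?thesis by simp
 next
  case False
  then obtain j where j: "j < k" "fst (v j) \<noteq> 0" by blast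
  hence "((spatial v)(k := (1, 0))) j = 0" using vB[OF j(1)] by (auto simp: spatial_def Basis_prod_def zero_prod_def)
  moreover have "j < Suc k" using j(1) by simp
  ultimately have "coeff (con_last k \<xi>) r v z = 0" unfolding coeff_def con_last_def by (intro form_zero_arg[OF \<xi>, of j])
  thus ?thesis by simp
 qed
 ultimately show ?thesis by (rule that)
qed

lemma coeff_pair: "coeff \<xi> r v (s, y) = \<xi> (\<iota> r) (s, inv_chart (\<iota> r) y) v"
 by (simp add: coeff_def inv_pair_def)

lemma coeff_tail_bound:
 assumes \<xi>: "measurable_form M k \<xi>" and r: "r < m" and t: "a \<le> t" and q: "1 < q"
  and f: "\<And>s. \<bar>f s\<bar> \<le> B" and B: "0 < B" and cd: "c < d"
  and supp: "\<And>s. s \<in> {t..b} ==> s \<notin> {c..d} ==> f s = 0"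
 shows "ennreal (\<bar>coeff (tail f b \<xi>) r v (t, y)\<bar> powr q) \<le>
  ennreal (B powr q * (d - c) powr (q - 1)) * (\<integral>\<^sup>+s. ennreal (indicator {c..d} s * \<bar>coeff \<xi> r v (s, y)\<bar> powr q) \<partial>lborel)"
 unfolding coeff_pair using t
 by (simp add: tail_def) (rule tail_powr_bound[OF q measurable_slice[OF \<xi> iota[OF r]] f B cd supp])

text \<open>A strip has finite coordinate measure, so \<open>L^p\<close> embeds in
  \<open>L^q\<close> there. This embedding is what the condition \<open>q \<le> p\<close>
  provides.\<close>

lemma strip_powr_finite:
 assumes \<xi>: "\<xi> \<in> Lp M p k" and q: "1 \<le> q" "q \<le> p" and r: "r < m" and v: "v \<in> tuples k"
 shows "(\<integral>\<^sup>+z. ennreal (indicator (strip r b) z * \<bar>coeff \<xi> r v z\<bar> powr q) \<partial>lborel) < \<infinity>"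
proof -
 have p: "1 \<le> p" using q by simp
 have \<xi>m: "measurable_form M k \<xi>" and E: "energy p k \<xi> r v < \<infinity>" using \<xi> Lp_iff[OF p] r v by blast+
 have "(\<integral>\<^sup>+z. ennreal (indicator (strip r b) z * \<bar>coeff \<xi> r v z\<bar> powr q) \<partial>lborel) \<le>
   (\<integral>\<^sup>+z. indicator (strip r b) z + ennreal (indicator (strip r b) z * \<bar>coeff \<xi> r v z\<bar> powr p) \<partial>lborel)"
 proof (rule nn_integral_mono)
  fix z
  have "x powr q \<le> 1 + x powr p" if "0 \<le> x" for x :: real
  proof (cases "x \<le> 1")
   case True
   hence "x powr q \<le> 1 powr q" using that q by (intro powr_mono2) auto
   thus ?thesis by (simp add: add_increasing2)
  next
   case False
   hence "x powr q \<le> x powr p" using q by (intro powr_mono) auto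
   thus ?thesis by simp
  qed
  hence "ennreal (indicator (strip r b) z * \<bar>coeff \<xi> r v z\<bar> powr q) \<le>
    ennreal (indicator (strip r b) z + indicator (strip r b) z * \<bar>coeff \<xi> r v z\<bar> powr p)"
   by (intro ennreal_leI) (simp add: indicator_def)
  also have "... = indicator (strip r b) z + ennreal (indicator (strip r b) z * \<bar>coeff \<xi> r v z\<bar> powr p)"
   by (simp add: ennreal_plus ennreal_indicator)
  finally show "ennreal (indicator (strip r b) z * \<bar>coeff \<xi> r v z\<bar> powr q) \<le>
    indicator (strip r b) z + ennreal (indicator (strip r b) z * \<bar>coeff \<xi> r v z\<bar> powr p)" .
 qed
 also have "... = emeasure lborel (strip r b) + (\<integral>\<^sup>+z. ennreal (indicator (strip r b) z * \<bar>coeff \<xi> r v z\<bar> powr p) \<partial>lborel)"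
  using borel_strip[OF r, of b] measurable_coeff_powr[OF \<xi>m r, of b v p]
  by (subst nn_integral_add) (auto intro!: measurable_compose[OF _ measurable_ennreal])
 also have "... < \<infinity>"
  using emeasure_strip[OF r, of b] strip_energy_finite[OF \<xi>m r v _ E, of b] p by simp
 finally show ?thesis .
qed

text \<open>A finiteness statement: the constants depend on \<open>b\<close> through the strip. The
  bound that is uniform in the height is \<open>energy_tail_bound\<close>.\<close>

lemma Lp_tail:
 assumes q: "1 < q" and \<xi>: "measurable_form M k \<xi>" and F: "fibre_integrable b \<xi>" and ab: "a < b"
  and f: "f \<in> borel_measurable borel" "\<And>s. \<bar>f s\<bar> \<le> B" and B: "0 < B"
  and fin: "\<And>r v. r < m ==> v \<in> tuples k ==>
    (\<integral>\<^sup>+z. ennreal (indicator (strip r b) z * \<bar>coeff \<xi> r v z\<bar> powr q) \<partial>lborel) < \<infinity>"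
 shows "tail f b \<xi> \<in> Lp M q k"
proof -
 have q1: "1 \<le> q" using q by simp
 have m: "measurable_form M k (tail f b \<xi>)" by (rule measurable_tail[OF \<xi> F f])
 have "energy q k (tail f b \<xi>) r v < \<infinity>" if r: "r < m" and v: "v \<in> tuples k" for r v
 proof (rule energy_finite_of_strip[OF m r v])
  show "0 < q" using q by simp
  show "coeff (tail f b \<xi>) r v z = 0" if "b < fst z" for z
   using that by (simp add: coeff_def tail_def inv_pair_def set_lebesgue_integral_def)
  define K where "K = ennreal (B powr q * (b - a) powr (q - 1))"
  define \<phi> where "\<phi> z = K * ennreal (indicator (strip r b) z * \<bar>coeff \<xi> r v z\<bar> powr q)" for z
  have \<phi>m: "\<phi> \<in> borel_measurable borel" unfolding \<phi>_def
   using measurable_coeff_powr[OF \<xi> r, of b v q] by simp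
  have "(\<integral>\<^sup>+z. ennreal (indicator (strip r b) z * \<bar>coeff (tail f b \<xi>) r v z\<bar> powr q) \<partial>lborel) \<le> ennreal (b - a) * (\<integral>\<^sup>+z. \<phi> z \<partial>lborel)"
  proof (rule nn_integral_fibre_bound[OF \<phi>m])
   show "a \<le> b" using ab by simp
   fix t y
   show "ennreal (indicator (strip r b) (t, y) * \<bar>coeff (tail f b \<xi>) r v (t, y)\<bar> powr q) \<le> indicator {a..b} t * (\<integral>\<^sup>+s. \<phi> (s, y) \<partial>lborel)"
   proof (cases "(t, y) \<in> strip r b")
    case True
    hence t: "a \<le> t" "t \<le> b" and y: "y \<in> Y r" by (auto simp: strip_def Z_def)
    have "ennreal (\<bar>coeff (tail f b \<xi>) r v (t, y)\<bar> powr q) \<le>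
     K * (\<integral>\<^sup>+s. ennreal (indicator {a..b} s * \<bar>coeff \<xi> r v (s, y)\<bar> powr q) \<partial>lborel)"
     unfolding K_def by (rule coeff_tail_bound[OF \<xi> r t(1) q f(2) B ab]) (use t in auto)
    also have "... = (\<integral>\<^sup>+s. \<phi> (s, y) \<partial>lborel)"
    proof -
     have "(\<lambda>s. ennreal (indicator {a..b} s * \<bar>coeff \<xi> r v (s, y)\<bar> powr q)) =
      (\<lambda>s. ennreal (indicator (strip r b) (s, y) * \<bar>coeff \<xi> r v (s, y)\<bar> powr q))"
      using y by (auto simp: fun_eq_iff strip_def Z_def indicator_def)
     moreover have "(\<lambda>s. ennreal (indicator (strip r b) (s, y) * \<bar>coeff \<xi> r v (s, y)\<bar> powr q)) \<in> borel_measurable lborel"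
      using measurable_compose[OF _ measurable_coeff_powr[OF \<xi> r, of b v q], of "\<lambda>s. (s, y)" borel]
      by (auto intro!: borel_measurable_continuous_onI continuous_intros measurable_compose[OF _ measurable_ennreal])
     ultimately show ?thesis unfolding \<phi>_def by (simp add: nn_integral_cmult)
    qed
    finally show ?thesis using True t by simp
   qed simp
  qed
  also have "(\<integral>\<^sup>+z. \<phi> z \<partial>lborel) = K * (\<integral>\<^sup>+z. ennreal (indicator (strip r b) z * \<bar>coeff \<xi> r v z\<bar> powr q) \<partial>lborel)"
   unfolding \<phi>_def using measurable_coeff_powr[OF \<xi> r, of b v q] by (intro nn_integral_cmult) auto
  also have "ennreal (b - a) * ... < \<infinity>"
   using fin[OF r v] by (auto simp: K_def ennreal_mult_less_top)
  finally show "(\<integral>\<^sup>+z. ennreal (indicator (strip r b) z * \<bar>coeff (tail f b \<xi>) r v z\<bar> powr q) \<partial>lborel) < \<infinity>" .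
 qed
 thus ?thesis using m Lp_iff[OF q1] by blast
qed

text \<open>Assumed as an inequality between coefficients, so that it serves for sums, for
  differences and for forms that are merely dominated.\<close>

lemma energy_add_le:
 assumes p: "0 < p" and r: "r < m" and v: "v \<in> tuples k"
  and m1: "measurable_form M k \<xi>\<^sub>1" and m2: "measurable_form M k \<xi>\<^sub>2"
  and le: "\<And>z. z \<in> Z r ==> \<bar>scoeff \<xi> r v z\<bar> \<le> \<bar>scoeff \<xi>\<^sub>1 r v z\<bar> + \<bar>scoeff \<xi>\<^sub>2 r v z\<bar>"
 shows "energy p k \<xi> r v \<le> ennreal (2 powr p) * (energy p k \<xi>\<^sub>1 r v + energy p k \<xi>\<^sub>2 r v)"
proof -
 have "energy p k \<xi> r v \<le> (\<integral>\<^sup>+z. ennreal (2 powr p) * (ennreal (weight r z * \<bar>scoeff \<xi>\<^sub>1 r v z\<bar> powr p) + ennreal (weight r z * \<bar>scoeff \<xi>\<^sub>2 r v z\<bar> powr p)) \<partial>lborel)"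
  unfolding energy_def
 proof (rule nn_integral_mono)
  fix z
  let ?x = "\<bar>scoeff \<xi>\<^sub>1 r v z\<bar>" and ?y = "\<bar>scoeff \<xi>\<^sub>2 r v z\<bar>"
  have w: "0 \<le> weight r z" by (rule weight_nonneg[OF r])
  have "weight r z * \<bar>scoeff \<xi> r v z\<bar> powr p \<le> weight r z * (2 powr p * (?x powr p + ?y powr p))"
  proof (cases "z \<in> Z r")
   case True
   have "\<bar>scoeff \<xi> r v z\<bar> powr p \<le> \<bar>?x + ?y\<bar> powr p"
    using le[OF True] p by (intro powr_mono2) auto
   also have "... \<le> 2 powr p * (\<bar>?x\<bar> powr p + \<bar>?y\<bar> powr p)" by (rule powr_add_le[OF p])
   finally show ?thesis using w by (intro mult_left_mono) auto
  next
   case False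
   thus ?thesis by (simp add: weight_def)
  qed
  also have "... = 2 powr p * (weight r z * ?x powr p + weight r z * ?y powr p)" by (simp add: algebra_simps)
  finally have "ennreal (weight r z * \<bar>scoeff \<xi> r v z\<bar> powr p) \<le> ennreal (2 powr p * (weight r z * ?x powr p + weight r z * ?y powr p))"
   by (rule ennreal_leI)
  also have "... = ennreal (2 powr p) * (ennreal (weight r z * ?x powr p) + ennreal (weight r z * ?y powr p))"
   using w by (simp add: ennreal_mult ennreal_plus)
  finally show "ennreal (weight r z * \<bar>scoeff \<xi> r v z\<bar> powr p) \<le>
   ennreal (2 powr p) * (ennreal (weight r z * ?x powr p) + ennreal (weight r z * ?y powr p))" .
 qed
 also have "... = ennreal (2 powr p) * (energy p k \<xi>\<^sub>1 r v + energy p k \<xi>\<^sub>2 r v)"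
  unfolding energy_def using measurable_energy[OF m1 r v, of p] measurable_energy[OF m2 r v, of p]
  by (subst nn_integral_cmult; (subst nn_integral_add)?) auto
 finally show ?thesis .
qed

lemma Lp_diff:
 assumes p: "1 \<le> p" and \<xi>: "\<xi> \<in> Lp M p k" and \<theta>: "\<theta> \<in> Lp M p k"
 shows "form_diff \<xi> \<theta> \<in> Lp M p k"
proof -
 have m: "measurable_form M k \<xi>" "measurable_form M k \<theta>" using \<xi> \<theta> Lp_iff[OF p] by blast+
 have "energy p k (form_diff \<xi> \<theta>) r v < \<infinity>" if "r < m" "v \<in> tuples k" for r v
 proof -
  have "energy p k (form_diff \<xi> \<theta>) r v \<le> ennreal (2 powr p) * (energy p k \<xi> r v + energy p k \<theta> r v)"
   by (rule energy_add_le) (use p that m in "auto simp: scoeff_def form_diff_def")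
  also have "... < \<infinity>" using \<xi> \<theta> Lp_iff[OF p] that by (simp add: ennreal_mult_less_top)
  finally show ?thesis .
 qed
 thus ?thesis using measurable_form_diff[OF m] Lp_iff[OF p] by blast
qed

lemma Lp_fscale:
 assumes p: "1 \<le> p" and \<xi>: "\<xi> \<in> Lp M p k" and f: "f \<in> borel_measurable borel" "\<And>t. \<bar>f t\<bar> \<le> 1"
 shows "fscale f \<xi> \<in> Lp M p k"
proof -
 have m: "measurable_form M k \<xi>" using \<xi> Lp_iff[OF p] by blast
 have "energy p k (fscale f \<xi>) r v < \<infinity>" if rv: "r < m" "v \<in> tuples k" for r v
 proof -
  \<comment> \<open>Domination by \<xi>, obtained from the statement on sums with \<xi> in both
    places; only finiteness matters here.\<close>
  have "energy p k (fscale f \<xi>) r v \<le> ennreal (2 powr p) * (energy p k \<xi> r v + energy p k \<xi> r v)"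
  proof (rule energy_add_le[OF _ rv m m])
   fix z
   have "\<bar>scoeff (fscale f \<xi>) r v z\<bar> \<le> 1 * \<bar>scoeff \<xi> r v z\<bar>"
    unfolding scoeff_def fscale_def abs_mult by (intro mult_right_mono f) simp
   thus "\<bar>scoeff (fscale f \<xi>) r v z\<bar> \<le> \<bar>scoeff \<xi> r v z\<bar> + \<bar>scoeff \<xi> r v z\<bar>" by simp
  qed (use p in simp)
  also have "... < \<infinity>" using \<xi> Lp_iff[OF p] rv by (simp add: ennreal_mult_less_top)
  finally show ?thesis .
 qed
 thus ?thesis using measurable_form_fscale[OF m f(1)] Lp_iff[OF p] by blast
qed

end

section \<open>Closed forms, changes on null sets, and representatives integrable on all
  rays\<close>

lemma wedge_diff_left:
 "wedge k l (\<lambda>v. \<alpha> v - \<alpha>' v) \<beta> w = wedge k l \<alpha> \<beta> w - wedge k l \<alpha>' \<beta> w"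
 by (simp add: wedge_def sum_subtractf[symmetric] diff_divide_distrib[symmetric] algebra_simps)

context cyl_cover
begin

lemma zero_form_Lp: "1 \<le> p ==> zero_form \<in> Lp M p k"
 unfolding Lp_iff measurable_form_iff is_form_M_iff
 by (simp add: zero_form_def alternating_zero energy_def scoeff_def)

text \<open>Weak closedness as a family of linear conditions on \<xi>. In this shape it is visibly
  stable under differences and under changes on null sets.\<close>

lemma closed_iff:
 assumes p: "1 \<le> p" and \<xi>: "\<xi> \<in> Lp M p k"
 shows "weak_deriv M k \<xi> zero_form \<longleftrightarrow>
  (\<forall>l u. Suc k + l = DIM(real \<times> 'e) --> test_form M l u --> form_integral M (wedge_form k (Suc l) \<xi> (ext_deriv M l u)) = 0)"
proof -
 have "wedge_form (Suc k) l zero_form u = zero_form" for l and u :: "('i, 'a, 'e) cform"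
  by (simp add: wedge_form_def zero_form_def wedge_zero_left)
 moreover have "form_integral M zero_form = 0" by (simp add: form_integral_def zero_form_def)
 moreover have "loc_integrable_form M k \<xi>" "loc_integrable_form M (Suc k) zero_form"
  using \<xi> zero_form_Lp[OF p, of "Suc k"] by (simp_all add: Lp_def)
 ultimately show ?thesis unfolding weak_deriv_def by simp
qed

definition ae_eq :: "('i, 'a, 'e) cform => ('i, 'a, 'e) cform => bool" where
 "ae_eq \<xi> \<xi>' \<longleftrightarrow> (\<forall>r<m. AE z in lborel. z \<in> Z r --> \<xi> (\<iota> r) (ipr r z) = \<xi>' (\<iota> r) (ipr r z))"

lemma ae_eq_sym: "ae_eq \<xi> \<xi>' ==> ae_eq \<xi>' \<xi>"
 unfolding ae_eq_def
proof (intro allI impI)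
 fix r assume "\<forall>r<m. AE z in lborel. z \<in> Z r --> \<xi> (\<iota> r) (ipr r z) = \<xi>' (\<iota> r) (ipr r z)" "r < m"
 hence "AE z in lborel. z \<in> Z r --> \<xi> (\<iota> r) (ipr r z) = \<xi>' (\<iota> r) (ipr r z)" by simp
 thus "AE z in lborel. z \<in> Z r --> \<xi>' (\<iota> r) (ipr r z) = \<xi> (\<iota> r) (ipr r z)"
  by eventually_elim simp
qed

lemma energy_ae:
 assumes "ae_eq \<xi> \<xi>'" "r < m"
 shows "energy p k \<xi> r v = energy p k \<xi>' r v"
 unfolding energy_def
proof (rule nn_integral_cong_AE)
 have "AE z in lborel. z \<in> Z r --> \<xi> (\<iota> r) (ipr r z) = \<xi>' (\<iota> r) (ipr r z)" using assms by (simp add: ae_eq_def)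
 thus "AE z in lborel. ennreal (weight r z * \<bar>scoeff \<xi> r v z\<bar> powr p) = ennreal (weight r z * \<bar>scoeff \<xi>' r v z\<bar> powr p)"
  by eventually_elim (auto simp: scoeff_def weight_def indicator_def)
qed

lemma closed_ae:
 assumes p: "1 \<le> p" and \<xi>: "\<xi> \<in> Lp M p k" and \<xi>': "\<xi>' \<in> Lp M p k" and ae: "ae_eq \<xi> \<xi>'"
  and closed: "weak_deriv M k \<xi>' zero_form"
 shows "weak_deriv M k \<xi> zero_form"
 unfolding closed_iff[OF p \<xi>]
proof (intro allI impI)
 fix l u assume kl: "Suc k + l = DIM(real \<times> 'e)" and u: "test_form M l u"
 note W = test_wedge_integral[OF \<xi> p kl u] and W' = test_wedge_integral[OF \<xi>' p kl u]
 have "(\<integral>z. indicator (Z r) z * wedge_coeff k (Suc l) \<xi> (ext_deriv M l u) r z \<partial>lborel) =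
   (\<integral>z. indicator (Z r) z * wedge_coeff k (Suc l) \<xi>' (ext_deriv M l u) r z \<partial>lborel)" if r: "r < m" for r
 proof (rule integral_cong_AE)
  have "AE z in lborel. z \<in> Z r --> \<xi> (\<iota> r) (ipr r z) = \<xi>' (\<iota> r) (ipr r z)" using ae r by (simp add: ae_eq_def)
  thus "AE z in lborel. indicator (Z r) z * wedge_coeff k (Suc l) \<xi> (ext_deriv M l u) r z =
    indicator (Z r) z * wedge_coeff k (Suc l) \<xi>' (ext_deriv M l u) r z"
   by eventually_elim (auto simp: wedge_coeff_def indicator_def)
 qed (use W(1)[OF r] W'(1)[OF r] in "blast dest: borel_measurable_integrable")+
 hence "form_integral M (wedge_form k (Suc l) \<xi> (ext_deriv M l u)) = form_integral M (wedge_form k (Suc l) \<xi>' (ext_deriv M l u))"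
  unfolding W(2) W'(2) by simp
 thus "form_integral M (wedge_form k (Suc l) \<xi> (ext_deriv M l u)) = 0"
  using closed kl u unfolding closed_iff[OF p \<xi>'] by simp
qed

lemma Z_Lp_diff:
 assumes p: "1 \<le> p" and \<xi>: "\<xi> \<in> Z_Lp M p k" and \<theta>: "\<theta> \<in> Z_Lp M p k"
 shows "form_diff \<xi> \<theta> \<in> Z_Lp M p k"
proof -
 have L: "\<xi> \<in> Lp M p k" "\<theta> \<in> Lp M p k" and cl: "weak_deriv M k \<xi> zero_form" "weak_deriv M k \<theta> zero_form"
  using \<xi> \<theta> by (simp_all add: Z_Lp_def)
 have LD: "form_diff \<xi> \<theta> \<in> Lp M p k" by (rule Lp_diff[OF p L])
 have "weak_deriv M k (form_diff \<xi> \<theta>) zero_form"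
  unfolding closed_iff[OF p LD]
 proof (intro allI impI)
  fix l u assume kl: "Suc k + l = DIM(real \<times> 'e)" and u: "test_form M l u"
  note W = test_wedge_integral[OF _ p kl u]
  have "wedge_coeff k (Suc l) (form_diff \<xi> \<theta>) (ext_deriv M l u) r z =
    wedge_coeff k (Suc l) \<xi> (ext_deriv M l u) r z - wedge_coeff k (Suc l) \<theta> (ext_deriv M l u) r z" for r z
   unfolding wedge_coeff_def form_diff_def by (rule wedge_diff_left)
  hence "(\<integral>z. indicator (Z r) z * wedge_coeff k (Suc l) (form_diff \<xi> \<theta>) (ext_deriv M l u) r z \<partial>lborel) =
    (\<integral>z. indicator (Z r) z * wedge_coeff k (Suc l) \<xi> (ext_deriv M l u) r z \<partial>lborel) -
    (\<integral>z. indicator (Z r) z * wedge_coeff k (Suc l) \<theta> (ext_deriv M l u) r z \<partial>lborel)" if "r < m" for r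
   using W(1)[OF L(1) that] W(1)[OF L(2) that]
   by (simp only: right_diff_distrib Bochner_Integration.integral_diff)
  hence "form_integral M (wedge_form k (Suc l) (form_diff \<xi> \<theta>) (ext_deriv M l u)) =
    form_integral M (wedge_form k (Suc l) \<xi> (ext_deriv M l u)) - form_integral M (wedge_form k (Suc l) \<theta> (ext_deriv M l u))"
   unfolding W(2)[OF LD] W(2)[OF L(1)] W(2)[OF L(2)] by (simp add: sum_subtractf)
  thus "form_integral M (wedge_form k (Suc l) (form_diff \<xi> \<theta>) (ext_deriv M l u)) = 0"
   using cl kl u unfolding closed_iff[OF p L(1)] closed_iff[OF p L(2)] by simp
 qed
 thus ?thesis using LD by (simp add: Z_Lp_def)
qed

text \<open>A representative all of whose fibre integrals exist.\<close>

definition good :: "nat => real => ('i, 'a, 'e) cform => 'a set" where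
 "good k b \<xi> = (\<Union>r<m. D r \<inter> (\<Inter>v\<in>tuples k.
   {x. (\<integral>\<^sup>+s. ennreal (indicator {a..b} s * \<bar>\<xi> (\<iota> r) (s, x) v\<bar>) \<partial>lborel) < \<infinity>}))"

text \<open>The exceptional set consists of whole rays and is defined without reference to the chart
  of evaluation; so setting the form to zero there gives a form again.\<close>

definition regular :: "nat => real => ('i, 'a, 'e) cform => ('i, 'a, 'e) cform" where
 "regular k b \<xi> = (\<lambda>i z v. if snd z \<in> good k b \<xi> then \<xi> i z v else 0)"

lemma borel_good:
 assumes \<xi>: "measurable_form M k \<xi>"
 shows "good k b \<xi> \<in> sets borel"
 unfolding good_def
proof (intro sets.finite_UN sets.Int borel_D)
 fix r assume "r \<in> {..<m}"
 hence r: "r < m" by simp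
 have "{x. (\<integral>\<^sup>+s. ennreal (indicator {a..b} s * \<bar>\<xi> (\<iota> r) (s, x) v\<bar>) \<partial>lborel) < \<infinity>} \<in> sets borel" for v
 proof -
  have m: "(\<lambda>z. \<xi> (\<iota> r) z v) \<in> borel_measurable (borel \<Otimes>\<^sub>M borel)"
   using \<xi> iota[OF r] by (simp add: measurable_form_iff borel_prod)
  have [measurable]: "(\<lambda>p. \<xi> (\<iota> r) (snd p, fst p) v) \<in> borel_measurable (borel \<Otimes>\<^sub>M (lborel::real measure))"
   by (rule measurable_compose[OF _ m]) simp
  have "(\<lambda>(x, s). ennreal (indicator {a..b} s * \<bar>\<xi> (\<iota> r) (s, x) v\<bar>)) \<in> borel_measurable (borel \<Otimes>\<^sub>M lborel)"
   unfolding case_prod_unfold by measurable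
  from lborel.borel_measurable_nn_integral[OF this]
  have "(\<lambda>x. \<integral>\<^sup>+s. ennreal (indicator {a..b} s * \<bar>\<xi> (\<iota> r) (s, x) v\<bar>) \<partial>lborel) \<in> borel_measurable borel" .
  from measurable_sets[OF this, of "{..<\<infinity>}"] show ?thesis by (simp add: vimage_def)
 qed
 thus "(\<Inter>v\<in>tuples k. {x. (\<integral>\<^sup>+s. ennreal (indicator {a..b} s * \<bar>\<xi> (\<iota> r) (s, x) v\<bar>) \<partial>lborel) < \<infinity>}) \<in> sets borel"
  by (cases "tuples k = ({} :: (nat => real \<times> 'e) set)") (auto intro!: sets.finite_INT)
qed auto

lemma measurable_regular:
 assumes \<xi>: "measurable_form M k \<xi>"
 shows "measurable_form M k (regular k b \<xi>)"
proof -
 have "(\<lambda>z. indicator (UNIV \<times> good k b \<xi>) z :: real) \<in> borel_measurable (borel :: (real \<times> 'a) measure)"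
  using borel_good[OF \<xi>, of b] by (intro borel_measurable_indicator borel_Times) auto
 from measurable_form_lincomb[OF \<xi> \<xi> this borel_measurable_const[of 0]] show ?thesis
  by (rule back_subst[where P = "measurable_form M k"]) (auto simp: regular_def fun_eq_iff indicator_def)
qed

text \<open>In the chart of a piece, integrability on tuples of basis vectors is the definition of
  \<open>good\<close>. Another chart changes the arguments by \<open>TM\<close>, which is constant
  along the ray, so its coefficients are finite combinations with constant factors.\<close>

lemma fibre_integrable_regular:
 assumes \<xi>: "measurable_form M k \<xi>"
 shows "fibre_integrable b (regular k b \<xi>)"
 unfolding fibre_integrable_def
proof (intro ballI allI)
 fix i x v assume i: "i \<in> idx N" and x: "x \<in> cdom N i"
 have f: "is_form M k \<xi>" using \<xi> by (simp add: measurable_form_iff)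
 show "set_integrable lborel {a..b} (\<lambda>s. regular k b \<xi> i (s, x) v)"
 proof (cases "x \<in> good k b \<xi>")
  case True
  then obtain r where r: "r < m" and xD: "x \<in> D r" and fin: "\<And>w. w \<in> tuples k ==>
    (\<integral>\<^sup>+s. ennreal (indicator {a..b} s * \<bar>\<xi> (\<iota> r) (s, x) w\<bar>) \<partial>lborel) < \<infinity>"
   by (auto simp: good_def)
  have xr: "x \<in> cdom N (\<iota> r)" using xD D_cdom[OF r] by blast
  have int: "set_integrable lborel {a..b} (\<lambda>s. \<xi> (\<iota> r) (s, x) w)" if "w \<in> tuples k" for w
   unfolding set_integrable_def
  proof (rule integrableI_bounded)
   show "(\<lambda>s. indicator {a..b} s *\<^sub>R \<xi> (\<iota> r) (s, x) w) \<in> borel_measurable lborel"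
    using measurable_slice[OF \<xi> iota[OF r], of x w] by simp
   show "(\<integral>\<^sup>+s. ennreal (norm (indicator {a..b} s *\<^sub>R \<xi> (\<iota> r) (s, x) w)) \<partial>lborel) < \<infinity>"
    using fin[OF that] by (simp add: abs_mult)
  qed
  define T where "T j = TM i (\<iota> r) x (v j)" for j
  have eq: "\<xi> i (s, x) v = (\<Sum>w\<in>tuples k. (\<Prod>j<k. T j \<bullet> w j) * \<xi> (\<iota> r) (s, x) w)" if "s \<in> {a..b}" for s
  proof -
   have s: "a \<le> s" using that by simp
   have "\<xi> i (s, x) v = \<xi> (\<iota> r) (s, x) T"
    unfolding T_def[abs_def] by (rule is_formD(3)[OF f i iota[OF r] x xr s])
   also have "... = (\<Sum>w\<in>{..<k} \<rightarrow>\<^sub>E Basis. (\<Prod>j<k. T j \<bullet> w j) * \<xi> (\<iota> r) (s, x) w)"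
    by (rule alternating_expand[OF is_formD(1)[OF f iota[OF r] xr s] finite_Basis]) (simp add: euclidean_representation)
   finally show ?thesis by (simp add: tuples_def)
  qed
  have "integrable lborel (\<lambda>s. \<Sum>w\<in>tuples k. (\<Prod>j<k. T j \<bullet> w j) * (indicator {a..b} s *\<^sub>R \<xi> (\<iota> r) (s, x) w))"
   using int unfolding set_integrable_def by (intro Bochner_Integration.integrable_sum integrable_mult_right) auto
  moreover have "(\<lambda>s. \<Sum>w\<in>tuples k. (\<Prod>j<k. T j \<bullet> w j) * (indicator {a..b} s *\<^sub>R \<xi> (\<iota> r) (s, x) w)) =
    (\<lambda>s. indicator {a..b} s *\<^sub>R regular k b \<xi> i (s, x) v)"
   using eq True by (auto simp: fun_eq_iff indicator_def regular_def)
  ultimately show ?thesis by (simp add: set_integrable_def)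
 next
  case False
  thus ?thesis by (simp add: regular_def set_integrable_def)
 qed
qed

text \<open>The coefficients are integrable on strips, so by Fubini their integrals along the rays
  are finite for almost every point of \<open>N\<close>.\<close>

lemma ae_eq_regular:
 assumes p: "1 \<le> p" and \<xi>: "\<xi> \<in> Lp M p k"
 shows "ae_eq \<xi> (regular k b \<xi>)"
 unfolding ae_eq_def
proof (intro allI impI)
 fix r assume r: "r < m"
 have "AE y in lborel. integrable lborel (\<lambda>s. indicator (strip r b) (s, y) * coeff \<xi> r v (s, y))" if v: "v \<in> tuples k" for v
  using coeff_strip_integrable(1)[OF \<xi> p r v, of b]
   lborel_pair.AE_integrable_snd[of "\<lambda>s y. indicator (strip r b) (s, y) * coeff \<xi> r v (s, y)"]
  by (simp add: lborel_prod case_prod_unfold)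
 hence "AE y in lborel. \<forall>v\<in>tuples k. integrable lborel (\<lambda>s. indicator (strip r b) (s, y) * coeff \<xi> r v (s, y))"
  by (subst AE_finite_all) auto
 hence "AE y in lborel. y \<in> Y r --> inv_chart (\<iota> r) y \<in> good k b \<xi>"
 proof eventually_elim
  case (elim y)
  show ?case
  proof
   assume y: "y \<in> Y r"
   have "(\<integral>\<^sup>+s. ennreal (indicator {a..b} s * \<bar>\<xi> (\<iota> r) (s, inv_chart (\<iota> r) y) v\<bar>) \<partial>lborel) < \<infinity>" if "v \<in> tuples k" for v
   proof -
    have "(\<integral>\<^sup>+s. ennreal (norm (indicator (strip r b) (s, y) * coeff \<xi> r v (s, y))) \<partial>lborel) < \<infinity>"
     using elim that by (simp add: integrable_iff_bounded)
    moreover have "norm (indicator (strip r b) (s, y) * coeff \<xi> r v (s, y)) = indicator {a..b} s * \<bar>\<xi> (\<iota> r) (s, inv_chart (\<iota> r) y) v\<bar>" for s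
     using y by (auto simp: strip_def Z_def indicator_def coeff_pair)
    ultimately show ?thesis by simp
   qed
   moreover have "inv_chart (\<iota> r) y \<in> D r" using y Y_iff[OF r] by blast
   ultimately show "inv_chart (\<iota> r) y \<in> good k b \<xi>" using r by (auto simp: good_def)
  qed
 qed
 hence "AE z in (lborel :: (real \<times> 'e) measure). snd z \<in> Y r --> inv_chart (\<iota> r) (snd z) \<in> good k b \<xi>"
  by (rule AE_lborel_snd)
 thus "AE z in lborel. z \<in> Z r --> \<xi> (\<iota> r) (ipr r z) = regular k b \<xi> (\<iota> r) (ipr r z)"
  by eventually_elim (auto simp: Z_def regular_def inv_pair_def fun_eq_iff)
qed

lemma Lp_ae:
 assumes p: "1 \<le> p" and \<xi>: "\<xi> \<in> Lp M p k" and \<xi>': "measurable_form M k \<xi>'" and ae: "ae_eq \<xi> \<xi>'"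
 shows "\<xi>' \<in> Lp M p k"
 using \<xi> \<xi>' energy_ae[OF ae] unfolding Lp_iff[OF p] by simp

section \<open>Energies above a height, and the uniform estimate of the averaged part\<close>

definition tail_energy :: "real => nat => ('i, 'a, 'e) cform => nat => (nat => real \<times> 'e) => real => ennreal" where
 "tail_energy p k \<xi> r v T =
   (\<integral>\<^sup>+z. ennreal (indicator {T..} (fst z) * (weight r z * \<bar>scoeff \<xi> r v z\<bar> powr p)) \<partial>lborel)"

lemma tail_energy_ae:
 assumes "ae_eq \<xi> \<xi>'" "r < m"
 shows "tail_energy p k \<xi> r v T = tail_energy p k \<xi>' r v T"
 unfolding tail_energy_def
proof (rule nn_integral_cong_AE)
 have "AE z in lborel. z \<in> Z r --> \<xi> (\<iota> r) (ipr r z) = \<xi>' (\<iota> r) (ipr r z)" using assms by (simp add: ae_eq_def)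
 thus "AE z in lborel. ennreal (indicator {T..} (fst z) * (weight r z * \<bar>scoeff \<xi> r v z\<bar> powr p)) =
   ennreal (indicator {T..} (fst z) * (weight r z * \<bar>scoeff \<xi>' r v z\<bar> powr p))"
  by eventually_elim (auto simp: scoeff_def weight_def indicator_def)
qed

lemma measurable_tail_energy:
 assumes \<xi>: "measurable_form M k \<xi>" and r: "r < m" and v: "v \<in> tuples k" and T: "T \<in> sets borel"
 shows "(\<lambda>z. ennreal (indicator T (fst z) * (weight r z * \<bar>scoeff \<xi> r v z\<bar> powr p))) \<in> borel_measurable borel"
proof -
 have "(\<lambda>z. indicator T (fst z) :: real) \<in> borel_measurable (borel :: (real \<times> 'e) measure)"
  by (rule measurable_compose[of fst _ borel]) (use T in "auto intro!: borel_measurable_continuous_onI continuous_intros")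
 from borel_measurable_times[OF this measurable_energy[OF \<xi> r v, of p]]
 show ?thesis by (rule measurable_compose[OF _ measurable_ennreal])
qed

lemma tail_energy_tendsto:
 assumes \<xi>: "measurable_form M k \<xi>" and r: "r < m" and v: "v \<in> tuples k" and E: "energy p k \<xi> r v < \<infinity>"
 shows "(\<lambda>j. tail_energy p k \<xi> r v (real j)) \<longlonglongrightarrow> 0"
proof -
 let ?w = "\<lambda>z. weight r z * \<bar>scoeff \<xi> r v z\<bar> powr p"
 have "(\<lambda>j. \<integral>\<^sup>+z. ennreal (indicator {real j..} (fst z) * ?w z) \<partial>lborel) \<longlonglongrightarrow> (\<integral>\<^sup>+z. 0 \<partial>(lborel :: (real \<times> 'e) measure))"
 proof (rule nn_integral_dominated_convergence[where w = "\<lambda>z. ennreal (?w z)"])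
  show "(\<lambda>z. ennreal (indicator {real j..} (fst z) * ?w z)) \<in> borel_measurable lborel" for j
   using measurable_tail_energy[OF \<xi> r v, of "{real j..}" p] by simp
  show "(\<lambda>z. ennreal (?w z)) \<in> borel_measurable lborel" using measurable_energy[OF \<xi> r v, of p] by simp
  show "AE z in lborel. ennreal (indicator {real j..} (fst z) * ?w z) \<le> ennreal (?w z)" for j
   using weight_nonneg[OF r] by (intro AE_I2 ennreal_leI) (simp add: indicator_def)
  show "(\<integral>\<^sup>+z. ennreal (?w z) \<partial>lborel) < \<infinity>" using E by (simp add: energy_def)
  show "AE z in lborel. (\<lambda>j. ennreal (indicator {real j..} (fst z) * ?w z)) \<longlonglongrightarrow> 0"
  proof (rule AE_I2, rule tendsto_eventually)
   fix z :: "real \<times> 'e"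
   have "eventually (\<lambda>j. fst z < real j) sequentially"
    by (rule eventually_compose_filterlim[OF eventually_gt_at_top filterlim_real_sequentially])
   thus "eventually (\<lambda>j. ennreal (indicator {real j..} (fst z) * ?w z) = 0) sequentially"
    by eventually_elim simp
  qed
 qed simp
 thus ?thesis by (simp add: tail_energy_def)
qed

text \<open>The exponent condition makes the factors \<open>h\<close> of the volume density and of the norm cancel.\<close>

lemma weight_scaled_spatial:
 assumes \<xi>: "is_form M k \<xi>" and r: "r < m" and z: "z \<in> Z r" and v: "v \<in> tuples k" and sp: "spatial_count k v = k"
  and kp: "real k * p = real DIM('e)"
 shows "weight r z * \<bar>scoeff \<xi> r v z\<bar> powr p =
  sqrt (gram_det (gmetric N (\<iota> r) (inv_chart (\<iota> r) (snd z)))) * \<bar>coeff \<xi> r v z\<bar> powr p"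
proof -
 have h: "0 < h (ipr r z)" by (rule h_ipr_pos[OF r z])
 have "\<bar>scoeff \<xi> r v z\<bar> powr p = (1 / h (ipr r z)) powr (real k * p) * \<bar>coeff \<xi> r v z\<bar> powr p"
  unfolding scoeff_eq[OF \<xi> r z v] sp using h
  by (simp add: abs_mult powr_mult power_abs powr_powr powr_realpow[symmetric])
 also have "(1 / h (ipr r z)) powr (real k * p) = 1 / h (ipr r z) ^ DIM('e)"
  unfolding kp using h by (simp add: powr_realpow power_one_over)
 finally show ?thesis using z h by (simp add: weight_def vol_dens_def inv_pair_def)
qed

text \<open>Without the exponent condition, a fibre integral at height \<open>t\<close> would be
  weighted by \<open>h\<close> at \<open>t\<close>, while the values of \<xi> in it are weighted by
  \<open>h\<close> at other heights. As \<open>h\<close> cancels, the weight is the same on the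
  whole ray, and Hoelder's inequality can be applied ray by ray.\<close>

lemma energy_tail_bound:
 assumes \<xi>: "measurable_form M k \<xi>" and F: "fibre_integrable b \<xi>" and r: "r < m" and v: "v \<in> tuples k"
  and p: "1 < p" and kp: "real k * p = real DIM('e)"
  and f: "\<And>s. \<bar>f s\<bar> \<le> B" "f \<in> borel_measurable borel" and B: "0 < B" and cd: "c < d" "a \<le> c" and ab: "a \<le> b"
  and supp: "\<And>s. s \<notin> {c..d} ==> f s = 0"
 shows "energy p k (tail f b (hor \<xi>)) r v \<le> ennreal ((b - a) * (B powr p * (d - c) powr (p - 1))) * tail_energy p k \<xi> r v c"
proof -
 let ?A = "tail f b (hor \<xi>)"
 have \<xi>f: "is_form M k \<xi>" using \<xi> by (simp add: measurable_form_iff)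
 have Am: "measurable_form M k ?A"
  by (rule measurable_tail[OF measurable_form_con(1)[OF \<xi>] fibre_integrable_con(1)[OF F] f(2,1)])
 hence Af: "is_form M k ?A" by (simp add: measurable_form_iff)
 show ?thesis
 proof (cases "spatial_count k v = k")
  case False
  \<comment> \<open>A tuple that contains d/dt: the horizontal part has coefficient zero on it, and
    so has its tail.\<close>
  have "coeff ?A r v z = 0" for z
  proof -
   have "coeff (hor \<xi>) r v (s, snd z) = 0" for s using coeff_hor[OF \<xi>f v] False by simp
   hence "hor \<xi> (\<iota> r) (s, inv_chart (\<iota> r) (snd z)) v = 0" for s by (simp add: coeff_pair)
   thus ?thesis by (simp add: coeff_def tail_def inv_pair_def set_lebesgue_integral_def)
  qed
  hence "weight r z * \<bar>scoeff ?A r v z\<bar> powr p = 0" for z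
   using scoeff_eq[OF Af r _ v, of z] by (cases "z \<in> Z r") (auto simp: weight_def)
  hence "energy p k ?A r v = (\<integral>\<^sup>+z. 0 \<partial>(lborel :: (real \<times> 'e) measure))"
   unfolding energy_def by (intro nn_integral_cong) (simp only: ennreal_0)
  thus ?thesis by simp
 next
  case True
  define K where "K = ennreal (B powr p * (d - c) powr (p - 1))"
  \<comment> \<open>The density of \<open>N\<close> alone. It depends on \<open>y\<close> only, so
    it passes through the integral over \<open>s\<close>.\<close>
  define g where "g y = sqrt (gram_det (gmetric N (\<iota> r) (inv_chart (\<iota> r) y)))" for y
  define \<phi> where "\<phi> z = K * ennreal (indicator {c..d} (fst z) * (weight r z * \<bar>scoeff \<xi> r v z\<bar> powr p))" for z
  have \<phi>m: "\<phi> \<in> borel_measurable borel" unfolding \<phi>_def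
   using measurable_tail_energy[OF \<xi> r v, of "{c..d}" p] by simp
  \<comment> \<open>Read off from the nonnegative weight at height \<open>a\<close> after division
    by the positive power of \<open>h\<close>.\<close>
  have g0: "0 \<le> g y" if "y \<in> Y r" for y
  proof -
   have z: "(a, y) \<in> Z r" using that by (simp add: Z_def)
   have "0 \<le> weight r (a, y)" by (rule weight_nonneg[OF r])
   hence "0 \<le> h (ipr r (a, y)) ^ DIM('e) * g y" using z by (simp add: weight_def vol_dens_def g_def inv_pair_def)
   thus ?thesis using zero_less_power[OF h_ipr_pos[OF r z], of "DIM('e)"] by (simp add: zero_le_mult_iff not_le)
  qed
  have "energy p k ?A r v \<le> ennreal (b - a) * (\<integral>\<^sup>+z. \<phi> z \<partial>lborel)"
   unfolding energy_def
  proof (rule nn_integral_fibre_bound[OF \<phi>m ab])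
   fix t y
   show "ennreal (weight r (t, y) * \<bar>scoeff ?A r v (t, y)\<bar> powr p) \<le> indicator {a..b} t * (\<integral>\<^sup>+s. \<phi> (s, y) \<partial>lborel)"
   proof (cases "(t, y) \<in> Z r \<and> t \<le> b")
    case True': True
    hence z: "(t, y) \<in> Z r" and t: "a \<le> t" "t \<le> b" and y: "y \<in> Y r" by (auto simp: Z_def)
    have "ennreal (weight r (t, y) * \<bar>scoeff ?A r v (t, y)\<bar> powr p) =
      ennreal (g y) * ennreal (\<bar>coeff ?A r v (t, y)\<bar> powr p)"
     using weight_scaled_spatial[OF Af r z v True kp] g0[OF y] by (simp add: g_def ennreal_mult)
    also have "... \<le> ennreal (g y) * (K * (\<integral>\<^sup>+s. ennreal (indicator {c..d} s * \<bar>coeff (hor \<xi>) r v (s, y)\<bar> powr p) \<partial>lborel))"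
     unfolding K_def
     by (intro mult_left_mono coeff_tail_bound[OF measurable_form_con(1)[OF \<xi>] r t(1) p f(1) B cd(1)]) (use supp in auto)
    also have "... = (\<integral>\<^sup>+s. ennreal (g y) * (K * ennreal (indicator {c..d} s * \<bar>coeff (hor \<xi>) r v (s, y)\<bar> powr p)) \<partial>lborel)"
     using measurable_slice[OF measurable_form_con(1)[OF \<xi>] iota[OF r], of "inv_chart (\<iota> r) y" v]
     by (simp add: nn_integral_cmult coeff_pair)
    also have "... = (\<integral>\<^sup>+s. \<phi> (s, y) \<partial>lborel)"
    proof (intro nn_integral_cong)
     fix s
     show "ennreal (g y) * (K * ennreal (indicator {c..d} s * \<bar>coeff (hor \<xi>) r v (s, y)\<bar> powr p)) = \<phi> (s, y)"
     proof (cases "s \<in> {c..d}")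
      case sc: True
      have "(s, y) \<in> Z r" using sc y cd by (simp add: Z_def)
      from weight_scaled_spatial[OF \<xi>f r this v True kp] show ?thesis
       using sc g0[OF y] coeff_hor[OF \<xi>f v, of r "(s, y)"] True
       by (simp add: \<phi>_def g_def[symmetric] ennreal_mult mult.left_commute)
     qed (simp add: \<phi>_def)
    qed
    finally show ?thesis using t by simp
   next
    case False
    have "weight r (t, y) * \<bar>scoeff ?A r v (t, y)\<bar> powr p = 0"
    proof (cases "(t, y) \<in> Z r")
     case True
     hence "b < t" using False by simp
     hence "scoeff ?A r v (t, y) = 0"
      by (simp add: scoeff_def tail_def inv_pair_def set_lebesgue_integral_def)
     thus ?thesis by simp
    qed (simp add: weight_def)
    thus ?thesis by (simp only: ennreal_0 zero_le)
   qed
  qed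
  also have "(\<integral>\<^sup>+z. \<phi> z \<partial>lborel) = K * (\<integral>\<^sup>+z. ennreal (indicator {c..d} (fst z) * (weight r z * \<bar>scoeff \<xi> r v z\<bar> powr p)) \<partial>lborel)"
   unfolding \<phi>_def using measurable_tail_energy[OF \<xi> r v, of "{c..d}" p] by (intro nn_integral_cmult) auto
  also have "... \<le> K * tail_energy p k \<xi> r v c"
   unfolding tail_energy_def using weight_nonneg[OF r]
   by (intro mult_left_mono nn_integral_mono ennreal_leI mult_right_mono) (auto simp: indicator_def)
  finally have "energy p k ?A r v \<le> ennreal (b - a) * (K * tail_energy p k \<xi> r v c)"
   by (simp add: mult_left_mono)
  also have "... = ennreal ((b - a) * (B powr p * (d - c) powr (p - 1))) * tail_energy p k \<xi> r v c"
   using ab by (simp add: K_def ennreal_mult mult.assoc)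
  finally show ?thesis .
 qed
qed

end

section \<open>Approximation by exact forms\<close>

context cyl_cover
begin

text \<open>The constant in the conclusion does not depend on \<open>T\<close>. It collects
  \<open>2 powr p\<close> from splitting the difference, \<open>1\<close> from the part cut off and
  \<open>3 * B powr p\<close> from the averaged part.\<close>

lemma exact_approximation:
 assumes q: "1 < q" "q \<le> p" and k: "real (Suc k1) * p = real DIM('e)" and \<xi>: "\<xi> \<in> Z_Lp M p (Suc k1)"
  and c: "\<And>k. Ck_on k UNIV c" "\<And>t. 0 \<le> c t" "\<And>t. c t \<le> B" "\<And>t. \<not> (1 \<le> t \<and> t \<le> 2) ==> c t = 0"
  and \<kappa>: "\<And>k. Ck_on k UNIV \<kappa>" "\<And>t. (\<kappa> has_real_derivative - c t) (at t)" "\<And>t. 0 \<le> \<kappa> t" "\<And>t. \<kappa> t \<le> 1"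
   "\<And>t. t \<le> 1 ==> \<kappa> t = 1" "\<And>t. t \<ge> 2 ==> \<kappa> t = 0"
  and B: "1 \<le> B" and T: "1 \<le> T" "\<bar>a\<bar> \<le> T"
 obtains \<theta> where "\<theta> \<in> B_Lp M q p (Suc k1)" "measurable_form M (Suc k1) (form_diff \<xi> \<theta>)"
  "\<And>r v. r < m ==> v \<in> tuples (Suc k1) ==>
   energy p (Suc k1) (form_diff \<xi> \<theta>) r v \<le> ennreal (2 powr p * (1 + 3 * B powr p)) * tail_energy p (Suc k1) \<xi> r v T"
proof -
 let ?E = "energy p (Suc k1)"
 have p: "1 < p" "1 \<le> p" "1 \<le> q" using q by simp_all
 have \<xi>L: "\<xi> \<in> Lp M p (Suc k1)" and \<xi>c: "weak_deriv M (Suc k1) \<xi> zero_form" using \<xi> by (simp_all add: Z_Lp_def)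
 have \<xi>m: "measurable_form M (Suc k1) \<xi>" using \<xi>L Lp_iff[OF p(2)] by blast
 \<comment> \<open>The rescaled cutoff vanishes beyond \<open>2 * T\<close>, so all fibre integrals
   can stop there.\<close>
 define b where "b = 2 * T"
 have ab: "a < b" using T by (simp add: b_def abs_if split: if_splits)
 \<comment> \<open>The whole construction uses this representative, for which every fibre integral
   exists; energies and closedness are transferred back and forth along almost everywhere
   equality.\<close>
 define w where "w = regular (Suc k1) b \<xi>"
 have wm: "measurable_form M (Suc k1) w" unfolding w_def by (rule measurable_regular[OF \<xi>m])
 have wf: "is_form M (Suc k1) w" using wm by (simp add: measurable_form_iff)
 have ae: "ae_eq \<xi> w" unfolding w_def by (rule ae_eq_regular[OF p(2) \<xi>L])
 have ae': "ae_eq w \<xi>" using ae by (rule ae_eq_sym)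
 have wL: "w \<in> Lp M p (Suc k1)" by (rule Lp_ae[OF p(2) \<xi>L wm ae])
 have wc: "weak_deriv M (Suc k1) w zero_form" by (rule closed_ae[OF p(2) wL \<xi>L ae' \<xi>c])
 have F: "fibre_integrable b w" unfolding w_def by (rule fibre_integrable_regular[OF \<xi>m])
 define \<chi>' where "\<chi>' t = \<kappa> (t / T)" for t
 let ?g = "fscale (\<lambda>t. 1 - \<chi>' t) w"
 let ?T = "\<lambda>r v. tail_energy p (Suc k1) w r v T"
 define c' where "c' t = c (t / T) / T" for t
 have K1: "Ck_on k UNIV \<chi>'" for k
  using Ck_on_affine[OF \<kappa>(1)[of k], of "1 / T" 0] by (simp add: \<chi>'_def[abs_def])
 have K2: "(\<chi>' has_real_derivative - c' t) (at t)" for t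
 proof -
  have "((\<lambda>t. t / T) has_real_derivative 1 / T) (at t)" using T by (auto intro!: derivative_eq_intros)
  from DERIV_chain2[OF \<kappa>(2)[of "t / T"] this] show ?thesis by (simp add: \<chi>'_def[abs_def] c'_def)
 qed
 have K3: "\<bar>\<chi>' t\<bar> \<le> 1" for t using \<kappa>(3,4)[of "t / T"] by (simp add: \<chi>'_def)
 have K3': "\<bar>\<chi>' t\<bar> \<le> B" for t using K3[of t] B by simp
 have K4: "\<chi>' t = 0" if "b < t" for t using that T \<kappa>(6)[of "t / T"] by (simp add: \<chi>'_def b_def field_simps)
 have K5: "\<chi>' t = 1" if "t < T" for t using that T \<kappa>(5)[of "t / T"] by (simp add: \<chi>'_def field_simps)
 have K6: "\<chi>' \<in> borel_measurable borel" using Ck_on_continuous[OF K1[of 0]] by (rule borel_measurable_continuous_onI)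
 have c1: "c' \<in> borel_measurable borel"
 proof -
  have "continuous_on UNIV c" using Ck_on_continuous[OF c(1)[of 0]] .
  hence "continuous_on UNIV (\<lambda>t. c (t / T))"
   by (rule continuous_on_compose2) (use T in "auto intro!: continuous_intros")
  thus ?thesis unfolding c'_def[abs_def] using T by (intro borel_measurable_continuous_onI continuous_intros) auto
 qed
 \<comment> \<open>Two bounds are kept: the crude \<open>B\<close> is enough for membership and for
   the weak derivative, while \<open>B / T\<close> carries the decay needed for the estimate of
   \<open>A\<close>.\<close>
 have c2: "\<bar>c' t\<bar> \<le> B / T" for t using c(2,3)[of "t / T"] T by (simp add: c'_def divide_right_mono)
 have "B / T \<le> B" using B T by (simp add: divide_le_eq mult_le_cancel_left1)
 hence c3: "\<bar>c' t\<bar> \<le> B" for t using c2[of t] by simp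
 have c4: "c' t = 0" if "t \<notin> {T..2 * T}" for t
 proof -
  have "\<not> (1 \<le> t / T \<and> t / T \<le> 2)" using that T by (simp add: field_simps)
  thus ?thesis using c(4) by (simp add: c'_def)
 qed
 define A where "A = tail c' b (hor w)"
 define \<theta> where "\<theta> = form_diff (fscale \<chi>' w) A"
 define \<psi> where "\<psi> = tail (\<lambda>s. (-1) ^ Suc k1 * \<chi>' s) b (con_last k1 w)"
 have B0: "0 < B" using B by simp
 have AL: "A \<in> Lp M p (Suc k1)" unfolding A_def
 proof (rule Lp_tail[OF p(1) measurable_form_con(1)[OF wm] fibre_integrable_con(1)[OF F] ab c1 c3 B0])
  fix r and v :: "nat => real \<times> 'e" assume rv: "r < m" "v \<in> tuples (Suc k1)"
  have "(\<integral>\<^sup>+z. ennreal (indicator (strip r b) z * \<bar>coeff (hor w) r v z\<bar> powr p) \<partial>lborel) \<le>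
    (\<integral>\<^sup>+z. ennreal (indicator (strip r b) z * \<bar>coeff w r v z\<bar> powr p) \<partial>lborel)"
   by (intro nn_integral_mono ennreal_leI mult_left_mono) (simp_all add: coeff_hor[OF wf rv(2)])
  also have "... < \<infinity>" by (rule strip_powr_finite[OF wL p(2) order_refl rv])
  finally show "(\<integral>\<^sup>+z. ennreal (indicator (strip r b) z * \<bar>coeff (hor w) r v z\<bar> powr p) \<partial>lborel) < \<infinity>" .
 qed
 have \<theta>L: "\<theta> \<in> Lp M p (Suc k1)" unfolding \<theta>_def by (rule Lp_diff[OF p(2) Lp_fscale[OF p(2) wL K6 K3] AL])
 have \<psi>L: "\<psi> \<in> Lp M q k1" unfolding \<psi>_def
 proof (rule Lp_tail[OF q(1) measurable_form_con(2)[OF wm] fibre_integrable_con(2)[OF F] ab _ _ B0])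
  show "(\<lambda>s. (-1) ^ Suc k1 * \<chi>' s) \<in> borel_measurable borel" using K6 by (intro borel_measurable_times) simp_all
  show "\<bar>(-1) ^ Suc k1 * \<chi>' s\<bar> \<le> B" for s using K3'[of s] by (simp add: abs_mult power_abs)
  fix r and v :: "nat => real \<times> 'e" assume rv: "r < m" "v \<in> tuples k1"
  obtain v' where v': "v' \<in> tuples (Suc k1)" "\<And>z. \<bar>coeff (con_last k1 w) r v z\<bar> \<le> \<bar>coeff w r v' z\<bar>"
   using coeff_con_last[OF wf rv(2)] by blast
  have "(\<integral>\<^sup>+z. ennreal (indicator (strip r b) z * \<bar>coeff (con_last k1 w) r v z\<bar> powr q) \<partial>lborel) \<le>
    (\<integral>\<^sup>+z. ennreal (indicator (strip r b) z * \<bar>coeff w r v' z\<bar> powr q) \<partial>lborel)"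
   using q by (intro nn_integral_mono ennreal_leI mult_left_mono powr_mono2 v'(2)) simp_all
  also have "... < \<infinity>" by (rule strip_powr_finite[OF wL p(3) q(2) rv(1) v'(1)])
  finally show "(\<integral>\<^sup>+z. ennreal (indicator (strip r b) z * \<bar>coeff (con_last k1 w) r v z\<bar> powr q) \<partial>lborel) < \<infinity>" .
 qed
 \<comment> \<open>Since \<open>p\<close> is at least \<open>1\<close>, the degree is at most the
   dimension of \<open>N\<close>, which leaves room for a test form of positive degree.\<close>
 have kn: "Suc k1 \<le> DIM('e)"
 proof -
  have "real (Suc k1) * 1 \<le> real (Suc k1) * p" using p by (intro mult_left_mono) auto
  hence "real (Suc k1) \<le> real DIM('e)" unfolding k by (simp only: mult_1_right)
  thus ?thesis by (simp only: of_nat_le_iff)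
 qed
 have wd: "weak_deriv M k1 \<psi> \<theta>" unfolding \<psi>_def \<theta>_def A_def
  by (rule weak_deriv_cut[OF p(2,3) wL wc F K2 K1 K3' K4 c1 c3 kn]) (use \<theta>L \<psi>L in "simp_all only: \<theta>_def \<psi>_def A_def")
 show thesis
 proof (rule that)
  show "\<theta> \<in> B_Lp M q p (Suc k1)" using wd \<theta>L \<psi>L by (auto simp: B_Lp_def Omega_Lp_def)
  have "form_diff \<xi> \<theta> \<in> Lp M p (Suc k1)" by (rule Lp_diff[OF p(2) \<xi>L \<theta>L])
  thus "measurable_form M (Suc k1) (form_diff \<xi> \<theta>)" using Lp_iff[OF p(2)] by blast
  fix r and v :: "nat => real \<times> 'e" assume r: "r < m" and v: "v \<in> tuples (Suc k1)"
  have "ae_eq (form_diff \<xi> \<theta>) (form_diff w \<theta>)"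
   unfolding ae_eq_def
  proof (intro allI impI)
   fix r assume "r < m"
   hence "AE z in lborel. z \<in> Z r --> \<xi> (\<iota> r) (ipr r z) = w (\<iota> r) (ipr r z)" using ae by (simp add: ae_eq_def)
   thus "AE z in lborel. z \<in> Z r --> form_diff \<xi> \<theta> (\<iota> r) (ipr r z) = form_diff w \<theta> (\<iota> r) (ipr r z)"
    by eventually_elim (simp add: form_diff_def)
  qed
  hence "?E (form_diff \<xi> \<theta>) r v = ?E (form_diff w \<theta>) r v" by (rule energy_ae[OF _ r])
  also have "... \<le> ennreal (2 powr p) * (?E ?g r v + ?E A r v)"
  proof (rule energy_add_le[OF _ r v])
   show "measurable_form M (Suc k1) ?g"
    using K6 by (intro measurable_form_fscale wm borel_measurable_diff) simp_all
   show "measurable_form M (Suc k1) A" using AL Lp_iff[OF p(2)] by blast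
   fix z
   have "scoeff (form_diff w \<theta>) r v z = scoeff ?g r v z + scoeff A r v z"
    by (simp add: scoeff_def form_diff_def \<theta>_def fscale_def algebra_simps)
   thus "\<bar>scoeff (form_diff w \<theta>) r v z\<bar> \<le> \<bar>scoeff ?g r v z\<bar> + \<bar>scoeff A r v z\<bar>"
    by simp
  qed (use p in simp)
  also have "... \<le> ennreal (2 powr p) * (?T r v + ennreal (3 * B powr p) * ?T r v)"
  proof (intro mult_left_mono add_mono)
   show "?E ?g r v \<le> ?T r v"
    unfolding energy_def tail_energy_def
   proof (intro nn_integral_mono ennreal_leI)
    fix z
    have eq: "scoeff ?g r v z = (1 - \<chi>' (fst z)) * scoeff w r v z"
     by (simp add: scoeff_def fscale_def inv_pair_def)
    show "weight r z * \<bar>scoeff ?g r v z\<bar> powr p \<le>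
      indicator {T..} (fst z) * (weight r z * \<bar>scoeff w r v z\<bar> powr p)"
    proof (cases "fst z < T")
     case True
     thus ?thesis by (simp add: eq K5)
    next
     case False
     have "\<bar>1 - \<chi>' (fst z)\<bar> \<le> 1" using \<kappa>(3,4)[of "fst z / T"] by (simp add: \<chi>'_def)
     hence "\<bar>1 - \<chi>' (fst z)\<bar> * \<bar>scoeff w r v z\<bar> \<le> 1 * \<bar>scoeff w r v z\<bar>" by (rule mult_right_mono) simp
     hence "\<bar>(1 - \<chi>' (fst z)) * scoeff w r v z\<bar> powr p \<le> \<bar>scoeff w r v z\<bar> powr p"
      using p by (intro powr_mono2) (simp_all add: abs_mult)
     thus ?thesis using False weight_nonneg[OF r, of z] by (simp add: eq mult_left_mono)
    qed
   qed
   have "?E A r v \<le> ennreal ((b - a) * ((B / T) powr p * (2 * T - T) powr (p - 1))) * ?T r v"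
    unfolding A_def
    by (rule energy_tail_bound[OF wm F r v p(1) k c2 c1]) (use B0 T ab c4 in auto)
   also have "... \<le> ennreal (3 * B powr p) * ?T r v"
   proof (intro mult_right_mono ennreal_leI)
    have "(B / T) powr p * (2 * T - T) powr (p - 1) = B powr p / T"
     using B0 T by (simp add: powr_divide powr_diff)
    \<comment> \<open>The length \<open>b - a\<close> is at most \<open>3 * T\<close> because
      \<open>\<bar>a\<bar> \<le> T\<close>.\<close>
    moreover have "(b - a) * (B powr p / T) \<le> (3 * T) * (B powr p / T)"
     using T by (intro mult_right_mono) (auto simp: b_def)
    ultimately show "(b - a) * ((B / T) powr p * (2 * T - T) powr (p - 1)) \<le> 3 * B powr p" using T by simp
   qed simp
   finally show "?E A r v \<le> ennreal (3 * B powr p) * ?T r v" .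
  qed simp_all
  also have "... = ennreal (2 powr p * (1 + 3 * B powr p)) * ?T r v"
   by (simp add: ennreal_mult ennreal_plus distrib_right mult.assoc)
  also have "?T r v = tail_energy p (Suc k1) \<xi> r v T" by (rule tail_energy_ae[OF ae' r])
  finally show "?E (form_diff \<xi> \<theta>) r v \<le> ennreal (2 powr p * (1 + 3 * B powr p)) * tail_energy p (Suc k1) \<xi> r v T" .
 qed
qed

lemma Z_Lp_subset_Bbar:
 assumes q: "1 < q" "q \<le> p" and k: "real (Suc k1) * p = real DIM('e)" and \<xi>: "\<xi> \<in> Z_Lp M p (Suc k1)"
 shows "\<xi> \<in> Bbar_Lp M q p (Suc k1)"
 unfolding Bbar_Lp_def
proof (intro CollectI conjI allI impI)
 let ?E = "\<lambda>\<theta> r v. energy p (Suc k1) (form_diff \<xi> \<theta>) r v"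
 have p: "1 < p" "1 \<le> p" using q by simp_all
 show \<xi>L: "\<xi> \<in> Lp M p (Suc k1)" using \<xi> by (simp add: Z_Lp_def)
 hence \<xi>m: "measurable_form M (Suc k1) \<xi>" and \<xi>E: "\<And>r v. r < m ==> v \<in> tuples (Suc k1) ==> energy p (Suc k1) \<xi> r v < \<infinity>"
  using Lp_iff[OF p(2)] by blast+
 fix \<epsilon> :: real assume \<epsilon>: "0 < \<epsilon>"
 obtain c \<kappa> :: "real => real" and B where
  c: "\<And>k. Ck_on k UNIV c" and \<kappa>: "\<And>k. Ck_on k UNIV \<kappa>" "\<And>t. (\<kappa> has_real_derivative - c t) (at t)"
  and c': "\<And>t. 0 \<le> c t" "\<And>t. c t \<le> B" "\<And>t. \<not> (1 \<le> t \<and> t \<le> 2) ==> c t = 0"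
  and \<kappa>': "\<And>t. 0 \<le> \<kappa> t" "\<And>t. \<kappa> t \<le> 1" "\<And>t. t \<le> 1 ==> \<kappa> t = 1" "\<And>t. t \<ge> 2 ==> \<kappa> t = 0"
  by (rule smooth_cutoff_exists) blast
 \<comment> \<open>A bound of at least \<open>1\<close> controls the cutoff \<kappa> together with
   the bump \<open>c\<close>.\<close>
 define B' where "B' = max 1 B"
 have B': "1 \<le> B'" "\<And>t. c t \<le> B'" using c'(2) by (auto simp: B'_def le_max_iff_disj)
 obtain C where C: "C > 0" "\<And>\<xi> \<delta>. measurable_form M (Suc k1) \<xi> ==> 0 \<le> \<delta> ==>
   (\<Sum>r<m. \<Sum>v\<in>tuples (Suc k1). energy p (Suc k1) \<xi> r v) \<le> ennreal \<delta> ==> Lp_norm M p (Suc k1) \<xi> \<le> (C * \<delta>) powr (1 / p)"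
  using Lp_norm_le[OF p(2), of "Suc k1"] by blast
 define V where "V = (tuples (Suc k1) :: (nat => real \<times> 'e) set)"
 \<comment> \<open>The solution of
   \<open>(C * \<delta>) powr (1 / p) = \<epsilon> / 2\<close>.\<close>
 define \<delta> where "\<delta> = (\<epsilon> / 2) powr p / C"
 define L where "L = 2 powr p * (1 + 3 * B' powr p)"
 \<comment> \<open>The amount \<delta> is shared among the \<open>m * card V\<close> energies, each
   of which comes with the factor \<open>L\<close>; the added \<open>1\<close> keeps the denominator
   positive.\<close>
 define \<eta> where "\<eta> = \<delta> / (L * (real m * real (card V) + 1))"
 have L: "0 < L" unfolding L_def by (intro mult_pos_pos add_pos_nonneg) simp_all
 have \<delta>: "0 < \<delta>" using \<epsilon> C(1) by (simp add: \<delta>_def)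
 have \<eta>: "0 < \<eta>" unfolding \<eta>_def using L \<delta> by (intro divide_pos_pos mult_pos_pos add_nonneg_pos) simp_all
 have "eventually (\<lambda>j. \<forall>r\<in>{..<m}. \<forall>v\<in>V. tail_energy p (Suc k1) \<xi> r v (real j) < ennreal \<eta>) sequentially"
  using \<eta> unfolding V_def
  by (intro eventually_ball_finite ballI order_tendstoD(2)[OF tail_energy_tendsto[OF \<xi>m _ _ \<xi>E]]) simp_all
 moreover have "eventually (\<lambda>j. max 1 \<bar>a\<bar> < real j) sequentially"
  by (rule eventually_compose_filterlim[OF eventually_gt_at_top filterlim_real_sequentially])
 ultimately have "eventually (\<lambda>j. (\<forall>r\<in>{..<m}. \<forall>v\<in>V. tail_energy p (Suc k1) \<xi> r v (real j) < ennreal \<eta>) \<and> max 1 \<bar>a\<bar> < real j) sequentially"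
  by (rule eventually_conj)
 then obtain j where j: "\<And>r v. r < m ==> v \<in> V ==> tail_energy p (Suc k1) \<xi> r v (real j) < ennreal \<eta>" "max 1 \<bar>a\<bar> < real j"
  using eventually_happens'[OF sequentially_bot] by (metis (no_types, lifting) lessThan_iff)
 have T: "1 \<le> real j" "\<bar>a\<bar> \<le> real j" using j(2) by simp_all
 obtain \<theta> where \<theta>: "\<theta> \<in> B_Lp M q p (Suc k1)" "measurable_form M (Suc k1) (form_diff \<xi> \<theta>)"
  "\<And>r v. r < m ==> v \<in> V ==>
   ?E \<theta> r v \<le> ennreal L * tail_energy p (Suc k1) \<xi> r v (real j)"
 proof (rule exact_approximation[OF q k \<xi> c c'(1) B'(2) c'(3) \<kappa> \<kappa>' B'(1) T])
  fix \<theta>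
  assume "\<theta> \<in> B_Lp M q p (Suc k1)" "measurable_form M (Suc k1) (form_diff \<xi> \<theta>)"
   "\<And>r v. r < m ==> v \<in> tuples (Suc k1) ==> ?E \<theta> r v
    \<le> ennreal (2 powr p * (1 + 3 * B' powr p)) * tail_energy p (Suc k1) \<xi> r v (real j)"
  thus thesis by (rule that[unfolded V_def L_def])
 qed
 have "?E \<theta> r v \<le> ennreal (L * \<eta>)" if "r < m" "v \<in> V" for r v
 proof -
  have "?E \<theta> r v \<le> ennreal L * ennreal \<eta>"
   using \<theta>(3)[OF that] j(1)[OF that] by (meson less_imp_le mult_left_mono order_trans zero_le)
  thus ?thesis using L \<eta> by (simp add: ennreal_mult)
 qed
 hence "(\<Sum>r<m. \<Sum>v\<in>V. ?E \<theta> r v) \<le> (\<Sum>r<m. \<Sum>v\<in>V. ennreal (L * \<eta>))"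
  by (intro sum_mono) simp
 also have "... = ennreal (\<Sum>r<m. \<Sum>v\<in>V. L * \<eta>)"
  using L \<eta> by (simp only: sum_ennreal sum_nonneg mult_nonneg_nonneg less_imp_le)
 also have "... \<le> ennreal \<delta>"
 proof (rule ennreal_leI)
  have "(\<Sum>r<m. \<Sum>v\<in>V. L * \<eta>) = (real m * real (card V)) * (L * \<eta>)" by simp
  also have "... \<le> (real m * real (card V) + 1) * (L * \<eta>)" using L \<eta> by (intro mult_right_mono) simp_all
  also have "... = \<delta>"
  proof -
   have "real m * real (card V) + 1 \<noteq> 0" using add_nonneg_pos[of "real m * real (card V)" 1] by simp
   thus ?thesis using L by (simp add: \<eta>_def)
  qed
  finally show "(\<Sum>r<m. \<Sum>v\<in>V. L * \<eta>) \<le> \<delta>" .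
 qed
 finally have "Lp_norm M p (Suc k1) (form_diff \<xi> \<theta>) \<le> (C * \<delta>) powr (1 / p)"
  using C(2)[OF \<theta>(2)] \<delta> unfolding V_def by simp
 also have "... = \<epsilon> / 2" using C(1) \<epsilon> p by (simp add: \<delta>_def powr_powr)
 also have "... < \<epsilon>" using \<epsilon> by simp
 finally show "\<exists>\<theta>\<in>B_Lp M q p (Suc k1). Lp_norm M p (Suc k1) (form_diff \<xi> \<theta>) < \<epsilon>" using \<theta>(1) by blast
qed

text \<open>The difference of two closed forms is closed and thus lies in the closure of the exact
  forms, so every class is the whole of \<open>Z_Lp\<close>. That there is a class at all is
  witnessed by \<open>zero_form\<close>.\<close>

lemma reduced_cohomology_trivial:
 assumes q: "1 < q" "q \<le> p" and k: "real k = real DIM('e) / p"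
 shows "reduced_cohomology M q p k = {cohomology_class M q p k zero_form}"
proof -
 have p: "1 < p" "1 \<le> p" using q by simp_all
 have kp: "real k * p = real DIM('e)" using k p by simp
 \<comment> \<open>Degree zero is ruled out because the model space of \<open>N\<close> has positive
   dimension; so there is a degree below \<open>k\<close> in which a primitive can live.\<close>
 have "k \<noteq> 0"
 proof
  assume "k = 0"
  thus False using kp DIM_positive[where 'a = 'e] by simp
 qed
 then obtain k1 where k1: "k = Suc k1" by (cases k) auto
 have zero: "zero_form \<in> Z_Lp M p k"
 proof -
  have "form_integral M (wedge_form k l zero_form u) = 0" for l and u :: "('i, 'a, 'e) cform"
   by (simp add: form_integral_def wedge_form_def zero_form_def wedge_zero_left)
  thus ?thesis unfolding Z_Lp_def using zero_form_Lp[OF p(2)] closed_iff[OF p(2) zero_form_Lp[OF p(2)]] by simp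
 qed
 have "cohomology_class M q p k \<xi> = Z_Lp M p k" if \<xi>: "\<xi> \<in> Z_Lp M p k" for \<xi>
  unfolding cohomology_class_def
 proof (intro equalityI subsetI CollectI conjI)
  fix \<xi>' assume "\<xi>' \<in> Z_Lp M p k"
  hence "form_diff \<xi>' \<xi> \<in> Z_Lp M p k" using \<xi> by (rule Z_Lp_diff[OF p(2)])
  thus "form_diff \<xi>' \<xi> \<in> Bbar_Lp M q p k"
   using Z_Lp_subset_Bbar[OF q, of k1] kp unfolding k1 by blast
 qed auto
 thus ?thesis unfolding reduced_cohomology_def using zero by auto
qed

end

theorem theorem5p3:
  fixes N :: "('i, 'a::{second_countable_topology, t2_space}, 'e::euclidean_space) riem"
    and a :: real
    and h :: "real \<times> 'a \<Rightarrow> real"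
  assumes "closed_riemannian_manifold N"
    and "smooth_fun (cylinder a N) h"
    and "\<And>z. z \<in> carr (cylinder a N) \<Longrightarrow> h z > 0"
  shows "(\<forall>(p::real) (q::real) (k::nat).
            1 < q \<and> q \<le> p \<and> real k = real DIM('e) / p \<longrightarrow>
            reduced_cohomology (twisted_cylinder a h N) q p k =
              {cohomology_class (twisted_cylinder a h N) q p k zero_form})
       \<and> (\<forall>q::real.
            1 < q \<and> q \<le> 2 \<and> even DIM('e) \<longrightarrow>
            reduced_cohomology (twisted_cylinder a h N) q 2 (DIM('e) div 2) =
              {cohomology_class (twisted_cylinder a h N) q 2 (DIM('e) div 2) zero_form})"
proof -
 interpret cyl N a h by unfold_locales (fact assms)+
 obtain m \<iota> K D pt where "cyl_cover N a h m \<iota> K D pt" using cover_exists by blast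
 then interpret cyl_cover N a h m \<iota> K D pt .
 show ?thesis
 proof (intro conjI allI impI)
  fix p q :: real and k :: nat assume "1 < q \<and> q \<le> p \<and> real k = real DIM('e) / p"
  thus "reduced_cohomology M q p k = {cohomology_class M q p k zero_form}"
   by (intro reduced_cohomology_trivial) auto
 next
  fix q :: real assume q: "1 < q \<and> q \<le> 2 \<and> even DIM('e)"
  hence "real (DIM('e) div 2) = real DIM('e) / 2" by (simp add: real_of_nat_div)
  thus "reduced_cohomology M q 2 (DIM('e) div 2) = {cohomology_class M q 2 (DIM('e) div 2) zero_form}"
   using q by (intro reduced_cohomology_trivial) auto
 qed
qed

end
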